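(* Let $k_1,k_2\in\mathbb{Z}$ and let $m\in\mathbb{R}$, $m\ge -1$. Then for a nonzero radial T-function $\varphi(r)$ on $D$, the commutator $[T_{e^{ik_1\theta}r^m},T_{e^{ik_2\theta}\varphi}]$ has finite rank on $L_h^2$ if and only if one of the following conditions holds (where $C$ denotes some constant): (1) $k_1=m=0$. (2) $k_2=0$ and $\varphi=C$. (3) $k_1=k_2=0$. (4) $k_1=k_2\neq 0$ and $\varphi=Cr^m$. (5) $k_1k_2=-1$ and $\varphi=C\left(\frac{m+1}{2}r^{-1}-\frac{m-1}{2}r\right)$. (6) $k_1k_2<-1$, $|k_2|\ge 2$, $m+|k_1|=0$ and $\varphi(r)=Cr^{|k_2|}$. (7) $k_1k_2<-1$, $|k_2|=1$ and $\widehat{\varphi}(z)=C\,\frac{\Gamma\left(\frac{z-1}{2|k_1|}\right)\Gamma\left(\frac{z+m+|k_1|+1}{2|k_1|}\right)}{\Gamma\left(\frac{z+2|k_1|+1}{2|k_1|}\right)\Gamma\left(\frac{z+m+|k_1|-1}{2|k_1|}\right)}$. (8) $k_1k_2>0$, $k_1\ne k_2$, $|k_2|<m+|k_1|+2$ and $\widehat{\varphi}(z)=C\,\frac{\Gamma\left(\frac{z+|k_2|}{2|k_1|}\right)\Gamma\left(\frac{z+m+|k_1|-|k_2|}{2|k_1|}\right)}{\Gamma\left(\frac{z+2|k_1|-|k_2|}{2|k_1|}\right)\Gamma\left(\frac{z+m+|k_1|+|k_2|}{2|k_1|}\right)}$. (9) $k_1k_2>0$, $|k_2|\ge m+|k_1|+2$,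 $m=(2n+1)|k_1|$ for some $n\in\mathbb{N}$ and $$\widehat{\varphi}(z)=C\,\frac{\left(\frac{z-|k_2|}{2|k_1|}+1\right)\left(\frac{z-|k_2|}{2|k_1|}+2\right)\cdots\left(\frac{z-|k_2|}{2|k_1|}+n\right)}{\frac{z+|k_2|}{2|k_1|}\left(\frac{z+|k_2|}{2|k_1|}+1\right)\cdots\left(\frac{z+|k_2|}{2|k_1|}+n\right)}.$$ In each of the conditions (1)-(5), $\mathrm{rank}\left([T_{e^{ik_1\theta}r^m},T_{e^{ik_2\theta}\varphi}]\right)=0$. In each of the conditions (6)-(9), $$\mathrm{Ran}\left([T_{e^{ik_1\theta}r^m},T_{e^{ik_2\theta}\varphi}]\right)=\mathrm{span}\left\{r^{|k|}e^{ik\theta}:k\in\Lambda_1\right\}$$ and $$[T_{e^{ik_1\theta}r^m},T_{e^{ik_2\theta}\varphi}]=\sum_{k\in\Lambda_{1/2}}C_k\left[\left(r^{|k|}e^{ik\theta}\right)\otimes\left(r^{|k-k_1-k_2|}e^{i(k-k_1-k_2)\theta}\right)-\left(r^{|-k+k_1+k_2|}e^{i(-k+k_1+k_2)\theta}\right)\otimes\left(r^{|-k|}e^{-ik\theta}\right)\right]$$ for some nonzero constants $C_k$. Furthermore (in conditions (6)-(9)), the rank of $[T_{e^{ik_1\theta}r^m},T_{e^{ik_2\theta}\varphi}]$ equals $|k_1|+|k_2|-1$ when $k_1+k_2$ is odd, and equals $|k_1|+|k_2|-2$ when $k_1+k_2$ is even.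
   Context: $D$ is the open unit disk in $\mathbb{C}$ and $dA$ is Lebesgue area measure on $D$ normalized so that $D$ has measure $1$. $L_h^2$ is the harmonic Bergman space: the closed subspace of $L^2(D,dA)$ consisting of (complex-valued) harmonic functions. $Q$ is the orthogonal projection of $L^2(D,dA)$ onto $L_h^2$, given by $Qf(z)=\int_D\left(\frac{1}{(1-z\bar w)^2}+\frac{1}{(1-\bar z w)^2}-1\right)f(w)\,dA(w)$; the integral formula extends $Q$ to $L^1(D,dA)$. For $u\in L^1(D,dA)$ the operator $h\mapsto Q(uh)$ is densely defined on the harmonic polynomials in $L_h^2$. $u$ is called a T-function if this operator is bounded in the $L_h^2$ norm; then the Toeplitz operator $T_u:L_h^2\to L_h^2$ is its continuous extension. (Every $u \in L^1(D,dA)$ essentially bounded on some annulus $r_0<|z|<1$ is a T-function.) Points of $D$ are written $re^{i\theta}$; a radial T-function is a T-function depending only on $r$, and for $k\in\mathbb{Z}$, $e^{ik\theta}\varphi(r)$ is a T-function iff $\varphi$ is. The commutator is $[A,B]=AB-BA$. A bounded operator $A$ on a Hilbert space has finite rank if the closure of its range $\mathrm{Ran}(A)$ is finite dimensional, and $\mathrm{rank}(A)=\dim\mathrm{Ran}(A)$ (rank $0$ is allowed). For $\phi,\psi\in L_h^2$, $(\phi\otimes\psi)h=\langle h,\psi\rangle\phi$. The Mellin transform of a radial $\varphi\in L^1([0,1],r\,dr)$ is $\widehat{\varphi}(z)=\int_0^1\varphi(r)r^{z-1}\,dr$, defined for $\mathrm{Re}\,z\ge 2$; formulas for $\widehat\varphi(z)$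 are understood there. $\mathbb{N}=\{0,1,2,\dots\}$; an empty product equals $1$. With $N_1=\max\{0,-k_1,-k_2,-k_1-k_2\}$: $\Lambda_1=\{k\in\mathbb{Z}:-N_1+1\le k\le N_1+k_1+k_2-1,\ k\ne\frac{k_1+k_2}{2}\}$ and $\Lambda_{1/2}=\{k\in\mathbb{Z}:\frac{k_1+k_2}{2}<k\le N_1+k_1+k_2-1\}$. *)

theory Defs
  imports "HOL-Analysis.Analysis" "HOL-Library.Function_Algebras" "HOL-Library.FuncSet"
begin

text \<open>
  Elements of \<open>L\<^sup>2(D, dA)\<close> that have a canonical continuous representative (harmonic functions)
  are modelled as functions \<open>complex \<Rightarrow> complex\<close> that vanish outside the disk, so that equality on
  the disk is equality of functions.  General elements of \<open>L\<^sup>1(D, dA)\<close> are represented by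
  Lebesgue measurable functions, whose values outside the disk are never used.
\<close>

abbreviation disk :: "complex set" where
  "disk \<equiv> ball 0 1"

definition dA :: "complex measure" where
  "dA = uniform_measure (lebesgue_on disk) disk"

definition on_disk :: "(complex \<Rightarrow> complex) \<Rightarrow> complex \<Rightarrow> complex" where
  "on_disk f = (\<lambda>z. if z \<in> disk then f z else 0)"

definition scale_fun :: "complex \<Rightarrow> (complex \<Rightarrow> complex) \<Rightarrow> complex \<Rightarrow> complex" where
  "scale_fun c f = (\<lambda>z. c * f z)"

text \<open>Addition of functions is the pointwise one of \<^theory>\<open>HOL-Library.Function_Algebras\<close>.\<close>

interpretation cfun: vector_space scale_fun
  by unfold_locales (auto simp: scale_fun_def algebra_simps fun_eq_iff)


section \<open>The harmonic Bergman space\<close>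

text \<open>
  \<open>f\<close> is twice continuously (real) differentiable on \<open>S\<close> with \<open>f\<^sub>x\<^sub>x + f\<^sub>y\<^sub>y = 0\<close>; the directions
  \<open>x\<close> and \<open>y\<close> are \<open>1\<close> and \<open>\<i>\<close>.
\<close>

definition harmonic_on :: "(complex \<Rightarrow> complex) \<Rightarrow> complex set \<Rightarrow> bool" where
  "harmonic_on f S \<longleftrightarrow>
     (\<exists>(f' :: complex \<Rightarrow> complex \<Rightarrow>\<^sub>L complex) (f'' :: complex \<Rightarrow> complex \<Rightarrow>\<^sub>L complex \<Rightarrow>\<^sub>L complex).
        (\<forall>z\<in>S. (f has_derivative blinfun_apply (f' z)) (at z)) \<and>
        (\<forall>z\<in>S. (f' has_derivative blinfun_apply (f'' z)) (at z)) \<and>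
        continuous_on S f'' \<and>
        (\<forall>z\<in>S. blinfun_apply (blinfun_apply (f'' z) 1) 1 + blinfun_apply (blinfun_apply (f'' z) \<i>) \<i> = 0))"

definition L2h :: "(complex \<Rightarrow> complex) set" where
  "L2h = {f. harmonic_on f disk \<and> integrable dA (\<lambda>z. (cmod (f z))\<^sup>2) \<and> (\<forall>z. z \<notin> disk \<longrightarrow> f z = 0)}"

definition inner_L2 :: "(complex \<Rightarrow> complex) \<Rightarrow> (complex \<Rightarrow> complex) \<Rightarrow> complex" where
  "inner_L2 f g = (\<integral>z. f z * cnj (g z) \<partial>dA)"

definition norm_L2 :: "(complex \<Rightarrow> complex) \<Rightarrow> real" where
  "norm_L2 f = sqrt (\<integral>z. (cmod (f z))\<^sup>2 \<partial>dA)"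

text \<open>The function \<open>r\<^bsup>\<bar>k\<bar>\<^esup> e\<^bsup>ik\<theta>\<^esup>\<close>; the value of the argument at the origin is irrelevant.\<close>

definition harm_monom :: "int \<Rightarrow> complex \<Rightarrow> complex" where
  "harm_monom k = on_disk (\<lambda>z. of_real (cmod z ^ nat \<bar>k\<bar>) * cis (of_int k * Arg z))"

definition harm_polys :: "(complex \<Rightarrow> complex) set" where
  "harm_polys =
     {h \<in> L2h. \<exists>n (a :: nat \<Rightarrow> nat \<Rightarrow> complex). \<forall>z\<in>disk. h z = (\<Sum>i\<le>n. \<Sum>j\<le>n. a i j * z ^ i * cnj z ^ j)}"

definition proj_Q :: "(complex \<Rightarrow> complex) \<Rightarrow> complex \<Rightarrow> complex" where
  "proj_Q f = on_disk (\<lambda>z. \<integral>w. (1 / (1 - z * cnj w)\<^sup>2 + 1 / (1 - cnj z * w)\<^sup>2 - 1) * f w \<partial>dA)"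


section \<open>Operators on the harmonic Bergman space\<close>

text \<open>
  Operators are extensional functions on \<^const>\<open>L2h\<close> (their value is \<^const>\<open>undefined\<close> elsewhere),
  so that two operators are equal iff they agree on \<^const>\<open>L2h\<close>.
\<close>

definition bounded_op :: "((complex \<Rightarrow> complex) \<Rightarrow> (complex \<Rightarrow> complex)) \<Rightarrow> bool" where
  "bounded_op T \<longleftrightarrow>
     T \<in> L2h \<rightarrow>\<^sub>E L2h \<and>
     (\<forall>f\<in>L2h. \<forall>g\<in>L2h. T (f + g) = T f + T g) \<and>
     (\<forall>c. \<forall>f\<in>L2h. T (scale_fun c f) = scale_fun c (T f)) \<and>
     (\<exists>B. \<forall>f\<in>L2h. norm_L2 (T f) \<le> B * norm_L2 f)"

definition T_function :: "(complex \<Rightarrow> complex) \<Rightarrow> bool" where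
  "T_function u \<longleftrightarrow>
     integrable dA u \<and>
     (\<exists>B. \<forall>h\<in>harm_polys. proj_Q (\<lambda>z. u z * h z) \<in> L2h \<and>
        norm_L2 (proj_Q (\<lambda>z. u z * h z)) \<le> B * norm_L2 h)"

text \<open>The continuous extension to \<^const>\<open>L2h\<close>; meaningful only if \<open>u\<close> is a T-function.\<close>

definition toeplitz :: "(complex \<Rightarrow> complex) \<Rightarrow> (complex \<Rightarrow> complex) \<Rightarrow> (complex \<Rightarrow> complex)" where
  "toeplitz u = (THE T. bounded_op T \<and> (\<forall>h\<in>harm_polys. T h = proj_Q (\<lambda>z. u z * h z)))"

definition commutator ::
  "((complex \<Rightarrow> complex) \<Rightarrow> (complex \<Rightarrow> complex)) \<Rightarrow> ((complex \<Rightarrow> complex) \<Rightarrow> (complex \<Rightarrow> complex)) \<Rightarrow>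
   (complex \<Rightarrow> complex) \<Rightarrow> (complex \<Rightarrow> complex)" where
  "commutator A B = (\<lambda>h\<in>L2h. A (B h) - B (A h))"

definition rank_one ::
  "(complex \<Rightarrow> complex) \<Rightarrow> (complex \<Rightarrow> complex) \<Rightarrow> (complex \<Rightarrow> complex) \<Rightarrow> (complex \<Rightarrow> complex)" where
  "rank_one p q = (\<lambda>h\<in>L2h. scale_fun (inner_L2 h q) p)"

definition Ran :: "((complex \<Rightarrow> complex) \<Rightarrow> (complex \<Rightarrow> complex)) \<Rightarrow> (complex \<Rightarrow> complex) set" where
  "Ran A = A ` L2h"

definition closure_L2h :: "(complex \<Rightarrow> complex) set \<Rightarrow> (complex \<Rightarrow> complex) set" where
  "closure_L2h S = {g \<in> L2h. \<forall>e>0. \<exists>f\<in>S. norm_L2 (f - g) < e}"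

definition finite_rank :: "((complex \<Rightarrow> complex) \<Rightarrow> (complex \<Rightarrow> complex)) \<Rightarrow> bool" where
  "finite_rank A \<longleftrightarrow> (\<exists>B. finite B \<and> closure_L2h (Ran A) \<subseteq> cfun.span B)"

text \<open>
  Complex dimension of the range.  As usual for \<^const>\<open>vector_space.dim\<close>, the value is \<open>0\<close> by
  convention if the range is infinite-dimensional, so it is meaningful only together with
  \<^const>\<open>finite_rank\<close>.
\<close>

definition op_rank :: "((complex \<Rightarrow> complex) \<Rightarrow> (complex \<Rightarrow> complex)) \<Rightarrow> nat" where
  "op_rank A = cfun.dim (Ran A)"


section \<open>Radial and quasihomogeneous symbols\<close>

text \<open>\<open>e\<^bsup>ik\<theta>\<^esup> \<phi>(r)\<close>; only the values of \<open>\<phi>\<close> on \<open>[0, 1)\<close> matter.\<close>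

definition quasihom :: "int \<Rightarrow> (real \<Rightarrow> complex) \<Rightarrow> complex \<Rightarrow> complex" where
  "quasihom k \<phi> = (\<lambda>z. cis (of_int k * Arg z) * \<phi> (cmod z))"

definition radial_eq :: "(real \<Rightarrow> complex) \<Rightarrow> (real \<Rightarrow> complex) \<Rightarrow> bool" where
  "radial_eq \<phi> \<psi> \<longleftrightarrow> (AE z in dA. \<phi> (cmod z) = \<psi> (cmod z))"

definition mellin :: "(real \<Rightarrow> complex) \<Rightarrow> complex \<Rightarrow> complex" where
  "mellin \<phi> z = (\<integral>r. \<phi> r * complex_of_real r powr (z - 1) \<partial>lebesgue_on {0..1})"

definition mellin_eq :: "(real \<Rightarrow> complex) \<Rightarrow> (complex \<Rightarrow> complex) \<Rightarrow> bool" where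
  "mellin_eq \<phi> F \<longleftrightarrow> (\<forall>z. Re z \<ge> 2 \<longrightarrow> mellin \<phi> z = F z)"

text \<open>
  Quotient of Gamma functions.  Using the entire reciprocal \<^const>\<open>rGamma\<close> makes explicit that
  \<open>1 / \<Gamma>\<close> is \<open>0\<close> at the poles of \<open>\<Gamma>\<close>, which may be met in a denominator.
\<close>

definition Gamma_quot :: "complex \<Rightarrow> complex \<Rightarrow> complex \<Rightarrow> complex \<Rightarrow> complex" where
  "Gamma_quot a b c d = Gamma a * Gamma b * rGamma c * rGamma d"


section \<open>Index sets\<close>

definition N1 :: "int \<Rightarrow> int \<Rightarrow> int" where
  "N1 k1 k2 = Max {0, - k1, - k2, - k1 - k2}"

definition Lambda1 :: "int \<Rightarrow> int \<Rightarrow> int set" where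
  "Lambda1 k1 k2 = {k. - N1 k1 k2 + 1 \<le> k \<and> k \<le> N1 k1 k2 + k1 + k2 - 1 \<and> 2 * k \<noteq> k1 + k2}"

definition LambdaHalf :: "int \<Rightarrow> int \<Rightarrow> int set" where
  "LambdaHalf k1 k2 = {k. k1 + k2 < 2 * k \<and> k \<le> N1 k1 k2 + k1 + k2 - 1}"

end

theory Submission
  imports Defs "HOL-Complex_Analysis.Complex_Analysis"
begin

text \<open>
  Operators with symbol \<open>e\<^bsup>ik\<theta>\<^esup> \<phi>(r)\<close> act on the orthogonal basis \<open>r\<^bsup>\<bar>n\<bar>\<^esup> e\<^bsup>in\<theta>\<^esup>\<close> as weighted
  shifts whose weights are values of the Mellin transform of \<open>\<phi>\<close>.  Hence the commutator is a weighted
  shift too, and it has finite rank iff almost all of its weights vanish.  Vanishing for large \<open>n\<close> is a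
  first-order recurrence with step \<open>2k\<^sub>1\<close> for the Mellin transform along an arithmetic progression.  A
  quotient of Gamma functions solves the same recurrence, and the quotient of both solutions has
  polynomial growth in a right half-plane, so it is constant by Carlson's theorem.  The zeros of
  \<open>1 / \<Gamma>\<close> then decide for which parameters this solution is the Mellin transform of an integrable
  function.  Conversely, the weights with small \<open>n\<close> do not vanish because quotients
  \<open>\<Gamma>(u + \<delta>) \<Gamma>(u + \<mu>) / (\<Gamma>(u) \<Gamma>(u + \<delta> + \<mu>))\<close> are injective in \<open>u\<close>, by strict monotonicity of the
  trigamma function.
\<close>

section \<open>Gamma quotients and Carlson's theorem\<close>

text \<open>The relation between the Mellin transform and the Gamma quotient is kept in multiplied
  form, with \<open>rGamma\<close> factors on both sides. It then holds also at poles of the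
  quotient, and comparing zeros at such points is what forces the extra conditions on
  \<open>m\<close>. The commutator coefficients are antisymmetric about n = -(k1 + k2)/2, so one end
  of the index line controls the other. They are invariant under a simultaneous change of sign of
  \<open>k1\<close>, \<open>k2\<close> and \<open>n\<close>, which leaves k1 > 0; for k1 = 0 the
  recurrence has step 0 and needs its own argument. The hypothesis concerns the symbol \<phi>(|z|),
  whose operator is diagonal and sees even moments only. Boundedness for the symbol with an angular
  factor needs all moments, and the odd ones are recovered from integrability. Since the growth is
  polynomial, Blaschke factors and the divergence of the harmonic series are enough for the
  uniqueness theorem. Since \<phi> is measurable only as a function on the disk, a Borel
  representative on the radius is constructed before radial integrals are taken.\<close>

text \<open>A zero of a bounded function on the half-plane can be divided out by its Blaschke factor
  without worsening the bound: transported to the disk by a Cayley map that sends 0 to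
  \<open>a\<close>, this is the Schwarz lemma.\<close>

lemma Schwarz_halfplane:
  fixes f :: "complex \<Rightarrow> complex" and a M :: real
  assumes f: "f holomorphic_on {z. Re z > 0}" and a: "a > 0"
    and M: "\<And>z. Re z > 0 \<Longrightarrow> norm (f z) \<le> M" and fa: "f (of_real a) = 0"
  obtains g where "g holomorphic_on {z. Re z > 0}" "\<And>z. Re z > 0 \<Longrightarrow> norm (g z) \<le> M"
    "\<And>z. Re z > 0 \<Longrightarrow> f z = (z - of_real a) / (z + of_real a) * g z"
proof -
  let ?H = "{z::complex. Re z > 0}"
  have opH: "open ?H" by (simp add: open_halfspace_Re_gt)
  have M0: "M \<ge> 0" using M[of 1] norm_ge_zero[of "f 1"] by (simp del: norm_ge_zero)
  define g where "g = (\<lambda>z. (if z = of_real a then deriv f (of_real a) else (f z - f (of_real a)) / (z - of_real a)) * (z + of_real a))"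
  have holg: "g holomorphic_on ?H"
    unfolding g_def by (intro holomorphic_intros pole_lemma_open f opH)
  have nz: "z + of_real a \<noteq> 0" if "Re z > 0" for z
    using that a by (auto simp: complex_eq_iff)
  have fg: "f z = (z - of_real a) / (z + of_real a) * g z" if "Re z > 0" for z
    using nz[OF that] fa by (auto simp: g_def)
  have bound: "norm (g z) \<le> M" if z: "Re z > 0" "z \<noteq> of_real a" for z
  proof (rule field_le_epsilon)
    fix e :: real assume e: "e > 0"
    \<comment> \<open>\<open>Schwarz_Lemma\<close> needs a strict bound by 1; the slack
      \<open>e\<close> provides it, and \<open>field_le_epsilon\<close> lets it tend to 0.\<close>
    define M' where "M' = M + e"
    have M': "M' > M" "M' > 0" using e M0 by (auto simp: M'_def)
    \<comment> \<open>Cayley map of the unit disk to the half-plane. The point \<open>w\<close>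
      below is the preimage of \<open>z\<close>, and as a function of \<open>z\<close> it is the
      Blaschke factor.\<close>
    define \<phi> where "\<phi> = (\<lambda>w::complex. of_real a * (1 + w) / (1 - w))"
    have Re\<phi>: "Re (\<phi> w) > 0" if "norm w < 1" for w
    proof -
      have w1: "w \<noteq> 1" using that by auto
      have "Re ((1 + w) / (1 - w)) = (1 - (norm w)\<^sup>2) / (norm (1 - w))\<^sup>2"
        by (simp add: Re_divide cmod_power2) (simp add: algebra_simps power2_eq_square)
      moreover have "(norm w)\<^sup>2 < 1" using that by (simp add: power_less_one_iff)
      ultimately have "Re ((1 + w) / (1 - w)) > 0" using w1 by simp
      then have "a * Re ((1 + w) / (1 - w)) > 0" using a by simp
      moreover have "\<phi> w = of_real a * ((1 + w) / (1 - w))" by (simp add: \<phi>_def)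
      ultimately show ?thesis by (metis Re_complex_of_real Im_complex_of_real times_complex.simps(1) diff_zero mult_zero_left)
    qed
    define F where "F = (\<lambda>w. f (\<phi> w) / of_real M')"
    have "F holomorphic_on ball 0 1"
      unfolding F_def
    proof (intro holomorphic_intros holomorphic_on_compose_gen[OF _ f, unfolded o_def])
      show "\<phi> holomorphic_on ball 0 1" unfolding \<phi>_def by (intro holomorphic_intros) auto
      show "\<phi> ` ball 0 1 \<subseteq> ?H" using Re\<phi> by auto
    qed (use M' in auto)
    moreover have "F 0 = 0" by (simp add: F_def \<phi>_def fa)
    moreover have "norm (F w) < 1" if "norm w < 1" for w
      using M[OF Re\<phi>[OF that]] M' by (simp add: F_def norm_divide)
    moreover define w where "w = (z - of_real a) / (z + of_real a)"
    moreover have w: "norm w < 1"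
    proof -
      have "norm (z - of_real a) < norm (z + of_real a)"
        using z a by (simp add: cmod_def power2_eq_square algebra_simps)
      then show ?thesis using nz[OF z(1)] by (simp add: w_def norm_divide)
    qed
    ultimately have "norm (F w) \<le> norm w" by (intro Schwarz_Lemma(1)) auto
    moreover have "\<phi> w = z"
    proof -
      have "1 + w = 2 * z / (z + of_real a)" "1 - w = 2 * of_real a / (z + of_real a)"
        using nz[OF z(1)] by (simp_all add: w_def field_simps)
      then show ?thesis using nz[OF z(1)] a by (simp add: \<phi>_def)
    qed
    ultimately have "norm (f z) \<le> M' * norm w"
      using M' by (simp add: F_def norm_divide field_simps)
    moreover have "norm (f z) = norm w * norm (g z)"
      using fg[OF z(1)] by (simp add: w_def norm_mult norm_divide)
    moreover have "norm w > 0" using z nz[OF z(1)] by (simp add: w_def)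
    ultimately show "norm (g z) \<le> M + e" by (simp add: M'_def mult.commute)
  qed
  \<comment> \<open>At \<open>a\<close> itself the quotient involves a derivative; the bound passes
    to it by continuity.\<close>
  have "norm (g (of_real a)) \<le> M"
  proof (rule tendsto_upperbound)
    have "isCont g (of_real a)"
      using holomorphic_on_imp_continuous_on[OF holg] opH a by (simp add: continuous_on_eq_continuous_at)
    then show "((\<lambda>z. norm (g z)) \<longlongrightarrow> norm (g (of_real a))) (at (of_real a))"
      by (intro tendsto_norm) (simp add: isCont_def)
    have "\<forall>\<^sub>F z in at (of_real a). z \<in> ?H - {of_real a}"
      using opH a by (intro eventually_at_in_open) auto
    then show "\<forall>\<^sub>F z in at (of_real a). norm (g z) \<le> M"
      by eventually_elim (use bound in auto)
  qed auto
  with bound fg holg that show ?thesis by metis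
qed

text \<open>Dividing out the first \<open>n\<close> zeros leaves a quotient still bounded by
  \<open>M\<close>, so \<open>f\<close> is at most \<open>M\<close> times a product of
  \<open>n\<close> Blaschke factors. At a real point to the left of all zeros these factors are at
  most exp(-d/(j + 1)), and the divergence of the harmonic series sends the product to 0. Vanishing
  on an interval gives vanishing everywhere.\<close>

lemma bounded_holomorphic_progression_eq_0:
  fixes f :: "complex \<Rightarrow> complex" and p c M :: real
  assumes f: "f holomorphic_on {z. Re z > 0}" and p: "p > 0" and c: "c > 0"
    and M: "\<And>z. Re z > 0 \<Longrightarrow> norm (f z) \<le> M"
    and zero: "\<And>j::nat. f (of_real (c + p * j)) = 0" and z: "Re z > 0"
  shows "f z = 0"
proof -
  let ?H = "{z::complex. Re z > 0}"
  define a where "a = (\<lambda>j::nat. c + p * real j)"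
  have apos: "a j > 0" for j using p c by (simp add: a_def add_pos_nonneg)
  have ainj: "a i = a j \<longleftrightarrow> i = j" for i j using p by (simp add: a_def)
  have quot: "\<exists>g. g holomorphic_on ?H \<and> (\<forall>z. Re z > 0 \<longrightarrow> norm (g z) \<le> M) \<and>
     (\<forall>z. Re z > 0 \<longrightarrow> f z = (\<Prod>j<n. (z - of_real (a j)) / (z + of_real (a j))) * g z)" for n
  proof (induction n)
    case 0
    show ?case by (rule exI[of _ f]) (use f M in auto)
  next
    case (Suc n)
    then obtain g where g: "g holomorphic_on ?H" "\<And>z. Re z > 0 \<Longrightarrow> norm (g z) \<le> M"
      "\<And>z. Re z > 0 \<Longrightarrow> f z = (\<Prod>j<n. (z - of_real (a j)) / (z + of_real (a j))) * g z" by auto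
    have "f (of_real (a n)) = 0" using zero[of n] by (simp add: a_def)
    moreover have "(\<Prod>j<n. (of_real (a n) - of_real (a j)) / (of_real (a n) + of_real (a j))) \<noteq> (0::complex)"
      using ainj apos by (simp flip: of_real_diff of_real_add) (metis add_pos_pos less_irrefl nat_neq_iff)
    ultimately have "g (of_real (a n)) = 0" using g(3)[of "of_real (a n)"] apos by auto
    from Schwarz_halfplane[OF g(1) apos g(2) this] obtain h where h: "h holomorphic_on ?H"
      "\<And>z. Re z > 0 \<Longrightarrow> norm (h z) \<le> M"
      "\<And>z. Re z > 0 \<Longrightarrow> g z = (z - of_real (a n)) / (z + of_real (a n)) * h z" by metis
    show ?case by (rule exI[of _ h]) (use h g(3) in auto)
  qed
  have f0: "f (of_real x) = 0" if x: "0 < x" "x < c" for x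
  proof -
    \<comment> \<open>Chosen so that the deficit 2x/(x + a_j) of the j-th factor is at least d/(j +
      1), since x + a_j \<le> (2c + p)(j + 1).\<close>
    define d where "d = 2 * x / (2 * c + p)"
    have d: "d > 0" using x p c by (simp add: d_def)
    have le: "norm (f (of_real x)) \<le> M * exp (- d * harm n)" for n
    proof -
      obtain g where g': "\<And>z. Re z > 0 \<Longrightarrow> norm (g z) \<le> M"
        "\<And>z. Re z > 0 \<Longrightarrow> f z = (\<Prod>j<n. (z - of_real (a j)) / (z + of_real (a j))) * g z"
        using quot[of n] by metis
      have g: "norm (g (of_real x :: complex)) \<le> M"
        "f (of_real x) = (\<Prod>j<n. (of_real x - of_real (a j)) / (of_real x + of_real (a j))) * g (of_real x)"
        using g'[of "of_real x"] x by simp_all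
      have fac: "norm ((of_real x - of_real (a j)) / (of_real x + of_real (a j)) :: complex) \<le> exp (- d / real (Suc j))" for j
      proof -
        have ax: "a j > x" using x(2) mult_nonneg_nonneg[of p "real j"] p unfolding a_def by linarith
        have "norm ((of_real x - of_real (a j)) / (of_real x + of_real (a j)) :: complex) = \<bar>(x - a j) / (x + a j)\<bar>"
          by (metis norm_of_real of_real_add of_real_diff of_real_divide)
        also have "\<dots> = 1 - 2 * x / (x + a j)"
          using ax x apos[of j] by (simp add: abs_if field_simps)
        also have "\<dots> \<le> 1 - d / real (Suc j)"
        proof -
          have "x + a j \<le> (2 * c + p) * real (Suc j)"
            using x p c mult_nonneg_nonneg[of c "real j"] unfolding a_def of_nat_Suc
            by (simp only: ring_distribs) linarith
          then have "2 * x / ((2 * c + p) * real (Suc j)) \<le> 2 * x / (x + a j)"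
            using x apos[of j] p c by (intro divide_left_mono mult_pos_pos) auto
          then show ?thesis by (simp add: d_def)
        qed
        also have "\<dots> \<le> exp (- d / real (Suc j))" using exp_ge_add_one_self[of "- d / real (Suc j)"] by simp
        finally show ?thesis .
      qed
      have "norm (f (of_real x)) = (\<Prod>j<n. norm ((of_real x - of_real (a j)) / (of_real x + of_real (a j)) :: complex)) * norm (g (of_real x))"
        by (simp add: g(2) norm_mult prod_norm)
      also have "\<dots> \<le> (\<Prod>j<n. exp (- d / real (Suc j))) * M"
        using fac g(1) by (intro mult_mono prod_mono prod_nonneg) auto
      also have "(\<Prod>j<n. exp (- d / real (Suc j))) = exp (\<Sum>j<n. - d / real (Suc j))" by (simp add: exp_sum)
      also have "(\<Sum>j<n. - d / real (Suc j)) = - d * harm n"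
        by (simp add: harm_altdef sum_distrib_left field_simps sum_negf)
      finally show ?thesis by (simp add: mult.commute)
    qed
    have "filterlim (\<lambda>n. d * harm n) at_top sequentially"
      by (rule filterlim_tendsto_pos_mult_at_top[OF tendsto_const d harm_at_top])
    then have "filterlim (\<lambda>n. - d * harm n) at_bot sequentially"
      by (simp add: filterlim_uminus_at_bot)
    then have "(\<lambda>n. exp (- d * harm n)) \<longlonglongrightarrow> 0" by (rule filterlim_compose[OF exp_at_bot])
    then have "(\<lambda>n. M * exp (- d * harm n)) \<longlonglongrightarrow> M * 0" by (intro tendsto_intros)
    then have "norm (f (of_real x)) \<le> M * 0" by (rule LIMSEQ_le_const) (use le in auto)
    then show ?thesis by simp
  qed
  show ?thesis
  proof (rule analytic_continuation[OF f, of "of_real ` {0<..<c}" "of_real (c/2)"])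
    show "open ?H" by (simp add: open_halfspace_Re_gt)
    show "connected ?H" by (simp add: convex_connected convex_halfspace_Re_gt)
    have "(c/2) islimpt {0<..<c}" using c by (intro interior_limit_point) (simp add: interior_open)
    then have "complex_of_real (c/2) islimpt of_real ` {0<..<c}"
      unfolding islimpt_approachable by (metis (no_types, lifting) dist_of_real of_real_eq_iff image_eqI)
    then show "complex_of_real (c/2) islimpt of_real ` {0<..<c}" .
  qed (use c z f0 in auto)
qed

text \<open>After a shift to Re z > 0, division by (z + 1)^N, which has no zero there, turns
  polynomial growth into boundedness.\<close>

lemma poly_bounded_progression_eq_0:
  fixes f :: "complex \<Rightarrow> complex" and p x0 z0 C :: real
  assumes f: "f holomorphic_on {z. Re z > x0}" and p: "p > 0" and z0: "z0 > x0"
    and C: "\<And>z. Re z > x0 \<Longrightarrow> norm (f z) \<le> C * (1 + norm z) ^ N"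
    and zero: "\<And>j::nat. f (of_real (z0 + p * j)) = 0" and z: "Re z > x0"
  shows "f z = 0"
proof -
  define g where "g = (\<lambda>z. f (z + of_real x0) / (z + 1) ^ N)"
  have nz: "z + 1 \<noteq> 0" if "Re z > 0" for z using that by (auto simp: complex_eq_iff)
  \<comment> \<open>As |z + 1| \<ge> 1 for Re z > 0, this constant gives 1 + |z + x0| \<le> D |z +
    1|.\<close>
  define D where "D = 3 + \<bar>x0\<bar>"
  have C0: "C \<ge> 0"
  proof -
    have "0 \<le> C * (1 + norm (of_real (x0 + 1) :: complex)) ^ N"
      using C[of "of_real (x0+1)"] by (simp del: of_real_add) (meson norm_ge_zero order_trans)
    moreover have "(1 + norm (of_real (x0 + 1) :: complex)) ^ N > 0"
      by (intro zero_less_power) (simp add: add_pos_nonneg)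
    ultimately show ?thesis by (metis mult_neg_pos not_le)
  qed
  have "g (z - of_real x0) = 0"
  proof (rule bounded_holomorphic_progression_eq_0[of g p "z0 - x0" "C * D ^ N"])
    show "g holomorphic_on {z. Re z > 0}"
      unfolding g_def
      by (intro holomorphic_intros holomorphic_on_compose_gen[OF _ f, unfolded o_def]) (use nz in auto)
  next
    fix z :: complex assume z: "Re z > 0"
    have "norm (z + 1) \<ge> 1" using z complex_Re_le_cmod[of "z+1"] by simp
    moreover have "norm (z + of_real x0) \<le> norm (z + 1) + 1 + \<bar>x0\<bar>"
    proof -
      have "z + of_real x0 = (z + 1) + (of_real x0 - 1)" by simp
      then have "norm (z + of_real x0) \<le> norm (z + 1) + norm (of_real x0 - 1 :: complex)"
        by (metis norm_triangle_ineq)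
      also have "norm (of_real x0 - 1 :: complex) \<le> \<bar>x0\<bar> + 1"
        using norm_triangle_ineq4[of "of_real x0 :: complex" 1] by simp
      finally show ?thesis by simp
    qed
    ultimately have "1 + norm (z + of_real x0) \<le> D * norm (z + 1)"
      using mult_left_mono[of 1 "norm (z+1)" "2 + \<bar>x0\<bar>"] by (simp add: D_def algebra_simps)
    then have "(1 + norm (z + of_real x0)) ^ N \<le> (D * norm (z + 1)) ^ N"
      by (intro power_mono) auto
    then have "norm (f (z + of_real x0)) \<le> C * (D * norm (z + 1)) ^ N"
      using C[of "z + of_real x0"] z C0 by (smt (verit) mult_left_mono Re_complex_of_real plus_complex.simps(1))
    then show "norm (g z) \<le> C * D ^ N"
      using nz[OF z] by (simp add: g_def norm_divide norm_power power_mult_distrib divide_le_eq mult.assoc)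
  next
    fix j :: nat
    show "g (of_real (z0 - x0 + p * j)) = 0" using zero[of j] by (simp add: g_def algebra_simps)
  qed (use p z0 z in auto)
  then show ?thesis using nz[of "z - of_real x0"] z by (simp add: g_def)
qed

section \<open>Polynomial growth of quotients of Gamma functions\<close>

text \<open>In Euler's product for the quotient every factor is 1 + s/(u + i), and |u + i| \<ge> c +
  i because Re u \<ge> c. Hence the modulus is largest at the real point \<open>c\<close>.\<close>

lemma norm_Gamma_ratio_le:
  assumes u: "Re u \<ge> c" and c: "c > 0" and s: "s \<ge> 0"
  shows "norm (Gamma u * rGamma (u + of_real s)) \<le> Gamma c * rGamma (c + s)"
proof (rule LIMSEQ_le)
  show "(\<lambda>n. norm (Gamma_series u n * rGamma_series (u + of_real s) n)) \<longlonglongrightarrow> norm (Gamma u * rGamma (u + of_real s))"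
    by (intro tendsto_intros Gamma_series_LIMSEQ rGamma_series_LIMSEQ)
  show "(\<lambda>n. Gamma_series c n * rGamma_series (c + s) n) \<longlonglongrightarrow> Gamma c * rGamma (c + s)"
    by (intro tendsto_intros Gamma_series_LIMSEQ rGamma_series_LIMSEQ)
  show "\<exists>N. \<forall>n\<ge>N. norm (Gamma_series u n * rGamma_series (u + of_real s) n) \<le> Gamma_series c n * rGamma_series (c + s) n"
  proof (intro exI[of _ 1] allI impI)
    fix n :: nat assume n: "n \<ge> 1"
    have unz: "u + of_nat i \<noteq> 0" for i using u c by (auto simp: complex_eq_iff)
    have pos: "pochhammer c (n+1) > 0" using c by (intro pochhammer_pos)
    \<comment> \<open>In the quotient of the partial products the factorials and n^u cancel, which
      leaves n^(-s) and a finite product.\<close>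
    have eq: "Gamma_series u n * rGamma_series (u + of_real s) n
        = exp (- of_real s * of_real (ln n)) * (\<Prod>i\<in>{0..n}. (u + of_real s + of_nat i) / (u + of_nat i))"
      by (simp add: Gamma_series_def rGamma_series_def pochhammer_prod atLeastLessThanSuc_atLeastAtMost prod_dividef exp_minus exp_add field_simps)
    have eq': "Gamma_series c n * rGamma_series (c + s) n
        = exp (- s * ln n) * (\<Prod>i\<in>{0..n}. (c + s + of_nat i) / (c + of_nat i))"
      by (simp add: Gamma_series_def rGamma_series_def pochhammer_prod atLeastLessThanSuc_atLeastAtMost prod_dividef exp_minus exp_add field_simps)
    have "norm ((u + of_real s + of_nat i) / (u + of_nat i)) \<le> (c + s + of_nat i) / (c + of_nat i)" for i
    proof -
      have "(u + of_real s + of_nat i) / (u + of_nat i) = 1 + of_real s / (u + of_nat i)"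
        using unz[of i] by (simp add: field_simps)
      then have "norm ((u + of_real s + of_nat i) / (u + of_nat i)) \<le> 1 + s / norm (u + of_nat i)"
        using norm_triangle_ineq[of 1 "of_real s / (u + of_nat i)"] s by (simp add: norm_divide)
      also have "c + i \<le> norm (u + of_nat i)" using complex_Re_le_cmod[of "u + of_nat i"] u by simp
      then have "1 + s / norm (u + of_nat i) \<le> 1 + s / (c + i)"
        using c s unz[of i] by (intro add_left_mono divide_left_mono mult_pos_pos) auto
      also have "\<dots> = (c + s + i) / (c + i)" using c by (simp add: field_simps)
      finally show ?thesis .
    qed
    then have "norm (\<Prod>i\<in>{0..n}. (u + of_real s + of_nat i) / (u + of_nat i)) \<le> (\<Prod>i\<in>{0..n}. (c + s + of_nat i) / (c + of_nat i))"
      by (simp only: prod_norm[symmetric]) (intro prod_mono, auto)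
    moreover have "norm (exp (- of_real s * of_real (ln n)) :: complex) = exp (- s * ln n)" by simp
    ultimately show "norm (Gamma_series u n * rGamma_series (u + of_real s) n) \<le> Gamma_series c n * rGamma_series (c + s) n"
      unfolding eq eq' by (simp only: norm_mult) (intro mult_left_mono, auto)
  qed
qed

text \<open>Raising \<beta> by a large integer \<open>N\<close> makes the gap \<open>s\<close>
  between the arguments nonnegative, where the quotient is bounded; undoing the shift costs a
  Pochhammer factor of degree \<open>N\<close>.\<close>

lemma Gamma_ratio_poly_bounded:
  fixes \<alpha> \<beta> x0 :: real
  assumes x0: "x0 + \<alpha> > 0" "x0 + \<beta> > 0"
  obtains C N where "C \<ge> 0" "\<And>w. Re w \<ge> x0 \<Longrightarrow> norm (Gamma (w + of_real \<alpha>) * rGamma (w + of_real \<beta>)) \<le> C * (1 + norm w) ^ N"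
proof -
  obtain N :: nat where N: "real N > \<bar>\<alpha>\<bar> + \<bar>\<beta>\<bar>" using reals_Archimedean2 by blast
  define s where "s = \<beta> + N - \<alpha>"
  have s: "s \<ge> 0" using N by (simp add: s_def)
  define B where "B = Gamma (x0 + \<alpha>) * rGamma (x0 + \<alpha> + s)"
  have B: "B \<ge> 0" unfolding B_def using norm_Gamma_ratio_le[of "x0+\<alpha>" "of_real (x0+\<alpha>)" s] x0 s
    by (smt (verit) Re_complex_of_real norm_ge_zero)
  define D where "D = 1 + \<bar>\<beta>\<bar> + N"
  show ?thesis
  proof (rule that[of "B * D ^ N" N])
    fix w :: complex assume w: "Re w \<ge> x0"
    have "pochhammer (w + of_real \<beta>) N * rGamma (w + of_real \<beta> + of_nat N) = rGamma (w + of_real \<beta>)"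
      by (rule pochhammer_rGamma[symmetric])
    moreover have "w + of_real \<beta> + of_nat N = (w + of_real \<alpha>) + of_real s" by (simp add: s_def)
    ultimately have eq: "Gamma (w + of_real \<alpha>) * rGamma (w + of_real \<beta>)
        = pochhammer (w + of_real \<beta>) N * (Gamma (w + of_real \<alpha>) * rGamma ((w + of_real \<alpha>) + of_real s))"
      by (metis mult.left_commute)
    have "norm (Gamma (w + of_real \<alpha>) * rGamma ((w + of_real \<alpha>) + of_real s)) \<le> B"
      unfolding B_def using w x0 s by (intro norm_Gamma_ratio_le) auto
    moreover have "norm (pochhammer (w + of_real \<beta>) N) \<le> (D * (1 + norm w)) ^ N"
    proof -
      have "norm (w + of_real \<beta> + of_nat i) \<le> D * (1 + norm w)" if "i < N" for i
      proof -
        have "norm (w + of_real \<beta> + of_nat i) \<le> norm w + \<bar>\<beta>\<bar> + i"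
          by (metis norm_triangle_mono norm_triangle_ineq norm_of_real norm_of_nat order_refl)
        also have "\<dots> \<le> norm w + \<bar>\<beta>\<bar> + N" using that by simp
        also have "\<dots> \<le> D * (1 + norm w)"
          using mult_nonneg_nonneg[OF abs_ge_zero[of \<beta>] norm_ge_zero[of w]]
            mult_nonneg_nonneg[OF of_nat_0_le_iff[of N] norm_ge_zero[of w]]
          unfolding D_def by (simp only: ring_distribs)
        finally show ?thesis .
      qed
      then have "norm (\<Prod>i = 0..<N. w + of_real \<beta> + of_nat i) \<le> (\<Prod>i = 0..<N. D * (1 + norm w))"
        by (simp only: prod_norm[symmetric]) (intro prod_mono, auto)
      then show ?thesis by (simp add: pochhammer_prod)
    qed
    ultimately have "norm (Gamma (w + of_real \<alpha>) * rGamma (w + of_real \<beta>)) \<le> (D * (1 + norm w)) ^ N * B"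
      unfolding eq norm_mult by (intro mult_mono zero_le_power mult_nonneg_nonneg) (use B in \<open>auto simp: D_def\<close>)
    then show "norm (Gamma (w + of_real \<alpha>) * rGamma (w + of_real \<beta>)) \<le> B * D ^ N * (1 + norm w) ^ N"
      by (simp add: power_mult_distrib mult_ac)
  qed (use B in \<open>auto simp: D_def\<close>)
qed

section \<open>Integration over the disk in polar coordinates\<close>

text \<open>Invariance of Lebesgue measure under orthogonal maps is used in \<open>real^2\<close>;
  multiplication by a unimodular number is transported there.\<close>

lemma mult_unit_orthogonal:
  fixes c :: complex assumes "norm c = 1"
  shows "\<exists>f :: real^2 \<Rightarrow> real^2. orthogonal_transformation f \<and>
     (\<forall>x. Complex (f x $ 1) (f x $ 2) = c * Complex (x $ 1) (x $ 2))"
proof (intro exI conjI allI)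
  let ?f = "\<lambda>x::real^2. vector [Re c * x$1 - Im c * x$2, Re c * x$2 + Im c * x$1] :: real^2"
  have c: "(Re c)\<^sup>2 + (Im c)\<^sup>2 = 1" using assms by (simp add: cmod_def)
  show "Complex (?f x $ 1) (?f x $ 2) = c * Complex (x $ 1) (x $ 2)" for x
    by (simp add: complex_eq_iff)
  have "linear ?f"
    by (rule linearI) (simp_all add: vec_eq_iff forall_2 algebra_simps)
  moreover have "norm (?f x) = norm x" for x
  proof -
    have "(Re c * x$1 - Im c * x$2)\<^sup>2 + (Re c * x$2 + Im c * x$1)\<^sup>2 = ((Re c)\<^sup>2 + (Im c)\<^sup>2) * ((x$1)\<^sup>2 + (x$2)\<^sup>2)"
      by (simp add: power2_eq_square algebra_simps)
    then show ?thesis using c by (simp add: norm_vec_def L2_set_def sum_2)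
  qed
  ultimately show "orthogonal_transformation ?f" by (simp add: orthogonal_transformation)
qed

lemma measurable_Complex_vec [measurable]: "(\<lambda>x::real^2. Complex (x $ 1) (x $ 2)) \<in> borel_measurable borel"
  by (intro borel_measurable_continuous_onI) (auto simp: Complex_eq intro!: continuous_intros)

lemma lborel_complex_vec: "(lborel :: complex measure) = distr lborel borel (\<lambda>x::real^2. Complex (x $ 1) (x $ 2))"
proof (rule lborel_eqI)
  fix l u :: complex assume le: "\<And>b. b \<in> Basis \<Longrightarrow> l \<bullet> b \<le> u \<bullet> b"
  have le': "Re l \<le> Re u" "Im l \<le> Im u" using le[of 1] le[of \<i>] by (auto simp: Basis_complex_def)
  have eq: "(\<lambda>x::real^2. Complex (x $ 1) (x $ 2)) -` box l u = box (vector [Re l, Im l]) (vector [Re u, Im u])"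
    by (auto simp: box_def Basis_complex_def Basis_vec_def inner_axis forall_2)
  have B2: "(Basis :: (real^2) set) = {axis 1 1, axis 2 1}"
    by (auto simp: Basis_vec_def UNIV_2)
  have ne: "axis 1 1 \<noteq> (axis 2 1 :: real^2)" by (simp add: axis_eq_axis)
  show "emeasure (distr lborel borel (\<lambda>x::real^2. Complex (x $ 1) (x $ 2))) (box l u) = ennreal (\<Prod>b\<in>Basis. (u - l) \<bullet> b)"
    using le' by (simp add: emeasure_distr eq emeasure_lborel_box_eq B2 ne inner_axis Basis_complex_def inner_diff_left)
qed simp

lemma lborel_complex_rotate:
  fixes c :: complex assumes c: "norm c = 1"
  shows "distr lborel borel ((*) c) = lborel"
proof (rule sym, rule lborel_eqI)
  let ?v = "\<lambda>x::real^2. Complex (x $ 1) (x $ 2)"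
  have c0: "c \<noteq> 0" using c by auto
  obtain f :: "real^2 \<Rightarrow> real^2" where f: "orthogonal_transformation f" "\<And>x. ?v (f x) = inverse c * ?v x"
    using mult_unit_orthogonal[of "inverse c"] c by (auto simp: norm_inverse)
  have [measurable]: "(*) c \<in> borel_measurable borel" by (intro borel_measurable_continuous_onI continuous_intros)
  fix l u :: complex assume le: "\<And>b. b \<in> Basis \<Longrightarrow> l \<bullet> b \<le> u \<bullet> b"
  define B where "B = ?v -` box l u"
  have B: "B \<in> sets borel" unfolding B_def using measurable_sets_borel[OF measurable_Complex_vec] by auto
  have emB: "emeasure lborel B = ennreal (\<Prod>b\<in>Basis. (u - l) \<bullet> b)"
  proof -
    have "emeasure lborel B = emeasure (lborel :: complex measure) (box l u)"
      unfolding B_def by (subst lborel_complex_vec) (simp add: emeasure_distr)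
    then show ?thesis using le by simp
  qed
  have Blm: "B \<in> lmeasurable"
    using B emB by (simp add: fmeasurable_def)
  define B' where "B' = ?v -` ((*) c -` box l u)"
  have B': "B' \<in> sets borel" unfolding B'_def using measurable_sets_borel[OF measurable_Complex_vec]
     measurable_sets_borel[of "(*) c" borel "box l u"] by auto
  \<comment> \<open>The preimage under multiplication by \<open>c\<close> is the image under the
    orthogonal map that realizes multiplication by \<open>inverse c\<close>.\<close>
  have "B' = f ` B"
  proof (intro set_eqI iffI)
    fix x assume "x \<in> B'"
    then have x: "c * ?v x \<in> box l u" by (simp add: B'_def)
    obtain y where y: "x = f y" using orthogonal_transformation_surj[OF f(1)] by (meson surjD)
    have "c * ?v x = ?v y" using f(2)[of y] c0 y by (simp add: field_simps)
    then show "x \<in> f ` B" using x y by (auto simp: B_def)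
  next
    fix x assume "x \<in> f ` B"
    then show "x \<in> B'" using f(2) c0 by (auto simp: B_def B'_def mult.assoc[symmetric])
  qed
  then have "measure lebesgue B' = measure lebesgue B" "B' \<in> lmeasurable"
    using measure_orthogonal_image[OF f(1) Blm] measurable_orthogonal_image[OF f(1) Blm] by auto
  then have "emeasure lebesgue B' = emeasure lebesgue B"
    by (metis Blm emeasure_eq_measure2)
  then have em: "emeasure lborel B' = emeasure lborel B"
    using B B' by simp
  have "emeasure (distr lborel borel ((*) c)) (box l u) = emeasure (lborel :: complex measure) ((*) c -` box l u)"
    by (simp add: emeasure_distr)
  also have "\<dots> = emeasure lborel B'"
    unfolding B'_def by (subst lborel_complex_vec, subst emeasure_distr)
      (use measurable_sets_borel[of "(*) c" borel "box l u"] in auto)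
  finally show "emeasure (distr lborel borel ((*) c)) (box l u) = ennreal (\<Prod>b\<in>Basis. (u - l) \<bullet> b)"
    using em emB by simp
qed simp

section \<open>Borel image measures of area and radius\<close>

text \<open>The image of \<open>dA\<close> under the inclusion into the plane
  (\<open>distr_dA\<close>): a Borel measure on all of \<open>complex\<close>, for which rotations
  and image measures involve neither completion nor restriction to the disk.\<close>

definition dAb :: "complex measure" where
  "dAb = density lborel (\<lambda>w. ennreal (indicator disk w / pi))"

lemma measurable_indicator_disk [measurable]:
  "(\<lambda>w. indicat_real disk w / pi) \<in> borel_measurable borel"
  by (intro borel_measurable_divide borel_measurable_indicator) auto

text \<open>The radial part 2r dr of the area measure, that is, the image of \<open>dAb\<close>
  under \<open>cmod\<close> (\<open>distr_dAb_cmod\<close>).\<close>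

definition dr2 :: "real measure" where
  "dr2 = density lborel (\<lambda>r. ennreal (2 * r * indicator {0..1} r))"

lemma sets_dAb [measurable_cong, simp]: "sets dAb = sets borel" and space_dAb [simp]: "space dAb = UNIV"
  and sets_dr2 [measurable_cong, simp]: "sets dr2 = sets borel" and space_dr2 [simp]: "space dr2 = UNIV"
  by (simp_all add: dAb_def dr2_def)

lemma measurable_cmod_dAb [measurable]: "cmod \<in> dAb \<rightarrow>\<^sub>M borel"
  by (subst measurable_cong_sets[OF sets_dAb refl]) measurable

lemma emeasure_lborel_ball_complex:
  "r \<ge> 0 \<Longrightarrow> emeasure lborel (ball (0::complex) r) = ennreal (pi * r\<^sup>2)"
  "r \<ge> 0 \<Longrightarrow> emeasure lborel (cball (0::complex) r) = ennreal (pi * r\<^sup>2)"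
  using unit_ball_vol_even[of 1] by (simp_all add: emeasure_ball emeasure_cball)

lemma emeasure_dAb:
  assumes [measurable]: "A \<in> sets borel"
  shows "emeasure dAb A = ennreal (1 / pi) * emeasure lborel (A \<inter> disk)"
proof -
  have "emeasure dAb A = (\<integral>\<^sup>+w. ennreal (indicator disk w / pi) * indicator A w \<partial>lborel)"
    unfolding dAb_def by (rule emeasure_density) auto
  also have "\<dots> = (\<integral>\<^sup>+w. ennreal (1 / pi) * indicator (A \<inter> disk) w \<partial>lborel)"
    by (intro nn_integral_cong) (auto split: split_indicator)
  finally show ?thesis by (simp add: nn_integral_cmult_indicator)
qed

lemma space_dA [simp]: "space dA = disk" and sets_dA: "sets dA = sets (lebesgue_on disk)"
  by (simp_all add: dA_def)

lemma id_measurable_dA: "(\<lambda>z. z) \<in> dA \<rightarrow>\<^sub>M borel"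
proof -
  have "(\<lambda>z. z) \<in> lebesgue_on disk \<rightarrow>\<^sub>M (borel :: complex measure)"
    by (intro measurable_restrict_space1 measurable_completion) simp
  then show ?thesis by (simp add: sets_dA cong: measurable_cong_sets)
qed

lemma emeasure_dA:
  assumes "A \<in> sets lebesgue"
  shows "emeasure dA (A \<inter> disk) = ennreal (1 / pi) * emeasure lebesgue (A \<inter> disk)"
proof -
  have sub: "A \<inter> disk \<in> sets (lebesgue_on disk)"
    using assms by (auto simp: sets_restrict_space_iff)
  have d: "disk \<in> sets (lebesgue_on disk)" by (simp add: sets_restrict_space_iff)
  have ed: "emeasure (lebesgue_on disk) disk = ennreal pi"
    using emeasure_lborel_ball_complex(1)[of 1] by (subst emeasure_restrict_space) auto
  have "emeasure dA (A \<inter> disk) = emeasure (lebesgue_on disk) (disk \<inter> (A \<inter> disk)) / emeasure (lebesgue_on disk) disk"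
    unfolding dA_def by (rule emeasure_uniform_measure[OF d sub])
  also have "emeasure (lebesgue_on disk) (disk \<inter> (A \<inter> disk)) = emeasure lebesgue (A \<inter> disk)"
    using assms by (subst emeasure_restrict_space) (auto simp: Int_ac)
  finally show ?thesis unfolding ed
    by (simp add: divide_ennreal_def inverse_ennreal mult.commute inverse_eq_divide)
qed

lemma distr_dA: "distr dA borel (\<lambda>z. z) = dAb"
proof (rule measure_eqI)
  fix A :: "complex set" assume "A \<in> sets (distr dA borel (\<lambda>z. z))"
  then have A: "A \<in> sets borel" by simp
  then have "emeasure (distr dA borel (\<lambda>z. z)) A = emeasure dA (A \<inter> disk)"
    by (subst emeasure_distr[OF id_measurable_dA]) auto
  also have "\<dots> = emeasure dAb A" using A by (subst emeasure_dA) (auto simp: emeasure_dAb)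
  finally show "emeasure (distr dA borel (\<lambda>z. z)) A = emeasure dAb A" .
qed simp

lemma integral_dA:
  fixes f :: "complex \<Rightarrow> 'b::{banach, second_countable_topology}"
  assumes "f \<in> borel_measurable borel"
  shows "integral\<^sup>L dA f = integral\<^sup>L dAb f" "integrable dA f \<longleftrightarrow> integrable dAb f"
  using integral_distr[OF id_measurable_dA assms] integrable_distr_eq[OF id_measurable_dA assms]
  by (simp_all add: distr_dA)

lemma emeasure_dAb_UNIV: "emeasure dAb UNIV = 1"
  by (simp add: emeasure_dAb emeasure_lborel_ball_complex(1)[of 1] flip: ennreal_mult')

lemma distr_dAb_rotate:
  assumes c: "norm c = 1"
  shows "distr dAb borel ((*) c) = dAb"
proof -
  have [measurable]: "(*) c \<in> borel_measurable borel" by (intro borel_measurable_continuous_onI continuous_intros)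
  have "dAb = density (distr lborel borel ((*) c)) (\<lambda>w. ennreal (indicator disk w / pi))"
    by (simp add: dAb_def lborel_complex_rotate[OF c])
  also have "\<dots> = distr (density lborel (\<lambda>w. ennreal (indicator disk (c * w) / pi))) borel ((*) c)"
    by (rule density_distr) simp_all
  also have "(\<lambda>w. ennreal (indicator disk (c * w) / pi)) = (\<lambda>w. ennreal (indicator disk w / pi))"
    using c by (auto simp: indicator_def norm_mult)
  finally show ?thesis by (simp add: dAb_def)
qed

text \<open>Both finite measures are compared on the rays {x<..}, where the normalized area outside
  a disk of radius \<open>y\<close> is 1 - y^2.\<close>

lemma distr_dAb_cmod: "distr dAb borel cmod = dr2"
proof (rule measure_eqI_lessThan)
  fix x :: real
  interpret finite_measure dAb by (rule finite_measureI) (simp add: emeasure_dAb_UNIV)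
  have m: "cmod -` {x<..} \<in> sets borel"
    using measurable_sets_borel[of cmod borel "{x<..}"] by simp
  have e1: "emeasure (distr dAb borel cmod) {x<..} = emeasure dAb (cmod -` {x<..})"
    by (subst emeasure_distr[OF measurable_cmod_dAb]) auto
  show "emeasure (distr dAb borel cmod) {x<..} < \<infinity>"
    unfolding e1 using emeasure_finite[of "cmod -` {x<..}"] by (simp add: less_top[symmetric])
  \<comment> \<open>Clamping \<open>x\<close> to [0, 1] gives one formula for all rays.\<close>
  define y where "y = max 0 (min 1 x)"
  have y: "0 \<le> y" "y \<le> 1" by (auto simp: y_def)
  have "emeasure dr2 {x<..} = (\<integral>\<^sup>+r. ennreal (2 * r) * indicator {y..1} r \<partial>lborel)"
    unfolding dr2_def
  proof (subst emeasure_density, goal_cases)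
    case 3
    have "AE r in lborel. r \<noteq> y" by (rule AE_lborel_singleton)
    then show ?case
      by (intro nn_integral_cong_AE) (auto split: split_indicator simp: y_def)
  qed auto
  also have "\<dots> = ennreal (1\<^sup>2 - y\<^sup>2)"
    using y by (intro nn_integral_FTC_Icc) (auto intro!: derivative_eq_intros)
  finally have e2: "emeasure dr2 {x<..} = ennreal (1 - y\<^sup>2)" by simp
  have yl: "y\<^sup>2 \<le> 1" using y by (simp add: power_le_one)
  have "emeasure dAb (cmod -` {x<..}) = ennreal (1/pi) * emeasure lborel (cmod -` {x<..} \<inter> disk)"
    by (rule emeasure_dAb[OF m])
  also have "emeasure lborel (cmod -` {x<..} \<inter> disk) = emeasure lborel (disk - cball 0 y)" if "x \<ge> 0"
    using that by (intro arg_cong[where f="emeasure lborel"]) (auto simp: y_def)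
  also have "emeasure lborel (disk - cball 0 y) = ennreal (pi * (1 - y\<^sup>2))" if "x \<ge> 0" "x < 1"
    using y that yl emeasure_lborel_ball_complex(1)[of 1] emeasure_lborel_ball_complex(2)[of y]
    by (subst emeasure_Diff) (auto simp: y_def ennreal_minus algebra_simps)
  finally have A: "emeasure dAb (cmod -` {x<..}) = ennreal (1 - y\<^sup>2)" if "x \<ge> 0" "x < 1"
    using that yl by (simp flip: ennreal_mult')
  have B: "emeasure dAb (cmod -` {x<..}) = ennreal (1 - y\<^sup>2)" if "x < 0"
  proof -
    have "cmod -` {x<..} = UNIV" using that by (auto intro: less_le_trans[OF _ norm_ge_zero])
    then show ?thesis using that emeasure_dAb_UNIV by (simp add: y_def)
  qed
  have C: "emeasure dAb (cmod -` {x<..}) = ennreal (1 - y\<^sup>2)" if "x \<ge> 1"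
  proof -
    have "cmod -` {x<..} \<inter> disk = {}" using that by auto
    then show ?thesis using that m by (simp add: y_def emeasure_dAb)
  qed
  show "emeasure (distr dAb borel cmod) {x<..} = emeasure dr2 {x<..}"
    unfolding e1 e2 using A B C by linarith
qed auto

lemma AE_dr2: "(AE r in dr2. P r) \<longleftrightarrow> (AE r in lborel. 0 < r \<and> r < 1 \<longrightarrow> P r)"
proof -
  have "AE r in lborel. r \<noteq> (0::real)" "AE r in lborel. r \<noteq> (1::real)" by (rule AE_lborel_singleton)+
  then have "AE r in lborel. (ennreal (2 * r * indicator {0..1} r) > 0 \<longleftrightarrow> 0 < r \<and> r < 1)"
    by eventually_elim (auto split: split_indicator )
  then show ?thesis
    unfolding dr2_def by (subst AE_density) (auto elim: eventually_elim2)
qed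

lemma AE_dA_radialI:
  assumes "AE r in lborel. 0 < r \<and> r < 1 \<longrightarrow> P r"
  shows "AE z in dA. P (cmod z)"
proof -
  have "AE r in dr2. P r" using assms by (simp add: AE_dr2)
  then have "AE r in distr (distr dA borel (\<lambda>z. z)) borel cmod. P r" unfolding distr_dA distr_dAb_cmod .
  then have "AE z in distr dA borel (\<lambda>z. z). P (cmod z)" by (rule AE_distrD[rotated]) simp
  then show ?thesis by (rule AE_distrD[OF id_measurable_dA])
qed

lemma integral_dAb_radial:
  fixes g :: "real \<Rightarrow> complex"
  assumes [measurable]: "g \<in> borel_measurable borel"
  shows "(\<integral>w. g (cmod w) \<partial>dAb) = integral\<^sup>L dr2 g" "integrable dAb (\<lambda>w. g (cmod w)) \<longleftrightarrow> integrable dr2 g"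
  using integral_distr[OF measurable_cmod_dAb assms] integrable_distr_eq[OF measurable_cmod_dAb assms]
  by (simp_all add: distr_dAb_cmod)

section \<open>Borel representatives of radial functions\<close>

text \<open>Preimages in the disk of \<open>T\<close> and of its complement are filled from inside,
  up to null sets, by countable unions of compact sets, and the images of these under
  \<open>cmod\<close> are again compact. The radii missed by both fillings form a Borel null set, so
  \<open>T\<close> is squeezed between Borel sets.\<close>

lemma null_set_between:
  fixes T :: "real set"
  assumes T: "T \<subseteq> {0..<1}" and E: "cmod -` T \<inter> disk \<in> sets lebesgue"
  shows "T \<in> sets lebesgue"
proof -
  have inner: "\<exists>B. B \<in> sets borel \<and> B \<subseteq> U \<and> cmod -` (U - B) \<inter> disk \<in> null_sets lebesgue"
    if E: "cmod -` U \<inter> disk \<in> sets lebesgue" for U :: "real set"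
  proof -
    obtain C N where CN: "fsigma C" "N \<in> null_sets lebesgue" "C \<union> N = cmod -` U \<inter> disk"
      using lebesgue_set_almost_fsigma[OF E] by metis
    from CN(1)[unfolded fsigma_Union_compact]
    obtain F :: "nat \<Rightarrow> complex set" where "range F \<subseteq> Collect compact" "C = (\<Union>i. F i)" by metis
    then have F: "\<And>i. compact (F i)" "C = (\<Union>i. F i)" by auto
    define B where "B = (\<Union>i. cmod ` F i)"
    have cB: "cmod ` F i \<in> sets borel" for i
      using compact_continuous_image[OF continuous_on_norm_id F(1)] by (simp add: borel_compact)
    have 1: "B \<in> sets borel" unfolding B_def using cB by auto
    have 2: "B \<subseteq> U" using F(2) CN(3) by (auto simp: B_def)
    have "cmod -` (U - B) \<inter> disk \<subseteq> N" using CN(3) F(2) by (auto simp: B_def)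
    then have "cmod -` (U - B) \<inter> disk \<in> null_sets lebesgue"
      using CN(2) by (rule null_sets_completion_subset)
    then show ?thesis using 1 2 by blast
  qed
  obtain B where B: "B \<in> sets borel" "B \<subseteq> T" "cmod -` (T - B) \<inter> disk \<in> null_sets lebesgue"
    using inner[OF E] by blast
  have "cmod -` ({0..<1} - T) \<inter> disk = disk - (cmod -` T \<inter> disk)" by auto
  then have "cmod -` ({0..<1} - T) \<inter> disk \<in> sets lebesgue" using E by auto
  from inner[OF this] obtain B2 where B2: "B2 \<in> sets borel" "B2 \<subseteq> {0..<1} - T"
    "cmod -` (({0..<1} - T) - B2) \<inter> disk \<in> null_sets lebesgue" by blast
  \<comment> \<open>The radii covered by neither filling. The preimage of \<open>D\<close> in the
    disk is null, and by \<open>distr_dAb_cmod\<close> so is \<open>D\<close>.\<close>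
  define D where "D = {0..<1} - B2 - B"
  have D: "D \<in> sets borel" using B B2 by (auto simp: D_def)
  have mD: "cmod -` D \<in> sets borel" using measurable_sets_borel[of cmod borel D] D by simp
  have "cmod -` D \<inter> disk = (cmod -` (T - B) \<inter> disk) \<union> (cmod -` (({0..<1} - T) - B2) \<inter> disk)"
    using B(2) B2(2) T by (auto simp: D_def)
  then have "cmod -` D \<inter> disk \<in> null_sets lebesgue" using B(3) B2(3) by auto
  then have "emeasure lborel (cmod -` D \<inter> disk) = 0" using mD by (simp add: null_sets_def)
  then have "emeasure dr2 D = 0"
    unfolding distr_dAb_cmod[symmetric] using D mD
    by (subst emeasure_distr[OF measurable_cmod_dAb]) (simp_all add: emeasure_dAb)
  then have "AE r in dr2. r \<notin> D" using D by (intro AE_not_in) (simp add: null_sets_def)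
  then have "AE r in lborel. 0 < r \<and> r < 1 \<longrightarrow> r \<notin> D" by (simp add: AE_dr2)
  moreover have "AE r in lborel. r \<noteq> (0::real)" by (rule AE_lborel_singleton)
  ultimately have "AE r in lborel. r \<notin> D" by eventually_elim (auto simp: D_def)
  then have "D \<in> null_sets lborel" using D by (simp add: AE_iff_null_sets)
  then have "D \<in> null_sets lebesgue" by (rule null_sets_completionI)
  moreover have "T - B \<subseteq> D" using B2(2) T by (auto simp: D_def)
  ultimately have "T - B \<in> null_sets lebesgue" by (metis null_sets_completion_subset)
  moreover have "B \<in> sets lebesgue" using B(1) by (simp add: sets_completionI_sets)
  ultimately have "B \<union> (T - B) \<in> sets lebesgue" by (metis sets.Un null_setsD2)
  moreover have "B \<union> (T - B) = T" using B(2) by auto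
  ultimately show ?thesis by simp
qed

text \<open>Sets of radii are measurable when the corresponding sets in the disk are, so \<phi> is
  Lebesgue measurable on the radius and agrees almost everywhere with a Borel function. The last
  claim is what makes the integrand of \<open>mellin\<close> measurable.\<close>

lemma radial_borel_representative:
  fixes \<phi> :: "real \<Rightarrow> complex"
  assumes m: "(\<lambda>z. \<phi> (cmod z)) \<in> borel_measurable dA"
  obtains \<phi>' where "\<phi>' \<in> borel_measurable borel" "AE r in lborel. 0 < r \<and> r < 1 \<longrightarrow> \<phi> r = \<phi>' r"
    "(\<lambda>r. if r \<in> {0..<1} then \<phi> r else 0) \<in> borel_measurable lebesgue"
proof -
  define \<psi> where "\<psi> = (\<lambda>r. if r \<in> {0..<1} then \<phi> r else 0)"
  have "\<psi> -` A \<in> sets lebesgue" if A: "A \<in> sets borel" for A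
  proof -
    have eq: "(\<lambda>z. \<phi> (cmod z)) -` A \<inter> disk = cmod -` (\<phi> -` A \<inter> {0..<1}) \<inter> disk" by auto
    have "(\<lambda>z. \<phi> (cmod z)) -` A \<inter> space dA \<in> sets dA" using m A by (rule measurable_sets)
    then have "cmod -` (\<phi> -` A \<inter> {0..<1}) \<inter> disk \<in> sets (lebesgue_on disk)"
      by (simp only: space_dA sets_dA eq)
    then have "cmod -` (\<phi> -` A \<inter> {0..<1}) \<inter> disk \<in> sets lebesgue"
      by (auto simp: sets_restrict_space_iff)
    then have 1: "\<phi> -` A \<inter> {0..<1} \<in> sets lebesgue" by (intro null_set_between) auto
    have "\<psi> -` A = (\<phi> -` A \<inter> {0..<1}) \<union> (if 0 \<in> A then - {0..<1} else {})"
      by (auto simp: \<psi>_def split: if_splits)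
    then show ?thesis using 1 by auto
  qed
  then have \<psi>: "\<psi> \<in> borel_measurable lebesgue" by (intro measurableI) simp_all
  then have "(\<lambda>r. Re (\<psi> r)) \<in> borel_measurable lebesgue" "(\<lambda>r. Im (\<psi> r)) \<in> borel_measurable lebesgue"
    by measurable
  from completion_ex_borel_measurable_real[OF this(1)] completion_ex_borel_measurable_real[OF this(2)]
  obtain g h where gh: "g \<in> borel_measurable lborel" "h \<in> borel_measurable lborel"
    and eq: "AE r in lborel. Re (\<psi> r) = g r" "AE r in lborel. Im (\<psi> r) = h r"
    by metis
  have [measurable]: "g \<in> borel_measurable borel" "h \<in> borel_measurable borel" using gh by simp_all
  show ?thesis
  proof (rule that[of "\<lambda>r. Complex (g r) (h r)"])
    show "(\<lambda>r. Complex (g r) (h r)) \<in> borel_measurable borel"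
      unfolding Complex_eq by measurable
    show "(\<lambda>r. if r \<in> {0..<1} then \<phi> r else 0) \<in> borel_measurable lebesgue"
      using \<psi> by (simp add: \<psi>_def)
    show "AE r in lborel. 0 < r \<and> r < 1 \<longrightarrow> \<phi> r = Complex (g r) (h r)"
      using eq by eventually_elim (auto simp: \<psi>_def complex_eq_iff split: if_splits)
  qed
qed

section \<open>Angular factors and their integrals\<close>

text \<open>\<open>Arg\<close> jumps along the negative axis, but its integral multiples enter only
  through powers of \<open>sgn\<close>, a form in which measurability and multiplicativity are
  evident. At 0 the convention \<open>Arg 0 = 0\<close> gives the value 1.\<close>

lemma cis_Arg_altdef:
  "cis (of_int k * Arg w) = (if w = 0 then 1 else if k \<ge> 0 then sgn w ^ nat k else cnj (sgn w) ^ nat (- k))"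
proof (cases "w = 0")
  case False
  then have sgn: "cis (Arg w) = sgn w" by (rule cis_Arg)
  show ?thesis
  proof (cases "k \<ge> 0")
    case True
    then show ?thesis using False sgn Complex.DeMoivre[of "Arg w" "nat k"] by simp
  next
    case neg: False
    have "cis (of_int k * Arg w) = cis (- Arg w) ^ nat (- k)"
      using neg Complex.DeMoivre[of "- Arg w" "nat (- k)"] by simp
    also have "cis (- Arg w) = cnj (sgn w)" using sgn by (simp flip: cis_cnj)
    finally show ?thesis using False neg by simp
  qed
qed (simp add: Arg_zero)

lemma measurable_cis_Arg [measurable]: "(\<lambda>w. cis (of_int k * Arg w)) \<in> borel_measurable borel"
proof -
  have [measurable]: "(sgn :: complex \<Rightarrow> complex) \<in> borel_measurable borel"
    unfolding sgn_div_norm by measurable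
  have [measurable]: "cnj \<in> borel_measurable borel"
    by (intro borel_measurable_continuous_onI continuous_intros)
  show ?thesis unfolding cis_Arg_altdef by measurable
qed

lemma cis_Arg_mult:
  assumes "norm c = 1" "w \<noteq> 0"
  shows "cis (of_int k * Arg (c * w)) = cis (of_int k * Arg c) * cis (of_int k * Arg w)"
  using assms by (auto simp: cis_Arg_altdef sgn_mult power_mult_distrib)

lemma emeasure_dAb_singleton: "emeasure dAb {0} = 0"
proof -
  have "emeasure lborel ({0} \<inter> disk :: complex set) \<le> emeasure lborel {0::complex}"
    by (intro emeasure_mono) auto
  then show ?thesis by (simp add: emeasure_dAb)
qed

lemma AE_dAb_nonzero: "AE w in dAb. w \<noteq> 0"
  using emeasure_dAb_singleton by (intro AE_I[of _ _ "{0}"]) auto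

text \<open>Rotation by an angle at which the angular factor is -1 preserves \<open>dAb\<close> and
  changes the sign of the integral.\<close>

lemma integral_dAb_angular:
  assumes [measurable]: "g \<in> borel_measurable borel" and k: "k \<noteq> 0"
  shows "(\<integral>w. cis (of_int k * Arg w) * g (cmod w) \<partial>dAb) = 0"
proof -
  define F where "F = (\<lambda>w. cis (of_int k * Arg w) * g (cmod w))"
  have [measurable]: "F \<in> borel_measurable borel" unfolding F_def by measurable
  \<comment> \<open>A unimodular number with c^k = -1; its angle pi/|k| lies in the range of
    \<open>Arg\<close>.\<close>
  define c where "c = cis (pi / \<bar>real_of_int k\<bar>)"
  have c: "norm c = 1" by (simp add: c_def)
  have [measurable]: "(*) c \<in> borel_measurable borel" by (intro borel_measurable_continuous_onI continuous_intros)
  have rot: "(*) c \<in> dAb \<rightarrow>\<^sub>M borel" by measurable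
  have "\<bar>real_of_int k\<bar> \<ge> 1" using k by linarith
  then have "pi / \<bar>real_of_int k\<bar> \<le> pi / 1" by (intro divide_left_mono) auto
  moreover have "0 < pi / \<bar>real_of_int k\<bar>" using k by simp
  ultimately have "pi / \<bar>real_of_int k\<bar> \<in> {-pi<..pi}" using pi_gt_zero unfolding greaterThanAtMost_iff by linarith
  then have "Arg c = pi / \<bar>real_of_int k\<bar>" unfolding c_def by (subst Arg_cis) auto
  then have "of_int k * Arg c = pi \<or> of_int k * Arg c = - pi"
    using k by (auto simp: abs_if)
  then have ck: "cis (of_int k * Arg c) = -1" by (auto simp: cis_pi simp flip: cis_cnj)
  have "integral\<^sup>L dAb F = integral\<^sup>L (distr dAb borel ((*) c)) F" by (simp add: distr_dAb_rotate[OF c])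
  also have "\<dots> = (\<integral>w. F (c * w) \<partial>dAb)" by (rule integral_distr[OF rot]) simp
  also have "\<dots> = (\<integral>w. - F w \<partial>dAb)"
  proof (rule integral_cong_AE)
    show "AE w in dAb. F (c * w) = - F w"
      using AE_dAb_nonzero by eventually_elim (simp add: F_def cis_Arg_mult[OF c] ck norm_mult c)
  qed measurable
  also have "\<dots> = - integral\<^sup>L dAb F" by simp
  finally show ?thesis by (simp add: F_def)
qed

section \<open>Expansion of harmonic functions\<close>

text \<open>The second difference of \<open>f\<close> is the increment of a function of one real
  variable, whose derivative is controlled by the first-order expansion of \<open>f'\<close> at
  \<open>z\<close>.\<close>

lemma second_difference_bound:
  fixes f :: "'a::real_normed_vector \<Rightarrow> 'b::real_normed_vector" and f' :: "'a \<Rightarrow> 'a \<Rightarrow>\<^sub>L 'b"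
  assumes f: "\<And>w. w \<in> ball z \<delta> \<Longrightarrow> (f has_derivative blinfun_apply (f' w)) (at w)"
    and f2: "bounded_linear f2"
    and \<epsilon>: "\<And>h. norm h < \<delta> \<Longrightarrow> norm (f' (z + h) - f' z - f2 h) \<le> \<epsilon> * norm h"
    and t: "t > 0" "t * (norm u + norm v) < \<delta>" and e0: "\<epsilon> > 0"
  shows "norm (f (z + t *\<^sub>R u + t *\<^sub>R v) - f (z + t *\<^sub>R u) - f (z + t *\<^sub>R v) + f z - (t * t) *\<^sub>R f2 v u)
     \<le> 2 * \<epsilon> * (norm u + norm v)\<^sup>2 * t * t"
proof -
  define M where "M = norm u + norm v"
  interpret f2: bounded_linear f2 by fact
  \<comment> \<open>The increment of \<open>g\<close> over [0, t] is exactly the quantity to be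
    estimated.\<close>
  define g where "g = (\<lambda>s. f (z + s *\<^sub>R u + t *\<^sub>R v) - f (z + s *\<^sub>R u) - (s * t) *\<^sub>R f2 v u)"
  define g' where "g' = (\<lambda>s. f' (z + (s *\<^sub>R u + t *\<^sub>R v)) u - f' (z + s *\<^sub>R u) u - t *\<^sub>R f2 v u)"
  have nb: "norm (s *\<^sub>R u + t *\<^sub>R v) \<le> t * M" "norm (s *\<^sub>R u) \<le> t * M" if "s \<in> {0..t}" for s
  proof -
    have "norm (s *\<^sub>R u) \<le> t * norm u" using that by (simp add: mult_right_mono)
    moreover have "norm (t *\<^sub>R v) = t * norm v" using t by simp
    ultimately show "norm (s *\<^sub>R u + t *\<^sub>R v) \<le> t * M" "norm (s *\<^sub>R u) \<le> t * M"
      using norm_triangle_ineq[of "s *\<^sub>R u" "t *\<^sub>R v"] mult_nonneg_nonneg[OF less_imp_le[OF t(1)] norm_ge_zero[of v]]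
      by (auto simp: M_def distrib_left simp del: norm_scaleR)
  qed
  have tM: "t * M < \<delta>" using t by (simp add: M_def)
  have "norm (g t - g 0) \<le> (2 * \<epsilon> * M * M * t) * norm (t - 0)"
  proof (rule differentiable_bound[where S="{0..t}" and f'="\<lambda>s d. d *\<^sub>R g' s"])
    fix s assume s: "s \<in> {0..t}"
    have b1: "z + s *\<^sub>R u + t *\<^sub>R v \<in> ball z \<delta>" "z + s *\<^sub>R u \<in> ball z \<delta>"
      using nb[OF s] tM unfolding mem_ball dist_norm add.assoc
      by (metis add_diff_cancel_left' norm_minus_commute order_le_less_trans)+
    have "((\<lambda>s. f (z + s *\<^sub>R u + t *\<^sub>R v)) has_derivative (\<lambda>d. f' (z + s *\<^sub>R u + t *\<^sub>R v) (d *\<^sub>R u))) (at s within {0..t})"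
      by (rule has_derivative_compose[where g=f and f="\<lambda>s. z + s *\<^sub>R u + t *\<^sub>R v", OF _ f[OF b1(1)]]) (auto intro!: derivative_eq_intros)
    moreover have "((\<lambda>s. f (z + s *\<^sub>R u)) has_derivative (\<lambda>d. f' (z + s *\<^sub>R u) (d *\<^sub>R u))) (at s within {0..t})"
      by (rule has_derivative_compose[where g=f and f="\<lambda>s. z + s *\<^sub>R u", OF _ f[OF b1(2)]]) (auto intro!: derivative_eq_intros)
    moreover have "((\<lambda>s. (s * t) *\<^sub>R f2 v u) has_derivative (\<lambda>d. (d * t) *\<^sub>R f2 v u)) (at s within {0..t})"
      by (auto intro!: derivative_eq_intros)
    ultimately have "(g has_derivative (\<lambda>d. f' (z + s *\<^sub>R u + t *\<^sub>R v) (d *\<^sub>R u) - f' (z + s *\<^sub>R u) (d *\<^sub>R u) - (d * t) *\<^sub>R f2 v u)) (at s within {0..t})"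
      unfolding g_def by (intro has_derivative_diff)
    then show "(g has_derivative (\<lambda>d. d *\<^sub>R g' s)) (at s within {0..t})"
      by (simp add: g'_def blinfun.scaleR_right algebra_simps)
    have "norm (g' s) = norm ((f' (z + (s *\<^sub>R u + t *\<^sub>R v)) - f' z - f2 (s *\<^sub>R u + t *\<^sub>R v)) u - (f' (z + s *\<^sub>R u) - f' z - f2 (s *\<^sub>R u)) u)"
      by (simp add: g'_def f2.add f2.scaleR blinfun.diff_left blinfun.add_left blinfun.scaleR_left algebra_simps)
    also have "\<dots> \<le> norm (f' (z + (s *\<^sub>R u + t *\<^sub>R v)) - f' z - f2 (s *\<^sub>R u + t *\<^sub>R v)) * norm u + norm (f' (z + s *\<^sub>R u) - f' z - f2 (s *\<^sub>R u)) * norm u"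
      by (intro order_trans[OF norm_triangle_ineq4] add_mono norm_blinfun)
    also have "\<dots> \<le> \<epsilon> * (t * M) * M + \<epsilon> * (t * M) * M"
      using nb[OF s] tM e0 t
      by (intro add_mono mult_mono order_trans[OF \<epsilon>] mult_left_mono) (auto simp: M_def)
    finally have g'b: "norm (g' s) \<le> 2 * \<epsilon> * M * M * t" by (simp add: algebra_simps)
    show "onorm (\<lambda>d. d *\<^sub>R g' s) \<le> 2 * \<epsilon> * M * M * t"
    proof (rule onorm_bound)
      show "0 \<le> 2 * \<epsilon> * M * M * t" using g'b norm_ge_zero order_trans by blast
      show "norm (d *\<^sub>R g' s) \<le> 2 * \<epsilon> * M * M * t * norm d" for d
        using mult_left_mono[OF g'b, of "norm d"] by (simp add: mult.commute)
    qed
  qed (use t in auto)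
  then show ?thesis using t by (simp add: g_def M_def power2_eq_square algebra_simps)
qed

text \<open>The second difference is symmetric in \<open>u\<close> and \<open>v\<close>, while its
  leading term is t^2 times \<open>f2 v u\<close> by one estimate and t^2 times
  \<open>f2 u v\<close> by the other.\<close>

lemma second_derivative_symmetric:
  fixes f :: "'a::real_normed_vector \<Rightarrow> 'b::real_normed_vector" and f' :: "'a \<Rightarrow> 'a \<Rightarrow>\<^sub>L 'b"
  assumes S: "open S" "z \<in> S"
    and f: "\<And>w. w \<in> S \<Longrightarrow> (f has_derivative blinfun_apply (f' w)) (at w)"
    and f2: "(f' has_derivative f2) (at z)"
  shows "blinfun_apply (f2 u) v = f2 v u"
proof -
  define M where "M = (norm u + norm v)\<^sup>2"
  have bl: "bounded_linear f2" using f2 by (rule has_derivative_bounded_linear)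
  have "norm (f2 u v - f2 v u) \<le> 0 + e" if e: "e > 0" for e
  proof -
    \<comment> \<open>The two estimates contribute 2\<epsilon>M each; M + 1 keeps the divisor
      positive.\<close>
    define \<epsilon> where "\<epsilon> = e / 4 / (M + 1)"
    have \<epsilon>0: "\<epsilon> > 0" using e by (simp add: \<epsilon>_def M_def add_nonneg_pos)
    obtain d1 where d1: "d1 > 0" "\<And>y. norm (y - z) < d1 \<Longrightarrow> norm (f' y - f' z - f2 (y - z)) \<le> \<epsilon> * norm (y - z)"
      using f2 \<epsilon>0 unfolding has_derivative_within_alt by auto
    obtain d2 where d2: "d2 > 0" "ball z d2 \<subseteq> S" using S openE by blast
    define \<delta> where "\<delta> = min d1 d2"
    have \<delta>: "\<delta> > 0" "\<And>w. w \<in> ball z \<delta> \<Longrightarrow> (f has_derivative blinfun_apply (f' w)) (at w)"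
      "\<And>h. norm h < \<delta> \<Longrightarrow> norm (f' (z + h) - f' z - f2 h) \<le> \<epsilon> * norm h"
      using d1 d2 f by (auto simp: \<delta>_def) (metis add_diff_cancel_left')
    define t where "t = \<delta> / (norm u + norm v + 1)"
    have t: "t > 0" using \<delta> by (simp add: t_def add_nonneg_pos)
    have "norm u + norm v < norm u + norm v + 1" by simp
    then have t2: "t * (norm u + norm v) < \<delta>"
      using \<delta>(1) by (simp add: t_def divide_less_eq add_nonneg_pos)
    have t3: "t * (norm v + norm u) < \<delta>" using t2 by (simp add: add.commute)
    let ?A = "f (z + t *\<^sub>R u + t *\<^sub>R v) - f (z + t *\<^sub>R u) - f (z + t *\<^sub>R v) + f z"
    have 1: "norm (?A - (t * t) *\<^sub>R f2 v u) \<le> 2 * \<epsilon> * M * t * t"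
      unfolding M_def by (rule second_difference_bound[OF \<delta>(2) bl \<delta>(3) t t2 \<epsilon>0])
    have "norm (f (z + t *\<^sub>R v + t *\<^sub>R u) - f (z + t *\<^sub>R v) - f (z + t *\<^sub>R u) + f z - (t * t) *\<^sub>R f2 u v) \<le> 2 * \<epsilon> * (norm v + norm u)\<^sup>2 * t * t"
      by (rule second_difference_bound[OF \<delta>(2) bl \<delta>(3) t t3 \<epsilon>0])
    then have 2: "norm (?A - (t * t) *\<^sub>R f2 u v) \<le> 2 * \<epsilon> * M * t * t"
      by (simp add: M_def algebra_simps)
    have "(t * t) * norm (f2 u v - f2 v u) = norm ((?A - (t * t) *\<^sub>R f2 v u) - (?A - (t * t) *\<^sub>R f2 u v))"
      using t by (simp add: algebra_simps flip: scaleR_diff_right)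
    also have "\<dots> \<le> 4 * \<epsilon> * M * t * t"
      using 1 2 norm_triangle_ineq4[of "?A - (t * t) *\<^sub>R f2 v u" "?A - (t * t) *\<^sub>R f2 u v"] by linarith
    finally have "(t * t) * norm (f2 u v - f2 v u) \<le> (t * t) * (4 * \<epsilon> * M)" by (simp add: algebra_simps)
    then have "norm (f2 u v - f2 v u) \<le> 4 * \<epsilon> * M" using t by simp
    also have "\<dots> \<le> 4 * \<epsilon> * (M + 1)" using \<epsilon>0 by simp
    also have "\<dots> = e"
    proof -
      have "M + 1 > 0" by (simp add: M_def add_nonneg_pos)
      then have "\<epsilon> * (M + 1) = e / 4" using \<epsilon>_def nonzero_eq_divide_eq[of "M + 1" \<epsilon> "e / 4"] by force
      then show ?thesis unfolding mult.assoc by simp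
    qed
    finally show ?thesis by simp
  qed
  then have "norm (f2 u v - f2 v u) \<le> 0" by (rule field_le_epsilon)
  then show ?thesis by simp
qed

text \<open>A real linear map with D i = i D 1 is complex linear: the Cauchy-Riemann criterion in
  the form used below.\<close>

lemma complex_linear_derivative:
  assumes "(f has_derivative D) (at z)" "D 1 = c" "D \<i> = \<i> * c"
  shows "(f has_field_derivative c) (at z)"
proof -
  interpret D: bounded_linear D using assms(1) by (rule has_derivative_bounded_linear)
  have "D v = c * v" for v
  proof -
    have "v = Re v *\<^sub>R 1 + Im v *\<^sub>R \<i>" by (simp add: complex_eq_iff)
    then have "D v = Re v *\<^sub>R D 1 + Im v *\<^sub>R D \<i>" by (metis D.add D.scaleR)
    also have "\<dots> = c * v" by (simp add: assms complex_eq_iff algebra_simps)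
    finally show ?thesis .
  qed
  then have "D = (*) c" by auto
  then show ?thesis using assms(1) by (simp add: has_field_derivative_def)
qed

text \<open>For u = (f_x - i f_y)/2, the complex derivative of \<open>f\<close> with respect to z,
  Laplace's equation and the symmetry of mixed derivatives are the Cauchy-Riemann equations. A
  primitive \<open>g\<close> of \<open>u\<close> exists on a convex set, and f - g is then
  antiholomorphic.\<close>

lemma harmonic_decomposition:
  assumes "harmonic_on f S" "open S" "convex S"
  obtains g h where "g holomorphic_on S" "h holomorphic_on S" "\<And>z. z \<in> S \<Longrightarrow> f z = g z + cnj (h z)"
proof -
  obtain f' :: "complex \<Rightarrow> complex \<Rightarrow>\<^sub>L complex" and f'' :: "complex \<Rightarrow> complex \<Rightarrow>\<^sub>L complex \<Rightarrow>\<^sub>L complex" where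
    f': "\<And>z. z \<in> S \<Longrightarrow> (f has_derivative blinfun_apply (f' z)) (at z)"
    and f'': "\<And>z. z \<in> S \<Longrightarrow> (f' has_derivative blinfun_apply (f'' z)) (at z)"
    and lap: "\<And>z. z \<in> S \<Longrightarrow> f'' z 1 1 + f'' z \<i> \<i> = 0"
    using assms(1) unfolding harmonic_on_def by blast
  have sym: "f'' z 1 \<i> = f'' z \<i> 1" if "z \<in> S" for z
    by (rule second_derivative_symmetric[OF assms(2) that f' f''[OF that]])
  define u where "u = (\<lambda>z. (f' z 1 - \<i> * f' z \<i>) / 2)"
  have u: "\<exists>d. (u has_field_derivative d) (at z)" if z: "z \<in> S" for z
  proof -
    have D: "((\<lambda>z. f' z w) has_derivative (\<lambda>v. f'' z v w)) (at z)" for w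
      by (rule bounded_linear.has_derivative[OF _ f''[OF z]]) (rule blinfun.bounded_linear_left)
    have "(u has_derivative (\<lambda>v. (f'' z v 1 - \<i> * f'' z v \<i>) / 2)) (at z)"
      unfolding u_def divide_inverse
      by (intro has_derivative_mult_left has_derivative_diff has_derivative_mult_right D)
    then have "(u has_field_derivative (f'' z 1 1 - \<i> * f'' z 1 \<i>) / 2) (at z)"
    proof (rule complex_linear_derivative)
      have "f'' z \<i> \<i> = - f'' z 1 1" using lap[OF z] by (metis add_eq_0_iff)
      then show "(f'' z \<i> 1 - \<i> * f'' z \<i> \<i>) / 2 = \<i> * ((f'' z 1 1 - \<i> * f'' z 1 \<i>) / 2)"
        by (simp add: sym[OF z] algebra_simps)
    qed simp
    then show ?thesis by blast
  qed
  then have "u holomorphic_on S"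
    by (auto simp: holomorphic_on_def field_differentiable_def intro: has_field_derivative_at_within)
  then obtain g where g: "\<And>z. z \<in> S \<Longrightarrow> (g has_field_derivative u z) (at z)"
    using holomorphic_convex_primitive'[OF assms(3) assms(2)] assms(2) by (metis at_within_open)
  define h where "h = (\<lambda>z. cnj (f z - g z))"
  have h: "\<exists>d. (h has_field_derivative d) (at z)" if z: "z \<in> S" for z
  proof -
    have "(h has_derivative (\<lambda>v. cnj (f' z v - u z * v))) (at z)"
      unfolding h_def using f'[OF z] g[OF z] unfolding has_field_derivative_def
      by (intro derivative_intros bounded_linear.has_derivative[OF bounded_linear_cnj])
    then have "(h has_field_derivative cnj (f' z 1 - u z)) (at z)"
    proof (rule complex_linear_derivative)
      show "cnj (f' z \<i> - u z * \<i>) = \<i> * cnj (f' z 1 - u z)"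
        by (simp add: u_def field_simps complex_eq_iff)
    qed simp
    then show ?thesis by blast
  qed
  show ?thesis
  proof (rule that[of g h])
    show "g holomorphic_on S" "h holomorphic_on S"
      using g h unfolding holomorphic_on_def field_differentiable_def by (meson has_field_derivative_at_within)+
  qed (simp add: h_def)
qed

section \<open>Series of harmonic monomials\<close>

lemma harm_monom_eq:
  assumes "z \<in> disk"
  shows "harm_monom n z = (if n \<ge> 0 then z ^ nat n else cnj z ^ nat (- n))"
proof (cases "z = 0")
  case True
  then show ?thesis by (auto simp: harm_monom_def on_disk_def cis_Arg_altdef power_0_left)
next
  case False
  have z: "of_real (cmod z) * sgn z = z" using False by (simp add: sgn_eq)
  then have z': "of_real (cmod z) * cnj (sgn z) = cnj z"
    by (metis complex_cnj_complex_of_real complex_cnj_mult)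
  show ?thesis
    using assms False z z' by (simp add: harm_monom_def on_disk_def cis_Arg_altdef flip: power_mult_distrib)
qed

lemma harm_monom_outside: "z \<notin> disk \<Longrightarrow> harm_monom n z = 0"
  by (simp add: harm_monom_def on_disk_def)

lemma norm_harm_monom: "z \<in> disk \<Longrightarrow> cmod (harm_monom n z) = cmod z ^ nat \<bar>n\<bar>"
  by (simp add: harm_monom_def on_disk_def norm_mult norm_power)

lemma norm_harm_monom_le: "cmod (harm_monom n z) \<le> 1"
  by (cases "z \<in> disk") (auto simp: norm_harm_monom harm_monom_outside intro!: power_le_one)

lemma harm_monom_measurable [measurable]: "harm_monom n \<in> borel_measurable borel"
  unfolding harm_monom_def on_disk_def by (rule measurable_If_set) auto

lemma has_sum_int_split:
  fixes F :: "int \<Rightarrow> 'a::{topological_comm_monoid_add,t3_space}"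
  assumes "((\<lambda>n. F (int n)) has_sum A) UNIV" "((\<lambda>n. F (- int (Suc n))) has_sum B) UNIV"
  shows "(F has_sum (A + B)) UNIV"
proof -
  have "(F has_sum A) (range int)"
    using assms(1) by (subst has_sum_reindex) (auto simp: o_def)
  moreover have "(F has_sum B) (range (\<lambda>n. - int (Suc n)))"
    using assms(2) by (subst has_sum_reindex) (auto simp: o_def inj_on_def)
  ultimately have "(F has_sum (A + B)) (range int \<union> range (\<lambda>n. - int (Suc n)))"
    by (intro has_sum_Un_disjoint) auto
  moreover have "range int \<union> range (\<lambda>n. - int (Suc n)) = UNIV"
  proof (rule sym, rule UNIV_eq_I)
    fix n :: int
    show "n \<in> range int \<union> range (\<lambda>n. - int (Suc n))"
      by (cases n rule: int_cases) auto
  qed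
  ultimately show ?thesis by simp
qed

lemma summable_on_int_abs:
  fixes f :: "nat \<Rightarrow> real"
  assumes "summable f" "\<And>n. f n \<ge> 0"
  shows "(\<lambda>n::int. f (nat \<bar>n\<bar>)) summable_on UNIV"
proof -
  have 1: "f summable_on UNIV" using assms by (simp add: summable_on_UNIV_nonneg_real_iff)
  have 2: "(\<lambda>n. f (Suc n)) summable_on UNIV" using assms summable_Suc_iff[of f] by (simp add: summable_on_UNIV_nonneg_real_iff)
  have "((\<lambda>n::int. f (nat \<bar>n\<bar>)) has_sum (infsum f UNIV + infsum (\<lambda>n. f (Suc n)) UNIV)) UNIV"
    by (rule has_sum_int_split)
      (use has_sum_infsum[OF 1] has_sum_infsum[OF 2] in \<open>simp_all add: nat_add_distrib del: of_nat_Suc\<close>)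
  then show ?thesis by (rule has_sum_imp_summable)
qed

text \<open>Unconditional sums over the integers become limits of symmetric partial sums, the form
  to which dominated convergence applies.\<close>

lemma has_sum_int_LIMSEQ:
  fixes f :: "int \<Rightarrow> 'a::{comm_monoid_add, topological_space}"
  assumes "(f has_sum S) UNIV"
  shows "(\<lambda>N. \<Sum>n\<in>{- int N..int N}. f n) \<longlonglongrightarrow> S"
proof -
  have "filterlim (\<lambda>N. {- int N..int N}) (finite_subsets_at_top UNIV) sequentially"
    unfolding filterlim_finite_subsets_at_top
  proof (intro allI impI)
    fix X :: "int set" assume "finite X \<and> X \<subseteq> UNIV"
    then have fin: "finite X" by simp
    define N0 where "N0 = nat (Max (insert 0 (abs ` X)))"
    have b: "\<bar>x\<bar> \<le> int N0" if "x \<in> X" for x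
      unfolding N0_def using fin that by (auto intro!: le_nat_iff[THEN iffD1] Max_ge_iff[THEN iffD2])
    show "\<forall>\<^sub>F N in sequentially. finite {- int N..int N} \<and> X \<subseteq> {- int N..int N} \<and> {- int N..int N} \<subseteq> UNIV"
      using eventually_ge_at_top[of N0]
    proof eventually_elim
      case (elim N)
      show ?case using b elim by (auto simp: abs_le_iff) (force dest: b)+
    qed
  qed
  then show ?thesis using assms unfolding has_sum_def by (rule filterlim_compose[rotated])
qed

text \<open>Absolute convergence of the expansion on every circle inside the disk. These are the
  coefficient sequences of arbitrary harmonic functions on the disk, with no condition at the
  boundary.\<close>

definition disk_conv :: "(int \<Rightarrow> complex) \<Rightarrow> bool" where
  "disk_conv a \<longleftrightarrow> (\<forall>\<rho>. 0 \<le> \<rho> \<and> \<rho> < 1 \<longrightarrow> (\<lambda>n. cmod (a n) * \<rho> ^ nat \<bar>n\<bar>) summable_on UNIV)"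

definition hser :: "(int \<Rightarrow> complex) \<Rightarrow> complex \<Rightarrow> complex" where
  "hser a = on_disk (\<lambda>z. \<Sum>\<^sub>\<infinity>n. a n * harm_monom n z)"

lemma hser_outside: "z \<notin> disk \<Longrightarrow> hser a z = 0"
  by (simp add: hser_def on_disk_def)

lemma hser_abs_summable:
  assumes "disk_conv a"
  shows "(\<lambda>n. norm (a n * harm_monom n z)) summable_on UNIV"
proof (cases "z \<in> disk")
  case True
  then have "(\<lambda>n. cmod (a n) * cmod z ^ nat \<bar>n\<bar>) summable_on UNIV"
    using assms unfolding disk_conv_def by auto
  then show ?thesis using True by (simp add: norm_mult norm_harm_monom)
qed (simp add: harm_monom_outside)

lemma hser_has_sum:
  assumes "disk_conv a"
  shows "((\<lambda>n. a n * harm_monom n z) has_sum hser a z) UNIV"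
proof (cases "z \<in> disk")
  case True
  then show ?thesis using abs_summable_summable[OF hser_abs_summable[OF assms, of z]]
    by (simp add: hser_def on_disk_def)
qed (simp add: harm_monom_outside hser_outside)

lemma hser_LIMSEQ:
  "disk_conv a \<Longrightarrow> (\<lambda>N. \<Sum>n\<in>{- int N..int N}. a n * harm_monom n z) \<longlonglongrightarrow> hser a z"
  by (rule has_sum_int_LIMSEQ[OF hser_has_sum])

lemma hser_measurable [measurable]:
  assumes "disk_conv a" shows "hser a \<in> borel_measurable borel"
  by (rule borel_measurable_LIMSEQ_metric[OF _ hser_LIMSEQ[OF assms]]) measurable

lemma disk_conv_add: "disk_conv a \<Longrightarrow> disk_conv b \<Longrightarrow> disk_conv (\<lambda>n. a n + b n)"
  unfolding disk_conv_def
proof (intro allI impI)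
  fix \<rho> :: real
  assume *: "\<forall>\<rho>. 0 \<le> \<rho> \<and> \<rho> < 1 \<longrightarrow> (\<lambda>n. cmod (a n) * \<rho> ^ nat \<bar>n\<bar>) summable_on UNIV"
    "\<forall>\<rho>. 0 \<le> \<rho> \<and> \<rho> < 1 \<longrightarrow> (\<lambda>n. cmod (b n) * \<rho> ^ nat \<bar>n\<bar>) summable_on UNIV" "0 \<le> \<rho> \<and> \<rho> < 1"
  then have "(\<lambda>n. cmod (a n) * \<rho> ^ nat \<bar>n\<bar> + cmod (b n) * \<rho> ^ nat \<bar>n\<bar>) summable_on UNIV"
    by (intro summable_on_add) auto
  then show "(\<lambda>n. cmod (a n + b n) * \<rho> ^ nat \<bar>n\<bar>) summable_on UNIV"
    by (rule summable_on_comparison_test)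
      (use * in \<open>auto simp flip: distrib_right intro!: mult_right_mono norm_triangle_ineq\<close>)
qed

lemma disk_conv_scale: "disk_conv a \<Longrightarrow> disk_conv (\<lambda>n. c * a n)"
  by (auto simp: disk_conv_def norm_mult mult.assoc intro!: summable_on_cmult_right)

lemma hser_add:
  assumes "disk_conv a" "disk_conv b"
  shows "hser (\<lambda>n. a n + b n) = hser a + hser b"
proof
  fix z
  have "((\<lambda>n. a n * harm_monom n z + b n * harm_monom n z) has_sum (hser a z + hser b z)) UNIV"
    by (intro has_sum_add hser_has_sum assms)
  moreover have "((\<lambda>n. (a n + b n) * harm_monom n z) has_sum hser (\<lambda>n. a n + b n) z) UNIV"
    by (intro hser_has_sum disk_conv_add assms)
  ultimately show "hser (\<lambda>n. a n + b n) z = (hser a + hser b) z"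
    by (simp add: distrib_right has_sum_unique)
qed

lemma hser_scale:
  assumes "disk_conv a"
  shows "hser (\<lambda>n. c * a n) = scale_fun c (hser a)"
proof
  fix z
  have "((\<lambda>n. c * (a n * harm_monom n z)) has_sum (c * hser a z)) UNIV"
    by (intro has_sum_cmult_right hser_has_sum assms)
  moreover have "((\<lambda>n. (c * a n) * harm_monom n z) has_sum hser (\<lambda>n. c * a n) z) UNIV"
    by (intro hser_has_sum disk_conv_scale assms)
  ultimately show "hser (\<lambda>n. c * a n) z = scale_fun c (hser a) z"
    by (simp add: scale_fun_def mult.assoc has_sum_unique)
qed

text \<open>At each point the second derivative is the form (u, v) -> g'' u v + cnj (h'' u v), so
  its values at (1, 1) and (i, i) cancel. \<open>M1\<close> and \<open>M2\<close> present it as a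
  map into bounded linear maps, as \<open>harmonic_on\<close> demands.\<close>

lemma harmonic_on_holomorphic_add_cnj:
  assumes S: "open S" and g: "g holomorphic_on S" and h: "h holomorphic_on S"
    and f: "\<And>z. z \<in> S \<Longrightarrow> f z = g z + cnj (h z)"
  shows "harmonic_on f S"
proof -
  define g1 where "g1 = deriv g" define g2 where "g2 = deriv g1"
  define h1 where "h1 = deriv h" define h2 where "h2 = deriv h1"
  have hol: "g1 holomorphic_on S" "g2 holomorphic_on S" "h1 holomorphic_on S" "h2 holomorphic_on S"
    unfolding g1_def g2_def h1_def h2_def by (intro holomorphic_deriv S g h)+
  have d: "(g has_derivative (*) (g1 z)) (at z)" "(g1 has_derivative (*) (g2 z)) (at z)"
    "(h has_derivative (*) (h1 z)) (at z)" "(h1 has_derivative (*) (h2 z)) (at z)" if "z \<in> S" for z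
    using holomorphic_derivI[OF g S that] holomorphic_derivI[OF hol(1) S that]
      holomorphic_derivI[OF h S that] holomorphic_derivI[OF hol(3) S that]
    by (simp_all add: g1_def g2_def h1_def h2_def has_field_derivative_def)
  define Mul :: "complex \<Rightarrow> complex \<Rightarrow>\<^sub>L complex" where "Mul = blinfun_mult_right"
  have Mul: "blinfun_apply (Mul c) v = c * v" for c v by (simp add: Mul_def)
  have blM: "bounded_linear Mul" unfolding Mul_def by (rule bounded_linear_blinfun_mult_right)
  define C where "C = Blinfun cnj"
  have C: "blinfun_apply C v = cnj v" for v by (simp add: C_def bounded_linear_Blinfun_apply bounded_linear_cnj)
  have blCM: "bounded_linear (\<lambda>c. C o\<^sub>L Mul c)"
    by (rule bounded_linear_compose[OF bounded_bilinear.bounded_linear_right[OF bounded_bilinear_blinfun_compose] blM])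
  define M1 where "M1 = Blinfun Mul" define M2 where "M2 = Blinfun (\<lambda>c. C o\<^sub>L Mul c)"
  have M: "blinfun_apply M1 c = Mul c" "blinfun_apply M2 c = C o\<^sub>L Mul c" for c
    by (simp_all add: M1_def M2_def bounded_linear_Blinfun_apply blM blCM)
  define f' where "f' = (\<lambda>z. Mul (g1 z) + (C o\<^sub>L Mul (h1 z)))"
  define f'' where "f'' = (\<lambda>z. (M1 o\<^sub>L Mul (g2 z)) + (M2 o\<^sub>L Mul (h2 z)))"
  show ?thesis unfolding harmonic_on_def
  proof (intro exI[of _ f'] exI[of _ f''] conjI ballI)
    fix z assume z: "z \<in> S"
    have "((\<lambda>z. g z + cnj (h z)) has_derivative (\<lambda>v. g1 z * v + cnj (h1 z * v))) (at z)"
      by (intro has_derivative_add d z bounded_linear.has_derivative[OF bounded_linear_cnj])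
    moreover have "blinfun_apply (f' z) = (\<lambda>v. g1 z * v + cnj (h1 z * v))"
      by (simp add: f'_def blinfun.add_left Mul C fun_eq_iff)
    ultimately have "((\<lambda>z. g z + cnj (h z)) has_derivative blinfun_apply (f' z)) (at z)"
      by simp
    then show "(f has_derivative blinfun_apply (f' z)) (at z)"
      by (rule has_derivative_transform_within_open[OF _ S z]) (simp add: f)
    have "(f' has_derivative (\<lambda>v. Mul (g2 z * v) + (C o\<^sub>L Mul (h2 z * v)))) (at z)"
      unfolding f'_def
      by (intro has_derivative_add bounded_linear.has_derivative[OF blM] bounded_linear.has_derivative[OF blCM] d z)
    moreover have "blinfun_apply (f'' z) = (\<lambda>v. Mul (g2 z * v) + (C o\<^sub>L Mul (h2 z * v)))"
      by (simp add: f''_def blinfun.add_left M Mul fun_eq_iff)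
    ultimately show "(f' has_derivative blinfun_apply (f'' z)) (at z)" by simp
    show "blinfun_apply (blinfun_apply (f'' z) 1) 1 + blinfun_apply (blinfun_apply (f'' z) \<i>) \<i> = 0"
      by (simp add: f''_def blinfun.add_left M Mul C mult.assoc)
  next
    have "continuous_on S (\<lambda>z. M1 o\<^sub>L Mul (g2 z))"
      by (intro bounded_linear.continuous_on[OF bounded_linear_compose[OF bounded_bilinear.bounded_linear_right[OF bounded_bilinear_blinfun_compose] blM]]
          holomorphic_on_imp_continuous_on hol)
    moreover have "continuous_on S (\<lambda>z. M2 o\<^sub>L Mul (h2 z))"
      by (intro bounded_linear.continuous_on[OF bounded_linear_compose[OF bounded_bilinear.bounded_linear_right[OF bounded_bilinear_blinfun_compose] blM]]
          holomorphic_on_imp_continuous_on hol)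
    ultimately show "continuous_on S f''" unfolding f''_def by (rule continuous_on_add)
  qed
qed

text \<open>The nonnegative indices form a holomorphic power series, and the negative ones the
  conjugate of another.\<close>

lemma hser_harmonic:
  assumes a: "disk_conv a"
  shows "harmonic_on (hser a) disk"
proof -
  define g where "g = (\<lambda>z. \<Sum>n. a (int n) * z ^ n)"
  \<comment> \<open>Index -(n + 1) belongs to the power n + 1, so the antiholomorphic part is the
    conjugate of z times h z.\<close>
  define h where "h = (\<lambda>z. \<Sum>n. cnj (a (- int (Suc n))) * z ^ n)"
  have ab: "summable (\<lambda>n. norm (a (int n) * z ^ n))" "summable (\<lambda>n. norm (cnj (a (- int (Suc n))) * z ^ Suc n))"
    if z: "z \<in> disk" for z
  proof -
    have s: "(\<lambda>n. norm (a n * harm_monom n z)) summable_on A" for A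
      using hser_abs_summable[OF a] summable_on_subset_banach by blast
    have "(\<lambda>n. norm (a (int n) * harm_monom (int n) z)) summable_on UNIV"
      using s[of "range int"] by (subst (asm) summable_on_reindex) (auto simp: o_def)
    then show "summable (\<lambda>n. norm (a (int n) * z ^ n))"
      using z by (simp add: summable_on_UNIV_nonneg_real_iff harm_monom_eq)
    have "(\<lambda>n. norm (a (- int (Suc n)) * harm_monom (- int (Suc n)) z)) summable_on UNIV"
      using s[of "range (\<lambda>n. - int (Suc n))"] by (subst (asm) summable_on_reindex) (auto simp: o_def inj_on_def)
    then show "summable (\<lambda>n. norm (cnj (a (- int (Suc n))) * z ^ Suc n))"
      using z by (simp add: summable_on_UNIV_nonneg_real_iff harm_monom_eq norm_mult norm_power nat_add_distrib)
  qed
  have ab2: "summable (\<lambda>n. cnj (a (- int (Suc n))) * z ^ n)" if z: "z \<in> disk" for z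
  proof (cases "z = 0")
    case False
    have "summable (\<lambda>n. inverse z * (cnj (a (- int (Suc n))) * z ^ Suc n))"
      by (intro summable_mult summable_norm_cancel[OF ab(2)[OF z]])
    then show ?thesis using False by (simp add: field_simps)
  qed (simp add: summable_0_powser powser_zero)
  have g: "g holomorphic_on disk"
    by (rule power_series_holomorphic[where a="\<lambda>n. a (int n)"])
      (use summable_norm_cancel[OF ab(1)] in \<open>simp add: g_def summable_sums\<close>)
  have h0: "h holomorphic_on disk"
    by (rule power_series_holomorphic[where a="\<lambda>n. cnj (a (- int (Suc n)))"])
      (use ab2 in \<open>simp add: h_def summable_sums del: of_nat_Suc\<close>)
  have h: "(\<lambda>z. z * h z) holomorphic_on disk" by (intro holomorphic_intros h0)
  have "hser a z = g z + cnj (z * h z)" if z: "z \<in> disk" for z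
  proof -
    have "((\<lambda>n. a (int n) * harm_monom (int n) z) has_sum g z) UNIV"
      using norm_summable_imp_has_sum[OF ab(1)[OF z]] summable_sums[OF summable_norm_cancel[OF ab(1)[OF z]]]
      using z by (simp add: harm_monom_eq g_def)
    moreover have "((\<lambda>n. a (- int (Suc n)) * harm_monom (- int (Suc n)) z) has_sum cnj (z * h z)) UNIV"
    proof (rule norm_summable_imp_has_sum)
      have eq: "a (- int (Suc n)) * harm_monom (- int (Suc n)) z = cnj (cnj (a (- int (Suc n))) * z ^ Suc n)" for n
        using z by (simp add: harm_monom_eq nat_add_distrib)
      show "summable (\<lambda>n. norm (a (- int (Suc n)) * harm_monom (- int (Suc n)) z))"
        unfolding eq complex_mod_cnj by (rule ab(2)[OF z])
      have "(\<lambda>n. z * (cnj (a (- int (Suc n))) * z ^ n)) sums (z * h z)"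
        unfolding h_def by (intro sums_mult summable_sums ab2 z)
      then have "(\<lambda>n. cnj (cnj (a (- int (Suc n))) * z ^ Suc n)) sums cnj (z * h z)"
        unfolding sums_cnj by (simp add: mult_ac)
      then show "(\<lambda>n. a (- int (Suc n)) * harm_monom (- int (Suc n)) z) sums cnj (z * h z)"
        by (simp only: eq)
    qed
    ultimately have "((\<lambda>n. a n * harm_monom n z) has_sum (g z + cnj (z * h z))) UNIV"
      by (rule has_sum_int_split[of "\<lambda>n. a n * harm_monom n z"])
    then show ?thesis using hser_has_sum[OF a] has_sum_unique by blast
  qed
  then show ?thesis using harmonic_on_holomorphic_add_cnj[OF _ g h] by auto
qed

text \<open>The coefficients are Taylor coefficients of the two holomorphic parts. The constant of
  the conjugated part is moved to the other one, so that index 0 is used only once.\<close>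

lemma harmonic_eq_hser:
  assumes f: "harmonic_on f disk" and out: "\<And>z. z \<notin> disk \<Longrightarrow> f z = 0"
  obtains a where "disk_conv a" "f = hser a"
proof -
  obtain g0 h0 where gh0: "g0 holomorphic_on disk" "h0 holomorphic_on disk" "\<And>z. z \<in> disk \<Longrightarrow> f z = g0 z + cnj (h0 z)"
    using harmonic_decomposition[OF f] by auto
  define g where "g = (\<lambda>z. g0 z + cnj (h0 0))" define h where "h = (\<lambda>z. h0 z - h0 0)"
  have gh: "g holomorphic_on disk" "h holomorphic_on disk" "\<And>z. z \<in> disk \<Longrightarrow> f z = g z + cnj (h z)" "h 0 = 0"
    using gh0 by (auto simp: g_def h_def intro!: holomorphic_intros)
  define G where "G = (\<lambda>n. (deriv ^^ n) g 0 / fact n)" define H where "H = (\<lambda>n. (deriv ^^ n) h 0 / fact n)"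
  have G: "(\<lambda>n. G n * z ^ n) sums g z" and H: "(\<lambda>n. H n * z ^ n) sums h z" if "z \<in> disk" for z
    using holomorphic_power_series[OF gh(1) that] holomorphic_power_series[OF gh(2) that] by (simp_all add: G_def H_def)
  have H0: "H 0 = 0" by (simp add: H_def gh(4))
  have ab: "summable (\<lambda>n. norm (G n * z ^ n))" "summable (\<lambda>n. norm (H n * z ^ n))" if zd: "z \<in> disk" for z
  proof -
    obtain r where r: "cmod z < r" "r < 1" using zd dense[of "cmod z" 1] by auto
    then have r0: "r > 0" by (meson le_less_trans norm_ge_zero)
    have "of_real r \<in> disk" using r r0 by simp
    then have "summable (\<lambda>n. G n * of_real r ^ n)" "summable (\<lambda>n. H n * of_real r ^ n)"
      using G H sums_summable by blast+
    then show "summable (\<lambda>n. norm (G n * z ^ n))" "summable (\<lambda>n. norm (H n * z ^ n))"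
      using powser_insidea[of G "of_real r" z] powser_insidea[of H "of_real r" z] r r0 by auto
  qed
  define a where "a = (\<lambda>n. if n \<ge> 0 then G (nat n) else cnj (H (nat (- n))))"
  have a1: "a (int n) = G n" and a2: "a (- int (Suc n)) = cnj (H (Suc n))" for n
    by (simp_all add: a_def nat_add_distrib)
  have conv: "disk_conv a" unfolding disk_conv_def
  proof (intro allI impI)
    fix \<rho> :: real assume \<rho>: "0 \<le> \<rho> \<and> \<rho> < 1"
    then have z: "complex_of_real \<rho> \<in> disk" by simp
    have "summable (\<lambda>n. norm (G n) * \<rho> ^ n + norm (H n) * \<rho> ^ n)"
      using ab[OF z] \<rho> by (intro summable_add) (simp_all add: norm_mult norm_power)
    then have "(\<lambda>n::int. norm (G (nat \<bar>n\<bar>)) * \<rho> ^ nat \<bar>n\<bar> + norm (H (nat \<bar>n\<bar>)) * \<rho> ^ nat \<bar>n\<bar>) summable_on UNIV"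
      using \<rho> by (intro summable_on_int_abs[where f="\<lambda>n. norm (G n) * \<rho> ^ n + norm (H n) * \<rho> ^ n"]) auto
    then show "(\<lambda>n. cmod (a n) * \<rho> ^ nat \<bar>n\<bar>) summable_on UNIV"
      by (rule summable_on_comparison_test) (use \<rho> in \<open>auto simp: a_def\<close>)
  qed
  have "f z = hser a z" for z
  proof (cases "z \<in> disk")
    case True
    have "((\<lambda>n. a (int n) * harm_monom (int n) z) has_sum g z) UNIV"
      using norm_summable_imp_has_sum[OF ab(1)[OF True] G[OF True]] True by (simp add: a1 harm_monom_eq)
    moreover have "((\<lambda>n. a (- int (Suc n)) * harm_monom (- int (Suc n)) z) has_sum cnj (h z)) UNIV"
    proof (rule norm_summable_imp_has_sum)
      have eq: "a (- int (Suc n)) * harm_monom (- int (Suc n)) z = cnj (H (Suc n) * z ^ Suc n)" for n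
        unfolding a2 using True by (simp add: harm_monom_eq nat_add_distrib)
      show "summable (\<lambda>n. norm (a (- int (Suc n)) * harm_monom (- int (Suc n)) z))"
        unfolding eq complex_mod_cnj using ab(2)[OF True] by (subst summable_Suc_iff)
      have "(\<lambda>n. H (Suc n) * z ^ Suc n) sums h z"
        using H[OF True] H0 by (subst sums_Suc_iff) simp
      then show "(\<lambda>n. a (- int (Suc n)) * harm_monom (- int (Suc n)) z) sums cnj (h z)"
        unfolding eq sums_cnj .
    qed
    ultimately have "((\<lambda>n. a n * harm_monom n z) has_sum (g z + cnj (h z))) UNIV"
      by (rule has_sum_int_split[of "\<lambda>n. a n * harm_monom n z"])
    then show ?thesis using hser_has_sum[OF conv] has_sum_unique gh(3)[OF True] by metis
  qed (simp add: out hser_outside)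
  then show ?thesis using that conv by blast
qed

section \<open>Orthogonality and Parseval's identity\<close>

lemma finite_measure_dAb: "finite_measure dAb"
  by (rule finite_measureI) (simp add: emeasure_dAb_UNIV)

lemma integrable_dAb_bounded:
  fixes f :: "complex \<Rightarrow> 'b::{banach, second_countable_topology}"
  assumes "f \<in> borel_measurable borel" "\<And>x. norm (f x) \<le> B"
  shows "integrable dAb f"
proof -
  interpret finite_measure dAb by (rule finite_measure_dAb)
  show ?thesis
    by (rule integrable_const_bound[of _ B]) (use assms in \<open>auto simp: measurable_cong_sets[OF sets_dAb refl]\<close>)
qed

lemma AE_dAb_disk: "AE w in dAb. w \<in> disk"
  unfolding dAb_def by (subst AE_density) (auto simp: indicator_def)

lemma measurable_cnj [measurable]: "cnj \<in> borel_measurable borel"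
  by (intro borel_measurable_continuous_onI continuous_intros)

lemma pred_ball [measurable]: "Measurable.pred borel (\<lambda>x. x \<in> ball a r)"
  unfolding pred_def using borel_open[OF open_ball[of a r]] by (simp del: mem_ball)

lemma harm_monom_product:
  assumes "w \<in> disk" "w \<noteq> 0"
  shows "cis (of_int l * Arg w) * harm_monom j w * cnj (harm_monom n w)
    = cis (of_int (l + j - n) * Arg w) * of_real (cmod w ^ (nat \<bar>j\<bar> + nat \<bar>n\<bar>))"
proof -
  have "cis (of_int (l + j - n) * Arg w) = cis (of_int l * Arg w) * cis (of_int j * Arg w) * cis (- (of_int n * Arg w))"
    by (simp add: cis_mult algebra_simps)
  then show ?thesis using assms by (simp add: harm_monom_def on_disk_def power_add cis_cnj mult_ac)
qed

text \<open>The angular factors combine to the single frequency l + j - n, whose integral vanishes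
  unless it is 0; what remains is a moment of \<open>g\<close>.\<close>

lemma integral_harm_monom_product:
  assumes [measurable]: "g \<in> borel_measurable borel"
  shows "(\<integral>w. cis (of_int l * Arg w) * g (cmod w) * harm_monom j w * cnj (harm_monom n w) \<partial>dAb)
    = (if l + j = n then (\<integral>r. g r * of_real (r ^ (nat \<bar>j\<bar> + nat \<bar>n\<bar>)) \<partial>dr2) else 0)"
proof -
  define h where "h = (\<lambda>r. g r * of_real (r ^ (nat \<bar>j\<bar> + nat \<bar>n\<bar>)))"
  have [measurable]: "h \<in> borel_measurable borel" unfolding h_def by measurable
  have "(\<integral>w. cis (of_int l * Arg w) * g (cmod w) * harm_monom j w * cnj (harm_monom n w) \<partial>dAb)
    = (\<integral>w. cis (of_int (l + j - n) * Arg w) * h (cmod w) \<partial>dAb)"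
  proof (rule integral_cong_AE)
    show "AE w in dAb. cis (of_int l * Arg w) * g (cmod w) * harm_monom j w * cnj (harm_monom n w) = cis (of_int (l + j - n) * Arg w) * h (cmod w)"
      using AE_dAb_disk AE_dAb_nonzero
    proof eventually_elim
      case (elim w)
      show ?case using harm_monom_product[OF elim, of l j n] by (simp add: h_def mult_ac)
    qed
  qed (simp_all only: measurable_cong_sets[OF sets_dAb refl], measurable)
  also have "\<dots> = (if l + j = n then integral\<^sup>L dr2 h else 0)"
    using integral_dAb_angular[of h "l + j - n"] integral_dAb_radial(1)[of h] by auto
  finally show ?thesis by (simp add: h_def)
qed

lemma integral_dr2_power:
  assumes "0 \<le> \<rho>" "\<rho> \<le> 1"
  shows "(\<integral>r. indicator {..<\<rho>} r * of_real (r ^ (2 * k)) \<partial>dr2) = (of_real (\<rho> ^ (2 * k + 2) / (real k + 1)) :: complex)"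
proof -
  have "(\<integral>r. indicator {..<\<rho>} r * r ^ (2 * k) \<partial>dr2) = (\<integral>r. (2 * r * indicator {0..1} r) * (indicator {..<\<rho>} r * r ^ (2 * k)) \<partial>lborel)"
    unfolding dr2_def by (subst integral_density) (auto simp: indicator_def)
  also have "\<dots> = (\<integral>r. (2 * r ^ (2 * k + 1)) * indicator {0..\<rho>} r \<partial>lborel)"
  proof (rule integral_cong_AE)
    have "AE r in lborel. r \<noteq> \<rho>" by (rule AE_lborel_singleton)
    then show "AE r in lborel. (2 * r * indicator {0..1} r) * (indicator {..<\<rho>} r * r ^ (2 * k)) = (2 * r ^ (2 * k + 1)) * indicator {0..\<rho>} r"
      by eventually_elim (use assms in \<open>auto split: split_indicator\<close>)
  qed measurable
  also have "\<dots> = \<rho> ^ (2 * k + 2) / (real k + 1) - 0 ^ (2 * k + 2) / (real k + 1)"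
  proof (rule integral_FTC_Icc_nonneg)
    fix x assume x: "x \<in> {0..\<rho>}"
    have "((\<lambda>x. x ^ (2 * k + 2) / (real k + 1)) has_real_derivative (real (2 * k + 2) * x ^ (2 * k + 1) / (real k + 1))) (at x)"
      using DERIV_cdivide[OF DERIV_pow[of "2 * k + 2" x UNIV], of "real k + 1"] by simp
    moreover have "real (2 * k + 2) * x ^ (2 * k + 1) / (real k + 1) = 2 * x ^ (2 * k + 1)"
      by (simp add: field_simps)
    ultimately show "((\<lambda>x. x ^ (2 * k + 2) / (real k + 1)) has_real_derivative 2 * x ^ (2 * k + 1)) (at x)" by metis
  qed (use assms in auto)
  finally have "(\<integral>r. indicator {..<\<rho>} r * r ^ (2 * k) \<partial>dr2) = \<rho> ^ (2 * k + 2) / (real k + 1)" by simp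
  moreover have "(\<integral>r. indicator {..<\<rho>} r * of_real (r ^ (2 * k)) \<partial>dr2) = complex_of_real (\<integral>r. indicator {..<\<rho>} r * r ^ (2 * k) \<partial>dr2)"
    by (subst integral_complex_of_real[symmetric], intro Bochner_Integration.integral_cong) (auto split: split_indicator)
  ultimately show ?thesis by simp
qed

lemma integral_ball_orthogonal:
  assumes \<rho>: "0 \<le> \<rho>" "\<rho> \<le> 1"
  shows "(\<integral>w. indicator (ball 0 \<rho>) w * (harm_monom j w * cnj (harm_monom k w)) \<partial>dAb)
    = (if j = k then of_real (\<rho> ^ (2 * nat \<bar>k\<bar> + 2) / (real_of_int \<bar>k\<bar> + 1)) else 0)"
proof -
  have "(\<integral>w. indicator (ball 0 \<rho>) w * (harm_monom j w * cnj (harm_monom k w)) \<partial>dAb)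
    = (\<integral>w. cis (of_int 0 * Arg w) * indicator {..<\<rho>} (cmod w) * harm_monom j w * cnj (harm_monom k w) \<partial>dAb)"
    by (intro Bochner_Integration.integral_cong) (auto simp: indicator_def)
  also have "\<dots> = (if 0 + j = k then (\<integral>r. indicator {..<\<rho>} r * of_real (r ^ (nat \<bar>j\<bar> + nat \<bar>k\<bar>)) \<partial>dr2) else 0)"
    by (rule integral_harm_monom_product) measurable
  also have "\<dots> = (if j = k then of_real (\<rho> ^ (2 * nat \<bar>k\<bar> + 2) / (real_of_int \<bar>k\<bar> + 1)) else 0)"
    using integral_dr2_power[OF \<rho>, of "nat \<bar>k\<bar>"] by (simp flip: mult_2)
  finally show ?thesis .
qed

lemma integral_ball_partial:
  assumes \<rho>: "0 \<le> \<rho>" "\<rho> \<le> 1" and F: "finite F"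
  shows "(\<integral>w. indicator (ball 0 \<rho>) w * (cmod (\<Sum>n\<in>F. a n * harm_monom n w))\<^sup>2 \<partial>dAb)
    = (\<Sum>n\<in>F. (cmod (a n))\<^sup>2 * (\<rho> ^ (2 * nat \<bar>n\<bar> + 2) / (real_of_int \<bar>n\<bar> + 1)))"
proof -
  let ?S = "\<lambda>w. \<Sum>n\<in>F. a n * harm_monom n w"
  let ?i = "\<lambda>w. indicator (ball 0 \<rho>) w :: complex"
  have int: "integrable dAb (\<lambda>w. ?i w * (harm_monom j w * cnj (harm_monom k w)))" for j k
  proof (rule integrable_dAb_bounded[of _ 1])
    show "norm (?i w * (harm_monom j w * cnj (harm_monom k w))) \<le> 1" for w
      using mult_le_one[OF norm_harm_monom_le norm_ge_zero norm_harm_monom_le, of j w k w]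
      by (auto simp: norm_mult indicator_def)
  qed measurable
  have "complex_of_real (\<integral>w. indicator (ball 0 \<rho>) w * (cmod (?S w))\<^sup>2 \<partial>dAb)
     = (\<integral>w. complex_of_real (indicator (ball 0 \<rho>) w * (cmod (?S w))\<^sup>2) \<partial>dAb)"
    by (rule integral_complex_of_real[symmetric])
  also have "\<dots> = (\<integral>w. (\<Sum>j\<in>F. \<Sum>k\<in>F. (a j * cnj (a k)) * (?i w * (harm_monom j w * cnj (harm_monom k w)))) \<partial>dAb)"
  proof (intro Bochner_Integration.integral_cong refl)
    fix w
    have "complex_of_real (indicator (ball 0 \<rho>) w * (cmod (?S w))\<^sup>2) = ?i w * (?S w * cnj (?S w))"
      by (subst complex_norm_square[symmetric]) (auto simp: indicator_def)
    also have "\<dots> = (\<Sum>j\<in>F. \<Sum>k\<in>F. ?i w * ((a j * harm_monom j w) * cnj (a k * harm_monom k w)))"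
      by (subst cnj_sum, subst sum_product) (simp only: sum_distrib_left)
    also have "\<dots> = (\<Sum>j\<in>F. \<Sum>k\<in>F. (a j * cnj (a k)) * (?i w * (harm_monom j w * cnj (harm_monom k w))))"
      by (intro sum.cong refl) (simp add: mult_ac)
    finally show "complex_of_real (indicator (ball 0 \<rho>) w * (cmod (?S w))\<^sup>2) = (\<Sum>j\<in>F. \<Sum>k\<in>F. (a j * cnj (a k)) * (?i w * (harm_monom j w * cnj (harm_monom k w))))" .
  qed
  also have "\<dots> = (\<Sum>j\<in>F. \<Sum>k\<in>F. (a j * cnj (a k)) * (\<integral>w. ?i w * (harm_monom j w * cnj (harm_monom k w)) \<partial>dAb))"
    using int by (subst Bochner_Integration.integral_sum, simp, intro sum.cong refl, subst Bochner_Integration.integral_sum) auto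
  also have "\<dots> = (\<Sum>j\<in>F. (a j * cnj (a j)) * of_real (\<rho> ^ (2 * nat \<bar>j\<bar> + 2) / (real_of_int \<bar>j\<bar> + 1)))"
    unfolding integral_ball_orthogonal[OF \<rho>] using F by (intro sum.cong refl) (simp add: if_distrib[of "\<lambda>x. _ * x"] sum.delta' cong: if_cong)
  also have "\<dots> = of_real (\<Sum>n\<in>F. (cmod (a n))\<^sup>2 * (\<rho> ^ (2 * nat \<bar>n\<bar> + 2) / (real_of_int \<bar>n\<bar> + 1)))"
    by (simp only: of_real_sum of_real_mult complex_norm_square)
  finally show ?thesis using of_real_eq_iff by blast
qed

text \<open>Inside a ball of radius \<rho> < 1 the partial sums are bounded uniformly, so Parseval's
  identity holds there for every series with \<open>disk_conv\<close>, before square integrability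
  on the whole disk is known.\<close>

lemma integral_ball_LIMSEQ:
  assumes a: "disk_conv a" and \<rho>: "0 \<le> \<rho>" "\<rho> < 1"
  shows "(\<lambda>N. \<Sum>n\<in>{- int N..int N}. (cmod (a n))\<^sup>2 * (\<rho> ^ (2 * nat \<bar>n\<bar> + 2) / (real_of_int \<bar>n\<bar> + 1)))
    \<longlonglongrightarrow> (\<integral>w. indicator (ball 0 \<rho>) w * (cmod (hser a w))\<^sup>2 \<partial>dAb)"
    "integrable dAb (\<lambda>w. indicator (ball 0 \<rho>) w * (cmod (hser a w))\<^sup>2)"
proof -
  note [measurable] = hser_measurable[OF a]
  \<comment> \<open>A common bound of all partial sums on the ball, finite by
    \<open>disk_conv\<close>.\<close>
  define M where "M = (\<Sum>\<^sub>\<infinity>n. cmod (a n) * \<rho> ^ nat \<bar>n\<bar>)"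
  have sm: "(\<lambda>n. cmod (a n) * \<rho> ^ nat \<bar>n\<bar>) summable_on UNIV" using a \<rho> by (auto simp: disk_conv_def)
  have bnd: "norm (indicator (ball 0 \<rho>) w * (cmod (\<Sum>n\<in>{- int N..int N}. a n * harm_monom n w))\<^sup>2) \<le> M\<^sup>2" for N w
  proof (cases "w \<in> ball 0 \<rho>")
    case True
    have "cmod (\<Sum>n\<in>{- int N..int N}. a n * harm_monom n w) \<le> (\<Sum>n\<in>{- int N..int N}. cmod (a n * harm_monom n w))"
      by (rule norm_sum)
    also have "\<dots> \<le> (\<Sum>n\<in>{- int N..int N}. cmod (a n) * \<rho> ^ nat \<bar>n\<bar>)"
      using True \<rho> by (intro sum_mono) (auto simp: norm_mult norm_harm_monom intro!: mult_left_mono power_mono)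
    also have "\<dots> \<le> M" unfolding M_def using sm \<rho> by (intro finite_sum_le_infsum) auto
    finally show ?thesis using True by (simp add: power_mono)
  qed simp
  define s where "s = (\<lambda>(N::nat) w. indicator (ball 0 \<rho>) w * (cmod (\<Sum>n\<in>{- int N..int N}. a n * harm_monom n w))\<^sup>2)"
  have lim: "(\<lambda>N. s N w) \<longlonglongrightarrow> indicator (ball 0 \<rho>) w * (cmod (hser a w))\<^sup>2" for w
    unfolding s_def by (intro tendsto_intros hser_LIMSEQ a)
  have m1: "(\<lambda>w. indicator (ball 0 \<rho>) w * (cmod (hser a w))\<^sup>2) \<in> borel_measurable dAb"
    by (subst measurable_cong_sets[OF sets_dAb refl]) measurable
  have m2: "s N \<in> borel_measurable dAb" for N
    unfolding s_def by (subst measurable_cong_sets[OF sets_dAb refl]) measurable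
  have w: "integrable dAb (\<lambda>w. M\<^sup>2)" by (rule integrable_dAb_bounded[of _ "norm (M\<^sup>2)"]) auto
  have l: "AE w in dAb. (\<lambda>N. s N w) \<longlonglongrightarrow> indicator (ball 0 \<rho>) w * (cmod (hser a w))\<^sup>2" using lim by simp
  have b: "AE w in dAb. norm (s N w) \<le> M\<^sup>2" for N unfolding s_def using bnd by (intro AE_I2)
  note dc = integrable_dominated_convergence[OF m1 m2 w l b] integral_dominated_convergence[OF m1 m2 w l b]
  show "integrable dAb (\<lambda>w. indicator (ball 0 \<rho>) w * (cmod (hser a w))\<^sup>2)" by (rule dc(1))
  show "(\<lambda>N. \<Sum>n\<in>{- int N..int N}. (cmod (a n))\<^sup>2 * (\<rho> ^ (2 * nat \<bar>n\<bar> + 2) / (real_of_int \<bar>n\<bar> + 1)))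
    \<longlonglongrightarrow> (\<integral>w. indicator (ball 0 \<rho>) w * (cmod (hser a w))\<^sup>2 \<partial>dAb)"
    using dc(2) \<rho> unfolding s_def by (simp add: integral_ball_partial)
qed

text \<open>Membership in \<open>L2h\<close> expressed by coefficients: the monomial of index n has
  squared norm 1/(|n| + 1).\<close>

definition l2w :: "(int \<Rightarrow> complex) \<Rightarrow> bool" where
  "l2w a \<longleftrightarrow> (\<lambda>n. (cmod (a n))\<^sup>2 / (real_of_int \<bar>n\<bar> + 1)) summable_on UNIV"

text \<open>One half of Parseval's identity. For finitely many coefficients the weights \<rho>^(2|n|
  + 2) tend to 1 with \<rho>, so every finite sum is at most the integral over the disk.\<close>

lemma hser_integrable_imp:
  assumes a: "disk_conv a" and int: "integrable dAb (\<lambda>w. (cmod (hser a w))\<^sup>2)"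
  shows "l2w a" "(\<Sum>\<^sub>\<infinity>n. (cmod (a n))\<^sup>2 / (real_of_int \<bar>n\<bar> + 1)) \<le> (\<integral>w. (cmod (hser a w))\<^sup>2 \<partial>dAb)"
proof -
  define I where "I = (\<integral>w. (cmod (hser a w))\<^sup>2 \<partial>dAb)"
  have P: "(\<Sum>n\<in>{- int N..int N}. (cmod (a n))\<^sup>2 * (\<rho> ^ (2 * nat \<bar>n\<bar> + 2) / (real_of_int \<bar>n\<bar> + 1))) \<le> I"
    if \<rho>: "0 \<le> \<rho>" "\<rho> < 1" for N \<rho>
  proof -
    have "(\<Sum>n\<in>{- int N..int N}. (cmod (a n))\<^sup>2 * (\<rho> ^ (2 * nat \<bar>n\<bar> + 2) / (real_of_int \<bar>n\<bar> + 1)))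
       \<le> (\<integral>w. indicator (ball 0 \<rho>) w * (cmod (hser a w))\<^sup>2 \<partial>dAb)"
      by (rule incseq_le[OF _ integral_ball_LIMSEQ(1)[OF a \<rho>]])
        (use \<rho> in \<open>auto intro!: incseq_SucI sum_mono2\<close>)
    also have "\<dots> \<le> I" unfolding I_def
      by (intro integral_mono integral_ball_LIMSEQ(2)[OF a \<rho>] int) (auto split: split_indicator)
    finally show ?thesis .
  qed
  have fin: "(\<Sum>n\<in>F. (cmod (a n))\<^sup>2 / (real_of_int \<bar>n\<bar> + 1)) \<le> I" if F: "finite F" for F
  proof -
    define N where "N = nat (Max (insert 0 (abs ` F)))"
    have b: "\<bar>x\<bar> \<le> int N" if "x \<in> F" for x
      unfolding N_def using F that by (auto intro!: le_nat_iff[THEN iffD1] Max_ge_iff[THEN iffD2])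
    have sub: "F \<subseteq> {- int N..int N}" using b by (auto simp: abs_le_iff) (force dest: b)+
    have "(\<Sum>n\<in>{- int N..int N}. (cmod (a n))\<^sup>2 * (1 ^ (2 * nat \<bar>n\<bar> + 2) / (real_of_int \<bar>n\<bar> + 1))) \<le> I"
    proof (rule tendsto_upperbound)
      show "((\<lambda>\<rho>. \<Sum>n\<in>{- int N..int N}. (cmod (a n))\<^sup>2 * (\<rho> ^ (2 * nat \<bar>n\<bar> + 2) / (real_of_int \<bar>n\<bar> + 1))) \<longlongrightarrow>
        (\<Sum>n\<in>{- int N..int N}. (cmod (a n))\<^sup>2 * (1 ^ (2 * nat \<bar>n\<bar> + 2) / (real_of_int \<bar>n\<bar> + 1)))) (at_left 1)"
        by (intro tendsto_intros) (auto simp: add_nonneg_eq_0_iff)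
      have "\<forall>\<^sub>F \<rho>::real in at_left 1. 0 < \<rho>" by (rule eventually_at_left_real[THEN eventually_mono]) auto
      moreover have "\<forall>\<^sub>F \<rho>::real in at_left 1. \<rho> < 1" by (simp add: eventually_at_filter)
      ultimately show "\<forall>\<^sub>F \<rho> in at_left 1. (\<Sum>n\<in>{- int N..int N}. (cmod (a n))\<^sup>2 * (\<rho> ^ (2 * nat \<bar>n\<bar> + 2) / (real_of_int \<bar>n\<bar> + 1))) \<le> I"
        by eventually_elim (rule P, auto)
    qed simp
    moreover have "(\<Sum>n\<in>F. (cmod (a n))\<^sup>2 / (real_of_int \<bar>n\<bar> + 1)) \<le> (\<Sum>n\<in>{- int N..int N}. (cmod (a n))\<^sup>2 / (real_of_int \<bar>n\<bar> + 1))"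
      by (intro sum_mono2 sub) auto
    ultimately show ?thesis by simp
  qed
  show sm: "l2w a" unfolding l2w_def
    by (rule nonneg_bdd_above_summable_on) (auto intro!: bdd_aboveI[of _ I] fin simp del: of_int_abs)
  show "(\<Sum>\<^sub>\<infinity>n. (cmod (a n))\<^sup>2 / (real_of_int \<bar>n\<bar> + 1)) \<le> I"
    by (rule infsum_le_finite_sums[OF sm[unfolded l2w_def] fin])
qed

text \<open>The other half. The integrals over balls of growing radius are bounded by the
  coefficient sum, and monotone convergence passes to the disk.\<close>

lemma hser_l2w_imp:
  assumes a: "disk_conv a" and l: "l2w a"
  shows "integrable dAb (\<lambda>w. (cmod (hser a w))\<^sup>2)"
    "(\<integral>w. (cmod (hser a w))\<^sup>2 \<partial>dAb) \<le> (\<Sum>\<^sub>\<infinity>n. (cmod (a n))\<^sup>2 / (real_of_int \<bar>n\<bar> + 1))"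
proof -
  note [measurable] = hser_measurable[OF a]
  define S where "S = (\<Sum>\<^sub>\<infinity>n. (cmod (a n))\<^sup>2 / (real_of_int \<bar>n\<bar> + 1))"
  define \<rho> where "\<rho> = (\<lambda>k::nat. 1 - 1 / (real k + 1))"
  have \<rho>: "0 \<le> \<rho> k" "\<rho> k < 1" for k by (auto simp: \<rho>_def field_simps)
  have mono: "\<rho> i \<le> \<rho> j" if "i \<le> j" for i j using that by (auto simp: \<rho>_def intro!: divide_left_mono)
  define s where "s = (\<lambda>k w. indicator (ball 0 (\<rho> k)) w * (cmod (hser a w))\<^sup>2)"
  have int: "integrable dAb (s k)" for k unfolding s_def by (rule integral_ball_LIMSEQ(2)[OF a \<rho>])
  have le: "integral\<^sup>L dAb (s k) \<le> S" for k
  proof (rule LIMSEQ_le_const2)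
    show "(\<lambda>N. \<Sum>n\<in>{- int N..int N}. (cmod (a n))\<^sup>2 * (\<rho> k ^ (2 * nat \<bar>n\<bar> + 2) / (real_of_int \<bar>n\<bar> + 1))) \<longlonglongrightarrow> integral\<^sup>L dAb (s k)"
      unfolding s_def by (rule integral_ball_LIMSEQ(1)[OF a \<rho>])
    show "\<exists>N. \<forall>n\<ge>N. (\<Sum>n\<in>{- int n..int n}. (cmod (a n))\<^sup>2 * (\<rho> k ^ (2 * nat \<bar>n\<bar> + 2) / (real_of_int \<bar>n\<bar> + 1))) \<le> S"
    proof (intro exI allI impI)
      fix N :: nat
      have "(\<Sum>n\<in>{- int N..int N}. (cmod (a n))\<^sup>2 * (\<rho> k ^ (2 * nat \<bar>n\<bar> + 2) / (real_of_int \<bar>n\<bar> + 1)))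
        \<le> (\<Sum>n\<in>{- int N..int N}. (cmod (a n))\<^sup>2 * (1 / (real_of_int \<bar>n\<bar> + 1)))"
        using \<rho>[of k] by (intro sum_mono mult_left_mono divide_right_mono power_le_one) auto
      also have "\<dots> \<le> S" unfolding S_def using l by (auto simp: l2w_def intro!: finite_sum_le_infsum)
      finally show "(\<Sum>n\<in>{- int N..int N}. (cmod (a n))\<^sup>2 * (\<rho> k ^ (2 * nat \<bar>n\<bar> + 2) / (real_of_int \<bar>n\<bar> + 1))) \<le> S" .
    qed
  qed
  have sm: "s i w \<le> s j w" if "i \<le> j" for i j w
    using mono[OF that] by (auto simp: s_def split: split_indicator)
  have "incseq (\<lambda>k. integral\<^sup>L dAb (s k))"
    by (intro incseq_SucI integral_mono int sm) auto
  then obtain x where x: "(\<lambda>k. integral\<^sup>L dAb (s k)) \<longlonglongrightarrow> x"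
    using incseq_convergent[of _ S] le by blast
  have xS: "x \<le> S" by (rule LIMSEQ_le_const2[OF x]) (use le in auto)
  have lim: "(\<lambda>k. s k w) \<longlonglongrightarrow> (cmod (hser a w))\<^sup>2" for w
  proof (cases "w \<in> disk")
    case True
    have "\<rho> \<longlonglongrightarrow> 1 - 0" unfolding \<rho>_def
      by (intro tendsto_intros) (use LIMSEQ_inverse_real_of_nat in \<open>simp add: inverse_eq_divide add.commute\<close>)
    then have "\<forall>\<^sub>F k in sequentially. \<rho> k > cmod w" using True by (intro order_tendstoD) auto
    then have "\<forall>\<^sub>F k in sequentially. s k w = (cmod (hser a w))\<^sup>2" by eventually_elim (simp add: s_def)
    then show ?thesis by (rule tendsto_eventually)
  qed (simp add: s_def hser_outside)
  have meas: "(\<lambda>w. (cmod (hser a w))\<^sup>2) \<in> borel_measurable dAb"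
    by (subst measurable_cong_sets[OF sets_dAb refl]) measurable
  note mc = integral_monotone_convergence[of dAb s, OF int _ _ x meas]
    integrable_monotone_convergence[of dAb s, OF int _ _ x meas]
  have m: "AE w in dAb. mono (\<lambda>k. s k w)" using sm by (auto simp: mono_def)
  have l: "AE w in dAb. (\<lambda>k. s k w) \<longlonglongrightarrow> (cmod (hser a w))\<^sup>2" using lim by auto
  show "integrable dAb (\<lambda>w. (cmod (hser a w))\<^sup>2)" using mc m l by blast
  show "(\<integral>w. (cmod (hser a w))\<^sup>2 \<partial>dAb) \<le> S" using mc m l xS by fastforce
qed

lemma infsum_int_weight_summable:
  assumes "0 \<le> \<rho>" "\<rho> < 1"
  shows "(\<lambda>n::int. (real_of_int \<bar>n\<bar> + 1) * \<rho> ^ nat \<bar>n\<bar>) summable_on UNIV"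
proof -
  have "summable (\<lambda>n. (real n + 1) * \<rho> ^ n)"
    using geometric_deriv_sums[of \<rho>] assms by (auto simp: sums_iff algebra_simps)
  then have "(\<lambda>n::int. (real (nat \<bar>n\<bar>) + 1) * \<rho> ^ nat \<bar>n\<bar>) summable_on UNIV"
    using assms by (intro summable_on_int_abs[where f="\<lambda>n. (real n + 1) * \<rho> ^ n"]) auto
  then show ?thesis by simp
qed

lemma l2w_imp_disk_conv:
  assumes "l2w a" shows "disk_conv a"
  unfolding disk_conv_def
proof (intro allI impI)
  fix \<rho> :: real assume \<rho>: "0 \<le> \<rho> \<and> \<rho> < 1"
  define S where "S = (\<Sum>\<^sub>\<infinity>n. (cmod (a n))\<^sup>2 / (real_of_int \<bar>n\<bar> + 1))"
  \<comment> \<open>A single term of the convergent sum bounds |a n|^2 linearly in |n|. As x \<le> 1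
    + x^2, also |a n| grows at most linearly, and the geometric factor absorbs this.\<close>
  have b: "cmod (a n) \<le> (1 + S) * (real_of_int \<bar>n\<bar> + 1)" for n
  proof -
    have "(\<Sum>n\<in>{n}. (cmod (a n))\<^sup>2 / (real_of_int \<bar>n\<bar> + 1)) \<le> S"
      unfolding S_def using assms by (intro finite_sum_le_infsum) (auto simp: l2w_def)
    then have sq: "(cmod (a n))\<^sup>2 \<le> S * (real_of_int \<bar>n\<bar> + 1)"
      by (simp add: divide_le_eq)
    have "cmod (a n) \<le> 1 + (cmod (a n))\<^sup>2"
    proof (cases "cmod (a n) \<le> 1")
      case True
      then show ?thesis using zero_le_power2[of "cmod (a n)"] by linarith
    next
      case False
      then show ?thesis using self_le_power[of "cmod (a n)" 2] by simp
    qed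
    then show ?thesis using sq by (simp add: distrib_right)
  qed
  have "(\<lambda>n::int. (1 + S) * ((real_of_int \<bar>n\<bar> + 1) * \<rho> ^ nat \<bar>n\<bar>)) summable_on UNIV"
    using infsum_int_weight_summable \<rho> by (intro summable_on_cmult_right) auto
  then show "(\<lambda>n. cmod (a n) * \<rho> ^ nat \<bar>n\<bar>) summable_on UNIV"
    by (rule summable_on_comparison_test)
      (use b \<rho> in \<open>auto simp: mult.assoc[symmetric] intro!: mult_right_mono simp del: of_int_abs\<close>)
qed

lemma hser_L2h: "l2w a \<Longrightarrow> hser a \<in> L2h"
  using hser_harmonic[OF l2w_imp_disk_conv] hser_l2w_imp(1)[OF l2w_imp_disk_conv] hser_outside
    integral_dA(2)[of "\<lambda>z. (cmod (hser a z))\<^sup>2"] hser_measurable[OF l2w_imp_disk_conv]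
  by (simp add: L2h_def)

lemma L2h_hser:
  assumes "f \<in> L2h" obtains a where "l2w a" "f = hser a"
proof -
  obtain a where a: "disk_conv a" "f = hser a" using assms harmonic_eq_hser[of f] by (auto simp: L2h_def)
  have "(\<lambda>z. (cmod (hser a z))\<^sup>2) \<in> borel_measurable borel" using hser_measurable[OF a(1)] by measurable
  then have "l2w a" using hser_integrable_imp(1)[OF a(1)] assms integral_dA(2) a(2) by (auto simp: L2h_def)
  then show ?thesis using that a by blast
qed

lemma norm_hser:
  assumes "l2w a"
  shows "(norm_L2 (hser a))\<^sup>2 = (\<Sum>\<^sub>\<infinity>n. (cmod (a n))\<^sup>2 / (real_of_int \<bar>n\<bar> + 1))"
proof -
  note a = l2w_imp_disk_conv[OF assms]
  have m: "(\<lambda>z. (cmod (hser a z))\<^sup>2) \<in> borel_measurable borel" using hser_measurable[OF a] by measurable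
  have "(norm_L2 (hser a))\<^sup>2 = (\<integral>z. (cmod (hser a z))\<^sup>2 \<partial>dAb)"
    by (simp add: norm_L2_def integral_dA(1)[OF m])
  then show ?thesis
    using hser_l2w_imp[OF a assms] hser_integrable_imp(2)[OF a] by linarith
qed

lemma norm_L2_nonneg: "norm_L2 f \<ge> 0"
  by (simp add: norm_L2_def)

text \<open>Coefficients depend continuously in norm on the function; uniqueness of the expansion
  and the description of closures rest on this.\<close>

lemma hser_coeff_le:
  assumes "l2w a"
  shows "(cmod (a n))\<^sup>2 \<le> (norm_L2 (hser a))\<^sup>2 * (real_of_int \<bar>n\<bar> + 1)"
proof -
  have "(\<Sum>n\<in>{n}. (cmod (a n))\<^sup>2 / (real_of_int \<bar>n\<bar> + 1)) \<le> (norm_L2 (hser a))\<^sup>2"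
    unfolding norm_hser[OF assms] using assms by (intro finite_sum_le_infsum) (auto simp: l2w_def)
  then show ?thesis by (simp add: divide_le_eq)
qed

lemma l2w_add: "l2w a \<Longrightarrow> l2w b \<Longrightarrow> l2w (\<lambda>n. a n + b n)"
  unfolding l2w_def
proof -
  assume *: "(\<lambda>n. (cmod (a n))\<^sup>2 / (real_of_int \<bar>n\<bar> + 1)) summable_on UNIV" "(\<lambda>n. (cmod (b n))\<^sup>2 / (real_of_int \<bar>n\<bar> + 1)) summable_on UNIV"
  then have "(\<lambda>n. 2 * ((cmod (a n))\<^sup>2 / (real_of_int \<bar>n\<bar> + 1) + (cmod (b n))\<^sup>2 / (real_of_int \<bar>n\<bar> + 1))) summable_on UNIV"
    by (intro summable_on_cmult_right summable_on_add)
  then show "(\<lambda>n. (cmod (a n + b n))\<^sup>2 / (real_of_int \<bar>n\<bar> + 1)) summable_on UNIV"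
  proof (rule summable_on_comparison_test)
    fix n
    have "(cmod (a n + b n))\<^sup>2 \<le> (cmod (a n) + cmod (b n))\<^sup>2" by (intro power_mono norm_triangle_ineq) auto
    also have "\<dots> \<le> 2 * ((cmod (a n))\<^sup>2 + (cmod (b n))\<^sup>2)"
      using zero_le_power2[of "cmod (a n) - cmod (b n)"] by (simp add: power2_eq_square algebra_simps)
    finally have "(cmod (a n + b n))\<^sup>2 / (real_of_int \<bar>n\<bar> + 1) \<le> 2 * ((cmod (a n))\<^sup>2 + (cmod (b n))\<^sup>2) / (real_of_int \<bar>n\<bar> + 1)"
      by (intro divide_right_mono) auto
    then show "(cmod (a n + b n))\<^sup>2 / (real_of_int \<bar>n\<bar> + 1) \<le> 2 * ((cmod (a n))\<^sup>2 / (real_of_int \<bar>n\<bar> + 1) + (cmod (b n))\<^sup>2 / (real_of_int \<bar>n\<bar> + 1))"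
      by (simp add: add_divide_distrib)
  qed auto
qed

lemma l2w_scale: "l2w a \<Longrightarrow> l2w (\<lambda>n. c * a n)"
  using summable_on_cmult_right[of "\<lambda>n. (cmod (a n))\<^sup>2 / (real_of_int \<bar>n\<bar> + 1)" UNIV "(cmod c)\<^sup>2"]
  by (simp add: l2w_def norm_mult power_mult_distrib)

lemma l2w_finite:
  assumes "finite {n. a n \<noteq> 0}" shows "l2w a"
proof -
  have "(\<lambda>n. (cmod (a n))\<^sup>2 / (real_of_int \<bar>n\<bar> + 1)) summable_on {n. a n \<noteq> 0}" using assms by (rule summable_on_finite)
  then show ?thesis unfolding l2w_def by (rule summable_on_cong_neutral[THEN iffD1, rotated -1]) auto
qed

lemma hser_inject:
  assumes "l2w a" "l2w b" "hser a = hser b"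
  shows "a = b"
proof
  fix n
  have l: "l2w (\<lambda>n. a n + (-1) * b n)" by (intro l2w_add l2w_scale assms)
  have "hser (\<lambda>n. a n + (-1) * b n) = hser a + scale_fun (-1) (hser b)"
    using hser_add hser_scale disk_conv_scale l2w_imp_disk_conv assms by metis
  also have "\<dots> = (\<lambda>_. 0)" by (auto simp: assms(3) scale_fun_def)
  finally have "norm_L2 (hser (\<lambda>n. a n + (-1) * b n)) = 0" by (simp add: norm_L2_def)
  then show "a n = b n" using hser_coeff_le[OF l, of n] by simp
qed

lemma harm_monom_hser: "harm_monom n = hser (\<lambda>k. if k = n then 1 else 0)"
proof
  fix z
  have l: "l2w (\<lambda>k. if k = n then 1 else 0)" by (rule l2w_finite) simp
  have "((\<lambda>k. (if k = n then 1 else 0) * harm_monom k z) has_sum (\<Sum>k\<in>{n}. (if k = n then 1 else 0) * harm_monom k z)) UNIV"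
    by (rule has_sum_finite_neutralI[of "{n}"]) auto
  then show "harm_monom n z = hser (\<lambda>k. if k = n then 1 else 0) z"
    using has_sum_unique[OF _ hser_has_sum[OF l2w_imp_disk_conv[OF l]], of z] by simp
qed

lemma harm_monom_L2h: "harm_monom n \<in> L2h"
  unfolding harm_monom_hser by (rule hser_L2h, rule l2w_finite) simp

text \<open>Adding a multiple \<open>c\<close> of the monomial changes the squared norm by an amount
  computable both as an integral and as a coefficient sum. Comparing the two for c = 1 and c = i
  gives the inner product without integrating an infinite series.\<close>

lemma inner_hser_harm_monom:
  assumes a: "l2w a"
  shows "inner_L2 (hser a) (harm_monom n) = a n / (of_int \<bar>n\<bar> + 1)"
proof -
  note dc = l2w_imp_disk_conv[OF a]
  note [measurable] = hser_measurable[OF dc]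
  define e where "e = harm_monom n"
  have em [measurable]: "e \<in> borel_measurable borel" by (simp add: e_def)
  have le: "l2w (\<lambda>k. if k = n then 1 else 0)" by (rule l2w_finite) simp
  define J where "J = inner_L2 (hser a) e"
  have J: "J = (\<integral>z. hser a z * cnj (e z) \<partial>dAb)" by (simp add: J_def inner_L2_def integral_dA(1))
  have mea: "(\<lambda>z. hser a z * cnj (e z)) \<in> borel_measurable dAb"
    by (subst measurable_cong_sets[OF sets_dAb refl]) measurable
  have ia: "integrable dAb (\<lambda>w. (cmod (hser a w))\<^sup>2)" by (rule hser_l2w_imp(1)[OF dc a])
  have i1: "integrable dAb (\<lambda>w. 1 :: real)" by (rule integrable_dAb_bounded[of _ 1]) auto
  have int: "integrable dAb (\<lambda>z. hser a z * cnj (e z))"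
  proof (rule Bochner_Integration.integrable_bound[OF Bochner_Integration.integrable_add[OF ia i1] mea], rule AE_I2)
    fix x
    have "cmod (hser a x * cnj (e x)) \<le> cmod (hser a x) * 1"
      unfolding norm_mult complex_mod_cnj e_def by (intro mult_left_mono norm_harm_monom_le) auto
    also have "\<dots> \<le> (cmod (hser a x))\<^sup>2 + 1"
      using zero_le_power2[of "cmod (hser a x) - 1"] by (simp add: power2_eq_square algebra_simps) (smt (verit) norm_ge_zero)
    finally show "norm (hser a x * cnj (e x)) \<le> norm ((cmod (hser a x))\<^sup>2 + 1)" by simp
  qed
  have ie: "integrable dAb (\<lambda>w. (cmod (e w))\<^sup>2)"
    by (rule integrable_dAb_bounded[of _ 1]) (auto simp: e_def norm_harm_monom_le power_le_one)
  have ne: "(\<integral>w. (cmod (e w))\<^sup>2 \<partial>dAb) = 1 / (real_of_int \<bar>n\<bar> + 1)"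
  proof -
    have "(\<integral>w. (cmod (e w))\<^sup>2 \<partial>dAb) = (norm_L2 e)\<^sup>2" by (simp add: norm_L2_def integral_dA(1))
    also have "\<dots> = (\<Sum>\<^sub>\<infinity>k. (cmod (if k = n then 1 else 0))\<^sup>2 / (real_of_int \<bar>k\<bar> + 1))"
      unfolding e_def harm_monom_hser by (rule norm_hser[OF le])
    also have "\<dots> = (\<Sum>\<^sub>\<infinity>k\<in>{n}. (cmod (if k = n then 1 else 0))\<^sup>2 / (real_of_int \<bar>k\<bar> + 1))"
      by (rule infsum_cong_neutral) auto
    finally show ?thesis by simp
  qed
  have key: "2 * Re (cnj c * J) = 2 * Re (cnj c * (a n / (of_int \<bar>n\<bar> + 1)))" for c
  proof -
    define b where "b = (\<lambda>k. a k + c * (if k = n then 1 else 0))"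
    have b: "l2w b" unfolding b_def by (intro l2w_add l2w_scale a le)
    have hb: "hser b z = hser a z + c * e z" for z
      unfolding b_def using hser_add[OF dc disk_conv_scale[OF l2w_imp_disk_conv[OF le]], of c] hser_scale[OF l2w_imp_disk_conv[OF le], of c]
      by (simp add: scale_fun_def e_def flip: harm_monom_hser)
    define R where "R = (\<lambda>z. Re (cnj c * (hser a z * cnj (e z))))"
    have "(norm_L2 (hser b))\<^sup>2 = (\<integral>z. (cmod (hser a z + c * e z))\<^sup>2 \<partial>dAb)"
      unfolding norm_L2_def hb by (subst integral_dA(1)) simp_all
    also have "\<dots> = (\<integral>z. (cmod (hser a z))\<^sup>2 + 2 * R z + (cmod c)\<^sup>2 * (cmod (e z))\<^sup>2 \<partial>dAb)"
      unfolding R_def by (intro Bochner_Integration.integral_cong refl)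
        (simp only: cmod_power2 power_mult_distrib[symmetric] norm_mult[symmetric], simp add: power2_eq_square algebra_simps)
    also have "\<dots> = (norm_L2 (hser a))\<^sup>2 + 2 * Re (cnj c * J) + (cmod c)\<^sup>2 * (1 / (real_of_int \<bar>n\<bar> + 1))"
    proof -
      have "(\<integral>z. R z \<partial>dAb) = Re (cnj c * J)"
        unfolding J R_def using int by (subst integral_Re) auto
      moreover have "integrable dAb R" unfolding R_def
        by (intro integrable_Re integrable_mult_right int)
      moreover have "(norm_L2 (hser a))\<^sup>2 = (\<integral>z. (cmod (hser a z))\<^sup>2 \<partial>dAb)"
        by (simp add: norm_L2_def integral_dA(1))
      ultimately show ?thesis using ia ie ne by simp
    qed
    finally have 1: "(norm_L2 (hser b))\<^sup>2 - (norm_L2 (hser a))\<^sup>2 = 2 * Re (cnj c * J) + (cmod c)\<^sup>2 / (real_of_int \<bar>n\<bar> + 1)" by simp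
    have "(norm_L2 (hser b))\<^sup>2 - (norm_L2 (hser a))\<^sup>2 = (\<Sum>\<^sub>\<infinity>k. (cmod (b k))\<^sup>2 / (real_of_int \<bar>k\<bar> + 1) - (cmod (a k))\<^sup>2 / (real_of_int \<bar>k\<bar> + 1))"
    proof (rule infsumI[symmetric])
      show "((\<lambda>k. (cmod (b k))\<^sup>2 / (real_of_int \<bar>k\<bar> + 1) - (cmod (a k))\<^sup>2 / (real_of_int \<bar>k\<bar> + 1)) has_sum
         ((norm_L2 (hser b))\<^sup>2 - (norm_L2 (hser a))\<^sup>2)) UNIV"
        unfolding norm_hser[OF a] norm_hser[OF b] diff_conv_add_uminus using a b unfolding l2w_def
        by (intro has_sum_add has_sum_uminusI has_sum_infsum)
    qed
    also have "\<dots> = (\<Sum>\<^sub>\<infinity>k\<in>{n}. (cmod (b k))\<^sup>2 / (real_of_int \<bar>k\<bar> + 1) - (cmod (a k))\<^sup>2 / (real_of_int \<bar>k\<bar> + 1))"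
      by (rule infsum_cong_neutral) (auto simp: b_def)
    also have "\<dots> = ((cmod (a n + c))\<^sup>2 - (cmod (a n))\<^sup>2) / (real_of_int \<bar>n\<bar> + 1)"
      by (simp add: b_def diff_divide_distrib)
    also have "(cmod (a n + c))\<^sup>2 - (cmod (a n))\<^sup>2 = 2 * Re (cnj c * a n) + (cmod c)\<^sup>2"
      by (simp only: cmod_power2) (simp add: power2_eq_square algebra_simps)
    also have "(2 * Re (cnj c * a n) + (cmod c)\<^sup>2) / (real_of_int \<bar>n\<bar> + 1) = 2 * Re (cnj c * (a n / (of_int \<bar>n\<bar> + 1))) + (cmod c)\<^sup>2 / (real_of_int \<bar>n\<bar> + 1)"
    proof -
      have "cnj c * (a n / (of_int \<bar>n\<bar> + 1)) = (cnj c * a n) / of_real (real_of_int \<bar>n\<bar> + 1)"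
        by (simp only: of_real_add of_real_of_int_eq of_real_1 times_divide_eq_right)
      then have "Re (cnj c * (a n / (of_int \<bar>n\<bar> + 1))) = Re (cnj c * a n) / (real_of_int \<bar>n\<bar> + 1)"
        by (metis Re_divide_of_real)
      then show ?thesis by (simp add: add_divide_distrib)
    qed
    finally show ?thesis using 1 by simp
  qed
  have "J = a n / (of_int \<bar>n\<bar> + 1)"
    using key[of 1] key[of \<i>] by (simp add: complex_eq_iff)
  then show ?thesis by (simp add: J_def e_def)
qed

section \<open>Toeplitz operators with quasihomogeneous symbols\<close>

definition radial_integrable :: "(real \<Rightarrow> complex) \<Rightarrow> bool" where
  "radial_integrable \<phi> \<longleftrightarrow> integrable dA (\<lambda>z. \<phi> (cmod z))"

lemma borel_measurable_dA:
  fixes f :: "complex \<Rightarrow> 'b::topological_space"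
  shows "f \<in> borel_measurable borel \<Longrightarrow> f \<in> borel_measurable dA"
  by (rule measurable_compose[OF id_measurable_dA])

lemma borel_measurable_dAb:
  fixes f :: "complex \<Rightarrow> 'b::topological_space"
  shows "f \<in> borel_measurable borel \<Longrightarrow> f \<in> borel_measurable dAb"
  by (subst measurable_cong_sets[OF sets_dAb refl])

lemma borel_measurable_dr2:
  fixes f :: "real \<Rightarrow> 'b::topological_space"
  shows "f \<in> borel_measurable borel \<Longrightarrow> f \<in> borel_measurable dr2"
  by (subst measurable_cong_sets[OF sets_dr2 refl])

text \<open>Replaces \<phi> by a Borel function on the radius and rewrites its Mellin transform over
  \<open>dr2\<close>. Since \<open>dr2\<close> is 2r dr, the exponent drops from s - 1 to s - 2 and
  a factor 1/2 appears.\<close>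

lemma radial_integrableE:
  assumes "radial_integrable \<phi>"
  obtains \<psi> where "\<psi> \<in> borel_measurable borel" "AE z in dA. \<phi> (cmod z) = \<psi> (cmod z)"
    "AE r in lborel. 0 < r \<and> r < 1 \<longrightarrow> \<phi> r = \<psi> r" "integrable dr2 \<psi>"
    "\<forall>s. mellin \<phi> s = (\<integral>r. \<psi> r * complex_of_real r powr (s - 2) \<partial>dr2) / 2"
proof -
  have m: "(\<lambda>z. \<phi> (cmod z)) \<in> borel_measurable dA" using assms by (auto simp: radial_integrable_def)
  obtain \<psi> where \<psi>: "\<psi> \<in> borel_measurable borel" "AE r in lborel. 0 < r \<and> r < 1 \<longrightarrow> \<phi> r = \<psi> r"
    and l: "(\<lambda>r. if r \<in> {0..<1} then \<phi> r else 0) \<in> borel_measurable lebesgue"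
    using radial_borel_representative[OF m] by blast
  note [measurable] = \<psi>(1)
  have ae: "AE z in dA. \<phi> (cmod z) = \<psi> (cmod z)" using AE_dA_radialI[OF \<psi>(2)] .
  have "integrable dA (\<lambda>z. \<psi> (cmod z))"
    by (rule integrable_cong_AE_imp[OF assms[unfolded radial_integrable_def]])
      (use ae in \<open>auto intro!: borel_measurable_dA\<close>)
  then have int: "integrable dr2 \<psi>"
    using integral_dA(2)[of "\<lambda>z. \<psi> (cmod z)"] integral_dAb_radial(2)[OF \<psi>(1)] by simp
  have mel: "mellin \<phi> s = (\<integral>r. \<psi> r * complex_of_real r powr (s - 2) \<partial>dr2) / 2" for s
  proof -
    have [measurable]: "(\<lambda>r. complex_of_real r powr t) \<in> borel_measurable borel" for t
      unfolding powr_def by measurable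
    define g where "g = (\<lambda>r. \<psi> r * complex_of_real r powr (s - 1))"
    have [measurable]: "g \<in> borel_measurable borel" unfolding g_def by measurable
    have n01: "AE r in lborel. r \<noteq> (0::real)" "AE r in lborel. r \<noteq> (1::real)" by (rule AE_lborel_singleton)+
    have "(\<lambda>r. (if r = 1 then \<phi> 1 else if r \<in> {0..<1} then \<phi> r else 0) * complex_of_real r powr (s - 1)) \<in> borel_measurable lebesgue"
      by (intro borel_measurable_times measurable_If l) (auto intro: measurable_completion)
    then have "(\<lambda>r. (if r = 1 then \<phi> 1 else if r \<in> {0..<1} then \<phi> r else 0) * complex_of_real r powr (s - 1)) \<in> borel_measurable (lebesgue_on {0..1})"
      by (rule measurable_restrict_space1)
    then have m1: "(\<lambda>r. \<phi> r * complex_of_real r powr (s - 1)) \<in> borel_measurable (lebesgue_on {0..1})"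
      by (rule measurable_cong[THEN iffD1, rotated]) auto
    have m2: "g \<in> borel_measurable (lebesgue_on {0..1})"
      by (intro measurable_restrict_space1 measurable_completion) simp
    have "AE r in lebesgue_on {0..1}. \<phi> r * complex_of_real r powr (s - 1) = g r"
    proof (subst AE_restrict_space_iff)
      show "AE r in lebesgue. r \<in> {0..1} \<longrightarrow> \<phi> r * complex_of_real r powr (s - 1) = g r"
        by (rule AE_completion) (use \<psi>(2) n01 in eventually_elim, auto simp: g_def)
    qed auto
    then have "mellin \<phi> s = integral\<^sup>L (lebesgue_on {0..1}) g"
      unfolding mellin_def by (rule integral_cong_AE[OF m1 m2])
    also have "\<dots> = (\<integral>r. indicator {0..1} r *\<^sub>R g r \<partial>lborel)"
      by (subst integral_restrict_space) (auto intro!: integral_completion)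
    also have "\<dots> = (\<integral>r. (2 * r * indicator {0..1} r) *\<^sub>R (\<psi> r * complex_of_real r powr (s - 2) / 2) \<partial>lborel)"
    proof (rule integral_cong_AE)
      show "AE r in lborel. indicator {0..1} r *\<^sub>R g r = (2 * r * indicator {0..1} r) *\<^sub>R (\<psi> r * complex_of_real r powr (s - 2) / 2)"
        using n01
      proof eventually_elim
        case (elim r)
        show ?case
        proof (cases "r \<in> {0..1}")
          case True
          then have r: "r > 0" using elim by auto
          have "complex_of_real r powr (s - 1) = complex_of_real r powr ((s - 2) + 1)" by simp
          also have "\<dots> = complex_of_real r powr (s - 2) * of_real r"
            using r by (subst powr_add) simp
          finally show ?thesis using True by (simp add: g_def scaleR_conv_of_real)
        qed simp
      qed
    qed measurable
    also have "\<dots> = (\<integral>r. \<psi> r * complex_of_real r powr (s - 2) / 2 \<partial>dr2)"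
      unfolding dr2_def by (subst integral_density) (auto simp: indicator_def)
    finally show ?thesis by simp
  qed
  show ?thesis by (rule that[OF \<psi>(1) ae \<psi>(2) int]) (use mel in blast)
qed

lemma mellin_nat:
  assumes "\<psi> \<in> borel_measurable borel" "mellin \<phi> (of_nat (j + 2)) = (\<integral>r. \<psi> r * complex_of_real r powr (of_nat (j + 2) - 2) \<partial>dr2) / 2"
  shows "(\<integral>r. \<psi> r * of_real (r ^ j) \<partial>dr2) = 2 * mellin \<phi> (of_nat (j + 2))"
proof -
  note [measurable] = assms(1)
  have [measurable]: "(\<lambda>r. complex_of_real r powr t) \<in> borel_measurable borel" for t
    unfolding powr_def by measurable
  have "(\<integral>r. \<psi> r * of_real (r ^ j) \<partial>dr2) = (\<integral>r. \<psi> r * complex_of_real r powr (of_nat (j + 2) - 2) \<partial>dr2)"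
  proof (rule integral_cong_AE)
    show "AE r in dr2. \<psi> r * of_real (r ^ j) = \<psi> r * complex_of_real r powr (of_nat (j + 2) - 2)"
      unfolding AE_dr2 by (intro AE_I2) (simp add: powr_nat')
  qed (auto intro!: borel_measurable_dr2)
  then show ?thesis using assms(2) by (simp add: mult.commute)
qed

section \<open>The projection as a kernel series\<close>

text \<open>Both fractions are sums of (n + 1) x^n over n \<ge> 0. Each contains the term of index
  0, and the summand -1 removes one of them.\<close>

lemma bergman_kernel_has_sum:
  assumes z: "z \<in> disk" and w: "w \<in> disk"
  shows "((\<lambda>n. (of_int \<bar>n\<bar> + 1) * harm_monom n z * cnj (harm_monom n w)) has_sum
    (1 / (1 - z * cnj w)\<^sup>2 + 1 / (1 - cnj z * w)\<^sup>2 - 1)) UNIV"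
proof -
  have geo: "((\<lambda>n. of_nat (Suc n) * x ^ n) has_sum 1 / (1 - x)\<^sup>2) UNIV" if "cmod x < 1" for x
  proof (rule norm_summable_imp_has_sum)
    show "(\<lambda>n. of_nat (Suc n) * x ^ n) sums (1 / (1 - x)\<^sup>2)" using geometric_deriv_sums[OF that] .
    show "summable (\<lambda>n. norm (of_nat (Suc n) * x ^ n))"
      using geometric_deriv_sums[of "cmod x"] that by (simp add: norm_mult norm_power sums_iff del: of_nat_Suc)
  qed
  have zw: "cmod (z * cnj w) < 1" "cmod (cnj z * w) < 1"
    using z w mult_strict_mono[of "cmod z" 1 "cmod w" 1] by (auto simp: norm_mult)
  define F where "F = (\<lambda>n. (of_int \<bar>n\<bar> + 1) * harm_monom n z * cnj (harm_monom n w))"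
  have "((\<lambda>n. F (int n)) has_sum (1 / (1 - z * cnj w)\<^sup>2)) UNIV"
    using geo[OF zw(1)] z w by (simp add: F_def harm_monom_eq power_mult_distrib mult_ac add.commute)
  moreover have "((\<lambda>n. F (- int (Suc n))) has_sum (1 / (1 - cnj z * w)\<^sup>2 - 1)) UNIV"
  proof (rule norm_summable_imp_has_sum)
    let ?x = "cnj z * w"
    have eq: "F (- int (Suc n)) = of_nat (Suc (Suc n)) * ?x ^ Suc n" for n
      using z w by (simp add: F_def harm_monom_eq power_mult_distrib nat_add_distrib mult_ac)
    have "(\<lambda>n. of_nat (Suc n) * ?x ^ n) sums (1 / (1 - ?x)\<^sup>2)" using geometric_deriv_sums[OF zw(2)] .
    then have "(\<lambda>n. of_nat (Suc (Suc n)) * ?x ^ Suc n) sums (1 / (1 - ?x)\<^sup>2 - 1)"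
      by (subst sums_Suc_iff) simp
    then show "(\<lambda>n. F (- int (Suc n))) sums (1 / (1 - ?x)\<^sup>2 - 1)" by (simp only: eq)
    have "summable (\<lambda>n. norm (of_nat (Suc n) * ?x ^ n))"
      using geometric_deriv_sums[of "cmod ?x"] zw(2) by (simp add: norm_mult norm_power sums_iff del: of_nat_Suc)
    then have "summable (\<lambda>n. norm (of_nat (Suc (Suc n)) * ?x ^ Suc n))"
      by (subst summable_Suc_iff[of "\<lambda>n. norm (of_nat (Suc n) * ?x ^ n)"])
    then show "summable (\<lambda>n. norm (F (- int (Suc n))))" by (simp only: eq)
  qed
  ultimately have "(F has_sum (1 / (1 - z * cnj w)\<^sup>2 + (1 / (1 - cnj z * w)\<^sup>2 - 1))) UNIV"
    by (rule has_sum_int_split)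
  then show ?thesis unfolding F_def add_diff_eq .
qed

text \<open>For fixed \<open>z\<close> the partial sums of the kernel are bounded uniformly in
  \<open>w\<close>, so dominated convergence applies to every integrable \<open>F\<close>.\<close>

lemma proj_Q_LIMSEQ:
  assumes F: "integrable dA F" and z: "z \<in> disk"
  shows "(\<lambda>N. \<Sum>n\<in>{- int N..int N}. (of_int \<bar>n\<bar> + 1) * harm_monom n z * (\<integral>w. F w * cnj (harm_monom n w) \<partial>dA)) \<longlonglongrightarrow> proj_Q F z"
proof -
  have Fm: "F \<in> borel_measurable dA" using F by auto
  have hm: "(\<lambda>w. cnj (harm_monom n w)) \<in> borel_measurable dA" for n by (intro borel_measurable_dA) measurable
  define M where "M = (\<Sum>\<^sub>\<infinity>n::int. (real_of_int \<bar>n\<bar> + 1) * cmod z ^ nat \<bar>n\<bar>)"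
  have sm: "(\<lambda>n::int. (real_of_int \<bar>n\<bar> + 1) * cmod z ^ nat \<bar>n\<bar>) summable_on UNIV"
    using z by (intro infsum_int_weight_summable) auto
  define k where "k = (\<lambda>(N::nat) w. \<Sum>n\<in>{- int N..int N}. (of_int \<bar>n\<bar> + 1) * harm_monom n z * cnj (harm_monom n w))"
  define kk where "kk = (\<lambda>w. 1 / (1 - z * cnj w)\<^sup>2 + 1 / (1 - cnj z * w)\<^sup>2 - 1 :: complex)"
  have kb: "cmod (k N w) \<le> M" for N w
  proof -
    have "cmod (k N w) \<le> (\<Sum>n\<in>{- int N..int N}. (real_of_int \<bar>n\<bar> + 1) * cmod z ^ nat \<bar>n\<bar>)"
      unfolding k_def
    proof (rule sum_norm_le)
      fix n
      have "cmod (of_int \<bar>n\<bar> + 1) = real_of_int \<bar>n\<bar> + 1"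
        by (metis abs_ge_zero norm_of_int of_int_1 of_int_add abs_of_nonneg add_nonneg_nonneg of_int_0_le_iff zero_le_one)
      then have "cmod ((of_int \<bar>n\<bar> + 1) * harm_monom n z * cnj (harm_monom n w)) \<le> (real_of_int \<bar>n\<bar> + 1) * cmod z ^ nat \<bar>n\<bar> * 1"
        unfolding norm_mult complex_mod_cnj norm_harm_monom[OF z]
        by (intro mult_mono norm_harm_monom_le) auto
      then show "cmod ((of_int \<bar>n\<bar> + 1) * harm_monom n z * cnj (harm_monom n w)) \<le> (real_of_int \<bar>n\<bar> + 1) * cmod z ^ nat \<bar>n\<bar>" by simp
    qed
    also have "\<dots> \<le> M" unfolding M_def using sm by (intro finite_sum_le_infsum) auto
    finally show ?thesis .
  qed
  have km: "k N \<in> borel_measurable dA" for N unfolding k_def by (intro borel_measurable_dA) measurable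
  have kkm: "kk \<in> borel_measurable dA" unfolding kk_def by (intro borel_measurable_dA) measurable
  have lim: "(\<lambda>N. k N w) \<longlonglongrightarrow> kk w" if "w \<in> disk" for w
    unfolding k_def kk_def by (rule has_sum_int_LIMSEQ[OF bergman_kernel_has_sum[OF z that]])
  have "(\<lambda>N. \<integral>w. k N w * F w \<partial>dA) \<longlonglongrightarrow> (\<integral>w. kk w * F w \<partial>dA)"
  proof (rule integral_dominated_convergence)
    show "integrable dA (\<lambda>w. M * norm (F w))" using F by auto
    show "AE w in dA. (\<lambda>N. k N w * F w) \<longlonglongrightarrow> kk w * F w"
      by (rule AE_I2) (auto intro!: tendsto_intros lim)
    show "AE w in dA. norm (k N w * F w) \<le> M * norm (F w)" for N
      by (rule AE_I2) (auto simp: norm_mult intro!: mult_right_mono kb)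
  qed (use km kkm Fm in measurable)
  moreover have "(\<integral>w. k N w * F w \<partial>dA) = (\<Sum>n\<in>{- int N..int N}. (of_int \<bar>n\<bar> + 1) * harm_monom n z * (\<integral>w. F w * cnj (harm_monom n w) \<partial>dA))" for N
  proof -
    have i: "integrable dA (\<lambda>w. F w * cnj (harm_monom n w))" for n
      by (rule Bochner_Integration.integrable_bound[OF F])
        (use Fm hm in \<open>auto simp: norm_mult intro!: mult_left_le norm_harm_monom_le\<close>)
    have "(\<integral>w. k N w * F w \<partial>dA) = (\<integral>w. (\<Sum>n\<in>{- int N..int N}. ((of_int \<bar>n\<bar> + 1) * harm_monom n z) * (F w * cnj (harm_monom n w))) \<partial>dA)"
      by (intro Bochner_Integration.integral_cong refl) (simp add: k_def sum_distrib_right sum_distrib_left mult_ac)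
    also have "\<dots> = (\<Sum>n\<in>{- int N..int N}. ((of_int \<bar>n\<bar> + 1) * harm_monom n z) * (\<integral>w. F w * cnj (harm_monom n w) \<partial>dA))"
      using i by (subst Bochner_Integration.integral_sum) auto
    finally show ?thesis .
  qed
  moreover have "proj_Q F z = (\<integral>w. kk w * F w \<partial>dA)" using z by (simp add: proj_Q_def on_disk_def kk_def)
  ultimately show ?thesis by simp
qed

text \<open>The operator with symbol \<open>quasihom k \<phi>\<close> sends the monomial of index n
  to this multiple of the monomial of index n + k. The factor |n + k| + 1 is the inverse squared
  norm of the target.\<close>

definition toep_wt :: "int \<Rightarrow> (real \<Rightarrow> complex) \<Rightarrow> int \<Rightarrow> complex" where
  "toep_wt k \<phi> n = 2 * (of_int \<bar>n + k\<bar> + 1) * mellin \<phi> (of_nat (nat \<bar>n\<bar> + nat \<bar>n + k\<bar> + 2))"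

lemma hser_finite:
  assumes "finite {n. c n \<noteq> 0}"
  shows "hser c z = (\<Sum>n | c n \<noteq> 0. c n * harm_monom n z)"
proof -
  have "((\<lambda>n. c n * harm_monom n z) has_sum (\<Sum>n | c n \<noteq> 0. c n * harm_monom n z)) UNIV"
    by (rule has_sum_finite_neutralI[OF assms]) auto
  then show ?thesis using has_sum_unique hser_has_sum[OF l2w_imp_disk_conv[OF l2w_finite[OF assms]]] by blast
qed

lemma quasihom_measurable_integrable:
  assumes "radial_integrable \<phi>"
  shows "integrable dA (\<lambda>w. quasihom k \<phi> w * harm_monom j w)"
proof (rule Bochner_Integration.integrable_bound[OF assms[unfolded radial_integrable_def]])
  have "(\<lambda>w. \<phi> (cmod w)) \<in> borel_measurable dA" using assms by (auto simp: radial_integrable_def)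
  moreover have "(\<lambda>w. cis (of_int k * Arg w)) \<in> borel_measurable dA" "harm_monom j \<in> borel_measurable dA"
    by (intro borel_measurable_dA; measurable)+
  ultimately show "(\<lambda>w. quasihom k \<phi> w * harm_monom j w) \<in> borel_measurable dA"
    unfolding quasihom_def by measurable
  show "AE w in dA. norm (quasihom k \<phi> w * harm_monom j w) \<le> norm (\<phi> (cmod w))"
    by (auto simp: quasihom_def norm_mult intro!: mult_left_le norm_harm_monom_le)
qed

lemma integral_quasihom:
  assumes \<phi>: "radial_integrable \<phi>"
  shows "(\<integral>w. quasihom k \<phi> w * harm_monom j w * cnj (harm_monom n w) \<partial>dA)
    = (if k + j = n then 2 * mellin \<phi> (of_nat (nat \<bar>j\<bar> + nat \<bar>n\<bar> + 2)) else 0)"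
proof -
  obtain \<psi> where \<psi>: "\<psi> \<in> borel_measurable borel" "AE z in dA. \<phi> (cmod z) = \<psi> (cmod z)"
    "AE r in lborel. 0 < r \<and> r < 1 \<longrightarrow> \<phi> r = \<psi> r" "integrable dr2 \<psi>"
    "\<forall>s. mellin \<phi> s = (\<integral>r. \<psi> r * complex_of_real r powr (s - 2) \<partial>dr2) / 2"
    by (rule radial_integrableE[OF \<phi>])
  note [measurable] = \<psi>(1)
  have "(\<integral>w. quasihom k \<phi> w * harm_monom j w * cnj (harm_monom n w) \<partial>dA)
     = (\<integral>w. cis (of_int k * Arg w) * \<psi> (cmod w) * harm_monom j w * cnj (harm_monom n w) \<partial>dA)"
  proof (rule integral_cong_AE)
    show "(\<lambda>w. quasihom k \<phi> w * harm_monom j w * cnj (harm_monom n w)) \<in> borel_measurable dA"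
      by (intro borel_measurable_times[OF borel_measurable_integrable[OF quasihom_measurable_integrable[OF \<phi>]]] borel_measurable_dA)
        measurable
    show "(\<lambda>w. cis (of_int k * Arg w) * \<psi> (cmod w) * harm_monom j w * cnj (harm_monom n w)) \<in> borel_measurable dA"
      by (intro borel_measurable_dA) measurable
    show "AE w in dA. quasihom k \<phi> w * harm_monom j w * cnj (harm_monom n w) = cis (of_int k * Arg w) * \<psi> (cmod w) * harm_monom j w * cnj (harm_monom n w)"
      using \<psi>(2) by eventually_elim (simp add: quasihom_def)
  qed
  also have "\<dots> = (\<integral>w. cis (of_int k * Arg w) * \<psi> (cmod w) * harm_monom j w * cnj (harm_monom n w) \<partial>dAb)"
    by (rule integral_dA(1)) measurable
  also have "\<dots> = (if k + j = n then (\<integral>r. \<psi> r * of_real (r ^ (nat \<bar>j\<bar> + nat \<bar>n\<bar>)) \<partial>dr2) else 0)"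
    by (rule integral_harm_monom_product[OF \<psi>(1)])
  also have "(\<integral>r. \<psi> r * of_real (r ^ (nat \<bar>j\<bar> + nat \<bar>n\<bar>)) \<partial>dr2) = 2 * mellin \<phi> (of_nat (nat \<bar>j\<bar> + nat \<bar>n\<bar> + 2))"
    by (rule mellin_nat[OF \<psi>(1) \<psi>(5)[rule_format]])
  finally show ?thesis .
qed

lemma proj_Q_quasihom:
  assumes \<phi>: "radial_integrable \<phi>" and c: "finite {n. c n \<noteq> 0}"
  shows "proj_Q (\<lambda>w. quasihom k \<phi> w * hser c w) = hser (\<lambda>n. toep_wt k \<phi> (n - k) * c (n - k))"
proof
  fix z
  define J where "J = {n. c n \<noteq> 0}"
  have J: "finite J" using c by (simp add: J_def)
  define b where "b = (\<lambda>n. toep_wt k \<phi> (n - k) * c (n - k))"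
  have bJ: "{n. b n \<noteq> 0} \<subseteq> (\<lambda>j. j + k) ` J"
    by (auto simp: b_def J_def image_iff) (metis diff_add_cancel)
  then have bf: "finite {n. b n \<noteq> 0}" using J finite_surj by blast
  show "proj_Q (\<lambda>w. quasihom k \<phi> w * hser c w) z = hser b z"
  proof (cases "z \<in> disk")
    case True
    define F where "F = (\<lambda>w. quasihom k \<phi> w * hser c w)"
    have F: "F w = (\<Sum>j\<in>J. c j * (quasihom k \<phi> w * harm_monom j w))" for w
      by (simp add: F_def hser_finite[OF c] J_def sum_distrib_left mult_ac)
    have iF: "integrable dA F" unfolding F
      by (intro Bochner_Integration.integrable_sum integrable_mult_right quasihom_measurable_integrable \<phi>)
    have coef: "(\<integral>w. F w * cnj (harm_monom n w) \<partial>dA) = 2 * mellin \<phi> (of_nat (nat \<bar>n - k\<bar> + nat \<bar>n\<bar> + 2)) * c (n - k)" for n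
    proof -
      have i: "integrable dA (\<lambda>w. quasihom k \<phi> w * harm_monom j w * cnj (harm_monom n w))" for j
      proof (rule Bochner_Integration.integrable_bound[OF quasihom_measurable_integrable[OF \<phi>, of k j]])
        show "(\<lambda>w. quasihom k \<phi> w * harm_monom j w * cnj (harm_monom n w)) \<in> borel_measurable dA"
          by (intro borel_measurable_times[OF borel_measurable_integrable[OF quasihom_measurable_integrable[OF \<phi>]]] borel_measurable_dA)
            measurable
      qed (auto simp: norm_mult intro!: mult_left_le norm_harm_monom_le)
      have "(\<integral>w. F w * cnj (harm_monom n w) \<partial>dA) = (\<integral>w. (\<Sum>j\<in>J. c j * (quasihom k \<phi> w * harm_monom j w * cnj (harm_monom n w))) \<partial>dA)"
        by (intro Bochner_Integration.integral_cong refl) (simp add: F sum_distrib_right sum_distrib_left mult_ac)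
      also have "\<dots> = (\<Sum>j\<in>J. c j * (\<integral>w. quasihom k \<phi> w * harm_monom j w * cnj (harm_monom n w) \<partial>dA))"
        using i by (subst Bochner_Integration.integral_sum) auto
      also have "\<dots> = (\<Sum>j\<in>J. if j = n - k then c (n - k) * (2 * mellin \<phi> (of_nat (nat \<bar>n - k\<bar> + nat \<bar>n\<bar> + 2))) else 0)"
        unfolding integral_quasihom[OF \<phi>] by (intro sum.cong refl) auto
      also have "\<dots> = c (n - k) * (2 * mellin \<phi> (of_nat (nat \<bar>n - k\<bar> + nat \<bar>n\<bar> + 2)))"
        using J by (simp add: J_def)
      finally show ?thesis by (simp add: mult_ac)
    qed
    have "(\<lambda>N. \<Sum>n\<in>{- int N..int N}. (of_int \<bar>n\<bar> + 1) * harm_monom n z * (\<integral>w. F w * cnj (harm_monom n w) \<partial>dA)) \<longlonglongrightarrow> proj_Q F z"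
      by (rule proj_Q_LIMSEQ[OF iF True])
    moreover have "(of_int \<bar>n\<bar> + 1) * harm_monom n z * (\<integral>w. F w * cnj (harm_monom n w) \<partial>dA) = b n * harm_monom n z" for n
      by (simp add: coef b_def toep_wt_def mult_ac)
    ultimately have "(\<lambda>N. \<Sum>n\<in>{- int N..int N}. b n * harm_monom n z) \<longlonglongrightarrow> proj_Q F z" by simp
    then have "proj_Q F z = hser b z"
      using hser_LIMSEQ[OF l2w_imp_disk_conv[OF l2w_finite[OF bf]]] LIMSEQ_unique by blast
    then show ?thesis by (simp add: F_def)
  qed (simp add: proj_Q_def on_disk_def hser_outside)
qed

text \<open>A harmonic function that is a polynomial of degree at most \<open>N\<close> in z and in
  cnj z is orthogonal to all monomials of index beyond \<open>N\<close>, so its expansion is finite;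
  the mixed terms never have to be eliminated by algebra.\<close>

lemma harm_polys_eq: "harm_polys = hser ` {c. finite {n. c n \<noteq> 0}}"
proof (intro set_eqI iffI)
  fix h assume h: "h \<in> harm_polys"
  then obtain N a where hp: "h \<in> L2h" "\<And>z. z \<in> disk \<Longrightarrow> h z = (\<Sum>i\<le>N. \<Sum>j\<le>N. a i j * z ^ i * cnj z ^ j)"
    unfolding harm_polys_def by auto
  obtain c where c: "l2w c" "h = hser c" using L2h_hser[OF hp(1)] by metis
  have "c n = 0" if n: "\<bar>n\<bar> > int N" for n
  proof -
    \<comment> \<open>\<open>harm_monom 0\<close> is 1 on the disk. Inserting it brings each term
      into the shape of \<open>integral_harm_monom_product\<close>, with a frequency i - j of
      modulus at most \<open>N\<close>.\<close>
    have mono: "z ^ i * cnj z ^ j = cis (of_int (int i - int j) * Arg z) * of_real (cmod z ^ (i + j)) * harm_monom 0 z"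
      if z: "z \<in> disk" "z \<noteq> 0" for z i j
      using harm_monom_product[OF z, of 0 "int i" "int j"] z
      by (simp add: harm_monom_eq mult.commute flip: of_real_power)
    have int: "integrable dAb (\<lambda>w. cis (of_int (int i - int j) * Arg w) * of_real (cmod w ^ (i + j)) * harm_monom 0 w * cnj (harm_monom n w))" for i j
    proof -
      have "integrable dAb (\<lambda>w. indicator disk w * (cis (of_int (int i - int j) * Arg w) * of_real (cmod w ^ (i + j)) * harm_monom 0 w * cnj (harm_monom n w)))"
      proof (rule integrable_dAb_bounded[of _ 1])
        show "cmod (indicator disk w * (cis (of_int (int i - int j) * Arg w) * of_real (cmod w ^ (i + j)) * harm_monom 0 w * cnj (harm_monom n w))) \<le> 1" for w
        proof (cases "w \<in> disk")
          case True
          have "cmod w ^ (i + j) \<le> 1" using True by (intro power_le_one) auto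
          then have "cmod w ^ (i + j) * cmod (harm_monom 0 w) * cmod (harm_monom n w) \<le> 1 * 1 * 1"
            by (intro mult_mono norm_harm_monom_le) auto
          then show ?thesis using True by (simp add: norm_mult norm_power)
        qed simp
      qed measurable
      moreover have "(\<lambda>w. cis (of_int (int i - int j) * Arg w) * of_real (cmod w ^ (i + j)) * harm_monom 0 w * cnj (harm_monom n w)) \<in> borel_measurable dAb"
        by (rule borel_measurable_dAb) measurable
      ultimately show ?thesis
        by (rule integrable_cong_AE_imp) (rule eventually_mono[OF AE_dAb_disk], simp)
    qed
    have "inner_L2 h (harm_monom n) = (\<integral>w. h w * cnj (harm_monom n w) \<partial>dAb)"
      unfolding inner_L2_def c(2) by (rule integral_dA(1)) (use hser_measurable[OF l2w_imp_disk_conv[OF c(1)]] in measurable)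
    also have "\<dots> = (\<integral>w. (\<Sum>i\<le>N. \<Sum>j\<le>N. a i j * (cis (of_int (int i - int j) * Arg w) * of_real (cmod w ^ (i + j)) * harm_monom 0 w * cnj (harm_monom n w))) \<partial>dAb)"
    proof (rule integral_cong_AE)
      show "(\<lambda>w. h w * cnj (harm_monom n w)) \<in> borel_measurable dAb"
        unfolding c(2) by (rule borel_measurable_dAb) (use hser_measurable[OF l2w_imp_disk_conv[OF c(1)]] in measurable)
      show "AE w in dAb. h w * cnj (harm_monom n w) = (\<Sum>i\<le>N. \<Sum>j\<le>N. a i j * (cis (of_int (int i - int j) * Arg w) * of_real (cmod w ^ (i + j)) * harm_monom 0 w * cnj (harm_monom n w)))"
        using AE_dAb_disk AE_dAb_nonzero
      proof eventually_elim
        case (elim w)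
        show ?case unfolding hp(2)[OF elim(1)] sum_distrib_right mult.assoc[of "a _ _"] mono[OF elim] ..
      qed
    qed (intro borel_measurable_dAb, measurable)
    also have "\<dots> = (\<Sum>i\<le>N. \<Sum>j\<le>N. a i j * (\<integral>w. cis (of_int (int i - int j) * Arg w) * of_real (cmod w ^ (i + j)) * harm_monom 0 w * cnj (harm_monom n w) \<partial>dAb))"
      using int by (subst Bochner_Integration.integral_sum, simp, intro sum.cong refl, subst Bochner_Integration.integral_sum) auto
    also have "\<dots> = 0"
    proof (intro sum.neutral ballI)
      fix i j assume ij: "i \<in> {..N}" "j \<in> {..N}"
      have "int i - int j + 0 \<noteq> n" using ij n by auto
      then show "a i j * (\<integral>w. cis (of_int (int i - int j) * Arg w) * of_real (cmod w ^ (i + j)) * harm_monom 0 w * cnj (harm_monom n w) \<partial>dAb) = 0"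
        using integral_harm_monom_product[of "\<lambda>r. of_real (r ^ (i + j))" "int i - int j" 0 n] by simp
    qed
    finally have "c n / (of_int \<bar>n\<bar> + 1) = 0" using inner_hser_harm_monom[OF c(1), of n] c(2) by simp
    moreover have "complex_of_int \<bar>n\<bar> + 1 \<noteq> 0"
      by (metis abs_ge_zero add_nonneg_pos less_irrefl of_int_1 of_int_add of_int_eq_0_iff zero_less_one)
    ultimately show ?thesis by simp
  qed
  then have "{n. c n \<noteq> 0} \<subseteq> {- int N..int N}" by (force simp: not_less)
  then have "finite {n. c n \<noteq> 0}" using finite_subset by blast
  then show "h \<in> hser ` {c. finite {n. c n \<noteq> 0}}" using c(2) by auto
next
  fix h assume "h \<in> hser ` {c. finite {n. c n \<noteq> 0}}"
  then obtain c where c: "finite {n. c n \<noteq> 0}" "h = hser c" by auto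
  define N where "N = nat (Max (insert 0 (abs ` {n. c n \<noteq> 0})))"
  have b: "\<bar>n\<bar> \<le> int N" if "c n \<noteq> 0" for n
    unfolding N_def using c(1) that by (auto intro!: le_nat_iff[THEN iffD1] Max_ge_iff[THEN iffD2])
  \<comment> \<open>Pure powers of z occupy the entries with j = 0, pure powers of cnj z those with
    i = 0.\<close>
  define a where "a = (\<lambda>i j. if i = 0 \<or> j = 0 then c (int i - int j) else 0)"
  have "h z = (\<Sum>i\<le>N. \<Sum>j\<le>N. a i j * z ^ i * cnj z ^ j)" if z: "z \<in> disk" for z
  proof -
    have "h z = (\<Sum>n | c n \<noteq> 0. c n * harm_monom n z)" using hser_finite[OF c(1)] c(2) by simp
    also have "\<dots> = (\<Sum>(i,j)\<in>{..N} \<times> {..N}. a i j * z ^ i * cnj z ^ j)"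
    proof (rule sum.reindex_bij_witness_not_neutral[where S'="{}" and T'="{(i,j). a i j = 0} \<inter> {..N} \<times> {..N}"
          and i="\<lambda>(i,j). int i - int j" and j="\<lambda>n. (nat n, nat (- n))"])
      show "finite ({(i,j). a i j = 0} \<inter> {..N} \<times> {..N})" by simp
    qed (use z b in \<open>force simp: a_def harm_monom_eq split: if_splits\<close>)+
    also have "\<dots> = (\<Sum>i\<le>N. \<Sum>j\<le>N. a i j * z ^ i * cnj z ^ j)" by (simp add: sum.cartesian_product)
    finally show ?thesis .
  qed
  then show "h \<in> harm_polys" unfolding harm_polys_def using hser_L2h[OF l2w_finite[OF c(1)]] c(2) by auto
qed

section \<open>Bounded operators from bounded weights\<close>

text \<open>Decay of order 1/s of the moments. By \<open>toep_wt_bound\<close> it makes the shift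
  with symbol \<open>quasihom k \<phi>\<close> bounded for every \<open>k\<close>.\<close>

definition mellin_bounded :: "(real \<Rightarrow> complex) \<Rightarrow> bool" where
  "mellin_bounded \<phi> \<longleftrightarrow> (\<exists>B. \<forall>s::nat. s \<ge> 2 \<longrightarrow> real s * cmod (mellin \<phi> (of_nat s)) \<le> B)"

lemma norm_of_int_abs_plus1: "cmod (of_int \<bar>n\<bar> + 1) = real_of_int \<bar>n\<bar> + 1"
  by (metis abs_ge_zero norm_of_int of_int_1 of_int_add abs_of_nonneg add_nonneg_nonneg of_int_0_le_iff zero_le_one)

text \<open>With x = |n + k| + 1 and y = |n| + 1 the Mellin transform is taken at x + y, so the
  estimate comes down to 4xy \<le> (x + y)^2.\<close>

lemma toep_wt_bound:
  assumes "mellin_bounded \<phi>"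
  obtains B where "B \<ge> 0" "\<And>n. (cmod (toep_wt k \<phi> n))\<^sup>2 / (real_of_int \<bar>n + k\<bar> + 1) \<le> B\<^sup>2 / (real_of_int \<bar>n\<bar> + 1)"
proof -
  obtain B0 where B0: "\<And>s::nat. s \<ge> 2 \<Longrightarrow> real s * cmod (mellin \<phi> (of_nat s)) \<le> B0"
    using assms by (auto simp: mellin_bounded_def)
  have B0p: "B0 \<ge> 0" using B0[of 2] norm_ge_zero[of "mellin \<phi> (of_nat 2)"] by linarith
  show ?thesis
  proof (rule that[OF B0p])
    fix n
    define x y where "x = real_of_int \<bar>n + k\<bar> + 1" and "y = real_of_int \<bar>n\<bar> + 1"
    define m where "m = cmod (mellin \<phi> (of_nat (nat \<bar>n\<bar> + nat \<bar>n + k\<bar> + 2)))"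
    have xy: "x > 0" "y > 0" by (auto simp: x_def y_def)
    have "cmod (toep_wt k \<phi> n) = 2 * x * m"
      by (simp only: toep_wt_def norm_mult norm_of_int_abs_plus1 m_def x_def) simp
    moreover have "(x + y) * m \<le> B0"
      using B0[of "nat \<bar>n\<bar> + nat \<bar>n + k\<bar> + 2"] by (simp add: m_def x_def y_def add_ac)
    then have "((x + y) * m)\<^sup>2 \<le> B0\<^sup>2" using xy by (intro power_mono) (auto simp: m_def)
    moreover have "4 * x * y * m\<^sup>2 \<le> ((x + y) * m)\<^sup>2"
    proof -
      have "4 * x * y \<le> (x + y)\<^sup>2" using zero_le_power2[of "x - y"] by (simp add: power2_eq_square algebra_simps)
      then show ?thesis by (simp add: power_mult_distrib mult_right_mono)
    qed
    ultimately have "(cmod (toep_wt k \<phi> n))\<^sup>2 * y \<le> B0\<^sup>2 * x"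
      using xy mult_left_mono[of "4 * x * y * m\<^sup>2" "B0\<^sup>2" x] by (simp add: power2_eq_square mult_ac)
    then show "(cmod (toep_wt k \<phi> n))\<^sup>2 / (real_of_int \<bar>n + k\<bar> + 1) \<le> B0\<^sup>2 / (real_of_int \<bar>n\<bar> + 1)"
      using xy by (simp add: divide_le_eq le_divide_eq x_def[symmetric] y_def[symmetric] del: of_int_abs)
  qed
qed

definition wshift :: "int \<Rightarrow> (int \<Rightarrow> complex) \<Rightarrow> (int \<Rightarrow> complex) \<Rightarrow> int \<Rightarrow> complex" where
  "wshift k w a = (\<lambda>n. w (n - k) * a (n - k))"

text \<open>The hypothesis says that the weights with respect to the normalized monomials are
  bounded by |B|.\<close>

lemma wshift_l2w:
  assumes B: "\<And>n. (cmod (w n))\<^sup>2 / (real_of_int \<bar>n + k\<bar> + 1) \<le> B\<^sup>2 / (real_of_int \<bar>n\<bar> + 1)" and a: "l2w a"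
  shows "l2w (wshift k w a)" "norm_L2 (hser (wshift k w a)) \<le> \<bar>B\<bar> * norm_L2 (hser a)"
proof -
  let ?g = "\<lambda>n. (cmod (w n * a n))\<^sup>2 / (real_of_int \<bar>n + k\<bar> + 1)"
  have le: "?g n \<le> B\<^sup>2 * ((cmod (a n))\<^sup>2 / (real_of_int \<bar>n\<bar> + 1))" for n
    using mult_right_mono[OF B[of n] zero_le_power2[of "cmod (a n)"]] by (simp add: norm_mult power_mult_distrib)
  have sa: "(\<lambda>n. B\<^sup>2 * ((cmod (a n))\<^sup>2 / (real_of_int \<bar>n\<bar> + 1))) summable_on UNIV"
    using a by (intro summable_on_cmult_right) (simp add: l2w_def)
  have sg: "?g summable_on UNIV" by (rule summable_on_comparison_test[OF sa]) (use le in auto)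
  have bij: "bij_betw (\<lambda>n. n - k) UNIV (UNIV :: int set)"
    by (rule bij_betwI[of _ _ _ "\<lambda>n. n + k"]) auto
  have eq: "(cmod (wshift k w a n))\<^sup>2 / (real_of_int \<bar>n\<bar> + 1) = ?g (n - k)" for n by (simp add: wshift_def)
  show l: "l2w (wshift k w a)" unfolding l2w_def eq
    using summable_on_reindex_bij_betw[OF bij, of ?g] sg by simp
  have "(norm_L2 (hser (wshift k w a)))\<^sup>2 = infsum ?g UNIV"
    unfolding norm_hser[OF l] eq by (rule infsum_reindex_bij_betw[OF bij])
  also have "\<dots> \<le> (\<Sum>\<^sub>\<infinity>n. B\<^sup>2 * ((cmod (a n))\<^sup>2 / (real_of_int \<bar>n\<bar> + 1)))"
    by (rule infsum_mono[OF sg sa le])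
  also have "\<dots> = B\<^sup>2 * (norm_L2 (hser a))\<^sup>2"
    unfolding norm_hser[OF a] using a by (intro infsum_cmult_right) (simp add: l2w_def)
  finally have "(norm_L2 (hser (wshift k w a)))\<^sup>2 \<le> (\<bar>B\<bar> * norm_L2 (hser a))\<^sup>2" by (simp add: power_mult_distrib)
  then show "norm_L2 (hser (wshift k w a)) \<le> \<bar>B\<bar> * norm_L2 (hser a)"
    by (rule power2_le_imp_le) (simp add: norm_L2_nonneg)
qed

lemma wshift_add: "wshift k w (\<lambda>n. a n + b n) = (\<lambda>n. wshift k w a n + wshift k w b n)"
  by (simp add: wshift_def algebra_simps)

lemma wshift_scale: "wshift k w (\<lambda>n. c * a n) = (\<lambda>n. c * wshift k w a n)"
  by (simp add: wshift_def algebra_simps)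

definition hcoef :: "(complex \<Rightarrow> complex) \<Rightarrow> int \<Rightarrow> complex" where
  "hcoef f = (SOME a. l2w a \<and> f = hser a)"

lemma hcoef_hser: "l2w a \<Longrightarrow> hcoef (hser a) = a"
  unfolding hcoef_def by (rule some_equality) (simp, metis hser_inject)

lemma hcoef: "f \<in> L2h \<Longrightarrow> l2w (hcoef f) \<and> hser (hcoef f) = f"
  by (metis L2h_hser hcoef_hser)

lemma hser_add_l2w: "l2w a \<Longrightarrow> l2w b \<Longrightarrow> hser a + hser b = hser (\<lambda>n. a n + b n)"
  by (rule hser_add[symmetric]; rule l2w_imp_disk_conv)

lemma hser_scale_l2w: "l2w a \<Longrightarrow> scale_fun c (hser a) = hser (\<lambda>n. c * a n)"
  by (rule hser_scale[symmetric]) (rule l2w_imp_disk_conv)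

lemma L2h_add:
  assumes "f \<in> L2h" "g \<in> L2h" shows "f + g \<in> L2h"
proof -
  obtain a b where ab: "l2w a" "f = hser a" "l2w b" "g = hser b" using assms L2h_hser by metis
  show ?thesis unfolding ab(2,4) hser_add_l2w[OF ab(1,3)] by (rule hser_L2h[OF l2w_add[OF ab(1,3)]])
qed

lemma L2h_scale:
  assumes "f \<in> L2h" shows "scale_fun c f \<in> L2h"
proof -
  obtain a where a: "l2w a" "f = hser a" using assms L2h_hser by metis
  show ?thesis unfolding a(2) hser_scale_l2w[OF a(1)] by (rule hser_L2h[OF l2w_scale[OF a(1)]])
qed

lemma norm_tail_tendsto_0:
  assumes a: "l2w a"
  shows "(\<lambda>N::nat. norm_L2 (hser (\<lambda>n. if \<bar>n\<bar> \<le> int N then 0 else a n))) \<longlonglongrightarrow> 0"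
proof -
  let ?f = "\<lambda>n. (cmod (a n))\<^sup>2 / (real_of_int \<bar>n\<bar> + 1)"
  have s: "?f summable_on UNIV" using a by (simp add: l2w_def)
  have la: "l2w (\<lambda>n. if \<bar>n\<bar> \<le> int N then 0 else a n)" for N
    unfolding l2w_def by (rule summable_on_comparison_test[OF s]) auto
  have "(norm_L2 (hser (\<lambda>n. if \<bar>n\<bar> \<le> int N then 0 else a n)))\<^sup>2 = infsum ?f UNIV - (\<Sum>n\<in>{- int N..int N}. ?f n)" for N
  proof -
    have "(norm_L2 (hser (\<lambda>n. if \<bar>n\<bar> \<le> int N then 0 else a n)))\<^sup>2 = infsum ?f (UNIV - {- int N..int N})"
      unfolding norm_hser[OF la] by (rule infsum_cong_neutral) (auto simp: abs_le_iff)
    also have "\<dots> = infsum ?f UNIV - infsum ?f {- int N..int N}"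
      using s by (intro infsum_Diff) auto
    finally show ?thesis by simp
  qed
  moreover have "(\<lambda>N. infsum ?f UNIV - (\<Sum>n\<in>{- int N..int N}. ?f n)) \<longlonglongrightarrow> infsum ?f UNIV - infsum ?f UNIV"
    by (intro tendsto_intros has_sum_int_LIMSEQ has_sum_infsum s)
  ultimately have "(\<lambda>N. (norm_L2 (hser (\<lambda>n. if \<bar>n\<bar> \<le> int N then 0 else a n)))\<^sup>2) \<longlonglongrightarrow> 0" by simp
  then have "(\<lambda>N. sqrt ((norm_L2 (hser (\<lambda>n. if \<bar>n\<bar> \<le> int N then 0 else a n)))\<^sup>2)) \<longlonglongrightarrow> sqrt 0" by (intro tendsto_intros)
  then show ?thesis by (simp add: norm_L2_nonneg)
qed

lemma norm_L2_scale_neg: "norm_L2 (scale_fun (-1) f) = norm_L2 f"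
  by (simp add: norm_L2_def scale_fun_def)

text \<open>Proved on coefficients through (x + y)^2 \<le> 2(x^2 + y^2), which costs the factor sqrt
  2; it is harmless in the limit argument it serves.\<close>

lemma norm_L2_triangle:
  assumes "f \<in> L2h" "g \<in> L2h"
  shows "norm_L2 (f + g) \<le> sqrt 2 * (norm_L2 f + norm_L2 g)"
proof -
  obtain a b where ab: "l2w a" "f = hser a" "l2w b" "g = hser b" using assms L2h_hser by metis
  have fg: "f + g = hser (\<lambda>n. a n + b n)" unfolding ab(2,4) by (rule hser_add_l2w[OF ab(1,3)])
  have "(norm_L2 (f + g))\<^sup>2 \<le> (\<Sum>\<^sub>\<infinity>n. 2 * ((cmod (a n))\<^sup>2 / (real_of_int \<bar>n\<bar> + 1) + (cmod (b n))\<^sup>2 / (real_of_int \<bar>n\<bar> + 1)))"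
    unfolding fg norm_hser[OF l2w_add[OF ab(1,3)]]
  proof (rule infsum_mono)
    show "(\<lambda>n. (cmod (a n + b n))\<^sup>2 / (real_of_int \<bar>n\<bar> + 1)) summable_on UNIV" using l2w_add[OF ab(1,3)] by (simp add: l2w_def)
    show "(\<lambda>n. 2 * ((cmod (a n))\<^sup>2 / (real_of_int \<bar>n\<bar> + 1) + (cmod (b n))\<^sup>2 / (real_of_int \<bar>n\<bar> + 1))) summable_on UNIV"
      using ab by (intro summable_on_cmult_right summable_on_add) (auto simp: l2w_def)
    fix n
    have "(cmod (a n + b n))\<^sup>2 \<le> (cmod (a n) + cmod (b n))\<^sup>2" by (intro power_mono norm_triangle_ineq) auto
    also have "\<dots> \<le> 2 * ((cmod (a n))\<^sup>2 + (cmod (b n))\<^sup>2)"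
      using zero_le_power2[of "cmod (a n) - cmod (b n)"] by (simp add: power2_eq_square algebra_simps)
    finally have "(cmod (a n + b n))\<^sup>2 / (real_of_int \<bar>n\<bar> + 1) \<le> 2 * ((cmod (a n))\<^sup>2 + (cmod (b n))\<^sup>2) / (real_of_int \<bar>n\<bar> + 1)"
      by (intro divide_right_mono) auto
    then show "(cmod (a n + b n))\<^sup>2 / (real_of_int \<bar>n\<bar> + 1) \<le> 2 * ((cmod (a n))\<^sup>2 / (real_of_int \<bar>n\<bar> + 1) + (cmod (b n))\<^sup>2 / (real_of_int \<bar>n\<bar> + 1))"
      by (simp add: add_divide_distrib)
  qed
  also have "\<dots> = 2 * ((norm_L2 f)\<^sup>2 + (norm_L2 g)\<^sup>2)"
    unfolding ab(2,4) norm_hser[OF ab(1)] norm_hser[OF ab(3)] using ab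
    by (subst infsum_cmult_right) (auto simp: l2w_def infsum_add intro!: summable_on_add)
  also have "\<dots> \<le> 2 * (norm_L2 f + norm_L2 g)\<^sup>2"
    using mult_nonneg_nonneg[OF norm_L2_nonneg[of f] norm_L2_nonneg[of g]] by (simp add: power2_eq_square algebra_simps)
  also have "\<dots> = (sqrt 2 * (norm_L2 f + norm_L2 g))\<^sup>2" by (simp add: power_mult_distrib)
  finally show ?thesis by (rule power2_le_imp_le) (simp add: norm_L2_nonneg)
qed

lemma norm_L2_eq_0:
  assumes "f \<in> L2h" "norm_L2 f = 0" shows "f = (\<lambda>_. 0)"
proof -
  obtain a where a: "l2w a" "f = hser a" using assms L2h_hser by metis
  have "a n = 0" for n using hser_coeff_le[OF a(1), of n] assms a by simp
  then show ?thesis by (auto simp: a(2) hser_def on_disk_def)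
qed

text \<open>Truncated expansions are harmonic polynomials and converge in norm, so they determine a
  bounded operator. This gives the uniqueness behind the definite description in
  \<open>toeplitz\<close>.\<close>

lemma bounded_op_unique:
  assumes T: "bounded_op T" "bounded_op S" and eq: "\<And>h. h \<in> harm_polys \<Longrightarrow> T h = S h"
  shows "T = S"
proof
  fix f
  show "T f = S f"
  proof (cases "f \<in> L2h")
    case False
    then show ?thesis using T unfolding bounded_op_def by (metis PiE_arb)
  next
    case True
    obtain a where a: "l2w a" "f = hser a" using L2h_hser[OF True] by metis
    define p r where "p = (\<lambda>N::nat. hser (\<lambda>n. if \<bar>n\<bar> \<le> int N then a n else 0))"
      and "r = (\<lambda>N::nat. hser (\<lambda>n. if \<bar>n\<bar> \<le> int N then 0 else a n))"
    have fin: "finite {n. (if \<bar>n\<bar> \<le> int N then a n else 0) \<noteq> 0}" for N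
      by (rule finite_subset[of _ "{- int N..int N}"]) (auto simp: abs_le_iff split: if_splits)
    have lr: "l2w (\<lambda>n. if \<bar>n\<bar> \<le> int N then 0 else a n)" for N
      using a(1) unfolding l2w_def by (rule summable_on_comparison_test) auto
    have p: "p N \<in> harm_polys" "p N \<in> L2h" for N
      unfolding p_def using fin by (auto simp: harm_polys_eq intro!: hser_L2h l2w_finite)
    have r: "r N \<in> L2h" for N unfolding r_def by (rule hser_L2h[OF lr])
    have f: "f = p N + r N" for N
    proof -
      have "p N + r N = hser (\<lambda>n. (if \<bar>n\<bar> \<le> int N then a n else 0) + (if \<bar>n\<bar> \<le> int N then 0 else a n))"
        unfolding p_def r_def by (rule hser_add[symmetric]; intro l2w_imp_disk_conv lr l2w_finite fin)
      also have "(\<lambda>n. (if \<bar>n\<bar> \<le> int N then a n else 0) + (if \<bar>n\<bar> \<le> int N then 0 else a n)) = a" by auto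
      finally show ?thesis using a(2) by metis
    qed
    obtain B1 B2 where B: "\<And>f. f \<in> L2h \<Longrightarrow> norm_L2 (T f) \<le> B1 * norm_L2 f" "\<And>f. f \<in> L2h \<Longrightarrow> norm_L2 (S f) \<le> B2 * norm_L2 f"
      using T unfolding bounded_op_def by metis
    have in_L2h: "T g \<in> L2h" "S g \<in> L2h" if "g \<in> L2h" for g using T that unfolding bounded_op_def by auto
    define D where "D = T f + scale_fun (-1) (S f)"
    have DL: "D \<in> L2h" unfolding D_def by (intro L2h_add L2h_scale in_L2h True)
    have "norm_L2 D \<le> sqrt 2 * (B1 * norm_L2 (r N) + B2 * norm_L2 (r N))" for N
    proof -
      have "T f = T (p N) + T (r N)" "S f = S (p N) + S (r N)"
        using T p(2) r f[of N] unfolding bounded_op_def by metis+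
      then have "D = T (r N) + scale_fun (-1) (S (r N))"
        using eq[OF p(1)] by (auto simp: D_def scale_fun_def)
      then have "norm_L2 D \<le> sqrt 2 * (norm_L2 (T (r N)) + norm_L2 (S (r N)))"
        using norm_L2_triangle[OF in_L2h(1)[OF r] L2h_scale[OF in_L2h(2)[OF r]]] by (metis norm_L2_scale_neg)
      also have "\<dots> \<le> sqrt 2 * (B1 * norm_L2 (r N) + B2 * norm_L2 (r N))"
        by (intro mult_left_mono add_mono B r) auto
      finally show ?thesis .
    qed
    moreover have "(\<lambda>N. sqrt 2 * (B1 * norm_L2 (r N) + B2 * norm_L2 (r N))) \<longlonglongrightarrow> sqrt 2 * (B1 * 0 + B2 * 0)"
      unfolding r_def by (intro tendsto_intros norm_tail_tendsto_0 a)
    ultimately have "norm_L2 D \<le> sqrt 2 * (B1 * 0 + B2 * 0)" by (intro LIMSEQ_le_const) blast+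
    then have "norm_L2 D = 0" using norm_L2_nonneg[of D] by simp
    then have "D = (\<lambda>_. 0)" by (rule norm_L2_eq_0[OF DL])
    then show "T f = S f" by (auto simp: D_def scale_fun_def fun_eq_iff)
  qed
qed

text \<open>The weighted shift is bounded and agrees with the projection formula on harmonic
  polynomials; uniqueness identifies it with the Toeplitz operator.\<close>

lemma toeplitz_quasihom:
  assumes \<phi>: "radial_integrable \<phi>" "mellin_bounded \<phi>"
  shows "f \<in> L2h \<Longrightarrow> toeplitz (quasihom k \<phi>) f = hser (wshift k (toep_wt k \<phi>) (hcoef f))"
    "\<exists>B. \<forall>n. (cmod (toep_wt k \<phi> n))\<^sup>2 / (real_of_int \<bar>n + k\<bar> + 1) \<le> B\<^sup>2 / (real_of_int \<bar>n\<bar> + 1)"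
proof -
  obtain B where B: "B \<ge> 0" "\<And>n. (cmod (toep_wt k \<phi> n))\<^sup>2 / (real_of_int \<bar>n + k\<bar> + 1) \<le> B\<^sup>2 / (real_of_int \<bar>n\<bar> + 1)"
    using toep_wt_bound[OF \<phi>(2)] by metis
  then show "\<exists>B. \<forall>n. (cmod (toep_wt k \<phi> n))\<^sup>2 / (real_of_int \<bar>n + k\<bar> + 1) \<le> B\<^sup>2 / (real_of_int \<bar>n\<bar> + 1)" by blast
  define S where "S = (\<lambda>f\<in>L2h. hser (wshift k (toep_wt k \<phi>) (hcoef f)))"
  note ws = wshift_l2w[of "toep_wt k \<phi>" k B, OF B(2)]
  have S: "S (hser a) = hser (wshift k (toep_wt k \<phi>) a)" if "l2w a" for a
    using that by (simp add: S_def hser_L2h hcoef_hser)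
  have bS: "bounded_op S" unfolding bounded_op_def
  proof (intro conjI ballI allI exI)
    show "S \<in> L2h \<rightarrow>\<^sub>E L2h" using hcoef ws(1) by (auto simp: S_def intro!: hser_L2h)
    fix f g assume f: "f \<in> L2h"
    obtain a where a: "l2w a" "f = hser a" using L2h_hser[OF f] by metis
    show "norm_L2 (S f) \<le> \<bar>B\<bar> * norm_L2 f" unfolding a(2) S[OF a(1)] by (rule ws(2)[OF a(1)])
    show "S (scale_fun c f) = scale_fun c (S f)" for c
      unfolding a(2) hser_scale_l2w[OF a(1)] S[OF a(1)] S[OF l2w_scale[OF a(1)]] wshift_scale
      by (rule hser_scale_l2w[OF ws(1)[OF a(1)], symmetric])
    assume g: "g \<in> L2h"
    obtain b where b: "l2w b" "g = hser b" using L2h_hser[OF g] by metis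
    show "S (f + g) = S f + S g"
      unfolding a(2) b(2) hser_add_l2w[OF a(1) b(1)] S[OF a(1)] S[OF b(1)] S[OF l2w_add[OF a(1) b(1)]] wshift_add
      by (rule hser_add_l2w[OF ws(1)[OF a(1)] ws(1)[OF b(1)], symmetric])
  qed
  have agree: "S h = proj_Q (\<lambda>z. quasihom k \<phi> z * h z)" if hp: "h \<in> harm_polys" for h
  proof -
    obtain c where c: "finite {n. c n \<noteq> 0}" "h = hser c" using hp unfolding harm_polys_eq by auto
    show ?thesis unfolding c(2) S[OF l2w_finite[OF c(1)]] proj_Q_quasihom[OF \<phi>(1) c(1)] by (simp add: wshift_def)
  qed
  have "toeplitz (quasihom k \<phi>) = S" unfolding toeplitz_def
  proof (rule the_equality)
    show "bounded_op S \<and> (\<forall>h\<in>harm_polys. S h = proj_Q (\<lambda>z. quasihom k \<phi> z * h z))" using bS agree by blast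
    show "T = S" if "bounded_op T \<and> (\<forall>h\<in>harm_polys. T h = proj_Q (\<lambda>z. quasihom k \<phi> z * h z))" for T
      using that bS agree by (intro bounded_op_unique) auto
  qed
  then show "toeplitz (quasihom k \<phi>) f = hser (wshift k (toep_wt k \<phi>) (hcoef f))" if "f \<in> L2h"
    using that by (simp add: S_def)
qed

lemma norm_harm_monom_pos: "norm_L2 (harm_monom n) > 0"
proof -
  have l: "l2w (\<lambda>k. if k = n then 1 else 0)" by (rule l2w_finite) simp
  have "(cmod 1)\<^sup>2 \<le> (norm_L2 (harm_monom n))\<^sup>2 * (real_of_int \<bar>n\<bar> + 1)"
    using hser_coeff_le[OF l, of n] by (simp flip: harm_monom_hser)
  then have "norm_L2 (harm_monom n) \<noteq> 0" by auto
  then show ?thesis using norm_L2_nonneg[of "harm_monom n"] by linarith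
qed

lemma norm_L2_scale: "norm_L2 (scale_fun c f) = cmod c * norm_L2 f"
  by (simp add: norm_L2_def scale_fun_def norm_mult power_mult_distrib real_sqrt_mult)

section \<open>Moments of a radial T-function\<close>

text \<open>On monomials the radial operator is diagonal, with weight 2(|n| + 1) times the moment at
  2|n| + 2, so its bound controls even arguments only. As \<phi> is integrable and r^l (1 - r) \<le>
  1/(l + 1), consecutive moments differ by a term of order 1/l, which carries the bound over to odd
  arguments.\<close>

lemma T_function_mellin_bounded:
  assumes T: "T_function (\<lambda>z. \<phi> (cmod z))"
  shows "radial_integrable \<phi>" "mellin_bounded \<phi>"
proof -
  show ri: "radial_integrable \<phi>" using T by (simp add: T_function_def radial_integrable_def)
  obtain B where B: "\<And>h. h \<in> harm_polys \<Longrightarrow> norm_L2 (proj_Q (\<lambda>z. \<phi> (cmod z) * h z)) \<le> B * norm_L2 h"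
    using T by (auto simp: T_function_def)
  have even: "real (2 * j) * cmod (mellin \<phi> (of_nat (2 * j))) \<le> B" if j: "j \<ge> 1" for j
  proof -
    define n where "n = int j - 1"
    have n: "\<bar>n\<bar> + 1 = int j" using j by (simp add: n_def)
    have fin: "finite {k. (if k = n then 1 else 0 :: complex) \<noteq> 0}" by simp
    have hp: "harm_monom n \<in> harm_polys" unfolding harm_polys_eq harm_monom_hser using fin by blast
    have "proj_Q (\<lambda>z. \<phi> (cmod z) * harm_monom n z) = hser (\<lambda>k. toep_wt 0 \<phi> (k - 0) * (if k - 0 = n then 1 else 0))"
      using proj_Q_quasihom[OF ri fin, of 0] by (simp add: quasihom_def flip: harm_monom_hser)
    also have "(\<lambda>k. toep_wt 0 \<phi> (k - 0) * (if k - 0 = n then 1 else 0)) = (\<lambda>k. toep_wt 0 \<phi> n * (if k = n then 1 else 0))" by auto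
    also have "hser \<dots> = scale_fun (toep_wt 0 \<phi> n) (harm_monom n)"
      unfolding harm_monom_hser by (rule hser_scale_l2w[symmetric]) (rule l2w_finite[OF fin])
    finally have "cmod (toep_wt 0 \<phi> n) * norm_L2 (harm_monom n) \<le> B * norm_L2 (harm_monom n)"
      using B[OF hp] by (simp add: norm_L2_scale)
    then have "cmod (toep_wt 0 \<phi> n) \<le> B" using norm_harm_monom_pos[of n] by simp
    moreover have "nat \<bar>n\<bar> + nat \<bar>n\<bar> + 2 = 2 * j" using n by linarith
    then have "toep_wt 0 \<phi> n = 2 * (of_int \<bar>n\<bar> + 1) * mellin \<phi> (of_nat (2 * j))" by (simp add: toep_wt_def)
    moreover have "real_of_int \<bar>n\<bar> + 1 = real j" using n by linarith
    ultimately show ?thesis by (simp only: norm_mult norm_of_int_abs_plus1) simp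
  qed
  obtain \<psi> where \<psi>: "\<psi> \<in> borel_measurable borel" "integrable dr2 \<psi>"
    "\<forall>s. mellin \<phi> s = (\<integral>r. \<psi> r * complex_of_real r powr (s - 2) \<partial>dr2) / 2"
    using radial_integrableE[OF ri] by metis
  note [measurable] = \<psi>(1)
  define I where "I = (\<integral>r. cmod (\<psi> r) \<partial>dr2)"
  have i: "integrable dr2 (\<lambda>r. \<psi> r * of_real (r ^ j))" for j
  proof (rule Bochner_Integration.integrable_bound[OF \<psi>(2)])
    show "AE r in dr2. norm (\<psi> r * of_real (r ^ j)) \<le> norm (\<psi> r)"
      unfolding AE_dr2 by (rule AE_I2) (auto simp: norm_mult norm_power intro!: mult_left_le power_le_one)
  qed (rule borel_measurable_dr2, measurable)
  have odd: "real (2 * j + 1) * cmod (mellin \<phi> (of_nat (2 * j + 1))) \<le> 2 * \<bar>B\<bar> + 2 * I" if j: "j \<ge> 1" for j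
  proof -
    obtain l where l: "2 * j = l + 2" using j by (metis add.commute le_Suc_ex mult_2 add_Suc_right mult_Suc_right nat_mult_1_right numeral_2_eq_2 One_nat_def plus_1_eq_Suc distrib_left)
    have "2 * mellin \<phi> (of_nat (2 * j + 1)) - 2 * mellin \<phi> (of_nat (2 * j)) = (\<integral>r. \<psi> r * of_real (r ^ (l + 1)) - \<psi> r * of_real (r ^ l) \<partial>dr2)"
      unfolding Bochner_Integration.integral_diff[OF i i] mellin_nat[OF \<psi>(1) \<psi>(3)[rule_format]] l
      by (simp add: eval_nat_numeral)
    also have "cmod \<dots> \<le> (\<integral>r. cmod (\<psi> r) * (1 / real (l + 1)) \<partial>dr2)"
    proof (rule order_trans[OF integral_norm_bound integral_mono_AE])
      show "integrable dr2 (\<lambda>r. cmod (\<psi> r * of_real (r ^ (l + 1)) - \<psi> r * of_real (r ^ l)))"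
        by (intro integrable_norm Bochner_Integration.integrable_diff i)
      show "integrable dr2 (\<lambda>r. cmod (\<psi> r) * (1 / real (l + 1)))" using \<psi>(2) by (intro integrable_mult_left integrable_norm)
      \<comment> \<open>(l + 1) r^l is at most the geometric sum of r^k over k \<le> l, and that sum
        times 1 - r is 1 - r^(l + 1).\<close>
      have pw: "r ^ l * (1 - r) \<le> 1 / real (l + 1)" if r: "0 < r" "r < 1" for r :: real
      proof -
        have "real (l + 1) * r ^ l = (\<Sum>k<l+1. r ^ l)" by simp
        also have "\<dots> \<le> (\<Sum>k<l+1. r ^ k)" using r by (intro sum_mono power_decreasing) auto
        finally have "(real (l + 1) * r ^ l) * (1 - r) \<le> (\<Sum>k<l+1. r ^ k) * (1 - r)" using r by (intro mult_right_mono) auto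
        also have "\<dots> = 1 - r ^ (l + 1)" by (metis one_diff_power_eq mult.commute)
        also have "\<dots> \<le> 1" using r by simp
        finally show ?thesis by (simp add: field_simps)
      qed
      have "cmod (\<psi> r * of_real (r ^ (l + 1)) - \<psi> r * of_real (r ^ l)) \<le> cmod (\<psi> r) * (1 / real (l + 1))" if r: "0 < r" "r < 1" for r
      proof -
        have "\<psi> r * of_real (r ^ (l + 1)) - \<psi> r * of_real (r ^ l) = - (\<psi> r * of_real (r ^ l * (1 - r)))"
          by (simp add: algebra_simps)
        then have "cmod (\<psi> r * of_real (r ^ (l + 1)) - \<psi> r * of_real (r ^ l)) = cmod (\<psi> r) * \<bar>r ^ l * (1 - r)\<bar>"
          by (simp only: norm_minus_cancel norm_mult norm_of_real)
        also have "\<bar>r ^ l * (1 - r)\<bar> = r ^ l * (1 - r)" using r by simp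
        finally show ?thesis using mult_left_mono[OF pw[OF r] norm_ge_zero[of "\<psi> r"]] by linarith
      qed
      then have "AE r in dr2. cmod (\<psi> r * of_real (r ^ (l + 1)) - \<psi> r * of_real (r ^ l)) \<le> cmod (\<psi> r) * (1 / real (l + 1))"
        unfolding AE_dr2 by (intro AE_I2) auto
      then show "AE r in dr2. cmod (\<psi> r * of_real (r ^ (l + 1)) - \<psi> r * of_real (r ^ l)) \<le> cmod (\<psi> r) * (1 / real (l + 1))" .
    qed
    also have "\<dots> = I / real (l + 1)" unfolding I_def by simp
    finally have "cmod (2 * mellin \<phi> (of_nat (2 * j + 1)) - 2 * mellin \<phi> (of_nat (2 * j))) \<le> I / real (l + 1)" .
    then have "2 * cmod (mellin \<phi> (of_nat (2 * j + 1))) \<le> 2 * cmod (mellin \<phi> (of_nat (2 * j))) + I / real (l + 1)"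
      using norm_triangle_sub[of "2 * mellin \<phi> (of_nat (2 * j + 1))" "2 * mellin \<phi> (of_nat (2 * j))"] by (simp add: norm_mult)
    then have "real (2 * j + 1) * (2 * cmod (mellin \<phi> (of_nat (2 * j + 1)))) \<le> real (2 * j + 1) * (2 * cmod (mellin \<phi> (of_nat (2 * j))) + I / real (l + 1))"
      by (intro mult_left_mono) auto
    also have "\<dots> = 2 * (real (2 * j + 1) * cmod (mellin \<phi> (of_nat (2 * j)))) + real (2 * j + 1) * (I / real (l + 1))"
      by (simp only: distrib_left)
    also have "\<dots> \<le> 2 * (2 * \<bar>B\<bar>) + 3 * I"
    proof (intro add_mono mult_left_mono)
      have "real (2 * j + 1) * cmod (mellin \<phi> (of_nat (2 * j))) \<le> 2 * real (2 * j) * cmod (mellin \<phi> (of_nat (2 * j)))"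
        using j by (intro mult_right_mono) auto
      then show "real (2 * j + 1) * cmod (mellin \<phi> (of_nat (2 * j))) \<le> 2 * \<bar>B\<bar>" using even[OF j] by linarith
      have I0: "I \<ge> 0" unfolding I_def by (rule integral_nonneg_AE) simp
      have "real (2 * j + 1) / real (l + 1) \<le> 3" using l by (simp add: divide_le_eq)
      then have "real (2 * j + 1) / real (l + 1) * I \<le> 3 * I" using I0 by (rule mult_right_mono)
      then show "real (2 * j + 1) * (I / real (l + 1)) \<le> 3 * I" by simp
    qed simp
    finally have "real (2 * j + 1) * cmod (mellin \<phi> (of_nat (2 * j + 1))) \<le> 2 * \<bar>B\<bar> + 3 / 2 * I" by simp
    moreover have "I \<ge> 0" unfolding I_def by (rule integral_nonneg_AE) simp
    ultimately show ?thesis by linarith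
  qed
  show "mellin_bounded \<phi>" unfolding mellin_bounded_def
  proof (intro exI[of _ "2 * \<bar>B\<bar> + 2 * I"] allI impI)
    fix s :: nat assume s: "s \<ge> 2"
    have I0: "I \<ge> 0" unfolding I_def by (rule integral_nonneg_AE) simp
    show "real s * cmod (mellin \<phi> (of_nat s)) \<le> 2 * \<bar>B\<bar> + 2 * I"
    proof (cases "even s")
      case True
      then obtain j where j: "s = 2 * j" by blast
      have "j \<ge> 1" using j s by simp
      then show ?thesis using even[of j] I0 unfolding j by linarith
    next
      case False
      then obtain j where j: "s = 2 * j + 1" by (metis oddE)
      have "j \<ge> 1" using j s by simp
      then show ?thesis using odd[of j] unfolding j by linarith
    qed
  qed
qed

section \<open>The symbol r^m\<close>

lemma integral_powr_01:
  assumes x: "x > 0"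
  shows "(\<integral>r. complex_of_real (r powr (x - 1)) \<partial>lebesgue_on {0..1}) = 1 / of_real x"
    "integrable (lebesgue_on {0..1}) (\<lambda>r. r powr (x - 1))"
proof -
  have hi: "((\<lambda>r. r powr (x - 1)) has_integral 1 / x) {0..1}"
    using has_integral_powr_from_0[of "x - 1" 1] x by simp
  then have ai: "(\<lambda>r. r powr (x - 1)) absolutely_integrable_on {0..1}"
    by (intro nonnegative_absolutely_integrable_1) (auto simp: has_integral_integrable)
  show i: "integrable (lebesgue_on {0..1}) (\<lambda>r. r powr (x - 1))"
    using ai by (subst integrable_restrict_space) (auto simp: set_integrable_def)
  have "(\<integral>r. r powr (x - 1) \<partial>lebesgue_on {0..1}) = 1 / x"
    using lebesgue_integral_eq_integral[OF i] hi by (simp add: integral_unique)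
  then show "(\<integral>r. complex_of_real (r powr (x - 1)) \<partial>lebesgue_on {0..1}) = 1 / of_real x"
    by (subst integral_complex_of_real) simp
qed

lemma mellin_powr:
  assumes "real s + m > 0" "s \<ge> 1"
  shows "mellin (\<lambda>r. complex_of_real (r powr m)) (of_nat s) = 1 / (of_nat s + of_real m)"
proof -
  have "mellin (\<lambda>r. complex_of_real (r powr m)) (of_nat s) = (\<integral>r. complex_of_real (r powr ((real s + m) - 1)) \<partial>lebesgue_on {0..1})"
    unfolding mellin_def
  proof (intro Bochner_Integration.integral_cong refl)
    fix r :: real assume "r \<in> space (lebesgue_on {0..1})"
    then have r: "0 \<le> r" "r \<le> 1" by auto
    have "complex_of_real r powr (of_nat s - 1) = complex_of_real (r powr (real s - 1))"
      using powr_of_real[of r "real s - 1"] r by simp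
    then show "complex_of_real (r powr m) * complex_of_real r powr (of_nat s - 1) = complex_of_real (r powr ((real s + m) - 1))"
      using r by (simp flip: of_real_mult powr_add add: algebra_simps)
  qed
  then show ?thesis using integral_powr_01(1)[OF assms(1)] by simp
qed

text \<open>For m \<ge> -1 the density r r^m is at most 1 on the unit interval, and s/(s + m) \<le>
  s/(s - 1) \<le> 2 for s \<ge> 2.\<close>

lemma powr_radial_integrable:
  assumes m: "m \<ge> - 1"
  shows "radial_integrable (\<lambda>r. complex_of_real (r powr m))" "mellin_bounded (\<lambda>r. complex_of_real (r powr m))"
proof -
  have [measurable]: "(\<lambda>r. complex_of_real (r powr m)) \<in> borel_measurable borel" by measurable
  have "integrable lborel (\<lambda>r::real. indicator {0..1} r *\<^sub>R (2::real))"
    unfolding real_scaleR_def by (intro integrable_mult_left integrable_real_indicator) auto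
  then have "integrable lborel (\<lambda>r. (2 * r * indicator {0..1} r) *\<^sub>R complex_of_real (r powr m))"
  proof (rule Bochner_Integration.integrable_bound)
    show "AE r in lborel. norm ((2 * r * indicator {0..1} r) *\<^sub>R complex_of_real (r powr m)) \<le> norm (indicator {0..1} r *\<^sub>R (2::real))"
    proof (rule AE_I2)
      fix r :: real
      show "norm ((2 * r * indicator {0..1} r) *\<^sub>R complex_of_real (r powr m)) \<le> norm (indicator {0..1} r *\<^sub>R (2::real))"
      proof (cases "r \<in> {0<..1}")
        case True
        then have "r * r powr m = r powr (1 + m)" by (simp add: powr_add)
        also have "\<dots> \<le> 1" using True m by (intro powr_le1) auto
        finally show ?thesis using True by (simp add: abs_mult)
      qed (auto simp: indicator_def)
    qed
  qed measurable
  then have "integrable dr2 (\<lambda>r. complex_of_real (r powr m))"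
    unfolding dr2_def by (subst integrable_density) (auto simp: indicator_def)
  then show "radial_integrable (\<lambda>r. complex_of_real (r powr m))"
    unfolding radial_integrable_def
    using integral_dA(2)[of "\<lambda>z. complex_of_real (cmod z powr m)"] integral_dAb_radial(2)[of "\<lambda>r. complex_of_real (r powr m)"]
    by simp
  show "mellin_bounded (\<lambda>r. complex_of_real (r powr m))"
    unfolding mellin_bounded_def
  proof (intro exI[of _ 2] allI impI)
    fix s :: nat assume s: "s \<ge> 2"
    have "mellin (\<lambda>r. complex_of_real (r powr m)) (of_nat s) = 1 / of_real (real s + m)"
      using mellin_powr[of s m] s m by simp
    then have "real s * cmod (mellin (\<lambda>r. complex_of_real (r powr m)) (of_nat s)) = real s / (real s + m)"
      using s m by (simp only: norm_divide norm_of_real) simp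
    also have "\<dots> \<le> 2" using s m by (simp add: divide_le_eq)
    finally show "real s * cmod (mellin (\<lambda>r. complex_of_real (r powr m)) (of_nat s)) \<le> 2" .
  qed
qed

section \<open>Weighted shifts and the commutator\<close>

lemma sum_fun_apply: "(\<Sum>i\<in>A. f i) x = (\<Sum>i\<in>A. (f i x :: 'b::comm_monoid_add))"
  by (induction A rule: infinite_finite_induct) auto

lemma hser_finite_sum:
  assumes "finite F" "\<And>n. n \<notin> F \<Longrightarrow> c n = 0"
  shows "hser c = (\<Sum>n\<in>F. scale_fun (c n) (harm_monom n))"
proof
  fix z
  have sub: "{n. c n \<noteq> 0} \<subseteq> F" using assms(2) by auto
  have "hser c z = (\<Sum>n | c n \<noteq> 0. c n * harm_monom n z)"
    by (rule hser_finite[OF finite_subset[OF sub assms(1)]])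
  also have "\<dots> = (\<Sum>n\<in>F. c n * harm_monom n z)"
    by (rule sum.mono_neutral_left[OF assms(1) sub]) auto
  finally show "hser c z = (\<Sum>n\<in>F. scale_fun (c n) (harm_monom n)) z"
    by (simp add: sum_fun_apply scale_fun_def)
qed

lemma l2w_supported: "finite F \<Longrightarrow> (\<And>n. n \<notin> F \<Longrightarrow> c n = 0) \<Longrightarrow> l2w c"
  by (rule l2w_finite, rule finite_subset[of _ F]) auto

lemma harm_monom_inj: "inj harm_monom"
proof (rule injI)
  fix m n :: int assume "harm_monom m = harm_monom n"
  then have "(\<lambda>k. if k = m then 1 else 0 :: complex) = (\<lambda>k. if k = n then 1 else 0)"
    unfolding harm_monom_hser by (intro hser_inject l2w_finite) auto
  then show "m = n" by (metis zero_neq_one)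
qed

lemma harm_monom_independent:
  assumes "finite F" shows "cfun.independent (harm_monom ` F)"
proof (rule cfun.independent_if_scalars_zero)
  fix u x assume u: "(\<Sum>x\<in>harm_monom ` F. scale_fun (u x) x) = 0" and x: "x \<in> harm_monom ` F"
  obtain n where n: "n \<in> F" "x = harm_monom n" using x by auto
  define c where "c = (\<lambda>n. if n \<in> F then u (harm_monom n) else 0)"
  have "hser c = (\<Sum>n\<in>F. scale_fun (u (harm_monom n)) (harm_monom n))"
    by (subst hser_finite_sum[OF assms]) (auto simp: c_def)
  also have "\<dots> = (\<Sum>x\<in>harm_monom ` F. scale_fun (u x) x)"
    by (subst sum.reindex) (auto intro: inj_on_subset[OF harm_monom_inj])
  also have "\<dots> = hser (\<lambda>_. 0)"
    unfolding u by (subst hser_finite_sum[of "{}"]) auto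
  finally have "c = (\<lambda>_. 0)"
    by (intro hser_inject l2w_supported[OF assms]) (auto simp: c_def intro: l2w_finite)
  then have "c n = 0" by metis
  then show "u x = 0" using n by (simp add: c_def)
qed (use assms in auto)

lemma span_harm_monom:
  assumes F: "finite F"
  shows "cfun.span (harm_monom ` F) = hser ` {c. \<forall>n. n \<notin> F \<longrightarrow> c n = 0}"
proof
  have "cfun.subspace (hser ` {c. \<forall>n. n \<notin> F \<longrightarrow> c n = 0})"
  proof (rule cfun.subspaceI)
    show "0 \<in> hser ` {c. \<forall>n. n \<notin> F \<longrightarrow> c n = 0}"
      by (rule image_eqI[of _ _ "\<lambda>_. 0"]) (subst hser_finite_sum[of "{}"], auto)
  next
    fix x y assume "x \<in> hser ` {c. \<forall>n. n \<notin> F \<longrightarrow> c n = 0}" "y \<in> hser ` {c. \<forall>n. n \<notin> F \<longrightarrow> c n = 0}"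
    then obtain a b where ab: "\<And>n. n \<notin> F \<Longrightarrow> a n = 0" "x = hser a" "\<And>n. n \<notin> F \<Longrightarrow> b n = 0" "y = hser b" by auto
    have "x + y = hser (\<lambda>n. a n + b n)" unfolding ab(2,4)
      by (rule hser_add_l2w) (use ab l2w_supported[OF F] in auto)
    then show "x + y \<in> hser ` {c. \<forall>n. n \<notin> F \<longrightarrow> c n = 0}" using ab by auto
  next
    fix k x assume "x \<in> hser ` {c. \<forall>n. n \<notin> F \<longrightarrow> c n = 0}"
    then obtain a where a: "\<And>n. n \<notin> F \<Longrightarrow> a n = 0" "x = hser a" by auto
    have "scale_fun k x = hser (\<lambda>n. k * a n)" unfolding a(2)
      by (rule hser_scale_l2w) (use a l2w_supported[OF F] in auto)
    then show "scale_fun k x \<in> hser ` {c. \<forall>n. n \<notin> F \<longrightarrow> c n = 0}" using a by auto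
  qed
  moreover have "harm_monom ` F \<subseteq> hser ` {c. \<forall>n. n \<notin> F \<longrightarrow> c n = 0}"
    unfolding harm_monom_hser by auto
  ultimately show "cfun.span (harm_monom ` F) \<subseteq> hser ` {c. \<forall>n. n \<notin> F \<longrightarrow> c n = 0}"
    by (intro cfun.span_minimal)
  show "hser ` {c. \<forall>n. n \<notin> F \<longrightarrow> c n = 0} \<subseteq> cfun.span (harm_monom ` F)"
  proof
    fix x assume "x \<in> hser ` {c. \<forall>n. n \<notin> F \<longrightarrow> c n = 0}"
    then obtain c where c: "\<And>n. n \<notin> F \<Longrightarrow> c n = 0" "x = hser c" by auto
    have "x = (\<Sum>n\<in>F. scale_fun (c n) (harm_monom n))"
      unfolding c(2) by (rule hser_finite_sum[OF F]) (rule c(1))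
    then show "x \<in> cfun.span (harm_monom ` F)"
      by (simp add: cfun.span_sum cfun.span_scale cfun.span_base)
  qed
qed

text \<open>A shift reaches exactly the monomials with nonzero weight, and a preimage is obtained by
  dividing by the weight. The range is closed because each coefficient outside \<open>F\<close> is
  continuous in norm and vanishes on it.\<close>

lemma wshift_op_Ran:
  fixes w :: "int \<Rightarrow> complex"
  assumes A: "\<And>a. l2w a \<Longrightarrow> l2w (wshift K w a)" "\<And>f. f \<in> L2h \<Longrightarrow> A f = hser (wshift K w (hcoef f))"
    and fin: "finite {n. w n \<noteq> 0}"
  shows "Ran A = cfun.span (harm_monom ` {n. w (n - K) \<noteq> 0})" "finite_rank A" "op_rank A = card {n. w n \<noteq> 0}"
proof -
  define F where "F = {n. w (n - K) \<noteq> 0}"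
  have F_eq: "F = (\<lambda>n. n + K) ` {n. w n \<noteq> 0}"
    unfolding F_def by (force simp: image_iff intro: exI[of _ "_ - K"])
  have F: "finite F" unfolding F_eq using fin by simp
  have cF: "card F = card {n. w n \<noteq> 0}" unfolding F_eq by (rule card_image) (auto simp: inj_on_def)
  have sp: "cfun.span (harm_monom ` F) = hser ` {c. \<forall>n. n \<notin> F \<longrightarrow> c n = 0}" by (rule span_harm_monom[OF F])
  show R: "Ran A = cfun.span (harm_monom ` F)"
  proof
    show "Ran A \<subseteq> cfun.span (harm_monom ` F)"
      unfolding sp Ran_def by (auto simp: A(2) wshift_def F_def)
    show "cfun.span (harm_monom ` F) \<subseteq> Ran A"
    proof
      fix x assume "x \<in> cfun.span (harm_monom ` F)"
      then obtain c where c: "\<And>n. n \<notin> F \<Longrightarrow> c n = 0" "x = hser c" unfolding sp by auto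
      define a where "a = (\<lambda>n. if w n = 0 then 0 else c (n + K) / w n)"
      have a: "l2w a" by (rule l2w_supported[OF fin]) (auto simp: a_def)
      have "wshift K w a = c" using c(1) by (auto simp: wshift_def a_def F_def)
      then have "x = A (hser a)" by (simp add: A(2) hser_L2h[OF a] hcoef_hser[OF a] c(2))
      then show "x \<in> Ran A" unfolding Ran_def using hser_L2h[OF a] by blast
    qed
  qed
  show "op_rank A = card {n. w n \<noteq> 0}"
  proof -
    have "op_rank A = card (harm_monom ` F)"
      unfolding op_rank_def R cfun.dim_span by (rule cfun.dim_eq_card_independent[OF harm_monom_independent[OF F]])
    also have "\<dots> = card F" by (intro card_image inj_on_subset[OF harm_monom_inj]) auto
    finally show ?thesis using cF by simp
  qed
  show "finite_rank A" unfolding finite_rank_def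
  proof (intro exI[of _ "harm_monom ` F"] conjI subsetI)
    fix g assume g: "g \<in> closure_L2h (Ran A)"
    then have gL: "g \<in> L2h" by (simp add: closure_L2h_def)
    obtain b where b: "l2w b" "g = hser b" using L2h_hser[OF gL] by metis
    have "b n = 0" if n: "n \<notin> F" for n
    proof (rule ccontr)
      assume nz: "b n \<noteq> 0"
      \<comment> \<open>A function whose n-th coefficient vanishes has distance at least
        \<open>e\<close> from \<open>g\<close>.\<close>
      define e where "e = cmod (b n) / sqrt (real_of_int \<bar>n\<bar> + 1)"
      have "e > 0" using nz by (simp add: e_def add_nonneg_pos)
      then obtain f where f: "f \<in> Ran A" "norm_L2 (f - g) < e" using g by (auto simp: closure_L2h_def)
      obtain c where c: "\<And>n. n \<notin> F \<Longrightarrow> c n = 0" "f = hser c" using f(1) unfolding R sp by auto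
      have lc: "l2w c" by (rule l2w_supported[OF F c(1)])
      have "f - g = f + scale_fun (-1) g" by (auto simp: scale_fun_def)
      also have "\<dots> = hser (\<lambda>n. c n + (-1) * b n)"
        unfolding c(2) b(2) hser_scale_l2w[OF b(1)] by (rule hser_add_l2w[OF lc l2w_scale[OF b(1)]])
      finally have fg: "f - g = hser (\<lambda>n. c n + (-1) * b n)" .
      have "(cmod (c n + (-1) * b n))\<^sup>2 \<le> (norm_L2 (f - g))\<^sup>2 * (real_of_int \<bar>n\<bar> + 1)"
        unfolding fg by (rule hser_coeff_le[OF l2w_add[OF lc l2w_scale[OF b(1)]]])
      then have "(cmod (b n))\<^sup>2 \<le> (norm_L2 (f - g))\<^sup>2 * (real_of_int \<bar>n\<bar> + 1)" by (simp add: c(1)[OF n])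
      also have "\<dots> < e\<^sup>2 * (real_of_int \<bar>n\<bar> + 1)"
        using f(2) norm_L2_nonneg[of "f - g"] by (intro mult_strict_right_mono power_strict_mono) auto
      also have "\<dots> = (cmod (b n))\<^sup>2" by (simp add: e_def power_divide)
      finally show False by simp
    qed
    then show "g \<in> cfun.span (harm_monom ` F)" unfolding sp using b(2) by auto
  qed (use F in auto)
qed

text \<open>Each nonzero weight puts a monomial into the range, and monomials are linearly
  independent.\<close>

lemma wshift_op_finite_rank:
  fixes w :: "int \<Rightarrow> complex"
  assumes A: "\<And>a. l2w a \<Longrightarrow> l2w (wshift K w a)" "\<And>f. f \<in> L2h \<Longrightarrow> A f = hser (wshift K w (hcoef f))"
    and fr: "finite_rank A"
  shows "finite {n. w n \<noteq> 0}"
proof (rule ccontr)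
  assume inf: "infinite {n. w n \<noteq> 0}"
  obtain B where B: "finite B" "closure_L2h (Ran A) \<subseteq> cfun.span B" using fr by (auto simp: finite_rank_def)
  have R: "harm_monom (n + K) \<in> closure_L2h (Ran A)" if n: "w n \<noteq> 0" for n
  proof -
    define a where "a = (\<lambda>k. if k = n then 1 / w n else 0)"
    have a: "l2w a" by (rule l2w_supported[of "{n}"]) (auto simp: a_def)
    have "wshift K w a = (\<lambda>k. if k = n + K then 1 else 0)" using n by (auto simp: wshift_def a_def)
    then have "A (hser a) = harm_monom (n + K)" by (simp add: A(2) hser_L2h[OF a] hcoef_hser[OF a] harm_monom_hser)
    then have "harm_monom (n + K) \<in> Ran A" unfolding Ran_def using hser_L2h[OF a] by force
    moreover have "norm_L2 (harm_monom (n + K) - harm_monom (n + K)) = 0" by (simp add: norm_L2_def)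
    ultimately show ?thesis unfolding closure_L2h_def using harm_monom_L2h
      by (intro CollectI conjI allI impI bexI[of _ "harm_monom (n + K)"]) simp_all
  qed
  obtain F where F: "F \<subseteq> {n. w n \<noteq> 0}" "finite F" "card F = card B + 1"
    using infinite_arbitrarily_large[OF inf, of "card B + 1"] by blast
  define G where "G = (\<lambda>n. n + K) ` F"
  have "harm_monom ` G \<subseteq> cfun.span B" using F(1) R B(2) by (auto simp: G_def)
  then have "card (harm_monom ` G) \<le> card B"
    using cfun.independent_span_bound[OF B(1) harm_monom_independent] F(2) by (auto simp: G_def)
  moreover have "card (harm_monom ` G) = card G" by (intro card_image inj_on_subset[OF harm_monom_inj]) auto
  moreover have "card G = card F" unfolding G_def by (rule card_image) (auto simp: inj_on_def)
  ultimately show False using F(3) by simp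
qed

section \<open>Coefficients of the commutator\<close>

text \<open>Up to the nonzero factor 4(|n + k1 + k2| + 1), the weight with which the commutator
  sends index n to n + k1 + k2. The Mellin transform 1/(s + m) of r^m is already inserted.\<close>

definition comm_coeff :: "int \<Rightarrow> int \<Rightarrow> real \<Rightarrow> (real \<Rightarrow> complex) \<Rightarrow> int \<Rightarrow> complex" where
  "comm_coeff k1 k2 m \<phi> n =
     (of_int \<bar>n + k2\<bar> + 1) * mellin \<phi> (of_int (\<bar>n\<bar> + \<bar>n + k2\<bar> + 2)) / (of_int (\<bar>n + k2\<bar> + \<bar>n + k1 + k2\<bar> + 2) + of_real m)
   - (of_int \<bar>n + k1\<bar> + 1) * mellin \<phi> (of_int (\<bar>n + k1\<bar> + \<bar>n + k1 + k2\<bar> + 2)) / (of_int (\<bar>n\<bar> + \<bar>n + k1\<bar> + 2) + of_real m)"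

text \<open>The reflection exchanges |n| with |n + k1 + k2| and |n + k1| with |n + k2|, and with
  them the two terms. At its fixed point the coefficient is therefore 0, which is why the midpoint
  is missing from \<open>Lambda1\<close>.\<close>

lemma comm_coeff_antisym: "comm_coeff k1 k2 m \<phi> (- n - k1 - k2) = - comm_coeff k1 k2 m \<phi> n"
proof -
  have "\<bar>- n - k1 - k2 + k2\<bar> = \<bar>n + k1\<bar>" "\<bar>- n - k1 - k2 + k1\<bar> = \<bar>n + k2\<bar>"
    "\<bar>- n - k1 - k2 + k1 + k2\<bar> = \<bar>n\<bar>" "\<bar>- n - k1 - k2\<bar> = \<bar>n + k1 + k2\<bar>" by (simp_all add: abs_if)
  note abs_eqs = this
  show ?thesis
    unfolding comm_coeff_def abs_eqs minus_diff_eq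
      add.commute[of "\<bar>n + k1 + k2\<bar>" "\<bar>n + k1\<bar>"] add.commute[of "\<bar>n + k1\<bar>" "\<bar>n\<bar>"]
      add.commute[of "\<bar>n + k2\<bar>" "\<bar>n\<bar>"] add.commute[of "\<bar>n + k1 + k2\<bar>" "\<bar>n + k2\<bar>"]
    by (rule refl)
qed

lemma commutator_coeff:
  fixes k1 k2 :: int
  assumes \<phi>: "radial_integrable \<phi>" "mellin_bounded \<phi>" and m: "m \<ge> - 1"
  defines "A \<equiv> commutator (toeplitz (quasihom k1 (\<lambda>r. complex_of_real (r powr m)))) (toeplitz (quasihom k2 \<phi>))"
    and "cc \<equiv> (\<lambda>n. 4 * (of_int \<bar>n + k1 + k2\<bar> + 1) * comm_coeff k1 k2 m \<phi> n)"
  shows "l2w a \<Longrightarrow> l2w (wshift (k1 + k2) cc a)" "f \<in> L2h \<Longrightarrow> A f = hser (wshift (k1 + k2) cc (hcoef f))"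
proof -
  define \<psi> where "\<psi> = (\<lambda>r. complex_of_real (r powr m))"
  have \<psi>: "radial_integrable \<psi>" "mellin_bounded \<psi>" unfolding \<psi>_def by (rule powr_radial_integrable[OF m])+
  define w1 w2 where "w1 = toep_wt k1 \<psi>" and "w2 = toep_wt k2 \<phi>"
  obtain B1 where B1: "\<And>n. (cmod (w1 n))\<^sup>2 / (real_of_int \<bar>n + k1\<bar> + 1) \<le> B1\<^sup>2 / (real_of_int \<bar>n\<bar> + 1)"
    using toeplitz_quasihom(2)[OF \<psi>] unfolding w1_def by metis
  obtain B2 where B2: "\<And>n. (cmod (w2 n))\<^sup>2 / (real_of_int \<bar>n + k2\<bar> + 1) \<le> B2\<^sup>2 / (real_of_int \<bar>n\<bar> + 1)"
    using toeplitz_quasihom(2)[OF \<phi>] unfolding w2_def by metis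
  note l1 = wshift_l2w(1)[of w1 k1 B1, OF B1] and l2 = wshift_l2w(1)[of w2 k2 B2, OF B2]
  have T1: "toeplitz (quasihom k1 \<psi>) (hser a) = hser (wshift k1 w1 a)" if "l2w a" for a
    using toeplitz_quasihom(1)[OF \<psi> hser_L2h[OF that], of k1] by (simp add: w1_def hcoef_hser[OF that])
  have T2: "toeplitz (quasihom k2 \<phi>) (hser a) = hser (wshift k2 w2 a)" if "l2w a" for a
    using toeplitz_quasihom(1)[OF \<phi> hser_L2h[OF that], of k2] by (simp add: w2_def hcoef_hser[OF that])
  have w1: "w1 n = 2 * (of_int \<bar>n + k1\<bar> + 1) / (of_int (\<bar>n\<bar> + \<bar>n + k1\<bar> + 2) + of_real m)" for n
    unfolding w1_def toep_wt_def \<psi>_def using m by (subst mellin_powr) auto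
  have w2: "w2 n = 2 * (of_int \<bar>n + k2\<bar> + 1) * mellin \<phi> (of_int (\<bar>n\<bar> + \<bar>n + k2\<bar> + 2))" for n
  proof -
    have "(of_nat (nat \<bar>n\<bar> + nat \<bar>n + k2\<bar> + 2) :: complex) = of_int (int (nat \<bar>n\<bar> + nat \<bar>n + k2\<bar> + 2))"
      by (rule of_int_of_nat_eq[symmetric])
    also have "int (nat \<bar>n\<bar> + nat \<bar>n + k2\<bar> + 2) = \<bar>n\<bar> + \<bar>n + k2\<bar> + 2" by simp
    finally show ?thesis unfolding w2_def toep_wt_def by (simp only:)
  qed
  have cc: "w1 (n + k2) * w2 n - w2 (n + k1) * w1 n = cc n" for n
  proof -
    have eq: "n + k2 + k1 = n + k1 + k2" by simp
    have alg: "2 * x / P * (2 * y * u) - 2 * x * v * (2 * y' / Q) = 4 * x * (y * u / P - y' * v / Q)"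
      for x y y' u v P Q :: complex by (simp add: algebra_simps)
    show ?thesis unfolding w1 w2 cc_def comm_coeff_def eq by (rule alg)
  qed
  have ws: "wshift k1 w1 (wshift k2 w2 a) n - wshift k2 w2 (wshift k1 w1 a) n = wshift (k1 + k2) cc a n" for a n
    unfolding wshift_def cc[symmetric] by (simp add: algebra_simps)
  show l: "l2w (wshift (k1 + k2) cc a)" if a: "l2w a" for a
  proof -
    have "l2w (\<lambda>n. wshift k1 w1 (wshift k2 w2 a) n + (-1) * wshift k2 w2 (wshift k1 w1 a) n)"
      by (intro l2w_add l2w_scale l1 l2 a)
    then show ?thesis using ws by simp
  qed
  assume f: "f \<in> L2h"
  obtain a where a: "l2w a" "f = hser a" using L2h_hser[OF f] by metis
  have "A f = toeplitz (quasihom k1 \<psi>) (toeplitz (quasihom k2 \<phi>) f) - toeplitz (quasihom k2 \<phi>) (toeplitz (quasihom k1 \<psi>) f)"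
    using f by (simp add: A_def commutator_def \<psi>_def)
  also have "\<dots> = hser (wshift k1 w1 (wshift k2 w2 a)) - hser (wshift k2 w2 (wshift k1 w1 a))"
    unfolding a(2) T1[OF a(1)] T2[OF a(1)] T1[OF l2[OF a(1)]] T2[OF l1[OF a(1)]] ..
  also have "\<dots> = hser (wshift k1 w1 (wshift k2 w2 a)) + scale_fun (-1) (hser (wshift k2 w2 (wshift k1 w1 a)))"
    by (auto simp: scale_fun_def)
  also have "\<dots> = hser (\<lambda>n. wshift k1 w1 (wshift k2 w2 a) n + (-1) * wshift k2 w2 (wshift k1 w1 a) n)"
    unfolding hser_scale_l2w[OF l2[OF l1[OF a(1)]]]
    by (rule hser_add_l2w[OF l1[OF l2[OF a(1)]] l2w_scale[OF l2[OF l1[OF a(1)]]]])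
  also have "(\<lambda>n. wshift k1 w1 (wshift k2 w2 a) n + (-1) * wshift k2 w2 (wshift k1 w1 a) n) = wshift (k1 + k2) cc a"
    using ws by (auto simp: fun_eq_iff)
  finally show "A f = hser (wshift (k1 + k2) cc (hcoef f))" by (simp add: a(2) hcoef_hser[OF a(1)])
qed

lemma of_int_abs_plus1_nonzero: "complex_of_int \<bar>n\<bar> + 1 \<noteq> 0"
  using norm_of_int_abs_plus1[of n] by (metis add_nonneg_pos abs_ge_zero less_irrefl norm_zero of_int_0_le_iff zero_less_one)

lemma commutator_finite_rank_iff:
  fixes k1 k2 :: int
  assumes \<phi>: "radial_integrable \<phi>" "mellin_bounded \<phi>" and m: "m \<ge> - 1"
  defines "A \<equiv> commutator (toeplitz (quasihom k1 (\<lambda>r. complex_of_real (r powr m)))) (toeplitz (quasihom k2 \<phi>))"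
  shows "finite_rank A \<longleftrightarrow> finite {n. comm_coeff k1 k2 m \<phi> n \<noteq> 0}"
    "finite {n. comm_coeff k1 k2 m \<phi> n \<noteq> 0} \<Longrightarrow> Ran A = cfun.span (harm_monom ` {k. comm_coeff k1 k2 m \<phi> (k - k1 - k2) \<noteq> 0})"
    "finite {n. comm_coeff k1 k2 m \<phi> n \<noteq> 0} \<Longrightarrow> op_rank A = card {n. comm_coeff k1 k2 m \<phi> n \<noteq> 0}"
proof -
  define cc where "cc = (\<lambda>n. 4 * (of_int \<bar>n + k1 + k2\<bar> + 1) * comm_coeff k1 k2 m \<phi> n)"
  note A = commutator_coeff[OF \<phi> m, of _ k1 k2, folded A_def cc_def]
  have cc0: "cc n \<noteq> 0 \<longleftrightarrow> comm_coeff k1 k2 m \<phi> n \<noteq> 0" for n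
    unfolding cc_def mult_eq_0_iff using of_int_abs_plus1_nonzero[of "n + k1 + k2"] by simp
  have s: "{n. cc n \<noteq> 0} = {n. comm_coeff k1 k2 m \<phi> n \<noteq> 0}" "{n. cc (n - (k1 + k2)) \<noteq> 0} = {k. comm_coeff k1 k2 m \<phi> (k - k1 - k2) \<noteq> 0}"
    by (simp_all add: cc0 diff_diff_eq)
  note R = wshift_op_Ran[of "k1 + k2" cc A, OF A, unfolded s]
  show "finite_rank A \<longleftrightarrow> finite {n. comm_coeff k1 k2 m \<phi> n \<noteq> 0}"
    using R(2) wshift_op_finite_rank[of "k1 + k2" cc A, OF A, unfolded s] by blast
  show "finite {n. comm_coeff k1 k2 m \<phi> n \<noteq> 0} \<Longrightarrow> Ran A = cfun.span (harm_monom ` {k. comm_coeff k1 k2 m \<phi> (k - k1 - k2) \<noteq> 0})"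
    "finite {n. comm_coeff k1 k2 m \<phi> n \<noteq> 0} \<Longrightarrow> op_rank A = card {n. comm_coeff k1 k2 m \<phi> n \<noteq> 0}"
    using R(1,3) by blast+
qed

section \<open>Index sets and the rank one expansion\<close>

lemma finite_Lambda: "finite (Lambda1 k1 k2)" "finite (LambdaHalf k1 k2)"
proof -
  show "finite (Lambda1 k1 k2)"
    by (rule finite_subset[of _ "{- N1 k1 k2 + 1..N1 k1 k2 + k1 + k2 - 1}"]) (auto simp: Lambda1_def)
  show "finite (LambdaHalf k1 k2)"
    by (rule finite_subset[of _ "{(k1 + k2) div 2..N1 k1 k2 + k1 + k2 - 1}"]) (auto simp: LambdaHalf_def)
qed

text \<open>On the index k of the image monomial the reflection is k -> k1 + k2 - k;
  \<open>LambdaHalf\<close> contains the larger element of each pair.\<close>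

lemma Lambda1_split:
  "Lambda1 k1 k2 = LambdaHalf k1 k2 \<union> (\<lambda>k. k1 + k2 - k) ` LambdaHalf k1 k2"
  "LambdaHalf k1 k2 \<inter> (\<lambda>k. k1 + k2 - k) ` LambdaHalf k1 k2 = {}"
proof -
  show "Lambda1 k1 k2 = LambdaHalf k1 k2 \<union> (\<lambda>k. k1 + k2 - k) ` LambdaHalf k1 k2"
  proof (intro set_eqI iffI)
    fix k assume k: "k \<in> Lambda1 k1 k2"
    show "k \<in> LambdaHalf k1 k2 \<union> (\<lambda>k. k1 + k2 - k) ` LambdaHalf k1 k2"
    proof (cases "2 * k > k1 + k2")
      case False
      then have "k1 + k2 - k \<in> LambdaHalf k1 k2" using k by (auto simp: Lambda1_def LambdaHalf_def)
      then have "k1 + k2 - (k1 + k2 - k) \<in> (\<lambda>k. k1 + k2 - k) ` LambdaHalf k1 k2" by (rule imageI)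
      then show ?thesis by simp
    qed (use k in \<open>auto simp: Lambda1_def LambdaHalf_def\<close>)
  qed (auto simp: Lambda1_def LambdaHalf_def)
qed (auto simp: LambdaHalf_def)

text \<open>Consequently the interval underlying \<open>Lambda1\<close> has |k1| + |k2| - 1
  elements, the midpoint included when it is an integer.\<close>

lemma N1_eq:
  assumes "k1 * k2 \<noteq> 0"
  shows "2 * N1 k1 k2 + k1 + k2 = \<bar>k1\<bar> + \<bar>k2\<bar>"
  using assms by (auto simp: N1_def max_def abs_if)

lemma card_Lambda1:
  assumes k: "k1 * k2 \<noteq> 0"
  shows "odd (k1 + k2) \<Longrightarrow> int (card (Lambda1 k1 k2)) = \<bar>k1\<bar> + \<bar>k2\<bar> - 1"
    "even (k1 + k2) \<Longrightarrow> int (card (Lambda1 k1 k2)) = \<bar>k1\<bar> + \<bar>k2\<bar> - 2"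
proof -
  let ?I = "{- N1 k1 k2 + 1..N1 k1 k2 + k1 + k2 - 1}"
  have N: "2 * N1 k1 k2 + k1 + k2 = \<bar>k1\<bar> + \<bar>k2\<bar>" by (rule N1_eq[OF k])
  have k0: "\<bar>k1\<bar> \<ge> 1" "\<bar>k2\<bar> \<ge> 1" using k by auto
  have cI: "int (card ?I) = \<bar>k1\<bar> + \<bar>k2\<bar> - 1" using N k0 by simp
  show "int (card (Lambda1 k1 k2)) = \<bar>k1\<bar> + \<bar>k2\<bar> - 1" if "odd (k1 + k2)"
  proof -
    have "2 * k \<noteq> k1 + k2" for k using that by (metis dvd_triv_left)
    then have "Lambda1 k1 k2 = ?I" by (auto simp: Lambda1_def)
    then show ?thesis using cI by simp
  qed
  show "int (card (Lambda1 k1 k2)) = \<bar>k1\<bar> + \<bar>k2\<bar> - 2" if ev: "even (k1 + k2)"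
  proof -
    obtain j where j: "k1 + k2 = 2 * j" using ev by blast
    have "Lambda1 k1 k2 = ?I - {j}" by (auto simp: Lambda1_def j)
    moreover have "j \<in> ?I" using N k0 j by auto
    ultimately have "card (Lambda1 k1 k2) = card ?I - 1" by simp
    moreover have "card ?I \<ge> 1" using cI k0 by linarith
    ultimately show ?thesis using cI by linarith
  qed
qed

text \<open>Antisymmetry pairs the terms of index k and k1 + k2 - k, and one constant serves both
  members of a pair with opposite signs.\<close>

lemma commutator_full_support:
  fixes k1 k2 :: int
  assumes \<phi>: "radial_integrable \<phi>" "mellin_bounded \<phi>" and m: "m \<ge> - 1" and k: "k1 * k2 \<noteq> 0"
    and supp: "\<And>k. comm_coeff k1 k2 m \<phi> (k - k1 - k2) \<noteq> 0 \<longleftrightarrow> k \<in> Lambda1 k1 k2"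
  defines "A \<equiv> commutator (toeplitz (quasihom k1 (\<lambda>r. complex_of_real (r powr m)))) (toeplitz (quasihom k2 \<phi>))"
  shows "finite_rank A" "Ran A = cfun.span (harm_monom ` Lambda1 k1 k2)"
    "\<exists>C :: int \<Rightarrow> complex. (\<forall>k\<in>LambdaHalf k1 k2. C k \<noteq> 0) \<and>
             (\<forall>h\<in>L2h. A h =
                (\<Sum>k\<in>LambdaHalf k1 k2. scale_fun (C k)
                   (rank_one (harm_monom k) (harm_monom (k - k1 - k2)) h -
                    rank_one (harm_monom (- k + k1 + k2)) (harm_monom (- k)) h)))"
    "odd (k1 + k2) \<Longrightarrow> int (op_rank A) = \<bar>k1\<bar> + \<bar>k2\<bar> - 1"
    "even (k1 + k2) \<Longrightarrow> int (op_rank A) = \<bar>k1\<bar> + \<bar>k2\<bar> - 2"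
proof -
  let ?c = "comm_coeff k1 k2 m \<phi>"
  have L: "{k. ?c (k - k1 - k2) \<noteq> 0} = Lambda1 k1 k2" using supp by auto
  have e: "{n. ?c n \<noteq> 0} = (\<lambda>k. k - k1 - k2) ` Lambda1 k1 k2"
  proof (intro set_eqI iffI)
    fix n assume "n \<in> {n. ?c n \<noteq> 0}"
    then have "n + k1 + k2 \<in> Lambda1 k1 k2" using supp[of "n + k1 + k2"] by simp
    then have "n + k1 + k2 - k1 - k2 \<in> (\<lambda>k. k - k1 - k2) ` Lambda1 k1 k2" by (rule imageI)
    then show "n \<in> (\<lambda>k. k - k1 - k2) ` Lambda1 k1 k2" by simp
  qed (use supp in auto)
  have fin: "finite {n. ?c n \<noteq> 0}" unfolding e using finite_Lambda(1) by simp
  have card: "card {n. ?c n \<noteq> 0} = card (Lambda1 k1 k2)" unfolding e by (rule card_image) (auto simp: inj_on_def)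
  note F = commutator_finite_rank_iff[OF \<phi> m, of k1 k2, folded A_def]
  show "finite_rank A" using F(1) fin by simp
  show "Ran A = cfun.span (harm_monom ` Lambda1 k1 k2)" using F(2)[OF fin] unfolding L .
  show "odd (k1 + k2) \<Longrightarrow> int (op_rank A) = \<bar>k1\<bar> + \<bar>k2\<bar> - 1"
    "even (k1 + k2) \<Longrightarrow> int (op_rank A) = \<bar>k1\<bar> + \<bar>k2\<bar> - 2"
    using F(3)[OF fin] card card_Lambda1[OF k] by simp_all
  \<comment> \<open>The last factor undoes the division by |k - k1 - k2| + 1 in the inner product
    with the monomial; in the reflected term the factor |k| + 1 plays this part.\<close>
  define C where "C = (\<lambda>k. 4 * (of_int \<bar>k\<bar> + 1) * ?c (k - k1 - k2) * (of_int \<bar>k - k1 - k2\<bar> + 1))"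
  have C0: "C k \<noteq> 0" if "k \<in> LambdaHalf k1 k2" for k
    using that supp[of k] Lambda1_split(1)[of k1 k2] of_int_abs_plus1_nonzero[of k] of_int_abs_plus1_nonzero[of "k - k1 - k2"]
    unfolding C_def mult_eq_0_iff by auto
  have rep: "A h = (\<Sum>k\<in>LambdaHalf k1 k2. scale_fun (C k)
                   (rank_one (harm_monom k) (harm_monom (k - k1 - k2)) h -
                    rank_one (harm_monom (- k + k1 + k2)) (harm_monom (- k)) h))" if h: "h \<in> L2h" for h
  proof -
    obtain a where a: "l2w a" "h = hser a" using L2h_hser[OF h] by metis
    define g where "g = (\<lambda>k. 4 * (of_int \<bar>k\<bar> + 1) * ?c (k - k1 - k2) * a (k - k1 - k2))"
    have "A h = hser (wshift (k1 + k2) (\<lambda>n. 4 * (of_int \<bar>n + k1 + k2\<bar> + 1) * ?c n) a)"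
      using commutator_coeff(2)[OF \<phi> m h, of k1 k2] by (simp add: A_def a(2) hcoef_hser[OF a(1)])
    also have "wshift (k1 + k2) (\<lambda>n. 4 * (of_int \<bar>n + k1 + k2\<bar> + 1) * ?c n) a = g"
      unfolding wshift_def g_def by (simp add: diff_diff_eq)
    also have "hser g = (\<Sum>k\<in>Lambda1 k1 k2. scale_fun (g k) (harm_monom k))"
      by (rule hser_finite_sum[OF finite_Lambda(1)]) (use supp in \<open>auto simp: g_def\<close>)
    also have "\<dots> = (\<Sum>k\<in>LambdaHalf k1 k2. scale_fun (g k) (harm_monom k)) + (\<Sum>k\<in>LambdaHalf k1 k2. scale_fun (g (k1 + k2 - k)) (harm_monom (k1 + k2 - k)))"
      unfolding Lambda1_split(1) using finite_Lambda(2) Lambda1_split(2)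
      by (subst sum.union_disjoint) (auto simp: sum.reindex inj_on_def)
    also have "\<dots> = (\<Sum>k\<in>LambdaHalf k1 k2. scale_fun (g k) (harm_monom k) + scale_fun (g (k1 + k2 - k)) (harm_monom (k1 + k2 - k)))"
      by (rule sum.distrib[symmetric])
    also have "\<dots> = (\<Sum>k\<in>LambdaHalf k1 k2. scale_fun (C k)
                   (rank_one (harm_monom k) (harm_monom (k - k1 - k2)) h -
                    rank_one (harm_monom (- k + k1 + k2)) (harm_monom (- k)) h))"
    proof (intro sum.cong refl)
      fix k
      have r1: "rank_one (harm_monom k) (harm_monom (k - k1 - k2)) h = scale_fun (a (k - k1 - k2) / (of_int \<bar>k - k1 - k2\<bar> + 1)) (harm_monom k)"
        using h by (simp only: rank_one_def restrict_apply' a(2) inner_hser_harm_monom[OF a(1)])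
      have r2: "rank_one (harm_monom (- k + k1 + k2)) (harm_monom (- k)) h = scale_fun (a (- k) / (of_int \<bar>k\<bar> + 1)) (harm_monom (k1 + k2 - k))"
      proof -
        have "- k + k1 + k2 = k1 + k2 - k" by simp
        then show ?thesis using h inner_hser_harm_monom[OF a(1), of "- k"]
          by (simp only: rank_one_def restrict_apply' a(2) abs_minus_cancel)
      qed
      have c1: "C k * (a (k - k1 - k2) / (of_int \<bar>k - k1 - k2\<bar> + 1)) = g k"
        unfolding C_def g_def using of_int_abs_plus1_nonzero[of "k - k1 - k2"] by (simp del: of_int_abs)
      have c2: "- (C k * (a (- k) / (of_int \<bar>k\<bar> + 1))) = g (k1 + k2 - k)"
      proof -
        have e1: "k1 + k2 - k - k1 - k2 = - k" "\<bar>k1 + k2 - k\<bar> = \<bar>k - k1 - k2\<bar>" by linarith+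
        have c': "?c (- k) = - ?c (k - k1 - k2)" using comm_coeff_antisym[of k1 k2 m \<phi> "k - k1 - k2"] by (simp add: algebra_simps)
        have alg: "- (4 * X * c * Y * (b / X)) = 4 * Y * (- c) * b" if "X \<noteq> 0" for X Y b c :: complex
          using that by (simp add: field_simps)
        show ?thesis unfolding C_def g_def e1 c' by (rule alg[OF of_int_abs_plus1_nonzero])
      qed
      show "scale_fun (g k) (harm_monom k) + scale_fun (g (k1 + k2 - k)) (harm_monom (k1 + k2 - k)) = scale_fun (C k)
                   (rank_one (harm_monom k) (harm_monom (k - k1 - k2)) h -
                    rank_one (harm_monom (- k + k1 + k2)) (harm_monom (- k)) h)"
        unfolding r1 r2 c1[symmetric] c2[symmetric] by (auto simp: scale_fun_def algebra_simps)
    qed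
    finally show ?thesis .
  qed
  show "\<exists>C :: int \<Rightarrow> complex. (\<forall>k\<in>LambdaHalf k1 k2. C k \<noteq> 0) \<and>
             (\<forall>h\<in>L2h. A h =
                (\<Sum>k\<in>LambdaHalf k1 k2. scale_fun (C k)
                   (rank_one (harm_monom k) (harm_monom (k - k1 - k2)) h -
                    rank_one (harm_monom (- k + k1 + k2)) (harm_monom (- k)) h)))"
    using C0 rep by blast
qed

section \<open>The Mellin transform\<close>

lemma powr_eq_exp: "r > 0 \<Longrightarrow> complex_of_real r powr s = exp (s * of_real (ln r))"
  by (simp add: powr_def Ln_of_real)

lemma norm_powr_le_1:
  assumes "0 < r" "r < 1" "Re s \<ge> 0"
  shows "cmod (complex_of_real r powr s) \<le> 1"
  using assms by (simp add: powr_eq_exp mult_nonneg_nonpos)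

text \<open>For Re s \<ge> 2 the integrand is dominated by |\<psi>|. For holomorphy, r^(w - z0) is
  expanded in powers of w - z0 on the largest ball around \<open>z0\<close> inside the half-plane:
  there exp(|w - z0| |ln r|) is absorbed by r^(Re z0 - 2), so the exponential series can be
  integrated term by term.\<close>

lemma mellin_props:
  assumes ri: "radial_integrable \<phi>"
  shows mellin_bounded_halfplane: "\<exists>M. \<forall>z. Re z \<ge> 2 \<longrightarrow> cmod (mellin \<phi> z) \<le> M"
    and mellin_continuous: "continuous_on {z. Re z \<ge> 2} (mellin \<phi>)"
    and mellin_holomorphic: "mellin \<phi> holomorphic_on {z. Re z > 2}"
proof -
  obtain \<psi> where \<psi>: "\<psi> \<in> borel_measurable borel" "integrable dr2 \<psi>"
    "\<forall>s. mellin \<phi> s = (\<integral>r. \<psi> r * complex_of_real r powr (s - 2) \<partial>dr2) / 2"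
    using radial_integrableE[OF ri] by metis
  note [measurable] = \<psi>(1)
  have m: "(\<lambda>r. \<psi> r * complex_of_real r powr (s - 2)) \<in> borel_measurable dr2" for s
    by (rule borel_measurable_dr2) measurable
  have n: "integrable dr2 (\<lambda>r. cmod (\<psi> r))" using \<psi>(2) by auto
  have b: "AE r in dr2. norm (\<psi> r * complex_of_real r powr (s - 2)) \<le> cmod (\<psi> r)" if "Re s \<ge> 2" for s
    unfolding AE_dr2 using that norm_powr_le_1[of _ "s - 2"] by (intro AE_I2) (auto simp: norm_mult intro!: mult_left_le)
  show "\<exists>M. \<forall>z. Re z \<ge> 2 \<longrightarrow> cmod (mellin \<phi> z) \<le> M"
  proof (intro exI[of _ "(\<integral>r. cmod (\<psi> r) \<partial>dr2) / 2"] allI impI)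
    fix z assume z: "Re z \<ge> 2"
    have "integrable dr2 (\<lambda>r. \<psi> r * complex_of_real r powr (z - 2))"
      by (rule Bochner_Integration.integrable_bound[OF n m]) (use b[OF z] in auto)
    then have "cmod (\<integral>r. \<psi> r * complex_of_real r powr (z - 2) \<partial>dr2) \<le> (\<integral>r. cmod (\<psi> r) \<partial>dr2)"
      by (intro order_trans[OF integral_norm_bound integral_mono_AE] integrable_norm n b[OF z])
    then show "cmod (mellin \<phi> z) \<le> (\<integral>r. cmod (\<psi> r) \<partial>dr2) / 2"
      unfolding \<psi>(3)[rule_format, of z] norm_divide by simp
  qed
  show "continuous_on {z. Re z \<ge> 2} (mellin \<phi>)"
  proof (rule continuous_on_sequentiallyI)
    fix u a assume u: "\<forall>n. u n \<in> {z. Re z \<ge> 2}" "a \<in> {z. Re z \<ge> 2}" "u \<longlonglongrightarrow> a"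
    have "(\<lambda>n. \<integral>r. \<psi> r * complex_of_real r powr (u n - 2) \<partial>dr2) \<longlonglongrightarrow> (\<integral>r. \<psi> r * complex_of_real r powr (a - 2) \<partial>dr2)"
    proof (rule integral_dominated_convergence[OF m m n])
      show "AE r in dr2. (\<lambda>n. \<psi> r * complex_of_real r powr (u n - 2)) \<longlonglongrightarrow> \<psi> r * complex_of_real r powr (a - 2)"
        unfolding AE_dr2 by (rule AE_I2) (auto simp: powr_eq_exp intro!: tendsto_intros u(3))
    qed (use b u(1) in auto)
    then show "(\<lambda>n. mellin \<phi> (u n)) \<longlonglongrightarrow> mellin \<phi> a"
      by (simp only: \<psi>(3)) (intro tendsto_divide tendsto_const, auto)
  qed
  have "mellin \<phi> holomorphic_on ball z0 (Re z0 - 2)" if z0: "Re z0 > 2" for z0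
  proof (rule power_series_holomorphic)
    fix w assume w: "w \<in> ball z0 (Re z0 - 2)"
    define h where "h = w - z0"
    have h: "cmod h < Re z0 - 2" using w by (simp add: h_def dist_norm norm_minus_commute)
    define t where "t = (\<lambda>k r. (h * of_real (ln r)) ^ k /\<^sub>R fact k * (\<psi> r * complex_of_real r powr (z0 - 2)))"
    have tm: "(\<lambda>r. \<Sum>k<K. t k r) \<in> borel_measurable dr2" for K
      unfolding t_def by (rule borel_measurable_dr2) measurable
    have tm1: "t k \<in> borel_measurable dr2" for k
      unfolding t_def by (rule borel_measurable_dr2) measurable
    \<comment> \<open>The first part dominates the partial sums in the limit, the second gives the
      integrability of single terms.\<close>
    have bd: "cmod (\<Sum>k<K. (h * of_real (ln r)) ^ k /\<^sub>R fact k * (\<psi> r * complex_of_real r powr (z0 - 2))) \<le> cmod (\<psi> r) \<and>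
       (\<Sum>k<K. cmod ((h * of_real (ln r)) ^ k /\<^sub>R fact k * (\<psi> r * complex_of_real r powr (z0 - 2)))) \<le> cmod (\<psi> r)"
      if r: "0 < r" "r < 1" for r K
    proof -
      define x where "x = h * complex_of_real (ln r)"
      have lr: "ln r < 0" using r by simp
      have nx: "cmod x = - cmod h * ln r" using lr by (simp add: x_def norm_mult)
      have "(\<Sum>k<K. cmod (x ^ k /\<^sub>R fact k)) = (\<Sum>k<K. cmod x ^ k /\<^sub>R fact k)" by (simp add: norm_power)
      also have "\<dots> \<le> (\<Sum>k. cmod x ^ k /\<^sub>R fact k)"
        by (rule sum_le_suminf[OF summable_exp_generic]) auto
      also have "\<dots> = exp (cmod x)" by (simp add: exp_def)
      finally have s1: "(\<Sum>k<K. cmod (x ^ k /\<^sub>R fact k)) \<le> exp (cmod x)" .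
      have "cmod (complex_of_real r powr (z0 - 2)) = exp ((Re z0 - 2) * ln r)" using r by (simp add: powr_eq_exp)
      then have "exp (cmod x) * cmod (complex_of_real r powr (z0 - 2)) = exp ((Re z0 - 2 - cmod h) * ln r)"
        by (simp add: nx algebra_simps flip: exp_add)
      also have "\<dots> \<le> 1" using h lr by (simp add: mult_nonneg_nonpos)
      finally have e: "exp (cmod x) * cmod (complex_of_real r powr (z0 - 2)) \<le> 1" .
      have "(\<Sum>k<K. cmod (x ^ k /\<^sub>R fact k * (\<psi> r * complex_of_real r powr (z0 - 2)))) = (\<Sum>k<K. cmod (x ^ k /\<^sub>R fact k)) * cmod (complex_of_real r powr (z0 - 2)) * cmod (\<psi> r)"
        by (simp add: norm_mult sum_distrib_right sum_distrib_left mult_ac)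
      also have "\<dots> \<le> (exp (cmod x) * cmod (complex_of_real r powr (z0 - 2))) * cmod (\<psi> r)"
        using s1 by (intro mult_right_mono) auto
      also have "\<dots> \<le> cmod (\<psi> r)" using mult_right_mono[OF e norm_ge_zero[of "\<psi> r"]] by simp
      finally have 2: "(\<Sum>k<K. cmod (x ^ k /\<^sub>R fact k * (\<psi> r * complex_of_real r powr (z0 - 2)))) \<le> cmod (\<psi> r)" .
      then have "cmod (\<Sum>k<K. x ^ k /\<^sub>R fact k * (\<psi> r * complex_of_real r powr (z0 - 2))) \<le> cmod (\<psi> r)"
        by (rule order_trans[OF norm_sum])
      with 2 show ?thesis by (simp add: x_def)
    qed
    have ti: "integrable dr2 (t k)" for k
    proof (rule Bochner_Integration.integrable_bound[OF n tm1])
      have "cmod (t k r) \<le> cmod (\<psi> r)" if r: "0 < r" "r < 1" for r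
      proof -
        have "cmod (t k r) \<le> (\<Sum>k<Suc k. cmod (t k r))" by (rule member_le_sum) auto
        also have "\<dots> \<le> cmod (\<psi> r)" using bd[OF r, of "Suc k"] unfolding t_def by blast
        finally show ?thesis .
      qed
      then show "AE r in dr2. norm (t k r) \<le> norm (cmod (\<psi> r))" unfolding AE_dr2 by (intro AE_I2) auto
    qed
    have "(\<lambda>K. \<integral>r. (\<Sum>k<K. t k r) \<partial>dr2) \<longlonglongrightarrow> (\<integral>r. \<psi> r * complex_of_real r powr (w - 2) \<partial>dr2)"
    proof (rule integral_dominated_convergence[OF m tm n])
      show "AE r in dr2. (\<lambda>K. \<Sum>k<K. t k r) \<longlonglongrightarrow> \<psi> r * complex_of_real r powr (w - 2)"
        unfolding AE_dr2
      proof (rule AE_I2, rule impI)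
        fix r :: real assume r: "0 < r \<and> r < 1"
        have "(\<lambda>k. (h * of_real (ln r)) ^ k /\<^sub>R fact k) sums exp (h * of_real (ln r))" by (rule exp_converges)
        then have "(\<lambda>k. t k r) sums (exp (h * of_real (ln r)) * (\<psi> r * complex_of_real r powr (z0 - 2)))"
          unfolding t_def by (rule sums_mult2)
        moreover have "exp (h * of_real (ln r)) * (\<psi> r * complex_of_real r powr (z0 - 2)) = \<psi> r * complex_of_real r powr (w - 2)"
          using r by (simp add: powr_eq_exp h_def algebra_simps flip: exp_add)
        ultimately show "(\<lambda>K. \<Sum>k<K. t k r) \<longlonglongrightarrow> \<psi> r * complex_of_real r powr (w - 2)" by (simp add: sums_def)
      qed
      show "AE r in dr2. norm (\<Sum>k<K. t k r) \<le> cmod (\<psi> r)" for K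
        unfolding AE_dr2 t_def using bd by (intro AE_I2) blast
    qed
    moreover have "(\<integral>r. (\<Sum>k<K. t k r) \<partial>dr2) = (\<Sum>k<K. \<integral>r. t k r \<partial>dr2)" for K
      using ti by (subst Bochner_Integration.integral_sum) auto
    ultimately have "(\<lambda>k. (\<integral>r. t k r \<partial>dr2)) sums (\<integral>r. \<psi> r * complex_of_real r powr (w - 2) \<partial>dr2)"
      by (simp add: sums_def)
    then have "(\<lambda>k. (\<integral>r. t k r \<partial>dr2) / 2) sums mellin \<phi> w"
      unfolding \<psi>(3)[rule_format, of w] by (rule sums_divide)
    moreover have "(\<integral>r. t k r \<partial>dr2) / 2 = ((\<integral>r. of_real (ln r) ^ k /\<^sub>R fact k * (\<psi> r * complex_of_real r powr (z0 - 2)) \<partial>dr2) / 2) * (w - z0) ^ k" for k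
    proof -
      have "(\<integral>r. t k r \<partial>dr2) = (\<integral>r. h ^ k * (of_real (ln r) ^ k /\<^sub>R fact k * (\<psi> r * complex_of_real r powr (z0 - 2))) \<partial>dr2)"
        unfolding t_def by (intro Bochner_Integration.integral_cong refl) (simp add: power_mult_distrib)
      then show ?thesis by (simp add: h_def)
    qed
    ultimately show "(\<lambda>k. ((\<integral>r. of_real (ln r) ^ k /\<^sub>R fact k * (\<psi> r * complex_of_real r powr (z0 - 2)) \<partial>dr2) / 2) * (w - z0) ^ k) sums mellin \<phi> w"
      by simp
  qed
  then have "\<exists>d. (mellin \<phi> has_field_derivative d) (at z0)" if "Re z0 > 2" for z0
    using holomorphic_derivI[of "mellin \<phi>" "ball z0 (Re z0 - 2)" z0 UNIV] that by auto
  then show "mellin \<phi> holomorphic_on {z. Re z > 2}"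
    unfolding holomorphic_on_def field_differentiable_def by (auto intro: has_field_derivative_at_within)
qed

section \<open>Uniqueness from moments\<close>

text \<open>By the Stone-Weierstrass theorem the integral of \<open>f\<close> against every
  continuous function vanishes, hence in the limit also against indicators of rays. The positive and
  negative parts of \<open>f\<close> therefore define the same measure, and densities are unique
  almost everywhere.\<close>

lemma zero_moments_imp_AE_zero:
  fixes f :: "real \<Rightarrow> real"
  assumes f: "f \<in> borel_measurable borel" "integrable dr2 f" and mom: "\<And>j. (\<integral>r. f r * r ^ j \<partial>dr2) = 0"
  shows "AE r in dr2. f r = 0"
proof -
  note [measurable] = f(1)
  have fm: "f \<in> borel_measurable dr2" by (rule borel_measurable_dr2[OF f(1)])
  have AE01: "AE r in dr2. r \<in> {0<..<1}" unfolding AE_dr2 by simp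
  have bint: "integrable dr2 (\<lambda>r. f r * g r)" if "g \<in> borel_measurable borel" "\<And>r. r \<in> {0<..<1} \<Longrightarrow> \<bar>g r\<bar> \<le> B" for g B
  proof (rule Bochner_Integration.integrable_bound)
    show "integrable dr2 (\<lambda>r. B * norm (f r))" using f(2) by (intro integrable_mult_right integrable_norm)
    show "(\<lambda>r. f r * g r) \<in> borel_measurable dr2" using that(1) by (intro borel_measurable_dr2) measurable
    show "AE r in dr2. norm (f r * g r) \<le> norm (B * norm (f r))"
      using AE01
    proof eventually_elim
      case (elim r)
      have "\<bar>g r\<bar> * \<bar>f r\<bar> \<le> B * \<bar>f r\<bar>" using that(2)[OF elim] by (intro mult_right_mono) auto
      also have "\<dots> \<le> \<bar>B\<bar> * \<bar>f r\<bar>" by (intro mult_right_mono) auto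
      finally have "\<bar>g r\<bar> * \<bar>f r\<bar> \<le> \<bar>B\<bar> * \<bar>f r\<bar>" .
      then show ?case by (simp add: abs_mult mult.commute)
    qed
  qed
  have cont: "(\<integral>r. f r * g r \<partial>dr2) = 0" if g: "continuous_on UNIV g" for g :: "real \<Rightarrow> real"
  proof -
    define I where "I = (\<integral>r. norm (f r) \<partial>dr2)"
    have gm [measurable]: "g \<in> borel_measurable borel" using g by (rule borel_measurable_continuous_onI)
    have "\<bar>\<integral>r. f r * g r \<partial>dr2\<bar> \<le> 0 + e" if e: "e > 0" for e
    proof -
      define e' where "e' = e / (I + 1)"
      have I: "I \<ge> 0" unfolding I_def by (rule integral_nonneg_AE) simp
      have e': "e' > 0" using e I by (simp add: e'_def)
      obtain p where p: "real_polynomial_function p" "\<And>x. x \<in> {0..1} \<Longrightarrow> \<bar>g x - p x\<bar> < e'"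
        using Stone_Weierstrass_real_polynomial_function[of "{0..1::real}" g e'] e' continuous_on_subset[OF g]
        by auto
      obtain a n where pa: "p = (\<lambda>x. \<Sum>i\<le>n. a i * x ^ i)" using p(1) unfolding real_polynomial_function_iff_sum by blast
      have [measurable]: "p \<in> borel_measurable borel" unfolding pa by measurable
      have pi: "integrable dr2 (\<lambda>r. f r * r ^ i)" for i
        by (rule bint[of _ 1]) (auto intro!: power_le_one)
      have "(\<integral>r. f r * p r \<partial>dr2) = (\<integral>r. (\<Sum>i\<le>n. a i * (f r * r ^ i)) \<partial>dr2)"
        unfolding pa by (intro Bochner_Integration.integral_cong refl) (simp add: sum_distrib_left mult_ac)
      also have "\<dots> = 0" using pi mom by (subst Bochner_Integration.integral_sum) auto
      finally have p0: "(\<integral>r. f r * p r \<partial>dr2) = 0" .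
      have pint: "integrable dr2 (\<lambda>r. f r * p r)" unfolding pa sum_distrib_left
        using pi by (intro Bochner_Integration.integrable_sum) (simp add: mult.left_commute)
      have dint: "integrable dr2 (\<lambda>r. f r * (g r - p r))"
        by (rule bint[of _ e']) (use p(2) in \<open>auto intro: less_imp_le\<close>)
      have "integrable dr2 (\<lambda>r. f r * (g r - p r) + f r * p r)" by (rule Bochner_Integration.integrable_add[OF dint pint])
      then have "(\<integral>r. f r * g r \<partial>dr2) = (\<integral>r. f r * (g r - p r) \<partial>dr2) + (\<integral>r. f r * p r \<partial>dr2)"
        using dint pint by (subst Bochner_Integration.integral_add[symmetric]) (auto simp: algebra_simps)
      then have "\<bar>\<integral>r. f r * g r \<partial>dr2\<bar> = norm (\<integral>r. f r * (g r - p r) \<partial>dr2)" using p0 by simp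
      also have "\<dots> \<le> (\<integral>r. e' * norm (f r) \<partial>dr2)"
      proof (rule order_trans[OF integral_norm_bound integral_mono_AE])
        show "integrable dr2 (\<lambda>r. norm (f r * (g r - p r)))" using dint by auto
        show "integrable dr2 (\<lambda>r. e' * norm (f r))" using f(2) by auto
        show "AE r in dr2. norm (f r * (g r - p r)) \<le> e' * norm (f r)"
          using AE01
        proof eventually_elim
          case (elim r)
          have "\<bar>f r\<bar> * \<bar>g r - p r\<bar> \<le> \<bar>f r\<bar> * e'" using p(2)[of r] elim by (intro mult_left_mono) auto
          then show ?case by (simp add: abs_mult mult.commute)
        qed
      qed
      also have "\<dots> = e' * I" by (simp add: I_def)
      also have "\<dots> \<le> e' * (I + 1)" using e' by simp
      also have "\<dots> = e" using I by (simp add: e'_def)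
      finally show ?thesis by simp
    qed
    then have "\<bar>\<integral>r. f r * g r \<partial>dr2\<bar> \<le> 0" by (rule field_le_epsilon)
    then show ?thesis by simp
  qed
  have tail: "(\<integral>r. f r * indicator {x<..} r \<partial>dr2) = 0" for x
  proof -
    \<comment> \<open>Continuous ramps that converge to the indicator of the ray.\<close>
    define g where "g = (\<lambda>(n::nat) r. min 1 (max 0 (real n * (r - x))))"
    have "(\<lambda>n. \<integral>r. f r * g n r \<partial>dr2) \<longlonglongrightarrow> (\<integral>r. f r * indicator {x<..} r \<partial>dr2)"
    proof (rule integral_dominated_convergence)
      show "integrable dr2 (\<lambda>r. norm (f r))" using f(2) by auto
      have "(\<lambda>n. g n r) \<longlonglongrightarrow> indicator {x<..} r" for r
      proof (cases "r > x")
        case True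
        obtain N :: nat where N: "real N * (r - x) > 1" using True reals_Archimedean3[of "r - x"] by auto
        have "\<forall>\<^sub>F n in sequentially. g n r = 1"
          using eventually_ge_at_top[of N]
        proof eventually_elim
          case (elim n)
          have "real N * (r - x) \<le> real n * (r - x)" using elim True by (intro mult_right_mono) auto
          then show ?case using N by (simp add: g_def)
        qed
        then show ?thesis using True by (simp add: tendsto_eventually)
      next
        case False
        then have "g n r = 0" for n by (simp add: g_def mult_nonneg_nonpos)
        then show ?thesis using False by simp
      qed
      then show "AE r in dr2. (\<lambda>n. f r * g n r) \<longlonglongrightarrow> f r * indicator {x<..} r" by (intro AE_I2 tendsto_intros)
      show "AE r in dr2. norm (f r * g n r) \<le> norm (f r)" for n
        by (intro AE_I2) (auto simp: g_def abs_mult intro!: mult_left_le)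
    qed (auto simp: g_def intro!: borel_measurable_dr2)
    moreover have "(\<integral>r. f r * g n r \<partial>dr2) = 0" for n
      by (rule cont) (auto simp: g_def intro!: continuous_intros)
    ultimately show ?thesis by (simp add: LIMSEQ_const_iff)
  qed
  have fin: "finite_measure dr2"
    using finite_measure.finite_measure_distr[OF finite_measure_dAb measurable_cmod_dAb] by (simp add: distr_dAb_cmod)
  interpret D: finite_measure dr2 by (rule fin)
  define fp where "fp = (\<lambda>r. max 0 (f r))" define fn where "fn = (\<lambda>r. max 0 (- f r))"
  have fpn [measurable]: "fp \<in> borel_measurable borel" "fn \<in> borel_measurable borel" unfolding fp_def fn_def by measurable
  have ip: "integrable dr2 (\<lambda>r. fp r * indicator A r)" "integrable dr2 (\<lambda>r. fn r * indicator A r)" if "A \<in> sets borel" for A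
    by (rule Bochner_Integration.integrable_bound[OF f(2)]; use that in \<open>auto simp: fp_def fn_def indicator_def intro!: borel_measurable_dr2\<close>)+
  have em: "emeasure (density dr2 (\<lambda>r. ennreal (fp r))) A = ennreal (\<integral>r. fp r * indicator A r \<partial>dr2)"
    "emeasure (density dr2 (\<lambda>r. ennreal (fn r))) A = ennreal (\<integral>r. fn r * indicator A r \<partial>dr2)" if A: "A \<in> sets borel" for A
  proof -
    have "emeasure (density dr2 (\<lambda>r. ennreal (fp r))) A = (\<integral>\<^sup>+r. ennreal (fp r * indicator A r) \<partial>dr2)"
      using A by (subst emeasure_density) (auto intro!: borel_measurable_dr2 nn_integral_cong split: split_indicator)
    also have "\<dots> = ennreal (\<integral>r. fp r * indicator A r \<partial>dr2)"
      by (rule nn_integral_eq_integral[OF ip(1)[OF A]]) (auto simp: fp_def)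
    finally show "emeasure (density dr2 (\<lambda>r. ennreal (fp r))) A = ennreal (\<integral>r. fp r * indicator A r \<partial>dr2)" .
    have "emeasure (density dr2 (\<lambda>r. ennreal (fn r))) A = (\<integral>\<^sup>+r. ennreal (fn r * indicator A r) \<partial>dr2)"
      using A by (subst emeasure_density) (auto intro!: borel_measurable_dr2 nn_integral_cong split: split_indicator)
    also have "\<dots> = ennreal (\<integral>r. fn r * indicator A r \<partial>dr2)"
      by (rule nn_integral_eq_integral[OF ip(2)[OF A]]) (auto simp: fn_def)
    finally show "emeasure (density dr2 (\<lambda>r. ennreal (fn r))) A = ennreal (\<integral>r. fn r * indicator A r \<partial>dr2)" .
  qed
  have "density dr2 (\<lambda>r. ennreal (fp r)) = density dr2 (\<lambda>r. ennreal (fn r))"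
  proof (rule measure_eqI_lessThan)
    fix x :: real
    have "(\<integral>r. fp r * indicator {x<..} r - fn r * indicator {x<..} r \<partial>dr2) = (\<integral>r. f r * indicator {x<..} r \<partial>dr2)"
      by (intro Bochner_Integration.integral_cong refl) (auto simp: fp_def fn_def split: split_indicator)
    then have "(\<integral>r. fp r * indicator {x<..} r \<partial>dr2) = (\<integral>r. fn r * indicator {x<..} r \<partial>dr2)"
      using ip[of "{x<..}"] tail[of x] by (simp add: Bochner_Integration.integral_diff)
    then show "emeasure (density dr2 (\<lambda>r. ennreal (fp r))) {x<..} = emeasure (density dr2 (\<lambda>r. ennreal (fn r))) {x<..}"
      by (simp add: em)
    show "emeasure (density dr2 (\<lambda>r. ennreal (fp r))) {x<..} < \<infinity>" by (simp add: em less_top[symmetric])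
  qed auto
  then have "AE r in dr2. ennreal (fp r) = ennreal (fn r)"
    by (intro D.density_unique) (auto intro!: borel_measurable_dr2)
  then show ?thesis by eventually_elim (auto simp: fp_def fn_def max_def split: if_splits)
qed

text \<open>Multiplying by r^n0 turns the large moments of \<psi> into all moments of a new function
  with the same zeros in (0, 1).\<close>

lemma mellin_zero_imp_radial_zero:
  assumes ri: "radial_integrable \<phi>" and zero: "\<And>n::nat. n \<ge> n0 \<Longrightarrow> mellin \<phi> (of_nat n) = 0"
  shows "radial_eq \<phi> (\<lambda>r. 0)"
proof -
  obtain \<psi> where \<psi>: "\<psi> \<in> borel_measurable borel" "AE r in lborel. 0 < r \<and> r < 1 \<longrightarrow> \<phi> r = \<psi> r" "integrable dr2 \<psi>"
    "\<forall>s. mellin \<phi> s = (\<integral>r. \<psi> r * complex_of_real r powr (s - 2) \<partial>dr2) / 2"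
    by (rule radial_integrableE[OF ri], rule that)
  note [measurable] = \<psi>(1)
  have int: "integrable dr2 (\<lambda>r. \<psi> r * of_real (r ^ j))" for j
  proof (rule Bochner_Integration.integrable_bound[OF \<psi>(3)])
    show "AE r in dr2. norm (\<psi> r * of_real (r ^ j)) \<le> norm (\<psi> r)"
      unfolding AE_dr2 by (rule AE_I2) (auto simp: norm_mult norm_power intro!: mult_left_le power_le_one)
  qed (rule borel_measurable_dr2, measurable)
  have mom: "(\<integral>r. \<psi> r * of_real (r ^ (n0 + j)) \<partial>dr2) = 0" for j
    using mellin_nat[OF \<psi>(1) \<psi>(4)[rule_format], of "n0 + j"] zero[of "n0 + j + 2"] by simp
  have "AE r in dr2. Re (\<psi> r) * r ^ n0 = 0"
  proof (rule zero_moments_imp_AE_zero)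
    show "integrable dr2 (\<lambda>r. Re (\<psi> r) * r ^ n0)" using integrable_Re[OF int[of n0]] by simp
    show "(\<integral>r. Re (\<psi> r) * r ^ n0 * r ^ j \<partial>dr2) = 0" for j
      using integral_Re[OF int[of "n0 + j"]] mom[of j] by (simp add: power_add mult.assoc)
  qed measurable
  moreover have "AE r in dr2. Im (\<psi> r) * r ^ n0 = 0"
  proof (rule zero_moments_imp_AE_zero)
    show "integrable dr2 (\<lambda>r. Im (\<psi> r) * r ^ n0)" using integrable_Im[OF int[of n0]] by simp
    show "(\<integral>r. Im (\<psi> r) * r ^ n0 * r ^ j \<partial>dr2) = 0" for j
      using integral_Im[OF int[of "n0 + j"]] mom[of j] by (simp add: power_add mult.assoc)
  qed measurable
  ultimately have "AE r in lborel. 0 < r \<and> r < 1 \<longrightarrow> \<phi> r = 0"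
    unfolding AE_dr2 using \<psi>(2) by eventually_elim (auto simp: complex_eq_iff)
  then show ?thesis unfolding radial_eq_def by (rule AE_dA_radialI)
qed

text \<open>Written as an integral over the disk, a moment inherits linearity and invariance under
  equality almost everywhere from \<open>dA\<close>.\<close>

lemma mellin_nat_quasihom:
  assumes "radial_integrable \<phi>"
  shows "2 * mellin \<phi> (of_nat (s + 2)) = (\<integral>w. quasihom (int s) \<phi> w * harm_monom 0 w * cnj (harm_monom (int s) w) \<partial>dA)"
  by (subst integral_quasihom[OF assms]) simp

lemma integrable_quasihom_product:
  assumes "radial_integrable \<phi>"
  shows "integrable dA (\<lambda>w. quasihom k \<phi> w * harm_monom j w * cnj (harm_monom n w))"
proof (rule Bochner_Integration.integrable_bound[OF quasihom_measurable_integrable[OF assms, of k j]])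
  show "(\<lambda>w. quasihom k \<phi> w * harm_monom j w * cnj (harm_monom n w)) \<in> borel_measurable dA"
    by (intro borel_measurable_times[OF borel_measurable_integrable[OF quasihom_measurable_integrable[OF assms]]] borel_measurable_dA)
      measurable
qed (auto simp: norm_mult intro!: mult_left_le norm_harm_monom_le)

lemma radial_integrable_diff:
  assumes "radial_integrable \<phi>" "radial_integrable \<eta>"
  shows "radial_integrable (\<lambda>r. \<phi> r - C * \<eta> r)"
  using assms unfolding radial_integrable_def by auto

lemma mellin_nat_diff:
  assumes "radial_integrable \<phi>" "radial_integrable \<eta>" "n \<ge> 2"
  shows "mellin (\<lambda>r. \<phi> r - C * \<eta> r) (of_nat n) = mellin \<phi> (of_nat n) - C * mellin \<eta> (of_nat n)"
proof -
  obtain s where s: "n = s + 2" using assms(3) by (metis add.commute le_Suc_ex)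
  have "2 * mellin (\<lambda>r. \<phi> r - C * \<eta> r) (of_nat n) = (\<integral>w. quasihom (int s) \<phi> w * harm_monom 0 w * cnj (harm_monom (int s) w)
      - C * (quasihom (int s) \<eta> w * harm_monom 0 w * cnj (harm_monom (int s) w)) \<partial>dA)"
    unfolding s mellin_nat_quasihom[OF radial_integrable_diff[OF assms(1,2)]]
    by (intro Bochner_Integration.integral_cong refl) (simp add: quasihom_def algebra_simps)
  also have "\<dots> = 2 * mellin \<phi> (of_nat n) - C * (2 * mellin \<eta> (of_nat n))"
    unfolding s mellin_nat_quasihom[OF assms(1)] mellin_nat_quasihom[OF assms(2)]
    using integrable_quasihom_product[OF assms(1)] integrable_quasihom_product[OF assms(2)]
    by (subst Bochner_Integration.integral_diff) auto
  finally have "2 * mellin (\<lambda>r. \<phi> r - C * \<eta> r) (of_nat n) = 2 * (mellin \<phi> (of_nat n) - C * mellin \<eta> (of_nat n))"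
    by (simp add: algebra_simps)
  then show ?thesis unfolding mult_cancel_left by simp
qed

lemma mellin_nat_cong:
  assumes "radial_integrable \<phi>" "radial_integrable \<eta>" "radial_eq \<phi> \<eta>" "n \<ge> 2"
  shows "mellin \<phi> (of_nat n) = mellin \<eta> (of_nat n)"
proof -
  obtain s where s: "n = s + 2" using assms(4) by (metis add.commute le_Suc_ex)
  have "2 * mellin \<phi> (of_nat n) = 2 * mellin \<eta> (of_nat n)"
    unfolding s mellin_nat_quasihom[OF assms(1)] mellin_nat_quasihom[OF assms(2)]
    by (rule integral_cong_AE[OF borel_measurable_integrable[OF integrable_quasihom_product[OF assms(1)]]
          borel_measurable_integrable[OF integrable_quasihom_product[OF assms(2)]]])
      (use assms(3) in \<open>auto simp: radial_eq_def quasihom_def elim: eventually_mono\<close>)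
  then show ?thesis unfolding mult_cancel_left by simp
qed

lemma radial_eq_of_mellin:
  assumes "radial_integrable \<phi>" "radial_integrable \<eta>"
    and "\<And>n::nat. n \<ge> n0 \<Longrightarrow> mellin \<phi> (of_nat n) = C * mellin \<eta> (of_nat n)"
  shows "radial_eq \<phi> (\<lambda>r. C * \<eta> r)"
proof -
  have "radial_eq (\<lambda>r. \<phi> r - C * \<eta> r) (\<lambda>r. 0)"
    by (rule mellin_zero_imp_radial_zero[OF radial_integrable_diff[OF assms(1,2)], of "max n0 2"])
      (simp add: mellin_nat_diff assms)
  then show ?thesis unfolding radial_eq_def by (rule eventually_mono) simp
qed

text \<open>Factors that might vanish are multiplied out beforehand, so both sides are holomorphic
  for Re z > 2 and analytic continuation applies. The boundary line Re z = 2 follows by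
  continuity.\<close>

lemma mellin_identity_extend:
  assumes ri: "radial_integrable \<phi>" and P: "P holomorphic_on UNIV" and Q: "Q holomorphic_on UNIV"
    and eq: "\<And>z. Re z > x0 \<Longrightarrow> mellin \<phi> z * P z = Q z" and z: "Re z \<ge> 2"
  shows "mellin \<phi> z * P z = Q z"
proof -
  have opn: "mellin \<phi> w * P w = Q w" if w: "Re w > 2" for w
  proof (rule analytic_continuation_open[of "{w. Re w > max x0 2}" "{w. Re w > 2}" "\<lambda>w. mellin \<phi> w * P w" Q])
    show "{w. Re w > max x0 2} \<noteq> {}" by (auto intro!: exI[of _ "of_real (max x0 2 + 1)"])
    show "open {w. Re w > max x0 2}" "open {w::complex. Re w > 2}" by (rule open_halfspace_Re_gt)+
    show "connected {w::complex. Re w > 2}" by (simp add: convex_connected convex_halfspace_Re_gt)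
    show "(\<lambda>w. mellin \<phi> w * P w) holomorphic_on {w. Re w > 2}"
      by (intro holomorphic_intros mellin_holomorphic[OF ri] holomorphic_on_subset[OF P]) auto
    show "Q holomorphic_on {w. Re w > 2}" by (rule holomorphic_on_subset[OF Q]) auto
  qed (use w eq in auto)
  define D where "D = (\<lambda>w. mellin \<phi> w * P w - Q w)"
  have cD: "continuous_on {w. Re w \<ge> 2} D" unfolding D_def
    by (intro continuous_intros mellin_continuous[OF ri] holomorphic_on_imp_continuous_on holomorphic_on_subset[OF P] holomorphic_on_subset[OF Q]) auto
  have s: "(\<lambda>n. z + of_real (1 / real (Suc n))) \<longlonglongrightarrow> z + of_real 0"
    by (intro tendsto_intros LIMSEQ_Suc[OF lim_1_over_n])
  have "(\<lambda>n. D (z + of_real (1 / real (Suc n)))) \<longlonglongrightarrow> D z"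
    by (rule continuous_on_tendsto_compose[OF cD]) (use s z in \<open>auto simp del: of_nat_Suc intro!: always_eventually add_increasing2\<close>)
  moreover have "D (z + of_real (1 / real (Suc n))) = 0" for n
  proof -
    have "1 / real (Suc n) > 0" by simp
    then have "Re (z + of_real (1 / real (Suc n))) > 2"
      using z unfolding plus_complex.sel Re_complex_of_real by linarith
    then show ?thesis using opn[of "z + of_real (1 / real (Suc n))"] unfolding D_def by simp
  qed
  ultimately have "(\<lambda>n. 0) \<longlonglongrightarrow> D z" by simp
  then have "D z = 0" by (simp add: LIMSEQ_const_iff)
  then show ?thesis by (simp add: D_def)
qed

section \<open>The commutation relation\<close>

text \<open>The exponential of the mixed second difference, with steps \<delta> and \<mu>, of the
  function -ln Gamma. Its logarithmic derivative is thus a second difference of the digamma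
  function.\<close>

definition gquot :: "real \<Rightarrow> real \<Rightarrow> real \<Rightarrow> real" where
  "gquot \<delta> \<mu> u = Gamma (u + \<delta>) * Gamma (u + \<mu>) / (Gamma u * Gamma (u + \<delta> + \<mu>))"

text \<open>Equal values give, by the mean value theorem, a critical point \<xi> of the logarithm,
  that is, equal \<delta>-increments of the digamma function at \<xi> and \<xi> + \<mu>. A second
  application gives equal trigamma values at \<zeta> and \<zeta> + \<delta>, against strict
  monotonicity. The sign of \<delta> is arbitrary.\<close>

lemma gquot_inj:
  assumes \<mu>: "\<mu> > 0" and \<delta>: "\<delta> \<noteq> 0" and u: "0 < u1" "0 < u1 + \<delta>" "u1 < u2"
  shows "gquot \<delta> \<mu> u1 \<noteq> gquot \<delta> \<mu> u2"
proof
  assume eq: "gquot \<delta> \<mu> u1 = gquot \<delta> \<mu> u2"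
  define h where "h = (\<lambda>t. ln_Gamma (t + \<delta>) + ln_Gamma (t + \<mu>) - ln_Gamma t - ln_Gamma (t + \<delta> + \<mu>))"
  have gh: "gquot \<delta> \<mu> t = exp (h t)" if "t > 0" "t + \<delta> > 0" for t
    using that \<mu> by (simp add: gquot_def h_def Gamma_real_pos_exp exp_add exp_diff)
  have "h u1 = h u2" using eq gh[of u1] gh[of u2] u by simp
  have dh: "(h has_real_derivative (Digamma (t + \<delta>) + Digamma (t + \<mu>) - Digamma t - Digamma (t + \<delta> + \<mu>))) (at t)"
    if "t > 0" "t + \<delta> > 0" for t
    unfolding h_def using that \<mu> by (auto intro!: derivative_eq_intros)
  obtain \<xi> where \<xi>: "u1 < \<xi>" "\<xi> < u2" "h u2 - h u1 = (u2 - u1) * (Digamma (\<xi> + \<delta>) + Digamma (\<xi> + \<mu>) - Digamma \<xi> - Digamma (\<xi> + \<delta> + \<mu>))"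
    using MVT2[OF u(3), of h "\<lambda>t. Digamma (t + \<delta>) + Digamma (t + \<mu>) - Digamma t - Digamma (t + \<delta> + \<mu>)"] dh u by auto
  have "Digamma (\<xi> + \<delta>) + Digamma (\<xi> + \<mu>) - Digamma \<xi> - Digamma (\<xi> + \<delta> + \<mu>) = 0"
    using \<xi>(3) unfolding \<open>h u1 = h u2\<close> using u(3) by simp
  then have z: "Digamma (\<xi> + \<delta>) - Digamma \<xi> = Digamma (\<xi> + \<mu> + \<delta>) - Digamma (\<xi> + \<mu>)"
    by (simp add: add_ac)
  have dD: "((\<lambda>t. Digamma (t + \<delta>) - Digamma t) has_real_derivative (Polygamma 1 (t + \<delta>) - Polygamma 1 t)) (at t)"
    if "\<xi> \<le> t" for t
  proof -
    have "t > 0" "t + \<delta> > 0" using that \<xi> u by auto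
    then have "t \<notin> \<int>\<^sub>\<le>\<^sub>0" "t + \<delta> \<notin> \<int>\<^sub>\<le>\<^sub>0" by (auto elim!: nonpos_Ints_cases)
    then show ?thesis by (auto intro!: derivative_eq_intros)
  qed
  obtain \<zeta> where \<zeta>: "\<xi> < \<zeta>" "\<zeta> < \<xi> + \<mu>" "(Digamma (\<xi> + \<mu> + \<delta>) - Digamma (\<xi> + \<mu>)) - (Digamma (\<xi> + \<delta>) - Digamma \<xi>) = (\<xi> + \<mu> - \<xi>) * (Polygamma 1 (\<zeta> + \<delta>) - Polygamma 1 \<zeta>)"
    using MVT2[of \<xi> "\<xi> + \<mu>" "\<lambda>t. Digamma (t + \<delta>) - Digamma t" "\<lambda>t. Polygamma 1 (t + \<delta>) - Polygamma 1 t"] dD \<mu> by auto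
  then have "Polygamma 1 (\<zeta> + \<delta>) = Polygamma 1 \<zeta>" using z \<mu> by simp
  moreover have "\<zeta> > 0" "\<zeta> + \<delta> > 0" using \<zeta> \<xi> u by auto
  ultimately show False
    using Polygamma_real_strict_antimono[of \<zeta> "\<zeta> + \<delta>" 1] Polygamma_real_strict_antimono[of "\<zeta> + \<delta>" \<zeta> 1] \<delta>
    by (cases "\<delta> > 0") auto
qed

lemma Gamma_real_plus1: "(t::real) > 0 \<Longrightarrow> Gamma (t + 1) = t * Gamma t"
  by (rule Gamma_plus1) (auto elim!: nonpos_Ints_cases)

text \<open>The Mellin transform forced by the commutation relation, on the positive axis.\<close>

definition mellin_sol :: "int \<Rightarrow> int \<Rightarrow> real \<Rightarrow> int \<Rightarrow> real" where
  "mellin_sol a b m z =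
     Gamma ((z + b) / (2 * a)) * Gamma ((z - b) / (2 * a) + (m + a) / (2 * a)) /
     (Gamma ((z - b) / (2 * a) + 1) * Gamma ((z + b) / (2 * a) + (m + a) / (2 * a)))"

text \<open>With u = (z - b)/(2a) and u + b/a = (z + b)/(2a), the linear factors that accompany the
  Mellin transform in a coefficient are absorbed by Gamma(x + 1) = x Gamma(x). Each product becomes
  a multiple of \<open>gquot\<close> with \<delta> = b/a or \<delta> = b/a - 1.\<close>

lemma mellin_sol_identities:
  fixes a b z :: int and m :: real
  assumes a: "a > 0" and z: "z - b > 0" "z + b > 0" and m: "m \<ge> - 1"
  defines "\<mu> \<equiv> (m + a) / (2 * a)" and "u \<equiv> real_of_int (z - b) / (2 * a)"
  shows "mellin_sol a b m z > 0"
    "real_of_int (z - b) * mellin_sol a b m z = 2 * real_of_int a * gquot (b / a) \<mu> u"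
    "(z + a - b + m) * mellin_sol a b m z = 2 * real_of_int a * gquot (b / a - 1) \<mu> (u + 1)"
    "z + b - 2 * a > 0 \<Longrightarrow> real_of_int (z - b) * (real_of_int z + b + m - a) * mellin_sol a b m z = 2 * real_of_int a * real_of_int (z + b - 2 * a) * gquot (b / a - 1) \<mu> u"
proof -
  define v where "v = real_of_int (z + b) / (2 * a)"
  have ar: "real_of_int a > 0" using a by simp
  have uv: "u > 0" "v > 0" using z ar by (simp_all add: u_def v_def del: of_int_add of_int_diff)
  have "m + a \<ge> 0" using m a by linarith
  then have \<mu>: "\<mu> \<ge> 0" using ar by (simp add: \<mu>_def)
  have S: "mellin_sol a b m z = Gamma v * Gamma (u + \<mu>) / (Gamma (u + 1) * Gamma (v + \<mu>))"
    by (simp add: mellin_sol_def u_def v_def \<mu>_def)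
  have ub: "u + b / a = v" using ar by (simp add: u_def v_def field_simps)
  have pos: "Gamma v > 0" "Gamma (u + \<mu>) > 0" "Gamma (u + 1) > 0" "Gamma (v + \<mu>) > 0" "Gamma u > 0"
    using uv \<mu> by (auto intro!: Gamma_real_pos)
  show "mellin_sol a b m z > 0" unfolding S using pos by simp
  have Gu: "Gamma (u + 1) = u * Gamma u" using uv by (intro Gamma_real_plus1)
  have zu: "real_of_int (z - b) = 2 * real_of_int a * u" using ar by (simp add: u_def)
  have zv: "real_of_int (z + b) = 2 * real_of_int a * v" using ar by (simp add: v_def)
  show "real_of_int (z - b) * mellin_sol a b m z = 2 * real_of_int a * gquot (b / a) \<mu> u"
    unfolding S gquot_def ub zu Gu using uv pos by (simp add: field_simps)
  have "u + 1 + (b / a - 1) = v" using ub by simp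
  moreover have "z + a - b + m = 2 * real_of_int a * (u + \<mu>)" using zu ar by (simp add: \<mu>_def field_simps)
  moreover have "u + \<mu> > 0" using uv \<mu> by simp
  moreover from this have "Gamma (u + 1 + \<mu>) = (u + \<mu>) * Gamma (u + \<mu>)"
    using Gamma_real_plus1[of "u + \<mu>"] by (simp add: add_ac)
  ultimately show "(z + a - b + m) * mellin_sol a b m z = 2 * real_of_int a * gquot (b / a - 1) \<mu> (u + 1)"
    unfolding S gquot_def by (simp add: field_simps)
  assume zp: "z + b - 2 * a > 0"
  have v1: "v - 1 > 0" using zp zv ar by (simp add: v_def field_simps)
  have Gv: "Gamma v = (v - 1) * Gamma (v - 1)" using Gamma_real_plus1[of "v - 1"] v1 by simp
  have v1\<mu>: "v - 1 + \<mu> > 0" using v1 \<mu> by simp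
  have Gv\<mu>: "Gamma (v + \<mu>) = (v - 1 + \<mu>) * Gamma (v - 1 + \<mu>)" using Gamma_real_plus1[of "v - 1 + \<mu>"] v1\<mu> by simp
  have p2: "Gamma (v - 1) > 0" "Gamma (v - 1 + \<mu>) > 0" using v1 v1\<mu> by (auto intro!: Gamma_real_pos)
  have e1: "u + (b / a - 1) = v - 1" using ub by simp
  have e2: "real_of_int z + b + m - a = 2 * real_of_int a * (v - 1 + \<mu>)" using zv ar by (simp add: \<mu>_def field_simps)
  have e3: "real_of_int (z + b - 2 * a) = 2 * real_of_int a * (v - 1)" using zv ar by (simp add: field_simps)
  have e4: "real_of_int (z - b) = 2 * real_of_int a * u" by (rule zu)
  show "real_of_int (z - b) * (real_of_int z + b + m - a) * mellin_sol a b m z = 2 * real_of_int a * real_of_int (z + b - 2 * a) * gquot (b / a - 1) \<mu> u"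
  proof -
    have alg: "(2 * c * u) * (2 * c * w) * ((p * X) * Y / ((u * U) * (w * W))) = 2 * c * (2 * c * p) * (X * Y / (U * W))"
      if "u \<noteq> 0" "w \<noteq> 0" for c u w p X Y U W :: real using that by (simp add: field_simps)
    show ?thesis unfolding S gquot_def e1 e2 e3 e4 Gu Gv Gv\<mu> by (rule alg) (use uv v1\<mu> in auto)
  qed
qed

text \<open>Clearing the denominators, which are positive because m \<ge> -1, leaves a real equation
  from which the complex constant \<open>C\<close> has cancelled.\<close>

lemma comm_coeff_eq_0_iff:
  assumes m: "m \<ge> - 1" and C: "C \<noteq> 0"
    and 1: "mellin \<phi> (of_int (\<bar>n\<bar> + \<bar>n + k2\<bar> + 2)) = C * of_real g1"
    and 2: "mellin \<phi> (of_int (\<bar>n + k1\<bar> + \<bar>n + k1 + k2\<bar> + 2)) = C * of_real g2"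
  shows "comm_coeff k1 k2 m \<phi> n = 0 \<longleftrightarrow>
    (\<bar>n + k2\<bar> + 1) * (\<bar>n\<bar> + \<bar>n + k1\<bar> + 2 + m) * g1 = (\<bar>n + k1\<bar> + 1) * (\<bar>n + k2\<bar> + \<bar>n + k1 + k2\<bar> + 2 + m) * g2"
proof -
  define P Q where "P = real_of_int (\<bar>n + k2\<bar> + \<bar>n + k1 + k2\<bar> + 2) + m" and "Q = real_of_int (\<bar>n\<bar> + \<bar>n + k1\<bar> + 2) + m"
  have PQ: "P > 0" "Q > 0" using m unfolding P_def Q_def by linarith+
  define x y where "x = real_of_int \<bar>n + k2\<bar> + 1" and "y = real_of_int \<bar>n + k1\<bar> + 1"
  have "comm_coeff k1 k2 m \<phi> n = (of_real x * (C * of_real g1)) / of_real P - (of_real y * (C * of_real g2)) / of_real Q"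
    unfolding comm_coeff_def 1 2 P_def Q_def x_def y_def by (simp del: of_int_abs)
  also have "\<dots> = C * of_real (x * g1 / P - y * g2 / Q)" by (simp add: algebra_simps)
  finally have "comm_coeff k1 k2 m \<phi> n = 0 \<longleftrightarrow> x * g1 / P - y * g2 / Q = 0" using C by (simp only: mult_eq_0_iff of_real_eq_0_iff) simp
  also have "\<dots> \<longleftrightarrow> x * Q * g1 = y * P * g2" using PQ by (simp add: field_simps)
  finally show ?thesis by (simp add: P_def Q_def x_def y_def add_ac)
qed

text \<open>For n \<ge> N1 both sides reduce to the same multiple of \<open>gquot\<close> at the
  same point. Below, the signs of n + b and n + a decide which arguments occur. Each range leads to
  \<open>gquot\<close> at two different points, except one in which the Mellin values coincide and a
  linear inequality decides. The condition m + a > 0 means \<mu> > 0, and b \<noteq> a means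
  \<delta> \<noteq> 0 for \<delta> = b/a - 1.\<close>

lemma comm_coeff_support:
  fixes a b :: int and m :: real
  assumes a: "a > 0" and m: "m \<ge> - 1" and ma: "m + a > 0" and C: "C \<noteq> 0"
    and b: "b > 0 \<and> b \<noteq> a \<or> b = - 1 \<and> a \<ge> 2"
    and sol: "\<And>z. z \<ge> 2 \<Longrightarrow> z - b > 0 \<Longrightarrow> mellin \<phi> (of_int z) = C * of_real (mellin_sol a b m z)"
  shows "n \<ge> N1 a b \<Longrightarrow> comm_coeff a b m \<phi> n = 0"
    "- (a + b) < 2 * n \<Longrightarrow> n < N1 a b \<Longrightarrow> comm_coeff a b m \<phi> n \<noteq> 0"
proof -
  let ?\<mu> = "(m + a) / (2 * a)" and ?u = "\<lambda>z::int. real_of_int (z - b) / (2 * a)"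
  have ar: "real_of_int a > 0" using a by simp
  have \<mu>: "?\<mu> > 0" using ma ar by simp
  note id = mellin_sol_identities[OF a _ _ m, of _ b]
  have N1: "N1 a b = max 0 (- b)" using a b by (auto simp: N1_def)
  {
    assume n: "n \<ge> N1 a b"
    define z where "z = 2 * n + b + 2"
    have z: "z \<ge> 2" "z - b > 0" "z + b > 0" using n b N1 by (auto simp: z_def max_def split: if_splits)
    have nn: "n \<ge> 0" "n + b \<ge> 0" using n N1 by auto
    have abs: "\<bar>n\<bar> + \<bar>n + b\<bar> + 2 = z" "\<bar>n + a\<bar> + \<bar>n + a + b\<bar> + 2 = z + 2 * a" using nn a by (auto simp: z_def)
    have "comm_coeff a b m \<phi> n = 0 \<longleftrightarrow>
       (\<bar>n + b\<bar> + 1) * (\<bar>n\<bar> + \<bar>n + a\<bar> + 2 + m) * mellin_sol a b m z = (\<bar>n + a\<bar> + 1) * (\<bar>n + b\<bar> + \<bar>n + a + b\<bar> + 2 + m) * mellin_sol a b m (z + 2 * a)"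
    proof (rule comm_coeff_eq_0_iff[OF m C])
      show "mellin \<phi> (of_int (\<bar>n\<bar> + \<bar>n + b\<bar> + 2)) = C * of_real (mellin_sol a b m z)"
        unfolding abs by (rule sol[OF z(1,2)])
      show "mellin \<phi> (of_int (\<bar>n + a\<bar> + \<bar>n + a + b\<bar> + 2)) = C * of_real (mellin_sol a b m (z + 2 * a))"
        unfolding abs by (rule sol) (use z a in linarith)+
    qed
    moreover have "(\<bar>n + b\<bar> + 1) * (\<bar>n\<bar> + \<bar>n + a\<bar> + 2 + m) * mellin_sol a b m z = (z + b) / 2 * (2 * a * gquot (b / a - 1) ?\<mu> (?u z + 1))"
    proof -
      have "(\<bar>n\<bar> + \<bar>n + a\<bar> + 2 + m) = z + a - b + m" "\<bar>n + b\<bar> + 1 = real_of_int (z + b) / 2" using nn a by (auto simp: z_def)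
      then show ?thesis using id(3)[OF z(2,3)] by (simp only: mult.assoc)
    qed
    moreover have "(\<bar>n + a\<bar> + 1) * (\<bar>n + b\<bar> + \<bar>n + a + b\<bar> + 2 + m) * mellin_sol a b m (z + 2 * a) = (z + b) / 2 * (2 * a * gquot (b / a - 1) ?\<mu> (?u z + 1))"
    proof -
      have e: "(\<bar>n + b\<bar> + \<bar>n + a + b\<bar> + 2 + m) = (z + 2 * a) + b + m - a" "\<bar>n + a\<bar> + 1 = real_of_int (z + 2 * a - b) / 2" using nn a by (auto simp: z_def)
      have u: "?u (z + 2 * a) = ?u z + 1" using ar by (simp add: field_simps)
      have "real_of_int (z + 2 * a - b) * (real_of_int (z + 2 * a) + b + m - a) * mellin_sol a b m (z + 2 * a) = 2 * real_of_int a * real_of_int (z + 2 * a + b - 2 * a) * gquot (b / a - 1) ?\<mu> (?u z + 1)"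
        using id(4)[of "z + 2 * a"] z a unfolding u by simp
      then show ?thesis unfolding e by (simp add: mult_ac)
    qed
    ultimately show "comm_coeff a b m \<phi> n = 0" by simp
  }
  assume n: "- (a + b) < 2 * n" "n < N1 a b"
  define \<nu> where "\<nu> = - n"
  have c: "comm_coeff a b m \<phi> n \<noteq> 0"
    if h: "z1 = \<bar>n\<bar> + \<bar>n + b\<bar> + 2" "z2 = \<bar>n + a\<bar> + \<bar>n + a + b\<bar> + 2" "z1 - b > 0" "z2 - b > 0"
      "(\<bar>n + b\<bar> + 1) * (\<bar>n\<bar> + \<bar>n + a\<bar> + 2 + m) * mellin_sol a b m z1 \<noteq> (\<bar>n + a\<bar> + 1) * (\<bar>n + b\<bar> + \<bar>n + a + b\<bar> + 2 + m) * mellin_sol a b m z2"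
    for z1 z2
  proof -
    have "z1 \<ge> 2" "z2 \<ge> 2" unfolding h(1,2) by auto
    then show ?thesis
      using comm_coeff_eq_0_iff[OF m C, of \<phi> n b "mellin_sol a b m z1" a "mellin_sol a b m z2"] sol h by blast
  qed
  have halve: "x * G = c * Q" if "X = 2 * x" "X * G = 2 * c * Q" for X x G c Q :: real
    using that by simp
  have am2: "a + 2 + m > 0" using m a by linarith
  show "comm_coeff a b m \<phi> n \<noteq> 0"
  proof (cases "b > 0")
    case True
    then have \<nu>: "\<nu> \<ge> 1" "2 * \<nu> < a + b" using n N1 by (auto simp: \<nu>_def)
    have ba: "b \<noteq> a" using b True by auto
    consider "\<nu> \<le> a" "\<nu> \<le> b" | "a < \<nu>" "\<nu> \<le> b" | "b < \<nu>" "\<nu> < a" using \<nu> by linarith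
    then show ?thesis
    proof cases
      \<comment> \<open>The points are (a - \<nu> + 1)/a and (a + 1)/a, which differ because \<nu>
        \<ge> 1.\<close>
      case 1
      define z2 where "z2 = 2 * a + b - 2 * \<nu> + 2"
      have abs: "\<bar>n\<bar> = \<nu>" "\<bar>n + b\<bar> = b - \<nu>" "\<bar>n + a\<bar> = a - \<nu>" "\<bar>n + a + b\<bar> = a + b - \<nu>" using 1 \<nu> by (auto simp: \<nu>_def)
      show ?thesis
      proof (rule c[of "b + 2" z2])
        show "b + 2 = \<bar>n\<bar> + \<bar>n + b\<bar> + 2" "z2 = \<bar>n + a\<bar> + \<bar>n + a + b\<bar> + 2" unfolding abs by (auto simp: z2_def)
        show "b + 2 - b > 0" "z2 - b > 0" using 1 by (auto simp: z2_def)
        have "?u z2 < ?u (b + 2) + 1" using ar \<nu> by (simp add: z2_def field_simps)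
        moreover have "0 < ?u z2" using ar 1 by (auto simp: z2_def)
        moreover have "?u z2 + (b / a - 1) = real_of_int (b - \<nu> + 1) / a" using ar by (simp add: z2_def field_simps)
        then have "0 < ?u z2 + (b / a - 1)" using ar 1 by simp
        ultimately have ne: "gquot (b / a - 1) ?\<mu> (?u z2) \<noteq> gquot (b / a - 1) ?\<mu> (?u (b + 2) + 1)"
          using ba ar \<mu> by (intro gquot_inj) auto
        have L: "(b - \<nu> + 1) * (\<nu> + (a - \<nu>) + 2 + m) * mellin_sol a b m (b + 2) = (b - \<nu> + 1) * (2 * a * gquot (b / a - 1) ?\<mu> (?u (b + 2) + 1))"
          using id(3)[of "b + 2"] True by (simp add: mult_ac add_ac)
        have alg: "x * Y' * G = p * (2 * c * Q)" if "X = 2 * x" "Y = Y'" "Z = 2 * p" "X * Y * G = 2 * c * Z * Q" for X Y Z x Y' G p c Q :: real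
          using that by (simp add: mult_ac)
        have "real_of_int (a - \<nu> + 1) * (real_of_int ((b - \<nu>) + (a + b - \<nu>)) + 2 + m) * mellin_sol a b m z2
            = real_of_int (b - \<nu> + 1) * (2 * real_of_int a * gquot (b / a - 1) ?\<mu> (?u z2))"
        proof (rule alg)
          show "real_of_int (z2 - b) = 2 * real_of_int (a - \<nu> + 1)"
            "real_of_int z2 + b + m - a = real_of_int ((b - \<nu>) + (a + b - \<nu>)) + 2 + m"
            "real_of_int (z2 + b - 2 * a) = 2 * real_of_int (b - \<nu> + 1)"
            by (auto simp: z2_def)
          show "real_of_int (z2 - b) * (real_of_int z2 + b + m - a) * mellin_sol a b m z2 = 2 * real_of_int a * real_of_int (z2 + b - 2 * a) * gquot (b / a - 1) ?\<mu> (?u z2)"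
            by (rule id(4)[of z2]) (use 1 True in \<open>auto simp: z2_def\<close>)
        qed
        then have R: "(a - \<nu> + 1) * ((b - \<nu>) + (a + b - \<nu>) + 2 + m) * mellin_sol a b m z2 = (b - \<nu> + 1) * (2 * a * gquot (b / a - 1) ?\<mu> (?u z2))"
          by simp
        have "real_of_int (b - \<nu> + 1) \<noteq> 0" using 1 by (simp del: of_int_add of_int_diff)
        then show "(\<bar>n + b\<bar> + 1) * (\<bar>n\<bar> + \<bar>n + a\<bar> + 2 + m) * mellin_sol a b m (b + 2) \<noteq> (\<bar>n + a\<bar> + 1) * (\<bar>n + b\<bar> + \<bar>n + a + b\<bar> + 2 + m) * mellin_sol a b m z2"
          unfolding abs using L R ne ar by simp
      qed
    next
      \<comment> \<open>Both Mellin arguments equal b + 2, so the Mellin value cancels; the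
        remaining factors differ by (a + b - 2\<nu>)(m + a).\<close>
      case 2
      have abs: "\<bar>n\<bar> = \<nu>" "\<bar>n + b\<bar> = b - \<nu>" "\<bar>n + a\<bar> = \<nu> - a" "\<bar>n + a + b\<bar> = a + b - \<nu>" using 2 \<nu> a by (auto simp: \<nu>_def)
      show ?thesis
      proof (rule c[of "b + 2" "b + 2"])
        have p: "mellin_sol a b m (b + 2) > 0" using id(1)[of "b + 2"] True by simp
        have "(b - \<nu> + 1) * (\<nu> + (\<nu> - a) + 2 + m) - (\<nu> - a + 1) * ((b - \<nu>) + (a + b - \<nu>) + 2 + m) = (a + b - 2 * \<nu>) * (m + a)"
          by (simp add: algebra_simps)
        moreover have "(a + b - 2 * \<nu>) * (m + a) > 0" using \<nu> ma by (intro mult_pos_pos) auto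
        ultimately have "(b - \<nu> + 1) * (\<nu> + (\<nu> - a) + 2 + m) \<noteq> (\<nu> - a + 1) * ((b - \<nu>) + (a + b - \<nu>) + 2 + m)" by linarith
        then show "(\<bar>n + b\<bar> + 1) * (\<bar>n\<bar> + \<bar>n + a\<bar> + 2 + m) * mellin_sol a b m (b + 2) \<noteq> (\<bar>n + a\<bar> + 1) * (\<bar>n + b\<bar> + \<bar>n + a + b\<bar> + 2 + m) * mellin_sol a b m (b + 2)"
          unfolding abs using p by simp
      qed (use abs in auto)
    next
      \<comment> \<open>The sums |n| + |n + a| and |n + b| + |n + a + b| are both equal to a, so
        this factor cancels. The two points differ unless 2\<nu> = a + b, the midpoint.\<close>
      case 3
      define z1 z2 where "z1 = 2 * \<nu> - b + 2" and "z2 = 2 * a + b - 2 * \<nu> + 2"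
      have abs: "\<bar>n\<bar> = \<nu>" "\<bar>n + b\<bar> = \<nu> - b" "\<bar>n + a\<bar> = a - \<nu>" "\<bar>n + a + b\<bar> = a + b - \<nu>" using 3 \<nu> True by (auto simp: \<nu>_def)
      show ?thesis
      proof (rule c[of z1 z2])
        show "z1 = \<bar>n\<bar> + \<bar>n + b\<bar> + 2" "z2 = \<bar>n + a\<bar> + \<bar>n + a + b\<bar> + 2" unfolding abs by (auto simp: z1_def z2_def)
        show zb: "z1 - b > 0" "z2 - b > 0" using 3 by (auto simp: z1_def z2_def)
        have "?u z1 < ?u z2" using \<nu> ar b by (intro divide_strict_right_mono) (auto simp: z1_def z2_def)
        moreover have "0 < ?u z1" using zb ar by (simp del: of_int_diff)
        moreover have "b / a > 0" using True ar by simp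
        ultimately have ne: "gquot (b / a) ?\<mu> (?u z1) \<noteq> gquot (b / a) ?\<mu> (?u z2)" using \<mu> by (intro gquot_inj) auto
        have z1: "real_of_int (z1 - b) = 2 * real_of_int (\<nu> - b + 1)" and z2: "real_of_int (z2 - b) = 2 * real_of_int (a - \<nu> + 1)" by (auto simp: z1_def z2_def)
        have L: "real_of_int (\<nu> - b + 1) * mellin_sol a b m z1 = a * gquot (b / a) ?\<mu> (?u z1)"
          by (rule halve[OF z1 id(2)[OF zb(1)]]) (use 3 True in \<open>simp add: z1_def\<close>)
        have R: "real_of_int (a - \<nu> + 1) * mellin_sol a b m z2 = a * gquot (b / a) ?\<mu> (?u z2)"
          by (rule halve[OF z2 id(2)[OF zb(2)]]) (use 3 True in \<open>simp add: z2_def\<close>)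
        have "(\<nu> - b + 1) * (\<nu> + (a - \<nu>) + 2 + m) * mellin_sol a b m z1 = (a + 2 + m) * (a * gquot (b / a) ?\<mu> (?u z1))"
          unfolding L[symmetric] by simp
        moreover have "(a - \<nu> + 1) * ((\<nu> - b) + (a + b - \<nu>) + 2 + m) * mellin_sol a b m z2 = (a + 2 + m) * (a * gquot (b / a) ?\<mu> (?u z2))"
          unfolding R[symmetric] by simp
        ultimately show "(\<bar>n + b\<bar> + 1) * (\<bar>n\<bar> + \<bar>n + a\<bar> + 2 + m) * mellin_sol a b m z1 \<noteq> (\<bar>n + a\<bar> + 1) * (\<bar>n + b\<bar> + \<bar>n + a + b\<bar> + 2 + m) * mellin_sol a b m z2"
          unfolding abs using ne ar am2 by simp
      qed
    qed
  next
    \<comment> \<open>As in the third range above, but with \<delta> = b/a negative, so that u +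
      \<delta> > 0 has to be checked as well.\<close>
    case False
    then have b1: "b = - 1" "a \<ge> 2" using b by auto
    have \<nu>: "\<nu> \<ge> 0" "2 * \<nu> < a - 1" using n N1 b1 by (auto simp: \<nu>_def)
    define z1 z2 where "z1 = 2 * \<nu> + 3" and "z2 = 2 * a - 2 * \<nu> + 1"
    have abs: "\<bar>n\<bar> = \<nu>" "\<bar>n + b\<bar> = \<nu> + 1" "\<bar>n + a\<bar> = a - \<nu>" "\<bar>n + a + b\<bar> = a - \<nu> - 1" using b1 \<nu> by (auto simp: \<nu>_def)
    show ?thesis
    proof (rule c[of z1 z2])
      show "z1 = \<bar>n\<bar> + \<bar>n + b\<bar> + 2" "z2 = \<bar>n + a\<bar> + \<bar>n + a + b\<bar> + 2" unfolding abs by (auto simp: z1_def z2_def)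
      show zb: "z1 - b > 0" "z2 - b > 0" using \<nu> b1 by (auto simp: z1_def z2_def)
      have zb': "z1 + b > 0" "z2 + b > 0" using \<nu> b1 by (auto simp: z1_def z2_def)
      have "?u z1 < ?u z2" using \<nu> ar b by (intro divide_strict_right_mono) (auto simp: z1_def z2_def)
      moreover have "0 < ?u z1" using zb ar by (simp del: of_int_diff)
      moreover have "?u z1 + b / a = real_of_int (z1 + b) / (2 * a)" using ar by (simp add: field_simps)
      then have "0 < ?u z1 + b / a" using zb'(1) ar by (simp del: of_int_add)
      moreover have "b / a \<noteq> 0" using b1 ar by simp
      ultimately have ne: "gquot (b / a) ?\<mu> (?u z1) \<noteq> gquot (b / a) ?\<mu> (?u z2)" using \<mu> by (intro gquot_inj) auto
      have z1: "real_of_int (z1 - b) = 2 * real_of_int (\<nu> + 2)" and z2: "real_of_int (z2 - b) = 2 * real_of_int (a - \<nu> + 1)" using b1 by (auto simp: z1_def z2_def)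
      have L: "real_of_int (\<nu> + 2) * mellin_sol a b m z1 = a * gquot (b / a) ?\<mu> (?u z1)"
        by (rule halve[OF z1 id(2)[OF zb(1) zb'(1)]])
      have R: "real_of_int (a - \<nu> + 1) * mellin_sol a b m z2 = a * gquot (b / a) ?\<mu> (?u z2)"
        by (rule halve[OF z2 id(2)[OF zb(2) zb'(2)]])
      have "(\<nu> + 1 + 1) * (\<nu> + (a - \<nu>) + 2 + m) * mellin_sol a b m z1 = (a + 2 + m) * (a * gquot (b / a) ?\<mu> (?u z1))"
        unfolding L[symmetric] by simp
      moreover have "(a - \<nu> + 1) * ((\<nu> + 1) + (a - \<nu> - 1) + 2 + m) * mellin_sol a b m z2 = (a + 2 + m) * (a * gquot (b / a) ?\<mu> (?u z2))"
        unfolding R[symmetric] by simp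
      ultimately show "(\<bar>n + b\<bar> + 1) * (\<bar>n\<bar> + \<bar>n + a\<bar> + 2 + m) * mellin_sol a b m z1 \<noteq> (\<bar>n + a\<bar> + 1) * (\<bar>n + b\<bar> + \<bar>n + a + b\<bar> + 2 + m) * mellin_sol a b m z2"
        unfolding abs using ne ar am2 by simp
    qed
  qed
qed

section \<open>From the recurrence to the Gamma relation\<close>

text \<open>For n and n + b nonnegative all absolute values open up, and in terms of z = 2n + b + 2
  the vanishing condition becomes this relation up to a common factor 2.\<close>

lemma comm_coeff_recurrence:
  assumes a: "a > 0" and m: "m \<ge> - 1" and n: "n \<ge> 0" "n + b \<ge> 0" and c: "comm_coeff a b m \<phi> n = 0"
    and z: "z = complex_of_int (2 * n + b + 2)"
  shows "(z + of_int b) * (z + of_real m + of_int a - of_int b) * mellin \<phi> z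
    = (z + 2 * of_int a - of_int b) * (z + of_real m + of_int a + of_int b) * mellin \<phi> (z + 2 * of_int a)"
proof -
  have abs: "\<bar>n\<bar> + \<bar>n + b\<bar> + 2 = 2 * n + b + 2" "\<bar>n + a\<bar> + \<bar>n + a + b\<bar> + 2 = 2 * n + b + 2 + 2 * a"
    "\<bar>n + b\<bar> + \<bar>n + a + b\<bar> + 2 = 2 * n + 2 * b + a + 2" "\<bar>n\<bar> + \<bar>n + a\<bar> + 2 = 2 * n + a + 2" "\<bar>n + b\<bar> = n + b" "\<bar>n + a\<bar> = n + a"
    using n a by auto
  define P Q where "P = complex_of_int (2 * n + 2 * b + a + 2) + of_real m" and "Q = complex_of_int (2 * n + a + 2) + of_real m"
  have "real_of_int (2 * n + 2 * b + a + 2) + m > 0" "real_of_int (2 * n + a + 2) + m > 0" using n a m by linarith+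
  moreover have "P = of_real (real_of_int (2 * n + 2 * b + a + 2) + m)" "Q = of_real (real_of_int (2 * n + a + 2) + m)"
    by (simp_all add: P_def Q_def)
  ultimately have PQ: "P \<noteq> 0" "Q \<noteq> 0" by (simp_all only: of_real_eq_0_iff)
  have z2: "of_int (2 * n + b + 2 + 2 * a) = z + 2 * of_int a" by (simp add: z)
  have "(of_int (n + b) + 1) * mellin \<phi> z / P = (of_int (n + a) + 1) * mellin \<phi> (z + 2 * of_int a) / Q"
    using c unfolding comm_coeff_def abs(1-4) z2 z[symmetric] P_def[symmetric] Q_def[symmetric]
    unfolding abs(5,6) by simp
  then have H: "(of_int (n + b) + 1) * mellin \<phi> z * Q = (of_int (n + a) + 1) * mellin \<phi> (z + 2 * of_int a) * P"
    using PQ by (simp add: frac_eq_eq mult_ac)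
  have alg: "X * Q' * M1 = Y * P' * M2"
    if "X = 2 * x" "Y = 2 * y" "Q' = Q" "P' = P" "x * M1 * Q = y * M2 * P" for X Y Q' P' x y M1 M2 :: complex
    using that by (simp add: mult_ac)
  show ?thesis
    by (rule alg[OF _ _ _ _ H]) (simp_all add: z P_def Q_def)
qed

lemma rGamma_pos_nonzero: "Re z > 0 \<Longrightarrow> rGamma z \<noteq> 0"
  by (auto simp: rGamma_eq_zero_iff elim!: nonpos_Ints_cases)

lemma Gamma_rGamma: "Re z > 0 \<Longrightarrow> Gamma z * rGamma z = 1"
  using rGamma_pos_nonzero[of z] by (simp add: rGamma_inverse_Gamma)

lemma Re_divide_int: "Re (z / (2 * of_int a)) = Re z / (2 * real_of_int a)"
proof -
  have "z / (2 * of_int a) = z / of_real (2 * real_of_int a)" by simp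
  then show ?thesis by (simp only: Re_divide_of_real)
qed

text \<open>\<open>h\<close> is the Mellin transform times the reciprocal of the Gamma solution. By
  the recurrence it is constant along the progression \<open>Z\<close>, and it grows polynomially,
  hence it is constant far to the right. In the form with \<open>rGamma\<close> the identity
  continues to Re z \<ge> 2. The constant is nonzero, since otherwise all large moments of \<phi>
  would vanish.\<close>

lemma mellin_Gamma_relation:
  fixes a b :: int and m :: real
  assumes ri: "radial_integrable \<phi>" and nz: "\<not> radial_eq \<phi> (\<lambda>r. 0)" and a: "a > 0" and m: "m \<ge> - 1"
    and zero: "\<And>n. n \<ge> n0 \<Longrightarrow> comm_coeff a b m \<phi> n = 0"
  obtains C where "C \<noteq> 0"
    "\<And>z. Re z \<ge> 2 \<Longrightarrow> mellin \<phi> z * (rGamma ((z + of_int b) / (2 * of_int a)) * rGamma ((z + of_real m + of_int a - of_int b) / (2 * of_int a)))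
      = C * (rGamma ((z + 2 * of_int a - of_int b) / (2 * of_int a)) * rGamma ((z + of_real m + of_int a + of_int b) / (2 * of_int a)))"
proof -
  have ar: "real_of_int a \<ge> 1" using a by simp
  have a0: "complex_of_int a \<noteq> 0" using a by simp
  define A B D E where "A = (\<lambda>z. (z + of_int b) / (2 * of_int a) :: complex)"
    and "B = (\<lambda>z. (z + of_real m + of_int a - of_int b) / (2 * of_int a) :: complex)"
    and "D = (\<lambda>z. (z + 2 * of_int a - of_int b) / (2 * of_int a) :: complex)"
    and "E = (\<lambda>z. (z + of_real m + of_int a + of_int b) / (2 * of_int a) :: complex)"
  \<comment> \<open>To the right of \<open>x0\<close> the four arguments have positive real part, as
    m + a \<ge> 0, and the Mellin transform is holomorphic.\<close>
  define x0 where "x0 = real_of_int \<bar>b\<bar> + 2"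
  have pos: "Re (A z) > 0" "Re (B z) > 0" "Re (D z) > 0" "Re (E z) > 0" if "Re z > x0" for z
    using that ar m unfolding A_def B_def D_def E_def Re_divide_int
    by (auto intro!: divide_pos_pos simp: x0_def)
  have nn: "A z \<notin> \<int>\<^sub>\<le>\<^sub>0" "B z \<notin> \<int>\<^sub>\<le>\<^sub>0" "D z \<notin> \<int>\<^sub>\<le>\<^sub>0" "E z \<notin> \<int>\<^sub>\<le>\<^sub>0" if "Re z > x0" for z
    using pos[OF that] by (auto elim!: nonpos_Ints_cases)
  have hol: "A holomorphic_on S" "B holomorphic_on S" "D holomorphic_on S" "E holomorphic_on S" for S
    unfolding A_def B_def D_def E_def using a0 by (auto intro!: holomorphic_intros)
  \<comment> \<open>Grouped in this way, each bracket is a quotient covered by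
    \<open>Gamma_ratio_poly_bounded\<close>.\<close>
  define K where "K = (\<lambda>z. (Gamma (D z) * rGamma (B z)) * (Gamma (E z) * rGamma (A z)))"
  have shift: "A (z + 2 * of_int a) = A z + 1" "B (z + 2 * of_int a) = B z + 1" "D (z + 2 * of_int a) = D z + 1" "E (z + 2 * of_int a) = E z + 1" for z
    using a0 by (simp_all add: A_def B_def D_def E_def field_simps)
  have Kshift: "K (z + 2 * of_int a) * (A z * B z) = K z * (D z * E z)" if "Re z > x0" for z
    unfolding K_def shift Gamma_plus1[OF nn(3)[OF that]] Gamma_plus1[OF nn(4)[OF that]]
  proof -
    have alg: "((d * gD) * rB1) * ((e * gE) * rA1) * (x * y) = (gD * rB) * (gE * rA) * (d * e)"
      if "x * rA1 = rA" "y * rB1 = rB" for d gD rB1 e gE rA1 x y rA rB :: complex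
      unfolding that[symmetric] by (simp add: mult_ac)
    show "D z * Gamma (D z) * rGamma (B z + 1) * (E z * Gamma (E z) * rGamma (A z + 1)) * (A z * B z) = Gamma (D z) * rGamma (B z) * (Gamma (E z) * rGamma (A z)) * (D z * E z)"
      by (rule alg[OF rGamma_plus1 rGamma_plus1])
  qed
  define h where "h = (\<lambda>z. mellin \<phi> z * K z)"
  \<comment> \<open>Large enough for the recurrence to hold and for the progression \<open>Z\<close>
    to start to the right of \<open>x0\<close>.\<close>
  define n1 where "n1 = max n0 (\<bar>b\<bar> + 1)"
  have n1: "n1 \<ge> n0" "n1 \<ge> \<bar>b\<bar> + 1" by (simp_all add: n1_def)
  define Z where "Z = (\<lambda>j::nat. complex_of_int (2 * (n1 + a * int j) + b + 2))"
  have n1t: "\<bar>b\<bar> + 2 < 2 * (n1 + t) + b + 2" "n1 + t \<ge> n0" "n1 + t \<ge> 0" "n1 + t + b \<ge> 0" if "t \<ge> 0" for t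
    using n1 that by (auto simp: abs_if split: if_splits)
  have ZRe: "Re (Z j) > x0" for j
  proof -
    have "a * int j \<ge> 0" using a by simp
    then have "2 * (n1 + a * int j) + b + 2 > \<bar>b\<bar> + 2" by (rule n1t(1))
    then show ?thesis unfolding Z_def x0_def by (simp only: complex_Re_of_int of_int_add[symmetric] of_int_numeral[symmetric, where ?'a = real] of_int_less_iff)
  qed
  have step: "h (Z (Suc j)) = h (Z j)" for j
  proof -
    let ?z = "Z j"
    have nj: "n1 + a * int j \<ge> n0" "n1 + a * int j \<ge> 0" "n1 + a * int j + b \<ge> 0"
      using n1t[of "a * int j"] a by simp_all
    have "Z (Suc j) = ?z + 2 * of_int a" by (simp add: Z_def algebra_simps)
    have AB: "A ?z * B ?z \<noteq> 0" using pos[OF ZRe[of j]] by auto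
    have "(2 * of_int a) * A ?z * ((2 * of_int a) * B ?z) * mellin \<phi> ?z = (2 * of_int a) * D ?z * ((2 * of_int a) * E ?z) * mellin \<phi> (?z + 2 * of_int a)"
      using comm_coeff_recurrence[OF a m nj(2,3) zero[OF nj(1)] Z_def[THEN fun_cong]] a0
      by (simp add: A_def B_def D_def E_def)
    then have "A ?z * B ?z * mellin \<phi> ?z = D ?z * E ?z * mellin \<phi> (?z + 2 * of_int a)"
      using a0 by (simp add: mult_ac)
    then have "h (?z + 2 * of_int a) * (A ?z * B ?z) = h ?z * (A ?z * B ?z)"
    proof -
      have alg: "M2 * K2 * AB = M1 * K1 * AB" if "AB * M1 = DE * M2" "K2 * AB = K1 * DE" for M1 M2 K1 K2 AB DE :: complex
      proof -
        have "M2 * K2 * AB = M2 * (K1 * DE)" by (simp add: that(2) mult.assoc)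
        also have "\<dots> = K1 * (DE * M2)" by (simp add: mult_ac)
        finally show ?thesis by (simp add: that(1)[symmetric] mult_ac)
      qed
      show "A ?z * B ?z * mellin \<phi> ?z = D ?z * E ?z * mellin \<phi> (?z + 2 * of_int a) \<Longrightarrow> h (?z + 2 * of_int a) * (A ?z * B ?z) = h ?z * (A ?z * B ?z)"
        unfolding h_def by (rule alg[OF _ Kshift[OF ZRe[of j]]])
    qed
    then show ?thesis using AB \<open>Z (Suc j) = ?z + 2 * of_int a\<close> by simp
  qed
  define C where "C = h (Z 0)"
  have hZ: "h (Z j) = C" for j by (induction j) (simp_all add: C_def step)
  obtain M where M: "\<And>z. Re z \<ge> 2 \<Longrightarrow> cmod (mellin \<phi> z) \<le> M" using mellin_bounded_halfplane[OF ri] by blast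
  \<comment> \<open>In the variable w = z/(2a) each of the four arguments is w plus a real constant,
    and \<open>x0\<close> becomes \<open>y0\<close>.\<close>
  define \<tau> \<mu> y0 where "\<tau> = real_of_int b / (2 * real_of_int a)" and "\<mu> = (m + real_of_int a) / (2 * real_of_int a)"
    and "y0 = x0 / (2 * real_of_int a)"
  have ABDE: "A z = z / (2 * of_int a) + of_real \<tau>" "B z = z / (2 * of_int a) + of_real (\<mu> - \<tau>)"
    "D z = z / (2 * of_int a) + of_real (1 - \<tau>)" "E z = z / (2 * of_int a) + of_real (\<mu> + \<tau>)" for z
    using a0 by (simp_all add: A_def B_def D_def E_def \<tau>_def \<mu>_def field_simps)
  have y: "y0 + \<tau> > 0" "y0 + (\<mu> - \<tau>) > 0" "y0 + (1 - \<tau>) > 0" "y0 + (\<mu> + \<tau>) > 0"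
  proof -
    have t: "\<bar>\<tau>\<bar> < y0" using ar by (simp add: \<tau>_def y0_def x0_def abs_divide divide_strict_right_mono)
    have "m + a \<ge> 0" using m ar by linarith
    then have "\<mu> \<ge> 0" using ar by (simp add: \<mu>_def)
    then show "y0 + \<tau> > 0" "y0 + (\<mu> - \<tau>) > 0" "y0 + (1 - \<tau>) > 0" "y0 + (\<mu> + \<tau>) > 0" using t by linarith+
  qed
  obtain C1 M1 where C1: "C1 \<ge> 0" "\<And>w. Re w \<ge> y0 \<Longrightarrow> norm (Gamma (w + of_real (1 - \<tau>)) * rGamma (w + of_real (\<mu> - \<tau>))) \<le> C1 * (1 + norm w) ^ M1"
    using Gamma_ratio_poly_bounded[OF y(3) y(2)] by metis
  obtain C2 M2 where C2: "C2 \<ge> 0" "\<And>w. Re w \<ge> y0 \<Longrightarrow> norm (Gamma (w + of_real (\<mu> + \<tau>)) * rGamma (w + of_real \<tau>)) \<le> C2 * (1 + norm w) ^ M2"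
    using Gamma_ratio_poly_bounded[OF y(4) y(1)] by metis
  have hC: "h z = C" if z: "Re z > x0" for z
  proof -
    have "h z - C = 0"
    proof (rule poly_bounded_progression_eq_0[of "\<lambda>z. h z - C" x0 "2 * real_of_int a" "Re (Z 0)" "M * (C1 * C2) + cmod C" "M1 + M2"])
      show "(\<lambda>z. h z - C) holomorphic_on {z. x0 < Re z}"
        unfolding h_def K_def
        by (intro holomorphic_intros hol holomorphic_on_subset[OF mellin_holomorphic[OF ri]] holomorphic_Gamma' holomorphic_rGamma')
          (use nn in \<open>auto simp: x0_def\<close>)
    next
      fix z assume z: "x0 < Re z"
      let ?w = "z / (2 * complex_of_int a)"
      have wle: "cmod ?w \<le> cmod z"
      proof -
        have "cmod ?w = cmod z / (2 * real_of_int a)" using ar by (simp add: norm_divide norm_mult)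
        also have "\<dots> \<le> cmod z / 1" using ar by (intro divide_left_mono) auto
        finally show ?thesis by simp
      qed
      have wRe: "Re ?w \<ge> y0" unfolding Re_divide_int y0_def using z ar by (intro divide_right_mono) auto
      have p: "(1 + cmod ?w) ^ k \<le> (1 + cmod z) ^ k" for k using wle by (intro power_mono) auto
      have "cmod (K z) \<le> (C1 * (1 + cmod ?w) ^ M1) * (C2 * (1 + cmod ?w) ^ M2)"
        unfolding K_def ABDE norm_mult[of "Gamma _ * rGamma _" "Gamma _ * rGamma _"]
        using C1 C2 wRe by (intro mult_mono) auto
      also have "\<dots> \<le> (C1 * (1 + cmod z) ^ M1) * (C2 * (1 + cmod z) ^ M2)"
        using C1(1) C2(1) p by (intro mult_mono) auto
      finally have Kb: "cmod (K z) \<le> (C1 * C2) * (1 + cmod z) ^ (M1 + M2)" by (simp add: power_add mult_ac)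
      have Mb: "cmod (mellin \<phi> z) \<le> M" using M z by (simp add: x0_def)
      have "M \<ge> 0" using Mb norm_ge_zero order_trans by blast
      then have "cmod (h z) \<le> M * ((C1 * C2) * (1 + cmod z) ^ (M1 + M2))"
        unfolding h_def norm_mult using Mb Kb by (intro mult_mono) auto
      moreover have "cmod C * 1 \<le> cmod C * (1 + cmod z) ^ (M1 + M2)" by (intro mult_left_mono one_le_power) auto
      ultimately show "cmod (h z - C) \<le> (M * (C1 * C2) + cmod C) * (1 + cmod z) ^ (M1 + M2)"
        using norm_triangle_ineq4[of "h z" C] by (simp add: algebra_simps)
    next
      fix j :: nat
      have "complex_of_real (Re (Z 0) + 2 * real_of_int a * real j) = Z j" by (simp add: Z_def algebra_simps)
      then show "h (complex_of_real (Re (Z 0) + 2 * real_of_int a * real j)) - C = 0" using hZ by simp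
    qed (use ar z ZRe in auto)
    then show ?thesis by simp
  qed
  have rel0: "mellin \<phi> z * (rGamma (A z) * rGamma (B z)) = C * (rGamma (D z) * rGamma (E z))" if z: "Re z > x0" for z
  proof -
    have "C * (rGamma (D z) * rGamma (E z)) = mellin \<phi> z * (rGamma (A z) * rGamma (B z)) * ((Gamma (D z) * rGamma (D z)) * (Gamma (E z) * rGamma (E z)))"
      unfolding hC[OF z, symmetric] h_def K_def by (simp only: mult_ac)
    then show ?thesis using Gamma_rGamma[OF pos(3)[OF z]] Gamma_rGamma[OF pos(4)[OF z]] by simp
  qed
  have rel: "mellin \<phi> z * (rGamma (A z) * rGamma (B z)) = C * (rGamma (D z) * rGamma (E z))" if z: "Re z \<ge> 2" for z
    by (rule mellin_identity_extend[OF ri _ _ rel0 z]) (intro holomorphic_intros holomorphic_rGamma' hol)+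
  have "C \<noteq> 0"
  proof
    assume C0: "C = 0"
    have "mellin \<phi> (of_nat n) = 0" if n: "n \<ge> nat (\<bar>b\<bar> + 3)" for n
    proof -
      have "Re (of_nat n) > x0" using n unfolding x0_def by simp
      then show ?thesis using rel0[of "of_nat n"] C0 rGamma_pos_nonzero[OF pos(1)] rGamma_pos_nonzero[OF pos(2)] by auto
    qed
    then show False using mellin_zero_imp_radial_zero[OF ri] nz by blast
  qed
  then show ?thesis using that rel unfolding A_def B_def D_def E_def by blast
qed

section \<open>Classification\<close>

text \<open>The conditions \<open>c1\<close> to \<open>c5\<close> of the theorem, under which every
  coefficient vanishes.\<close>

definition cond_zero :: "int \<Rightarrow> int \<Rightarrow> real \<Rightarrow> (real \<Rightarrow> complex) \<Rightarrow> bool" where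
  "cond_zero k1 k2 m \<phi> \<longleftrightarrow> (k1 = 0 \<and> m = 0) \<or> (k2 = 0 \<and> (\<exists>C::complex. radial_eq \<phi> (\<lambda>r. C))) \<or> (k1 = 0 \<and> k2 = 0) \<or>
     (k1 = k2 \<and> k2 \<noteq> 0 \<and> (\<exists>C::complex. radial_eq \<phi> (\<lambda>r. C * of_real (r powr m)))) \<or>
     (k1 * k2 = - 1 \<and> (\<exists>C::complex. radial_eq \<phi> (\<lambda>r. C * of_real ((m + 1) / 2 * r powr (- 1) - (m - 1) / 2 * r))))"

text \<open>The conditions \<open>c6\<close> to \<open>c9\<close> of the theorem, under which the
  image indices with nonzero coefficient are exactly those in \<open>Lambda1\<close>.\<close>

definition cond_full :: "int \<Rightarrow> int \<Rightarrow> real \<Rightarrow> (real \<Rightarrow> complex) \<Rightarrow> bool" where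
  "cond_full k1 k2 m \<phi> \<longleftrightarrow>
     (k1 * k2 < - 1 \<and> \<bar>k2\<bar> \<ge> 2 \<and> m + of_int \<bar>k1\<bar> = 0 \<and> (\<exists>C::complex. radial_eq \<phi> (\<lambda>r. C * of_real (r ^ nat \<bar>k2\<bar>)))) \<or>
     (k1 * k2 < - 1 \<and> \<bar>k2\<bar> = 1 \<and>
       (\<exists>C::complex. mellin_eq \<phi> (\<lambda>z. C * Gamma_quot
          ((z - 1) / (2 * complex_of_int \<bar>k1\<bar>)) ((z + complex_of_real m + complex_of_int \<bar>k1\<bar> + 1) / (2 * complex_of_int \<bar>k1\<bar>))
          ((z + 2 * complex_of_int \<bar>k1\<bar> + 1) / (2 * complex_of_int \<bar>k1\<bar>)) ((z + complex_of_real m + complex_of_int \<bar>k1\<bar> - 1) / (2 * complex_of_int \<bar>k1\<bar>))))) \<or>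
     (k1 * k2 > 0 \<and> k1 \<noteq> k2 \<and> of_int \<bar>k2\<bar> < m + of_int \<bar>k1\<bar> + 2 \<and>
       (\<exists>C::complex. mellin_eq \<phi> (\<lambda>z. C * Gamma_quot
          ((z + complex_of_int \<bar>k2\<bar>) / (2 * complex_of_int \<bar>k1\<bar>)) ((z + complex_of_real m + complex_of_int \<bar>k1\<bar> - complex_of_int \<bar>k2\<bar>) / (2 * complex_of_int \<bar>k1\<bar>))
          ((z + 2 * complex_of_int \<bar>k1\<bar> - complex_of_int \<bar>k2\<bar>) / (2 * complex_of_int \<bar>k1\<bar>)) ((z + complex_of_real m + complex_of_int \<bar>k1\<bar> + complex_of_int \<bar>k2\<bar>) / (2 * complex_of_int \<bar>k1\<bar>))))) \<or>
     (k1 * k2 > 0 \<and> of_int \<bar>k2\<bar> \<ge> m + of_int \<bar>k1\<bar> + 2 \<and>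
       (\<exists>n::nat. m = (2 * of_nat n + 1) * of_int \<bar>k1\<bar> \<and>
         (\<exists>C::complex. mellin_eq \<phi> (\<lambda>z. C *
            ((\<Prod>j=1..n. (z - complex_of_int \<bar>k2\<bar>) / (2 * complex_of_int \<bar>k1\<bar>) + of_nat j) /
             (\<Prod>j=0..n. (z + complex_of_int \<bar>k2\<bar>) / (2 * complex_of_int \<bar>k1\<bar>) + of_nat j))))))"

text \<open>Together with \<open>comm_coeff_uminus\<close> this reduces negative \<open>k1\<close>
  to positive \<open>k1\<close>.\<close>

lemma cond_uminus: "cond_zero (- k1) (- k2) m \<phi> = cond_zero k1 k2 m \<phi>" "cond_full (- k1) (- k2) m \<phi> = cond_full k1 k2 m \<phi>"
  unfolding cond_zero_def cond_full_def by simp_all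

lemma comm_coeff_uminus: "comm_coeff (- k1) (- k2) m \<phi> (- n) = comm_coeff k1 k2 m \<phi> n"
proof -
  have "\<bar>- n + - k2\<bar> = \<bar>n + k2\<bar>" "\<bar>- n + - k1\<bar> = \<bar>n + k1\<bar>" "\<bar>- n + - k1 + - k2\<bar> = \<bar>n + k1 + k2\<bar>" by (simp_all add: abs_if)
  then show ?thesis unfolding comm_coeff_def by (simp only: abs_minus_cancel)
qed

lemma radial_eqI: "(\<And>r. 0 < r \<Longrightarrow> r < 1 \<Longrightarrow> f r = g r) \<Longrightarrow> radial_eq f g"
  unfolding radial_eq_def by (rule AE_dA_radialI) auto

lemma radial_eq_trans: "radial_eq f g \<Longrightarrow> radial_eq g h \<Longrightarrow> radial_eq f h"
  unfolding radial_eq_def by (erule (1) eventually_elim2) simp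

lemma mellin_cmult: "mellin (\<lambda>r. C * \<eta> r) s = C * mellin \<eta> s"
  by (simp add: mellin_def mult.assoc)

lemma radial_integrable_cmult: "radial_integrable \<eta> \<Longrightarrow> radial_integrable (\<lambda>r. C * \<eta> r)"
  by (auto simp: radial_integrable_def)

lemma of_int_nat_eq: "s \<ge> 0 \<Longrightarrow> of_int s = (of_nat (nat s) :: complex)"
  by (metis int_nat_eq of_int_of_nat_eq)

lemma mellin_int_cmult:
  assumes "radial_integrable \<phi>" "radial_integrable \<eta>" "radial_eq \<phi> (\<lambda>r. C * \<eta> r)" "s \<ge> 2"
  shows "mellin \<phi> (of_int s) = C * mellin \<eta> (of_int s)"
proof -
  have "mellin \<phi> (of_nat (nat s)) = mellin (\<lambda>r. C * \<eta> r) (of_nat (nat s))"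
    by (rule mellin_nat_cong[OF assms(1) radial_integrable_cmult[OF assms(2)] assms(3)]) (use assms(4) in simp)
  then show ?thesis using assms(4) by (simp only: mellin_cmult of_int_nat_eq)
qed

lemma mellin_powr_int:
  assumes "m \<ge> - 1" "s \<ge> 2"
  shows "mellin (\<lambda>r. complex_of_real (r powr m)) (of_int s) = of_real (1 / (real_of_int s + m))"
proof -
  have "complex_of_int s = of_nat (nat s)" by (rule of_int_nat_eq[OF order_trans[OF zero_le_numeral assms(2)]])
  moreover have "mellin (\<lambda>r. complex_of_real (r powr m)) (of_int s) = 1 / (of_nat (nat s) + of_real m)"
    unfolding of_int_nat_eq[OF order_trans[OF zero_le_numeral assms(2)]] by (rule mellin_powr) (use assms in simp_all)
  ultimately show ?thesis by simp
qed

text \<open>Origin of the combination of r^(-1) and r: its transform is the partial fraction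
  expansion of (s + m)/((s - 1)(s + 1)), to which the Gamma quotient for a = 1 and b = -1 collapses
  up to a constant.\<close>

lemma mellin_powr_minus1_comb:
  fixes m :: real
  defines "\<eta> \<equiv> (\<lambda>r. complex_of_real ((m + 1) / 2 * r powr (- 1) - (m - 1) / 2 * r))"
  shows "radial_integrable \<eta>" "s \<ge> 2 \<Longrightarrow> mellin \<eta> (of_int s) = of_real ((real_of_int s + m) / ((real_of_int s - 1) * (real_of_int s + 1)))"
proof -
  define e1 e2 where "e1 = (\<lambda>r. of_real ((m + 1) / 2) * complex_of_real (r powr (- 1)))" and "e2 = (\<lambda>r. complex_of_real (r powr 1))"
  have ri: "radial_integrable e1" "radial_integrable e2"
    unfolding e1_def e2_def by (rule radial_integrable_cmult[OF powr_radial_integrable(1)], simp) (rule powr_radial_integrable(1), simp)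
  have d: "radial_integrable (\<lambda>r. e1 r - of_real ((m - 1) / 2) * e2 r)" by (rule radial_integrable_diff[OF ri])
  have eq: "\<eta> (cmod z) = e1 (cmod z) - of_real ((m - 1) / 2) * e2 (cmod z)" for z
    unfolding \<eta>_def e1_def e2_def by simp
  have re': "radial_eq \<eta> (\<lambda>r. e1 r - of_real ((m - 1) / 2) * e2 r)" unfolding radial_eq_def eq by (rule AE_I2) (rule refl)
  show re: "radial_integrable \<eta>" using d unfolding radial_integrable_def eq .
  assume s: "s \<ge> 2"
  have s2: "2 \<le> nat s" using s by simp
  have s3: "of_int s = (of_nat (nat s) :: complex)"
    by (rule of_int_nat_eq[OF order_trans[OF zero_le_numeral s]])
  have p1: "mellin (\<lambda>r. complex_of_real (r powr 1)) (of_int s) = of_real (1 / (real_of_int s + 1))"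
    by (rule mellin_powr_int[OF _ s]) simp
  have "mellin \<eta> (of_int s) = mellin (\<lambda>r. e1 r - of_real ((m - 1) / 2) * e2 r) (of_int s)"
    unfolding s3 by (rule mellin_nat_cong[OF re d re' s2])
  also have "\<dots> = mellin e1 (of_int s) - of_real ((m - 1) / 2) * mellin e2 (of_int s)"
    unfolding s3 by (rule mellin_nat_diff[OF ri s2])
  also have "\<dots> = of_real ((m + 1) / 2) * of_real (1 / (real_of_int s + (- 1))) - of_real ((m - 1) / 2) * of_real (1 / (real_of_int s + 1))"
    unfolding e1_def e2_def mellin_cmult mellin_powr_int[OF order_refl s] p1 by (rule refl)
  also have "\<dots> = of_real ((m + 1) / 2 * (1 / (real_of_int s + (- 1))) - (m - 1) / 2 * (1 / (real_of_int s + 1)))" by simp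
  also have "(m + 1) / 2 * (1 / (real_of_int s + (- 1))) - (m - 1) / 2 * (1 / (real_of_int s + 1)) = (real_of_int s + m) / ((real_of_int s - 1) * (real_of_int s + 1))"
  proof -
    have "real_of_int s - 1 \<noteq> 0" "real_of_int s + 1 \<noteq> 0" using s by linarith+
    then show ?thesis by (simp add: divide_simps) (simp add: algebra_simps)
  qed
  finally show "mellin \<eta> (of_int s) = of_real ((real_of_int s + m) / ((real_of_int s - 1) * (real_of_int s + 1)))" .
qed

lemma comm_coeff_eq_0I:
  assumes m: "m \<ge> - 1"
    and 1: "mellin \<phi> (of_int (\<bar>n\<bar> + \<bar>n + k2\<bar> + 2)) = C * of_real g1"
    and 2: "mellin \<phi> (of_int (\<bar>n + k1\<bar> + \<bar>n + k1 + k2\<bar> + 2)) = C * of_real g2"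
    and eq: "(\<bar>n + k2\<bar> + 1) * (\<bar>n\<bar> + \<bar>n + k1\<bar> + 2 + m) * g1 = (\<bar>n + k1\<bar> + 1) * (\<bar>n + k2\<bar> + \<bar>n + k1 + k2\<bar> + 2 + m) * g2"
  shows "comm_coeff k1 k2 m \<phi> n = 0"
proof (cases "C = 0")
  case True
  then show ?thesis unfolding comm_coeff_def 1 2 by simp
next
  case False
  then show ?thesis using comm_coeff_eq_0_iff[OF m False 1 2] eq by blast
qed

text \<open>A constant symbol and a multiple of r^m only need cancellation against the denominators.
  The case k1 k2 = -1 is computed for n \<ge> 1 and carried to n \<le> -1 by antisymmetry, whose
  fixed point is 0.\<close>

lemma comm_coeff_zero_pos:
  assumes a: "a > 0" and m: "m \<ge> - 1" and ri: "radial_integrable \<phi>" and c: "cond_zero a b m \<phi>"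
  shows "comm_coeff a b m \<phi> n = 0"
proof -
  note pw = powr_radial_integrable(1)
  consider (c2) C where "b = 0" "radial_eq \<phi> (\<lambda>r. C)" | (c4) C where "a = b" "radial_eq \<phi> (\<lambda>r. C * of_real (r powr m))"
    | (c5) C where "a * b = - 1" "radial_eq \<phi> (\<lambda>r. C * of_real ((m + 1) / 2 * r powr (- 1) - (m - 1) / 2 * r))"
    using c a unfolding cond_zero_def by auto
  then show ?thesis
  proof cases
    case c2
    have "radial_eq \<phi> (\<lambda>r. C * complex_of_real (r powr 0))" by (rule radial_eq_trans[OF c2(2)]) (rule radial_eqI, simp)
    then have mel: "mellin \<phi> (of_int s) = C * of_real (1 / (real_of_int s + 0))" if "s \<ge> 2" for s
      using mellin_int_cmult[OF ri pw[of 0] _ that] mellin_powr_int[of 0 s] that by simp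
    show ?thesis
    proof (rule comm_coeff_eq_0I[OF m mel mel])
      show "(\<bar>n + b\<bar> + 1) * (\<bar>n\<bar> + \<bar>n + a\<bar> + 2 + m) * (1 / (real_of_int (\<bar>n\<bar> + \<bar>n + b\<bar> + 2) + 0)) =
        (\<bar>n + a\<bar> + 1) * (\<bar>n + b\<bar> + \<bar>n + a + b\<bar> + 2 + m) * (1 / (real_of_int (\<bar>n + a\<bar> + \<bar>n + a + b\<bar> + 2) + 0))"
      proof -
        define x y where "x = real_of_int \<bar>n\<bar> + 1" and "y = real_of_int \<bar>n + a\<bar> + 1"
        have xy: "x > 0" "y > 0" by (auto simp: x_def y_def)
        have "x * (x + y + m) * (1 / (2 * x)) = y * (x + y + m) * (1 / (2 * y))" using xy by simp
        then show ?thesis unfolding x_def y_def c2(1) by (simp add: algebra_simps)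
      qed
    qed auto
  next
    case c4
    have mel: "mellin \<phi> (of_int s) = C * of_real (1 / (real_of_int s + m))" if "s \<ge> 2" for s
      using mellin_int_cmult[OF ri pw[OF m] c4(2) that] mellin_powr_int[OF m that] by simp
    show ?thesis
    proof (rule comm_coeff_eq_0I[OF m mel mel])
      show "(\<bar>n + b\<bar> + 1) * (\<bar>n\<bar> + \<bar>n + a\<bar> + 2 + m) * (1 / (real_of_int (\<bar>n\<bar> + \<bar>n + b\<bar> + 2) + m)) =
        (\<bar>n + a\<bar> + 1) * (\<bar>n + b\<bar> + \<bar>n + a + b\<bar> + 2 + m) * (1 / (real_of_int (\<bar>n + a\<bar> + \<bar>n + a + b\<bar> + 2) + m))"
      proof -
        define p q where "p = real_of_int (\<bar>n\<bar> + \<bar>n + b\<bar> + 2) + m" and "q = real_of_int (\<bar>n + b\<bar> + \<bar>n + b + b\<bar> + 2) + m"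
        have pq: "p > 0" "q > 0" unfolding p_def q_def using m by linarith+
        have "x * p * (1 / p) = x * q * (1 / q)" for x using pq by simp
        then show ?thesis unfolding p_def q_def c4(1) by simp
      qed
    qed auto
  next
    case c5
    then have ab: "a = 1" "b = - 1" using a by (auto simp: zmult_eq_1_iff) (smt (verit) mult_minus_right zmult_eq_1_iff)+
    have mel: "mellin \<phi> (of_int s) = C * of_real ((real_of_int s + m) / ((real_of_int s - 1) * (real_of_int s + 1)))" if "s \<ge> 2" for s
      using mellin_int_cmult[OF ri mellin_powr_minus1_comb(1) c5(2) that] mellin_powr_minus1_comb(2)[OF that] by simp
    have pos: "comm_coeff a b m \<phi> n = 0" if n: "n \<ge> 1" for n
    proof (rule comm_coeff_eq_0I[OF m mel mel])
      have abs: "\<bar>n\<bar> = n" "\<bar>n + b\<bar> = n - 1" "\<bar>n + a\<bar> = n + 1" "\<bar>n + a + b\<bar> = n" using n ab by auto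
      define x where "x = real_of_int n"
      have x: "x \<ge> 1" using n by (simp add: x_def)
      have "x * (2 * x + 3 + m) * ((2 * x + 1 + m) / ((2 * x) * (2 * x + 2))) = (x + 2) * (2 * x + 1 + m) * ((2 * x + 3 + m) / ((2 * x + 2) * (2 * x + 4)))"
        using x by (simp add: divide_simps) (simp add: algebra_simps)
      then show "(\<bar>n + b\<bar> + 1) * (\<bar>n\<bar> + \<bar>n + a\<bar> + 2 + m) * ((real_of_int (\<bar>n\<bar> + \<bar>n + b\<bar> + 2) + m) / ((real_of_int (\<bar>n\<bar> + \<bar>n + b\<bar> + 2) - 1) * (real_of_int (\<bar>n\<bar> + \<bar>n + b\<bar> + 2) + 1))) =
        (\<bar>n + a\<bar> + 1) * (\<bar>n + b\<bar> + \<bar>n + a + b\<bar> + 2 + m) * ((real_of_int (\<bar>n + a\<bar> + \<bar>n + a + b\<bar> + 2) + m) / ((real_of_int (\<bar>n + a\<bar> + \<bar>n + a + b\<bar> + 2) - 1) * (real_of_int (\<bar>n + a\<bar> + \<bar>n + a + b\<bar> + 2) + 1)))"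
        unfolding abs x_def by (simp add: algebra_simps)
    qed auto
    have anti: "comm_coeff a b m \<phi> (- n) = - comm_coeff a b m \<phi> n" for n
      using comm_coeff_antisym[of a b m \<phi> n] ab by simp
    consider "n \<ge> 1" | "n = 0" | "- n \<ge> 1" by linarith
    then show ?thesis
    proof cases
      case 2
      then show ?thesis using anti[of 0] by simp
    next
      case 3
      then show ?thesis using pos[of "- n"] anti[of n] by simp
    qed (rule pos)
  qed
qed

lemma of_int_a_pos:
  assumes "(a::int) > 0"
  shows "real_of_int a \<ge> 1" "complex_of_int a \<noteq> 0"
  using assms by auto

lemma rGamma_ratio_1: "Re z > 0 \<Longrightarrow> Gamma z * rGamma (z + 1) = 1 / z"
proof -
  assume z: "Re z > 0"
  then have "z \<noteq> 0" by auto
  moreover have "z * (Gamma z * rGamma (z + 1)) = Gamma z * rGamma z" using rGamma_plus1[of z] by (simp add: mult_ac)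
  ultimately show ?thesis using Gamma_rGamma[OF z] by (simp add: field_simps)
qed

text \<open>Where \<open>A\<close> and \<open>B\<close> have positive real part, both factors on the
  left are invertible.\<close>

lemma Gamma_relation_solve:
  assumes "f * (rGamma A * rGamma B) = C * (rGamma D * rGamma E)" "Re A > 0" "Re B > 0"
  shows "f = C * Gamma_quot A B D E"
proof -
  have "f = (Gamma A * rGamma A) * (Gamma B * rGamma B) * f" using Gamma_rGamma assms(2,3) by simp
  also have "\<dots> = Gamma A * Gamma B * (f * (rGamma A * rGamma B))" by (simp add: mult_ac)
  finally show ?thesis unfolding assms(1) Gamma_quot_def by (simp add: mult_ac)
qed

lemma prod_shift_pochhammer:
  "(\<Prod>j=1..n. w + of_nat j) = pochhammer (w + 1 :: complex) n" "(\<Prod>j=0..n. w + of_nat j) = pochhammer w (Suc n)"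
proof -
  show "(\<Prod>j=0..n. w + of_nat j) = pochhammer w (Suc n)" by (simp add: pochhammer_Suc_prod atLeast0AtMost)
  have "(\<Prod>j=1..n. w + of_nat j) = (\<Prod>j=0..<n. w + 1 + of_nat j)"
    by (subst prod.atLeast_Suc_atMost_Suc_shift[of _ 0 "n - 1", symmetric] prod.reindex_bij_witness[of _ Suc "\<lambda>j. j - 1"], auto)
  then show "(\<Prod>j=1..n. w + of_nat j) = pochhammer (w + 1) n" by (simp add: pochhammer_prod)
qed

lemma mellin_determines_radial:
  assumes "radial_integrable \<phi>" "radial_integrable \<eta>"
    and mel: "\<And>s::int. s \<ge> max 2 s0 \<Longrightarrow> mellin \<phi> (of_int s) = C * mellin \<eta> (of_int s)"
  shows "radial_eq \<phi> (\<lambda>r. C * \<eta> r)"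
proof (rule radial_eq_of_mellin[OF assms(1,2)])
  fix n :: nat assume "n \<ge> nat (max 2 s0)"
  then have "int n \<ge> max 2 s0" by linarith
  from mel[OF this] show "mellin \<phi> (of_nat n) = C * mellin \<eta> (of_nat n)" by simp
qed

section \<open>Conditions forced by finite rank\<close>

text \<open>For b = 0, b = a and the pair a = 1, b = -1 the Gamma quotient collapses to a rational
  function with a known symbol. In two ranges the relation has an obstruction: its left side
  vanishes at a point with Re z \<ge> 2, namely z = -b for b \<le> -2 and z = b - m - a for b \<ge>
  m + a + 2. A factor on the right must vanish there too, which restricts \<open>m\<close>. In the
  remaining ranges the quotient is valid for all Re z \<ge> 2.\<close>

lemma finite_support_imp_cond_pos:
  fixes a b :: int and m :: real
  assumes ri: "radial_integrable \<phi>" and nz: "\<not> radial_eq \<phi> (\<lambda>r. 0)" and a: "a > 0" and m: "m \<ge> - 1"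
    and zero: "\<And>n. n \<ge> n0 \<Longrightarrow> comm_coeff a b m \<phi> n = 0"
  shows "cond_zero a b m \<phi> \<or> cond_full a b m \<phi>"
proof -
  note ar = of_int_a_pos[OF a]
  note pw = powr_radial_integrable(1)
  define A B D E where "A = (\<lambda>z. (z + of_int b) / (2 * of_int a) :: complex)"
    and "B = (\<lambda>z. (z + of_real m + of_int a - of_int b) / (2 * of_int a) :: complex)"
    and "D = (\<lambda>z. (z + 2 * of_int a - of_int b) / (2 * of_int a) :: complex)"
    and "E = (\<lambda>z. (z + of_real m + of_int a + of_int b) / (2 * of_int a) :: complex)"
  have "\<exists>C. C \<noteq> 0 \<and> (\<forall>z. Re z \<ge> 2 \<longrightarrow> mellin \<phi> z * (rGamma (A z) * rGamma (B z)) = C * (rGamma (D z) * rGamma (E z)))"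
    unfolding A_def B_def D_def E_def by (rule mellin_Gamma_relation[OF ri nz a m zero], assumption) blast
  then obtain C where C: "C \<noteq> 0" and H: "\<And>z. Re z \<ge> 2 \<Longrightarrow> mellin \<phi> z * (rGamma (A z) * rGamma (B z)) = C * (rGamma (D z) * rGamma (E z))"
    by blast
  have Re: "Re (A z) = (Re z + b) / (2 * a)" "Re (B z) = (Re z + m + a - b) / (2 * a)" "Re (D z) = (Re z + 2 * a - b) / (2 * a)"
    "Re (E z) = (Re z + m + a + b) / (2 * a)" for z
    unfolding A_def B_def D_def E_def Re_divide_int by simp_all
  have Rei: "Re (complex_of_int s) = s" for s by simp
  consider "b = 0" | "b = a" | "b \<le> - 2" | "b = - 1" "a = 1" | "b = - 1" "a \<ge> 2" | "b > 0" "b \<noteq> a" "b < m + a + 2" | "b > 0" "b \<ge> m + a + 2"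
    using a by linarith
  then show ?thesis
  proof cases
    case 1
    have "radial_eq \<phi> (\<lambda>r. 2 * of_int a * C * of_real (r powr 0))"
    proof (rule mellin_determines_radial[OF ri pw])
      fix s :: int assume "s \<ge> max 2 2"
      then have s: "s \<ge> 2" by simp
      have pos: "Re (A (of_int s)) > 0" "Re (B (of_int s)) > 0" using s ar m 1 unfolding Re by (auto intro!: divide_pos_pos)
      have eq: "E (of_int s) = B (of_int s)" "D (of_int s) = A (of_int s) + 1" using 1 ar by (simp_all add: A_def B_def D_def E_def field_simps)
      have "mellin \<phi> (of_int s) = C * Gamma_quot (A (of_int s)) (B (of_int s)) (A (of_int s) + 1) (B (of_int s))"
        using Gamma_relation_solve[OF H pos] s unfolding eq by simp
      also have "\<dots> = C * (Gamma (A (of_int s)) * rGamma (A (of_int s) + 1)) * (Gamma (B (of_int s)) * rGamma (B (of_int s)))"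
        by (simp add: Gamma_quot_def)
      also have "\<dots> = C * (1 / A (of_int s))" by (simp only: rGamma_ratio_1[OF pos(1)] Gamma_rGamma[OF pos(2)] mult_1_right)
      also have "\<dots> = 2 * of_int a * C * of_real (1 / (real_of_int s + 0))" using 1 by (simp add: A_def)
      finally show "mellin \<phi> (of_int s) = 2 * of_int a * C * mellin (\<lambda>r. complex_of_real (r powr 0)) (of_int s)"
        using mellin_powr_int[OF _ s, of 0] by simp
    qed simp
    then have "radial_eq \<phi> (\<lambda>r. 2 * of_int a * C)" by (rule radial_eq_trans) (rule radial_eqI, simp)
    then show ?thesis using 1 unfolding cond_zero_def by blast
  next
    case 2
    have "radial_eq \<phi> (\<lambda>r. 2 * of_int a * C * of_real (r powr m))"
    proof (rule mellin_determines_radial[OF ri pw[OF m]])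
      fix s :: int assume "s \<ge> max 2 2"
      then have s: "s \<ge> 2" by simp
      have pos: "Re (A (of_int s)) > 0" "Re (B (of_int s)) > 0" using s ar m 2 unfolding Re by (auto intro!: divide_pos_pos)
      have eq: "D (of_int s) = A (of_int s)" "E (of_int s) = B (of_int s) + 1" using 2 ar by (simp_all add: A_def B_def D_def E_def field_simps)
      have "mellin \<phi> (of_int s) = C * Gamma_quot (A (of_int s)) (B (of_int s)) (A (of_int s)) (B (of_int s) + 1)"
        using Gamma_relation_solve[OF H pos] s unfolding eq by simp
      also have "\<dots> = C * (Gamma (B (of_int s)) * rGamma (B (of_int s) + 1)) * (Gamma (A (of_int s)) * rGamma (A (of_int s)))"
        by (simp add: Gamma_quot_def)
      also have "\<dots> = C * (1 / B (of_int s))" by (simp only: rGamma_ratio_1[OF pos(2)] Gamma_rGamma[OF pos(1)] mult_1_right)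
      also have "\<dots> = 2 * of_int a * C * of_real (1 / (real_of_int s + m))" using 2 by (simp add: B_def)
      finally show "mellin \<phi> (of_int s) = 2 * of_int a * C * mellin (\<lambda>r. complex_of_real (r powr m)) (of_int s)"
        by (simp only: mellin_powr_int[OF m s])
    qed
    then show ?thesis using 2 a unfolding cond_zero_def by auto
  next
    case 3
    \<comment> \<open>\<open>A\<close> is 0 at z = -b, so the left side vanishes. On the right
      \<open>D\<close> has positive real part, hence \<open>E\<close>, which equals (m + a)/(2a),
      must be a pole of Gamma; this leaves only a = 1 and m = -1.\<close>
    have "C * (rGamma (D (of_int (- b))) * rGamma (E (of_int (- b)))) = 0"
      using H[of "of_int (- b)"] 3 by (simp add: A_def)
    moreover have "Re (D (of_int (- b))) > 0" using 3 ar unfolding Re Rei by (auto intro!: divide_pos_pos)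
    ultimately have "rGamma (E (of_int (- b))) = 0" using C rGamma_pos_nonzero by simp
    then have "\<not> Re (E (of_int (- b))) > 0" using rGamma_pos_nonzero by blast
    then have "m + a \<le> 0" using ar unfolding Re Rei by (simp add: divide_simps split: if_splits)
    then have am: "a = 1" "m = - 1" using ar m by auto
    have "radial_eq \<phi> (\<lambda>r. 2 * C * of_real (r powr (- b)))"
    proof (rule mellin_determines_radial[OF ri pw])
      fix s :: int assume "s \<ge> max 2 (1 - b)"
      then have s: "s \<ge> 2" "s > - b" by auto
      have pos: "Re (A (of_int s)) > 0" "Re (B (of_int s)) > 0" using s am 3 unfolding Re Rei by auto
      have eq: "E (of_int s) = A (of_int s)" "D (of_int s) = B (of_int s) + 1" using am by (simp_all add: A_def B_def D_def E_def field_simps)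
      have "mellin \<phi> (of_int s) = C * Gamma_quot (A (of_int s)) (B (of_int s)) (B (of_int s) + 1) (A (of_int s))"
        using Gamma_relation_solve[OF H pos] s unfolding eq by simp
      also have "\<dots> = C * (Gamma (B (of_int s)) * rGamma (B (of_int s) + 1)) * (Gamma (A (of_int s)) * rGamma (A (of_int s)))"
        by (simp add: Gamma_quot_def)
      also have "\<dots> = C * (1 / B (of_int s))" by (simp only: rGamma_ratio_1[OF pos(2)] Gamma_rGamma[OF pos(1)] mult_1_right)
      also have "\<dots> = 2 * C * of_real (1 / (real_of_int s + real_of_int (- b)))" using am by (simp add: B_def)
      finally show "mellin \<phi> (of_int s) = 2 * C * mellin (\<lambda>r. complex_of_real (r powr real_of_int (- b))) (of_int s)"
        using mellin_powr_int[OF _ s(1), of "real_of_int (- b)"] 3 by simp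
    qed (use 3 in simp)
    then have "radial_eq \<phi> (\<lambda>r. 2 * C * of_real (r ^ nat \<bar>b\<bar>))"
    proof (rule radial_eq_trans, intro radial_eqI)
      fix r :: real assume "0 < r"
      have "real_of_int (- b) = real (nat \<bar>b\<bar>)" using 3 by simp
      then have "r powr real_of_int (- b) = r ^ nat \<bar>b\<bar>" using \<open>0 < r\<close> by (simp only: powr_realpow)
      then show "2 * C * complex_of_real (r powr real_of_int (- b)) = 2 * C * complex_of_real (r ^ nat \<bar>b\<bar>)" by simp
    qed
    then show ?thesis unfolding cond_full_def using 3 am by auto
  next
    case 4
    have "radial_eq \<phi> (\<lambda>r. 2 * C * of_real ((m + 1) / 2 * r powr (- 1) - (m - 1) / 2 * r))"
    proof (rule mellin_determines_radial[OF ri mellin_powr_minus1_comb(1)])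
      fix s :: int assume "s \<ge> max 2 2"
      then have s: "s \<ge> 2" by simp
      have pos1: "Re (A (of_int s)) > 0" using s 4 unfolding Re by simp
      then have pos: "Re (A (of_int s)) > 0" "Re (A (of_int s) + 1) > 0" "Re (B (of_int s)) > 0" "Re (E (of_int s)) > 0"
        using s m 4 by (simp_all add: Re(2,4))
      have eq: "B (of_int s) = E (of_int s) + 1" "D (of_int s) = A (of_int s) + 1 + 1" using 4 by (simp_all add: A_def B_def D_def E_def field_simps)
      have ne: "E (of_int s) \<notin> \<int>\<^sub>\<le>\<^sub>0" "A (of_int s) \<notin> \<int>\<^sub>\<le>\<^sub>0" "A (of_int s) \<noteq> 0" using pos by (auto elim!: nonpos_Ints_cases)
      have "mellin \<phi> (of_int s) = C * Gamma_quot (A (of_int s)) (E (of_int s) + 1) (A (of_int s) + 1 + 1) (E (of_int s))"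
        using Gamma_relation_solve[OF H pos(1,3)] s unfolding eq by simp
      also have "\<dots> = C * (Gamma (A (of_int s) + 1) * rGamma (A (of_int s) + 1 + 1)) / A (of_int s) * (E (of_int s) * (Gamma (E (of_int s)) * rGamma (E (of_int s))))"
        unfolding Gamma_quot_def Gamma_plus1[OF ne(1)] Gamma_plus1[OF ne(2)] using ne(3) by simp
      also have "\<dots> = C * (1 / (A (of_int s) + 1)) / A (of_int s) * E (of_int s)" by (simp only: rGamma_ratio_1[OF pos(2)] Gamma_rGamma[OF pos(4)] mult_1_right)
      also have "\<dots> = 2 * C * of_real ((real_of_int s + m) / ((real_of_int s - 1) * (real_of_int s + 1)))"
      proof -
        have alg: "C * (1 / ((z - 1) / 2 + 1)) / ((z - 1) / 2) * ((z + w) / 2) = 2 * C * ((z + w) / ((z - 1) * (z + 1)))" if "z \<noteq> 1" "z \<noteq> - 1" for z w :: complex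
        proof -
          have e: "(z - 1) / 2 + 1 = (z + 1) / 2" by (simp add: field_simps)
          have "z - 1 \<noteq> 0" "z + 1 \<noteq> 0" using that by (simp_all flip: eq_neg_iff_add_eq_0)
          then show ?thesis unfolding e by (simp add: divide_simps)
        qed
        have n1: "complex_of_int s \<noteq> 1" using s by simp
        have n2: "complex_of_int s \<noteq> - 1"
        proof
          assume "complex_of_int s = - 1"
          then have "complex_of_int s = of_int (- 1)" by simp
          then show False using s by (simp only: of_int_eq_iff)
        qed
        have AE: "A (of_int s) = (of_int s - 1) / 2" "E (of_int s) = (of_int s + of_real m) / 2" using 4 by (simp_all add: A_def E_def)
        show ?thesis unfolding AE alg[OF n1 n2] by simp
      qed
      finally show "mellin \<phi> (of_int s) = 2 * C * mellin (\<lambda>r. complex_of_real ((m + 1) / 2 * r powr (- 1) - (m - 1) / 2 * r)) (of_int s)"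
        by (simp only: mellin_powr_minus1_comb(2)[OF s])
    qed
    then show ?thesis unfolding cond_zero_def using 4 by auto
  next
    case 5
    have "mellin_eq \<phi> (\<lambda>z. C * Gamma_quot (A z) (B z) (D z) (E z))"
      unfolding mellin_eq_def
    proof (intro allI impI Gamma_relation_solve[OF H])
      fix z assume z: "2 \<le> Re z"
      show "Re (A z) > 0" "Re (B z) > 0" using 5 m z unfolding Re by (auto intro!: divide_pos_pos)
    qed
    then show ?thesis unfolding cond_full_def A_def B_def D_def E_def using 5 by auto
  next
    case 6
    have "mellin_eq \<phi> (\<lambda>z. C * Gamma_quot (A z) (B z) (D z) (E z))"
      unfolding mellin_eq_def
    proof (intro allI impI Gamma_relation_solve[OF H])
      fix z assume z: "2 \<le> Re z"
      show "Re (A z) > 0" "Re (B z) > 0" using 6 m z ar unfolding Re by (auto intro!: divide_pos_pos)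
    qed
    moreover have "a * b > 0" "\<bar>a\<bar> = a" "\<bar>b\<bar> = b" "a \<noteq> b" using 6 a by auto
    moreover have "real_of_int \<bar>b\<bar> < m + of_int \<bar>a\<bar> + 2" using 6 a by simp
    ultimately show ?thesis unfolding cond_full_def A_def B_def D_def E_def
      by - (rule disjI2, rule disjI2, rule disjI2, rule disjI1, intro conjI exI[of _ C], simp_all)
  next
    case 7
    \<comment> \<open>The zero of \<open>B\<close>. Here \<open>E\<close> equals b/a > 0, so
      \<open>D\<close>, which equals (a - m)/(2a), must be an integer -n \<le> 0, that is, m = (2n +
      1)a.\<close>
    define z0 where "z0 = complex_of_real (b - m - a)"
    have "B z0 = 0" by (simp add: B_def z0_def)
    moreover have "Re z0 \<ge> 2" using 7 by (simp add: z0_def)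
    ultimately have "rGamma (D z0) * rGamma (E z0) = 0" using H[of z0] C by simp
    moreover have "Re (E z0) > 0" unfolding Re using 7 ar by (auto simp: z0_def intro!: divide_pos_pos)
    ultimately have "rGamma (D z0) = 0" using rGamma_pos_nonzero by simp
    then obtain k where k: "D z0 = of_int k" "k \<le> 0" by (auto simp: rGamma_eq_zero_iff elim!: nonpos_Ints_cases)
    define n where "n = nat (- k)"
    have "D z0 = of_real ((a - m) / (2 * a))" by (simp add: D_def z0_def)
    then have "complex_of_real ((a - m) / (2 * a)) = of_real (of_int k)" using k by simp
    then have "(a - m) / (2 * a) = of_int k" by (simp only: of_real_eq_iff)
    then have "m = (2 * (- real_of_int k) + 1) * a" using ar by (simp add: field_simps)
    moreover have "- real_of_int k = real n" using k(2) by (simp add: n_def)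
    ultimately have mn: "m = (2 * real n + 1) * a" by simp
    define w where "w = (\<lambda>z. (z - of_int b) / (2 * of_int a) :: complex)"
    have mc: "complex_of_real m = (2 * of_nat n + 1) * of_int a" unfolding mn by simp
    have eqs: "B z = w z + 1 + of_nat n" "D z = w z + 1" "E z = A z + of_nat (Suc n)" for z
      unfolding A_def B_def D_def E_def w_def mc using ar(2) by (simp_all add: field_simps)
    \<comment> \<open>Both sides share the factors \<open>rGamma (B z)\<close> and
      \<open>rGamma (E z)\<close>. The first vanishes at \<open>z0\<close>, so they are cancelled
      far to the right only, and the resulting identity with entire \<open>P\<close> and
      \<open>Q\<close> is continued back to Re z \<ge> 2.\<close>
    define P Q where "P = (\<lambda>z. \<Prod>j=0..n. A z + of_nat j)" and "Q = (\<lambda>z. C * (\<Prod>j=1..n. w z + of_nat j))"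
    have ext: "mellin \<phi> z * P z = Q z" if "Re z \<ge> 2" for z
    proof (rule mellin_identity_extend[OF ri _ _ _ that])
      show "P holomorphic_on UNIV" "Q holomorphic_on UNIV"
        unfolding P_def Q_def A_def w_def using ar(2) by (auto intro!: holomorphic_intros)
      fix z assume z: "Re z > real_of_int (max 2 b)"
      then have z2: "Re z \<ge> 2" by simp
      have nz: "rGamma (B z) \<noteq> 0" "rGamma (E z) \<noteq> 0"
        using z ar m 7 unfolding Re by (auto intro!: rGamma_pos_nonzero divide_pos_pos simp: Re)
      have "rGamma (A z) = P z * rGamma (E z)" "C * rGamma (D z) = Q z * rGamma (B z)"
        unfolding P_def Q_def prod_shift_pochhammer eqs using pochhammer_rGamma[of "A z" "Suc n"] pochhammer_rGamma[of "w z + 1" n] by simp_all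
      then show "mellin \<phi> z * P z = Q z" using H[OF z2] nz by (auto simp: mult_ac)
    qed
    have "mellin_eq \<phi> (\<lambda>z. C * ((\<Prod>j=1..n. w z + of_nat j) / (\<Prod>j=0..n. A z + of_nat j)))"
      unfolding mellin_eq_def
    proof (intro allI impI)
      fix z assume z: "Re z \<ge> 2"
      have "Re (A z + of_nat j) > 0" for j using z 7 ar by (auto simp: Re intro!: add_pos_nonneg divide_pos_pos)
      then have "A z + of_nat j \<noteq> 0" for j by (metis less_irrefl zero_complex.sel(1))
      then have "P z \<noteq> 0" by (simp add: P_def)
      then show "mellin \<phi> z = C * ((\<Prod>j=1..n. w z + of_nat j) / (\<Prod>j=0..n. A z + of_nat j))"
        using ext[OF z] unfolding P_def Q_def by (simp add: field_simps)
    qed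
    moreover have "a * b > 0" "\<bar>a\<bar> = a" "\<bar>b\<bar> = b" using 7 a by auto
    moreover have "real_of_int \<bar>b\<bar> \<ge> m + of_int \<bar>a\<bar> + 2" using 7 a by simp
    ultimately show ?thesis unfolding cond_full_def A_def w_def using mn
      by - (rule disjI2, rule disjI2, rule disjI2, rule disjI2, rule conjI, simp, rule conjI, simp, rule exI[of _ n], rule conjI, simp, rule exI[of _ C], simp)
  qed
qed

section \<open>Supports under the stated conditions\<close>

lemma Gamma_quot_of_real:
  "Gamma_quot (of_real p) (of_real q) (of_real r) (of_real s) = of_real (Gamma p * Gamma q / (Gamma r * Gamma s))"
  by (simp add: Gamma_quot_def Gamma_complex_of_real rGamma_complex_of_real rGamma_inverse_Gamma divide_inverse)

lemma mellin_sol_Gamma_quot: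
  assumes a: "a > 0"
  shows "Gamma_quot ((of_int z + of_int b) / (2 * of_int a)) ((of_int z + of_real m + of_int a - of_int b) / (2 * of_int a))
    ((of_int z + 2 * of_int a - of_int b) / (2 * of_int a)) ((of_int z + of_real m + of_int a + of_int b) / (2 * of_int a))
    = of_real (mellin_sol a b m z)"
proof -
  note ar = of_int_a_pos[OF a]
  let ?r = "of_real :: real \<Rightarrow> complex"
  have e: "(of_int z + of_int b) / (2 * of_int a) = ?r ((z + b) / (2 * a))"
    "(of_int z + of_real m + of_int a - of_int b) / (2 * of_int a) = ?r ((z - b) / (2 * a) + (m + a) / (2 * a))"
    "(of_int z + 2 * of_int a - of_int b) / (2 * of_int a) = ?r ((z - b) / (2 * a) + 1)"
    "(of_int z + of_real m + of_int a + of_int b) / (2 * of_int a) = ?r ((z + b) / (2 * a) + (m + a) / (2 * a))"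
    using ar by (simp_all add: field_simps)
  show ?thesis unfolding e Gamma_quot_of_real mellin_sol_def by simp
qed

text \<open>For m = (2n + 1)a the shift \<mu> = (m + a)/(2a) is the integer n + 1, so the Gamma
  quotients are Pochhammer products.\<close>

lemma mellin_sol_pochhammer:
  assumes a: "a > 0" and z: "z - b > 0" "z + b > 0" and m: "m = (2 * real n + 1) * a"
  shows "(\<Prod>j=1..n. (of_int z - of_int b) / (2 * of_int a) + of_nat j) / (\<Prod>j=0..n. (of_int z + of_int b) / (2 * of_int a) + of_nat j)
    = complex_of_real (mellin_sol a b m z)"
proof -
  note ar = of_int_a_pos[OF a]
  define w v where "w = real_of_int (z - b) / (2 * a)" and "v = real_of_int (z + b) / (2 * a)"
  have wv: "w > 0" "v > 0" using z ar by (simp_all add: w_def v_def del: of_int_add of_int_diff)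
  have e: "(of_int z - of_int b) / (2 * of_int a) = complex_of_real w" "(of_int z + of_int b) / (2 * of_int a) = complex_of_real v"
    by (simp_all add: w_def v_def)
  have \<mu>: "(m + real_of_int a) / (2 * real_of_int a) = real n + 1" using ar by (simp add: m field_simps)
  have "mellin_sol a b m z = Gamma v * Gamma (w + (real n + 1)) / (Gamma (w + 1) * Gamma (v + (real n + 1)))"
    by (simp add: mellin_sol_def w_def v_def \<mu>)
  moreover have "w + 1 \<notin> \<int>\<^sub>\<le>\<^sub>0" "v \<notin> \<int>\<^sub>\<le>\<^sub>0" using wv by (auto elim!: nonpos_Ints_cases)
  then have "pochhammer (w + 1) n = Gamma (w + (real n + 1)) / Gamma (w + 1)" "pochhammer v (Suc n) = Gamma (v + (real n + 1)) / Gamma v"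
    by (simp_all add: pochhammer_Gamma add_ac)
  ultimately have "mellin_sol a b m z = pochhammer (w + 1) n / pochhammer v (Suc n)"
    by simp
  moreover have "pochhammer (complex_of_real w + 1) n = of_real (pochhammer (w + 1) n)" "pochhammer (complex_of_real v) (Suc n) = of_real (pochhammer v (Suc n))"
    by (simp_all only: pochhammer_of_real[symmetric] of_real_add of_real_1)
  ultimately show ?thesis unfolding e prod_shift_pochhammer by simp
qed

text \<open>Here m + a = 0, so \<mu> = 0 and \<open>gquot\<close> is constantly 1 where it is
  defined. Comparing its values gives no information, and the coefficients are computed
  directly.\<close>

lemma comm_coeff_support_power:
  assumes b: "b \<le> - 2" and C: "C \<noteq> 0"
    and mel: "\<And>s. s \<ge> 2 \<Longrightarrow> mellin \<phi> (of_int s) = C * of_real (1 / (real_of_int s - real_of_int b))"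
  shows "n \<ge> - b \<Longrightarrow> comm_coeff 1 b (- 1) \<phi> n = 0"
    "- (1 + b) < 2 * n \<Longrightarrow> n < - b \<Longrightarrow> comm_coeff 1 b (- 1) \<phi> n \<noteq> 0"
proof -
  have m: "- 1 \<ge> (- 1 :: real)" by simp
  have iff: "comm_coeff 1 b (- 1) \<phi> n = 0 \<longleftrightarrow>
    (\<bar>n + b\<bar> + 1) * (\<bar>n\<bar> + \<bar>n + 1\<bar> + 2 + (- 1 :: real)) * (1 / (real_of_int (\<bar>n\<bar> + \<bar>n + b\<bar> + 2) - real_of_int b)) =
    (\<bar>n + 1\<bar> + 1) * (\<bar>n + b\<bar> + \<bar>n + 1 + b\<bar> + 2 + (- 1 :: real)) * (1 / (real_of_int (\<bar>n + 1\<bar> + \<bar>n + 1 + b\<bar> + 2) - real_of_int b))"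
    by (rule comm_coeff_eq_0_iff[OF m C mel mel]) simp_all
  define x y where "x = real_of_int n" and "y = real_of_int b"
  show "comm_coeff 1 b (- 1) \<phi> n = 0" if n: "n \<ge> - b"
  proof -
    have abs: "\<bar>n\<bar> = n" "\<bar>n + b\<bar> = n + b" "\<bar>n + 1\<bar> = n + 1" "\<bar>n + 1 + b\<bar> = n + 1 + b" using n b by auto
    have x: "x \<ge> 0" using n b by (simp add: x_def)
    have "(x + y + 1) * (2 * x + 2) * (1 / (2 * x + 2)) = (x + 2) * (2 * x + 2 * y + 2) * (1 / (2 * x + 4))"
      using x by (simp add: divide_simps) (simp add: algebra_simps)
    then show ?thesis unfolding iff abs by (simp add: x_def y_def algebra_simps)
  qed
  show "comm_coeff 1 b (- 1) \<phi> n \<noteq> 0" if n: "- (1 + b) < 2 * n" "n < - b"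
  proof -
    have abs: "\<bar>n\<bar> = n" "\<bar>n + b\<bar> = - b - n" "\<bar>n + 1\<bar> = n + 1" "\<bar>n + 1 + b\<bar> = - b - n - 1" using n b by auto
    have y: "2 - 2 * y > 0" using b by (simp add: y_def)
    have xy: "2 * x + y + 1 \<noteq> 0"
    proof
      assume "2 * x + y + 1 = 0"
      then have "real_of_int (2 * n + b + 1) = 0" by (simp add: x_def y_def)
      then have "2 * n + b + 1 = 0" by (simp only: of_int_eq_0_iff)
      then show False using n by simp
    qed
    have "(- y - x + 1) * (2 * x + 2) - (x + 2) * (- 2 * y - 2 * x) = 2 * (2 * x + y + 1)" by (simp add: algebra_simps)
    then have "(- y - x + 1) * (2 * x + 2) \<noteq> (x + 2) * (- 2 * y - 2 * x)" using xy by auto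
    then have "(- y - x + 1) * (2 * x + 2) * (1 / (2 - 2 * y)) \<noteq> (x + 2) * (- 2 * y - 2 * x) * (1 / (2 - 2 * y))" using y by simp
    moreover have "(\<bar>n + b\<bar> + 1) * (\<bar>n\<bar> + \<bar>n + 1\<bar> + 2 + (- 1 :: real)) * (1 / (real_of_int (\<bar>n\<bar> + \<bar>n + b\<bar> + 2) - real_of_int b))
        = (- y - x + 1) * (2 * x + 2) * (1 / (2 - 2 * y))"
      unfolding abs by (simp add: x_def y_def)
    moreover have "(\<bar>n + 1\<bar> + 1) * (\<bar>n + b\<bar> + \<bar>n + 1 + b\<bar> + 2 + (- 1 :: real)) * (1 / (real_of_int (\<bar>n + 1\<bar> + \<bar>n + 1 + b\<bar> + 2) - real_of_int b))
        = (x + 2) * (- 2 * y - 2 * x) * (1 / (2 - 2 * y))"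
      unfolding abs by (simp add: x_def y_def algebra_simps)
    ultimately show ?thesis unfolding iff by simp
  qed
qed

text \<open>The conditions stated through Mellin transforms make the transform a multiple of
  \<open>mellin_sol\<close> at the relevant integers, so \<open>comm_coeff_support\<close> applies;
  the power symbol is settled by \<open>comm_coeff_support_power\<close>.\<close>

lemma cond_full_support_pos:
  fixes a b :: int and m :: real
  assumes ri: "radial_integrable \<phi>" and nz: "\<not> radial_eq \<phi> (\<lambda>r. 0)" and a: "a > 0" and m: "m \<ge> - 1"
    and c: "cond_full a b m \<phi>"
  shows "n \<ge> N1 a b \<Longrightarrow> comm_coeff a b m \<phi> n = 0"
    "- (a + b) < 2 * n \<Longrightarrow> n < N1 a b \<Longrightarrow> comm_coeff a b m \<phi> n \<noteq> 0"
proof -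
  note ar = of_int_a_pos[OF a]
  \<comment> \<open>With C = 0 all large moments of \<phi> would vanish. The formula is asked for
    only from some \<open>s0\<close> on, since one condition gives it only there.\<close>
  have nonzero: "C \<noteq> 0" if F: "\<And>z. z \<ge> s0 \<Longrightarrow> mellin \<phi> (of_int z) = C * F z" for C F and s0 :: int
  proof
    assume "C = 0"
    have "radial_eq \<phi> (\<lambda>r. 0)"
    proof (rule mellin_zero_imp_radial_zero[OF ri])
      fix n :: nat assume "n \<ge> nat s0"
      then have "int n \<ge> s0" by linarith
      from F[OF this] show "mellin \<phi> (of_nat n) = 0" using \<open>C = 0\<close> by simp
    qed
    then show False using nz by contradiction
  qed
  have sign: "\<bar>b\<bar> = b" if "a * b > 0" using that a by (simp add: zero_less_mult_iff)
  have sign': "b < 0" if "a * b < - 1" using that a by (metis less_trans mult_less_0_iff neg_0_less_iff_less not_less_iff_gr_or_eq zero_less_one)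
  have aa: "\<bar>a\<bar> = a" using a by simp
  have "(n \<ge> N1 a b \<longrightarrow> comm_coeff a b m \<phi> n = 0) \<and> (- (a + b) < 2 * n \<longrightarrow> n < N1 a b \<longrightarrow> comm_coeff a b m \<phi> n \<noteq> 0)"
    using c unfolding cond_full_def
  proof (elim disjE conjE exE)
    fix C assume 6: "a * b < - 1" "\<bar>b\<bar> \<ge> 2" "m + of_int \<bar>a\<bar> = 0" "radial_eq \<phi> (\<lambda>r. C * of_real (r ^ nat \<bar>b\<bar>))"
    have am: "a = 1" "m = - 1" using 6(3) a m by auto
    have b: "b \<le> - 2" using sign'[OF 6(1)] 6(2) by simp
    have "radial_eq \<phi> (\<lambda>r. C * complex_of_real (r powr real_of_int (- b)))"
    proof (rule radial_eq_trans[OF 6(4)], intro radial_eqI)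
      fix r :: real assume "0 < r"
      have "real_of_int (- b) = real (nat \<bar>b\<bar>)" using b by simp
      then have "r powr real_of_int (- b) = r ^ nat \<bar>b\<bar>" using \<open>0 < r\<close> by (simp only: powr_realpow)
      then show "C * complex_of_real (r ^ nat \<bar>b\<bar>) = C * complex_of_real (r powr real_of_int (- b))" by simp
    qed
    note R = this
    have b1: "- 1 \<le> real_of_int (- b)" using b by simp
    have mel: "mellin \<phi> (of_int s) = C * of_real (1 / (real_of_int s - real_of_int b))" if "s \<ge> 2" for s
      using mellin_int_cmult[OF ri powr_radial_integrable(1)[OF b1] R that] mellin_powr_int[OF b1 that] by simp
    have "N1 a b = - b" using b am by (simp add: N1_def)
    then show ?thesis using comm_coeff_support_power[OF b nonzero[OF mel] mel] am by simp
  next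
    fix C assume 7: "a * b < - 1" "\<bar>b\<bar> = 1" "mellin_eq \<phi> (\<lambda>z. C * Gamma_quot
          ((z - 1) / (2 * complex_of_int \<bar>a\<bar>)) ((z + complex_of_real m + complex_of_int \<bar>a\<bar> + 1) / (2 * complex_of_int \<bar>a\<bar>))
          ((z + 2 * complex_of_int \<bar>a\<bar> + 1) / (2 * complex_of_int \<bar>a\<bar>)) ((z + complex_of_real m + complex_of_int \<bar>a\<bar> - 1) / (2 * complex_of_int \<bar>a\<bar>)))"
    have b: "b = - 1" using sign'[OF 7(1)] 7(2) by simp
    have a2: "a \<ge> 2" using 7(1) b by simp
    have mel: "mellin \<phi> (of_int z) = C * of_real (mellin_sol a b m z)" if "z \<ge> 2" for z
    proof -
      have "Re (of_int z) \<ge> 2" using that by simp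
      then have "mellin \<phi> (of_int z) = C * Gamma_quot
          ((of_int z - 1) / (2 * complex_of_int \<bar>a\<bar>)) ((of_int z + complex_of_real m + complex_of_int \<bar>a\<bar> + 1) / (2 * complex_of_int \<bar>a\<bar>))
          ((of_int z + 2 * complex_of_int \<bar>a\<bar> + 1) / (2 * complex_of_int \<bar>a\<bar>)) ((of_int z + complex_of_real m + complex_of_int \<bar>a\<bar> - 1) / (2 * complex_of_int \<bar>a\<bar>))"
        using 7(3) unfolding mellin_eq_def by blast
      then show ?thesis using mellin_sol_Gamma_quot[OF a, of z b m] by (simp add: aa b)
    qed
    have ma: "m + a > 0" using a2 m by linarith
    show ?thesis using comm_coeff_support[OF a m ma nonzero[OF mel] _ mel] b a2 by blast
  next
    fix C assume 8: "a * b > 0" "a \<noteq> b" "of_int \<bar>b\<bar> < m + of_int \<bar>a\<bar> + 2" "mellin_eq \<phi> (\<lambda>z. C * Gamma_quot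
          ((z + complex_of_int \<bar>b\<bar>) / (2 * complex_of_int \<bar>a\<bar>)) ((z + complex_of_real m + complex_of_int \<bar>a\<bar> - complex_of_int \<bar>b\<bar>) / (2 * complex_of_int \<bar>a\<bar>))
          ((z + 2 * complex_of_int \<bar>a\<bar> - complex_of_int \<bar>b\<bar>) / (2 * complex_of_int \<bar>a\<bar>)) ((z + complex_of_real m + complex_of_int \<bar>a\<bar> + complex_of_int \<bar>b\<bar>) / (2 * complex_of_int \<bar>a\<bar>)))"
    have bb: "\<bar>b\<bar> = b" by (rule sign[OF 8(1)])
    then have b: "b > 0" using 8(1) a by (auto simp: zero_less_mult_iff)
    have mel: "mellin \<phi> (of_int z) = C * of_real (mellin_sol a b m z)" if "z \<ge> 2" for z
    proof -
      have "Re (of_int z) \<ge> 2" using that by simp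
      then show ?thesis using 8(4) unfolding mellin_eq_def aa bb mellin_sol_Gamma_quot[OF a, of z b m, symmetric] by blast
    qed
    \<comment> \<open>Otherwise a = 1, and b < m + a + 2 \<le> 2 leaves b = 1 = a, which is
      excluded.\<close>
    have ma: "m + a > 0"
    proof (rule ccontr)
      assume "\<not> m + a > 0"
      then have "real_of_int b < 2" "real_of_int a \<le> 1" using 8(3) m unfolding aa bb by linarith+
      then show False using a b 8(2) by auto
    qed
    show ?thesis using comm_coeff_support[OF a m ma nonzero[OF mel] _ mel] b 8(2) by blast
  next
    fix k C assume 9: "a * b > 0" "of_int \<bar>b\<bar> \<ge> m + of_int \<bar>a\<bar> + 2" "m = (2 * of_nat k + 1) * of_int \<bar>a\<bar>" "mellin_eq \<phi> (\<lambda>z. C *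
            ((\<Prod>j=1..k. (z - complex_of_int \<bar>b\<bar>) / (2 * complex_of_int \<bar>a\<bar>) + of_nat j) /
             (\<Prod>j=0..k. (z + complex_of_int \<bar>b\<bar>) / (2 * complex_of_int \<bar>a\<bar>) + of_nat j)))"
    have bb: "\<bar>b\<bar> = b" by (rule sign[OF 9(1)])
    then have b: "b > 0" using 9(1) a by (auto simp: zero_less_mult_iff)
    have mk: "m = (2 * real k + 1) * a" using 9(3) a by simp
    \<comment> \<open>The product formula is matched with \<open>mellin_sol\<close> for z > b only.
      \<open>mel'\<close> states it from 2 + b on, the form that \<open>nonzero\<close>
      expects.\<close>
    have mel: "mellin \<phi> (of_int z) = C * of_real (mellin_sol a b m z)" if "z \<ge> 2" "z - b > 0" for z
    proof -
      have re: "Re (of_int z) \<ge> 2" using that by simp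
      have zb: "z + b > 0" using that b by simp
      show ?thesis using 9(4) re unfolding mellin_eq_def aa bb mellin_sol_pochhammer[OF a that(2) zb mk, symmetric] by blast
    qed
    have mel': "mellin \<phi> (of_int z) = C * of_real (mellin_sol a b m z)" if "z \<ge> 2 + b" for z
      by (rule mel) (use that b in auto)
    have m0: "m > 0" unfolding mk using ar by (intro mult_pos_pos) auto
    then have ma: "m + a > 0" using ar by simp
    have "b \<noteq> a" using 9(2) m0 unfolding aa bb by auto
    then show ?thesis using comm_coeff_support[OF a m ma nonzero[OF mel'] _ mel] b by blast
  qed
  then show "n \<ge> N1 a b \<Longrightarrow> comm_coeff a b m \<phi> n = 0" "- (a + b) < 2 * n \<Longrightarrow> n < N1 a b \<Longrightarrow> comm_coeff a b m \<phi> n \<noteq> 0"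
    by blast+
qed

text \<open>Indices with 2k > k1 + k2 correspond to the half described by the hypotheses;
  antisymmetry settles the other half and the midpoint.\<close>

lemma comm_coeff_support_iff:
  assumes ab: "k1 * k2 \<noteq> 0"
    and zero: "\<And>n. n \<ge> N1 k1 k2 \<Longrightarrow> comm_coeff k1 k2 m \<phi> n = 0"
    and nonzero: "\<And>n. - (k1 + k2) < 2 * n \<Longrightarrow> n < N1 k1 k2 \<Longrightarrow> comm_coeff k1 k2 m \<phi> n \<noteq> 0"
  shows "comm_coeff k1 k2 m \<phi> (k - k1 - k2) \<noteq> 0 \<longleftrightarrow> k \<in> Lambda1 k1 k2"
proof -
  let ?c = "comm_coeff k1 k2 m \<phi>"
  \<comment> \<open>This makes the lower bound in \<open>Lambda1\<close> automatic for 2k > k1 + k2,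
    and by reflection the upper bound for 2k < k1 + k2.\<close>
  have N: "2 * N1 k1 k2 + k1 + k2 \<ge> 2"
  proof -
    have "\<bar>k1\<bar> \<ge> 1" "\<bar>k2\<bar> \<ge> 1" using ab by auto
    then show ?thesis using N1_eq[OF ab] by linarith
  qed
  have anti: "?c (k - k1 - k2) = - ?c (- k)" using comm_coeff_antisym[of k1 k2 m \<phi> "k - k1 - k2"] by (simp add: algebra_simps)
  have supp: "?c n \<noteq> 0 \<longleftrightarrow> n < N1 k1 k2" if "- (k1 + k2) < 2 * n" for n
    using zero[of n] nonzero[OF that] by (metis not_le)
  consider "2 * k > k1 + k2" | "2 * k < k1 + k2" | "2 * k = k1 + k2" by linarith
  then show ?thesis
  proof cases
    case 1
    then show ?thesis using supp[of "k - k1 - k2"] N by (auto simp: Lambda1_def)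
  next
    case 2
    then show ?thesis using supp[of "- k"] N unfolding anti by (auto simp: Lambda1_def)
  next
    case 3
    then have e: "k - k1 - k2 = - k" by simp
    have "?c (- k) = - ?c (- k)" using anti unfolding e .
    then have "?c (k - k1 - k2) = 0" unfolding e by simp
    then show ?thesis using 3 by (simp add: Lambda1_def)
  qed
qed

lemma Lambda1_uminus:
  assumes "k1 * k2 \<noteq> 0"
  shows "- k \<in> Lambda1 (- k1) (- k2) \<longleftrightarrow> k \<in> Lambda1 k1 k2"
proof -
  have "N1 (- k1) (- k2) = N1 k1 k2 + k1 + k2" using N1_eq[OF assms] N1_eq[of "- k1" "- k2"] assms by simp
  then show ?thesis by (auto simp: Lambda1_def)
qed

lemma cond_full_support:
  assumes ri: "radial_integrable \<phi>" and nz: "\<not> radial_eq \<phi> (\<lambda>r. 0)" and m: "m \<ge> - 1" and c: "cond_full k1 k2 m \<phi>"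
  shows "k1 * k2 \<noteq> 0" "comm_coeff k1 k2 m \<phi> (k - k1 - k2) \<noteq> 0 \<longleftrightarrow> k \<in> Lambda1 k1 k2"
proof -
  show ab: "k1 * k2 \<noteq> 0" using c unfolding cond_full_def by auto
  then consider "k1 > 0" | "- k1 > 0" by (cases k1 "0::int" rule: linorder_cases) auto
  then show "comm_coeff k1 k2 m \<phi> (k - k1 - k2) \<noteq> 0 \<longleftrightarrow> k \<in> Lambda1 k1 k2"
  proof cases
    case 1
    show ?thesis by (rule comm_coeff_support_iff[OF ab cond_full_support_pos[OF ri nz 1 m c]])
  next
    case 2
    have c': "cond_full (- k1) (- k2) m \<phi>" using c by (simp only: cond_uminus)
    have e: "- k - - k1 - - k2 = - (k - k1 - k2)" by simp
    have "- k1 * - k2 \<noteq> 0" using ab by simp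
    from comm_coeff_support_iff[OF this cond_full_support_pos[OF ri nz 2 m c'], of "- k"]
    have "comm_coeff (- k1) (- k2) m \<phi> (- (k - k1 - k2)) \<noteq> 0 \<longleftrightarrow> - k \<in> Lambda1 (- k1) (- k2)"
      by (simp only: e)
    then show ?thesis by (simp only: comm_coeff_uminus Lambda1_uminus[OF ab])
  qed
qed

text \<open>For k1 = 0 either m = 0 and the first operator is the identity, or k2 = 0 and both
  operators are diagonal.\<close>

lemma cond_zero_comm_coeff:
  assumes ri: "radial_integrable \<phi>" and m: "m \<ge> - 1" and c: "cond_zero k1 k2 m \<phi>"
  shows "comm_coeff k1 k2 m \<phi> n = 0"
proof (cases k1 "0::int" rule: linorder_cases)
  case greater
  show ?thesis by (rule comm_coeff_zero_pos[OF greater m ri c])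
next
  case less
  have "cond_zero (- k1) (- k2) m \<phi>" using c by (simp only: cond_uminus)
  then have "comm_coeff (- k1) (- k2) m \<phi> (- n) = 0" using less by (intro comm_coeff_zero_pos[OF _ m ri]) auto
  then show ?thesis by (simp only: comm_coeff_uminus)
next
  case equal
  have alg: "(x + 1) * M / (2 * x + 2) = M / 2" if "x + 1 \<noteq> 0" for x M :: complex
  proof -
    have e: "2 * x + 2 = 2 * (x + 1)" by simp
    show ?thesis unfolding e using that by (simp del: distrib_left_numeral)
  qed
  from c equal have "m = 0 \<or> k2 = 0" unfolding cond_zero_def by auto
  then show ?thesis
  proof
    assume "m = 0"
    have "comm_coeff 0 k2 0 \<phi> n = (of_int \<bar>n + k2\<bar> + 1) * mellin \<phi> (of_int (\<bar>n\<bar> + \<bar>n + k2\<bar> + 2)) / (2 * of_int \<bar>n + k2\<bar> + 2)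
      - (of_int \<bar>n\<bar> + 1) * mellin \<phi> (of_int (\<bar>n\<bar> + \<bar>n + k2\<bar> + 2)) / (2 * of_int \<bar>n\<bar> + 2)"
    proof -
      have "complex_of_int (\<bar>j\<bar> + \<bar>j\<bar> + 2) + of_real 0 = 2 * of_int \<bar>j\<bar> + 2" for j by (simp del: of_int_abs)
      then show ?thesis unfolding comm_coeff_def add_0_right by (simp only:)
    qed
    also have "\<dots> = 0" unfolding alg[OF of_int_abs_plus1_nonzero] by (rule diff_self)
    finally show ?thesis using equal \<open>m = 0\<close> by simp
  qed (use equal in \<open>simp add: comm_coeff_def\<close>)
qed

text \<open>For k1 = 0 both terms contain the same Mellin value, and clearing denominators leaves it
  multiplied by b m. If this product is nonzero, the transform vanishes along a progression of step
  2 and, being bounded, vanishes identically.\<close>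

lemma finite_support_imp_m_k2_0:
  assumes ri: "radial_integrable \<phi>" and nz: "\<not> radial_eq \<phi> (\<lambda>r. 0)" and m: "m \<ge> - 1"
    and zero: "\<And>n. n \<ge> n0 \<Longrightarrow> comm_coeff 0 b m \<phi> n = 0"
  shows "m = 0 \<or> b = 0"
proof (rule ccontr)
  assume bm: "\<not> (m = 0 \<or> b = 0)"
  define n1 where "n1 = max n0 (\<bar>b\<bar> + 1)"
  have M0: "mellin \<phi> (of_int (2 * n + b + 2)) = 0" if n: "n \<ge> n1" for n
  proof (rule ccontr)
    assume ne: "mellin \<phi> (of_int (2 * n + b + 2)) \<noteq> 0"
    have n': "n \<ge> n0" "n \<ge> \<bar>b\<bar> + 1" using n by (simp_all add: n1_def)
    have abs: "\<bar>n\<bar> = n" "\<bar>n + b\<bar> = n + b" "\<bar>n + 0\<bar> = n" "\<bar>n + 0 + b\<bar> = n + b" using n'(2) by auto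
    have i: "\<bar>n\<bar> + \<bar>n + b\<bar> + 2 = 2 * n + b + 2" "\<bar>n + 0\<bar> + \<bar>n + 0 + b\<bar> + 2 = 2 * n + b + 2" unfolding abs by simp_all
    have "comm_coeff 0 b m \<phi> n = 0 \<longleftrightarrow> (\<bar>n + b\<bar> + 1) * (\<bar>n\<bar> + \<bar>n + 0\<bar> + 2 + m) * 1 = (\<bar>n + 0\<bar> + 1) * (\<bar>n + b\<bar> + \<bar>n + 0 + b\<bar> + 2 + m) * 1"
      by (rule comm_coeff_eq_0_iff[OF m ne]) (simp_all only: i of_real_1 mult_1_right)
    then have "(real_of_int n + b + 1) * (2 * n + 2 + m) = (real_of_int n + 1) * (2 * n + 2 * b + 2 + m)"
      using zero[OF n'(1)] unfolding abs by (simp add: algebra_simps)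
    then have "b * m = 0" by (simp add: algebra_simps)
    then show False using bm by simp
  qed
  obtain K where K: "\<And>z. Re z \<ge> 2 \<Longrightarrow> cmod (mellin \<phi> z) \<le> K" using mellin_bounded_halfplane[OF ri] by blast
  have n1: "n1 \<ge> \<bar>b\<bar> + 1" by (simp add: n1_def)
  have "radial_eq \<phi> (\<lambda>r. 0)"
  proof (rule mellin_zero_imp_radial_zero[OF ri, of 3])
    fix n :: nat assume n: "n \<ge> 3"
    show "mellin \<phi> (of_nat n) = 0"
    proof (rule poly_bounded_progression_eq_0[of "mellin \<phi>" 2 2 "real_of_int (2 * n1 + b + 2)" K 0])
      have "2 * n1 + b + 2 > 2" using n1 by linarith
      then show "2 < real_of_int (2 * n1 + b + 2)" by linarith
      show "mellin \<phi> (complex_of_real (real_of_int (2 * n1 + b + 2) + 2 * real j)) = 0" for j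
      proof -
        have "complex_of_real (real_of_int (2 * n1 + b + 2) + 2 * real j) = of_int (2 * (n1 + int j) + b + 2)" by simp
        then show ?thesis using M0[of "n1 + int j"] by (simp only:)
      qed
    qed (use mellin_holomorphic[OF ri] K n in auto)
  qed
  then show False using nz by contradiction
qed

text \<open>From finiteness only the vanishing beyond some index is used; the conditions forced by
  it already determine the whole support.\<close>

lemma finite_support_imp_cond:
  assumes ri: "radial_integrable \<phi>" and nz: "\<not> radial_eq \<phi> (\<lambda>r. 0)" and m: "m \<ge> - 1"
    and fin: "finite {n. comm_coeff k1 k2 m \<phi> n \<noteq> 0}"
  shows "cond_zero k1 k2 m \<phi> \<or> cond_full k1 k2 m \<phi>"
proof -
  obtain B where B: "\<And>n. comm_coeff k1 k2 m \<phi> n \<noteq> 0 \<Longrightarrow> \<bar>n\<bar> \<le> B"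
  proof -
    have "bdd_above (abs ` {n. comm_coeff k1 k2 m \<phi> n \<noteq> 0})" using fin by (intro bdd_above_finite finite_imageI)
    then show thesis using that unfolding bdd_above_def by auto
  qed
  show ?thesis
  proof (cases k1 "0::int" rule: linorder_cases)
    case greater
    show ?thesis
      by (rule finite_support_imp_cond_pos[OF ri nz greater m, of "B + 1"]) (use B in force)
  next
    case less
    have "comm_coeff (- k1) (- k2) m \<phi> n = 0" if "n \<ge> B + 1" for n
      using comm_coeff_uminus[of k1 k2 m \<phi> "- n"] B[of "- n"] that by force
    then have "cond_zero (- k1) (- k2) m \<phi> \<or> cond_full (- k1) (- k2) m \<phi>"
      using less by (intro finite_support_imp_cond_pos[OF ri nz _ m, of _ "B + 1"]) auto
    then show ?thesis by (simp only: cond_uminus)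
  next
    case equal
    have "m = 0 \<or> k2 = 0"
      by (rule finite_support_imp_m_k2_0[OF ri nz m, of "B + 1"]) (use B equal in force)
    then show ?thesis using equal unfolding cond_zero_def by auto
  qed
qed

theorem theorem4p4:
  fixes k1 k2 :: int and m :: real and \<phi> :: "real \<Rightarrow> complex"
  assumes "m \<ge> - 1"
    and "T_function (\<lambda>z. \<phi> (cmod z))"
    and "\<not> radial_eq \<phi> (\<lambda>r. 0)"
  shows
    "let A = commutator (toeplitz (quasihom k1 (\<lambda>r. complex_of_real (r powr m)))) (toeplitz (quasihom k2 \<phi>));
         a1 = complex_of_int \<bar>k1\<bar>;
         a2 = complex_of_int \<bar>k2\<bar>;
         M = complex_of_real m;
         c1 = (k1 = 0 \<and> m = 0);
         c2 = (k2 = 0 \<and> (\<exists>C::complex. radial_eq \<phi> (\<lambda>r. C)));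
         c3 = (k1 = 0 \<and> k2 = 0);
         c4 = (k1 = k2 \<and> k2 \<noteq> 0 \<and> (\<exists>C::complex. radial_eq \<phi> (\<lambda>r. C * of_real (r powr m))));
         c5 = (k1 * k2 = - 1 \<and>
               (\<exists>C::complex. radial_eq \<phi>
                  (\<lambda>r. C * of_real ((m + 1) / 2 * r powr (- 1) - (m - 1) / 2 * r))));
         c6 = (k1 * k2 < - 1 \<and> \<bar>k2\<bar> \<ge> 2 \<and> m + of_int \<bar>k1\<bar> = 0 \<and>
               (\<exists>C::complex. radial_eq \<phi> (\<lambda>r. C * of_real (r ^ nat \<bar>k2\<bar>))));
         c7 = (k1 * k2 < - 1 \<and> \<bar>k2\<bar> = 1 \<and>
               (\<exists>C::complex. mellin_eq \<phi> (\<lambda>z. C * Gamma_quot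
                  ((z - 1) / (2 * a1)) ((z + M + a1 + 1) / (2 * a1))
                  ((z + 2 * a1 + 1) / (2 * a1)) ((z + M + a1 - 1) / (2 * a1)))));
         c8 = (k1 * k2 > 0 \<and> k1 \<noteq> k2 \<and> of_int \<bar>k2\<bar> < m + of_int \<bar>k1\<bar> + 2 \<and>
               (\<exists>C::complex. mellin_eq \<phi> (\<lambda>z. C * Gamma_quot
                  ((z + a2) / (2 * a1)) ((z + M + a1 - a2) / (2 * a1))
                  ((z + 2 * a1 - a2) / (2 * a1)) ((z + M + a1 + a2) / (2 * a1)))));
         c9 = (k1 * k2 > 0 \<and> of_int \<bar>k2\<bar> \<ge> m + of_int \<bar>k1\<bar> + 2 \<and>
               (\<exists>n::nat. m = (2 * of_nat n + 1) * of_int \<bar>k1\<bar> \<and>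
                 (\<exists>C::complex. mellin_eq \<phi> (\<lambda>z. C *
                    ((\<Prod>j=1..n. (z - a2) / (2 * a1) + of_nat j) /
                     (\<Prod>j=0..n. (z + a2) / (2 * a1) + of_nat j))))))
     in
       (finite_rank A \<longleftrightarrow> c1 \<or> c2 \<or> c3 \<or> c4 \<or> c5 \<or> c6 \<or> c7 \<or> c8 \<or> c9) \<and>
       (c1 \<or> c2 \<or> c3 \<or> c4 \<or> c5 \<longrightarrow> op_rank A = 0) \<and>
       (c6 \<or> c7 \<or> c8 \<or> c9 \<longrightarrow>
          Ran A = cfun.span (harm_monom ` Lambda1 k1 k2) \<and>
          (\<exists>C :: int \<Rightarrow> complex.
             (\<forall>k\<in>LambdaHalf k1 k2. C k \<noteq> 0) \<and>
             (\<forall>h\<in>L2h. A h =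
                (\<Sum>k\<in>LambdaHalf k1 k2. scale_fun (C k)
                   (rank_one (harm_monom k) (harm_monom (k - k1 - k2)) h -
                    rank_one (harm_monom (- k + k1 + k2)) (harm_monom (- k)) h)))) \<and>
          (odd (k1 + k2) \<longrightarrow> int (op_rank A) = \<bar>k1\<bar> + \<bar>k2\<bar> - 1) \<and>
          (even (k1 + k2) \<longrightarrow> int (op_rank A) = \<bar>k1\<bar> + \<bar>k2\<bar> - 2))"
proof -
  define A where "A = commutator (toeplitz (quasihom k1 (\<lambda>r. complex_of_real (r powr m)))) (toeplitz (quasihom k2 \<phi>))"
  note m = assms(1) and nz = assms(3)
  have ri: "radial_integrable \<phi>" and mb: "mellin_bounded \<phi>"
    using T_function_mellin_bounded[OF assms(2)] by blast+
  note F = commutator_finite_rank_iff[OF ri mb m, of k1 k2, folded A_def]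
  have zero: "finite_rank A" "op_rank A = 0" if "cond_zero k1 k2 m \<phi>"
  proof -
    have e: "{n. comm_coeff k1 k2 m \<phi> n \<noteq> 0} = {}" using cond_zero_comm_coeff[OF ri m that] by simp
    show "finite_rank A" "op_rank A = 0" using F(1,3) unfolding e by simp_all
  qed
  note full = commutator_full_support[OF ri mb m cond_full_support(1)[OF ri nz m] cond_full_support(2)[OF ri nz m], of k1 k2, folded A_def, rotated]
  have iff: "finite_rank A \<longleftrightarrow> cond_zero k1 k2 m \<phi> \<or> cond_full k1 k2 m \<phi>"
    using finite_support_imp_cond[OF ri nz m] F(1) zero(1) full(1) by blast
  \<comment> \<open>The propositional structure is settled for variables, so that the long
    conditions only have to be identified with \<open>cond_zero\<close> and
    \<open>cond_full\<close>.\<close>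
  have goal: "(finite_rank A \<longleftrightarrow> P) \<and> (Z \<longrightarrow> op_rank A = 0) \<and> (W \<longrightarrow> R \<and> S \<and> T \<and> U)"
    if "P \<longleftrightarrow> cond_zero k1 k2 m \<phi> \<or> cond_full k1 k2 m \<phi>" "Z \<longleftrightarrow> cond_zero k1 k2 m \<phi>" "W \<longleftrightarrow> cond_full k1 k2 m \<phi>"
      "cond_full k1 k2 m \<phi> \<Longrightarrow> R" "cond_full k1 k2 m \<phi> \<Longrightarrow> S" "cond_full k1 k2 m \<phi> \<Longrightarrow> T" "cond_full k1 k2 m \<phi> \<Longrightarrow> U"
    for P Z W R S T U
    using that iff zero by blast
  show ?thesis
    unfolding Let_def A_def[symmetric]
    by (rule goal; (rule full(2,3) | (rule impI, rule full(4,5)) | (simp only: cond_zero_def cond_full_def disj_assoc))?; assumption?)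
qed

end
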